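(* Let $\Omega\subset\mathbf{C}^n$ be open, $\Phi\in C^\infty(\Omega;\mathbf{R})$ strictly plurisubharmonic, $x_0\in\Omega$, let $\Psi$ be an almost holomorphic polarization of $\Phi$ near $(x_0,\overline{x_0})$, and let $\varphi(y,\widetilde x;x,\widetilde y)=\Psi(x,\widetilde y)-\Psi(x,\widetilde x)-\Psi(y,\widetilde y)+\Psi(y,\widetilde x)$. There exists an elliptic symbol $a(x,\widetilde y;h)\in S^0_{\mathrm{cl}}(\mathrm{neigh}((x_0,\overline{x_0}),\mathbf{C}^{2n}))$ of the form $$a(x,\widetilde y;h)\sim\sum_{j=0}^\infty a_j(x,\widetilde y)h^j\quad\text{in }C^\infty,$$ with $a_j\in C^\infty(\mathrm{neigh}((x_0,\overline{x_0}),\mathbf{C}^{2n}))$ satisfying $$(\partial_{\overline x}a_j)(x,\widetilde y)=\mathcal{O}(|\widetilde y-\overline x|^\infty),\qquad(\partial_{\overline{\widetilde y}}a_j)(x,\widetilde y)=\mathcal{O}(|\widetilde y-\overline x|^\infty),\qquad j=0,1,2,\dots,$$ such that $$(A_\Gamma a)(y,\overline y;h)=\frac1{h^n}\iint_{\Gamma(y,\overline y)}e^{\frac2h\varphi(y,\overline y;x,\widetilde y)}a(x,\widetilde y;h)\,dx\,d\widetilde y=1+\mathcal{O}(h^\infty),\qquad y\in\mathrm{neigh}(x_0,\mathbf{C}^n).$$ Here $\Gamma(y,\overline y)$ is a good contour for the function $(x,\widetilde y)\mapsto\mathrm{Re}\,\varphi(y,\overline y;x,\widetilde y)$. The restrictions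 of the $a_j$'s to the anti-diagonal $\widetilde y=\overline x$ are uniquely determined, for $j\ge0$, and we have $$a_0(x,\overline x)=A_n\,\det(\Phi''_{x\overline x}(x)),\qquad x\in\mathrm{neigh}(x_0,\mathbf{C}^n),$$ with $A_n\ne0$ depending on $n$ only.
   Context: $h>0$ is a small parameter; $\mathcal{O}(h^\infty)$ means $\mathcal{O}_N(h^N)$ for every $N$, uniformly in $y$; similarly $\mathcal{O}(|\widetilde y-\overline x|^\infty)$ means $\mathcal{O}_N(|\widetilde y-\overline x|^N)$ for every $N$, locally uniformly. $\mathrm{neigh}(p,E)$ denotes a sufficiently small open neighborhood of $p$ in $E$. $\Phi$ strictly plurisubharmonic means $\sum_{j,k}\frac{\partial^2\Phi}{\partial x_j\partial\overline{x}_k}(x)\xi_j\overline{\xi}_k\ge c(x)|\xi|^2$ for $x\in\Omega$, $\xi\in\mathbf{C}^n$, with some $0<c\in C(\Omega)$; $\Phi''_{x\overline x}=(\partial^2\Phi/\partial x_j\partial\overline x_k)_{j,k}$. An almost holomorphic polarization of $\Phi$ near $(x_0,\overline{x_0})$ is a function $\Psi\in C^\infty(\mathrm{neigh}((x_0,\overline{x_0}),\mathbf{C}^{2n}_{x,y}))$ with $\Psi(x,\overline x)=\Phi(x)$ near $x_0$ and, for all $N$ and $1\le j\le n$, $\partial_{\overline x_j}\Psi(x,y)$ and $\partial_{\overline y_j}\Psi(x,y)$ both $\mathcal{O}_N(|y-\overline x|^N)$, locally uniformly. $a\in S^0_{\mathrm{cl}}$ with $a\sim\sum h^ja_j$ in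 $C^\infty$: for every $N$ all derivatives of $a-\sum_{j<N}h^ja_j$ are $\mathcal{O}(h^N)$ locally uniformly. Elliptic: $a_0$ is nowhere zero near $(x_0,\overline{x_0})$. Good contour: a smooth $2n$-(real-)dimensional contour $\Gamma(y,\widetilde x)\subset\mathbf{C}^{2n}_{x,\widetilde y}$ (image of a fixed neighborhood of $0$ in $\mathbf{R}^{2n}$, contained in a sufficiently small neighborhood of $(x_0,\overline{x_0})$), passing through $(y,\widetilde x)$ (the image of $0$), depending smoothly on $(y,\widetilde x)\in\mathrm{neigh}((x_0,\overline{x_0}),\mathbf{C}^{2n})$, along which $\mathrm{Re}\,\varphi(y,\widetilde x;x,\widetilde y)\le-\frac1C\,\mathrm{dist}((x,\widetilde y),(y,\widetilde x))^2$ with a uniform $C>0$. An example is the affine contour $\mathrm{neigh}(0,\mathbf{C}^n)\ni z\mapsto(y+z,\widetilde x-\overline z)$. Here $dx\,d\widetilde y=dx_1\wedge\dots\wedge dx_n\wedge d\widetilde y_1\wedge\dots\wedge d\widetilde y_n$; the affine contour carries a fixed orientation (depending only on $n$), and other good contours are oriented compatibly with deformation to it through good contours. For $\widetilde x=\overline y$ the choice of good contour affects the integral only by $\mathcal{O}(h^\infty)$. *)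

theory Defs
  imports "HOL-Analysis.Analysis"
begin

section \<open>Smooth functions and Wirtinger derivatives\<close>

text \<open>\<open>iter_deriv [v1, ..., vk] f\<close> is the iterated directional derivative of \<open>f\<close> along
  \<open>v1\<close>, then \<open>v2\<close>, and so on.\<close>

primrec iter_deriv ::
  "'a::real_normed_vector list \<Rightarrow> ('a \<Rightarrow> 'b::real_normed_vector) \<Rightarrow> 'a \<Rightarrow> 'b" where
  "iter_deriv [] f = f"
| "iter_deriv (v # vs) f = iter_deriv vs (\<lambda>x. frechet_derivative f (at x) v)"

text \<open>Meant for open \<open>S\<close> in a finite-dimensional space. All iterated directional derivatives are
  differentiable on \<open>S\<close>, hence continuous, so this is the usual \<open>C\<^sup>\<infinity>\<close>.\<close>

definition smooth_on ::
  "'a::real_normed_vector set \<Rightarrow> ('a \<Rightarrow> 'b::real_normed_vector) \<Rightarrow> bool" where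
  "smooth_on S f \<longleftrightarrow> (\<forall>vs. \<forall>x\<in>S. iter_deriv vs f differentiable (at x))"

definition vconj :: "complex^'n \<Rightarrow> complex^'n" where
  "vconj x = (\<chi> j. cnj (x $ j))"

definition d_hol :: "'n::finite \<Rightarrow> (complex^'n \<Rightarrow> complex) \<Rightarrow> complex^'n \<Rightarrow> complex" where
  "d_hol j f x = (frechet_derivative f (at x) (axis j 1)
                  - \<i> * frechet_derivative f (at x) (axis j \<i>)) / 2"

definition d_bar :: "'n::finite \<Rightarrow> (complex^'n \<Rightarrow> complex) \<Rightarrow> complex^'n \<Rightarrow> complex" where
  "d_bar j f x = (frechet_derivative f (at x) (axis j 1)
                  + \<i> * frechet_derivative f (at x) (axis j \<i>)) / 2"

definition levi_matrix :: "(complex^'n::finite \<Rightarrow> real) \<Rightarrow> complex^'n \<Rightarrow> complex^'n^'n" where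
  "levi_matrix \<Phi> x = (\<chi> j k. d_hol j (d_bar k (\<lambda>z. complex_of_real (\<Phi> z))) x)"

text \<open>The Levi matrix of a real smooth function is Hermitian, so the sum below is real and
  \<open>Re\<close> only changes its type.\<close>

definition strictly_psh_on :: "(complex^'n::finite) set \<Rightarrow> (complex^'n \<Rightarrow> real) \<Rightarrow> bool" where
  "strictly_psh_on \<Omega> \<Phi> \<longleftrightarrow>
     (\<exists>c. continuous_on \<Omega> c \<and> (\<forall>x\<in>\<Omega>. c x > 0 \<and>
        (\<forall>\<xi>. Re (\<Sum>j\<in>UNIV. \<Sum>k\<in>UNIV. levi_matrix \<Phi> x $ j $ k * \<xi> $ j * cnj (\<xi> $ k))
              \<ge> c x * (norm \<xi>)\<^sup>2)))"

section \<open>Almost holomorphic functions and the phase\<close>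

type_synonym 'n cpair = "(complex^'n) \<times> (complex^'n)"

text \<open>Both antiholomorphic derivatives vanish to infinite order on the anti-diagonal
  \<open>y = vconj x\<close>, locally uniformly on the open set \<open>D\<close>.\<close>

definition almost_hol_on :: "'n::finite cpair set \<Rightarrow> ('n cpair \<Rightarrow> complex) \<Rightarrow> bool" where
  "almost_hol_on D f \<longleftrightarrow>
     (\<forall>(N::nat) j K. compact K \<and> K \<subseteq> D \<longrightarrow>
        (\<exists>C. \<forall>(x, y)\<in>K.
           norm (d_bar j (\<lambda>x'. f (x', y)) x) \<le> C * norm (y - vconj x) ^ N \<and>
           norm (d_bar j (\<lambda>y'. f (x, y')) y) \<le> C * norm (y - vconj x) ^ N))"

definition almost_hol_polarization ::
  "'n::finite cpair set \<Rightarrow> ('n cpair \<Rightarrow> complex) \<Rightarrow> (complex^'n \<Rightarrow> real) \<Rightarrow> complex^'n \<Rightarrow> bool" where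
  "almost_hol_polarization D \<Psi> \<Phi> x0 \<longleftrightarrow>
     open D \<and> (x0, vconj x0) \<in> D \<and> smooth_on D \<Psi> \<and> almost_hol_on D \<Psi> \<and>
     (\<forall>\<^sub>F x in nhds x0. \<Psi> (x, vconj x) = complex_of_real (\<Phi> x))"

text \<open>\<open>phase \<Psi> (y, x') (x, y')\<close> is \<open>\<phi>(y, x'; x, y')\<close>, with primes in place of tildes.\<close>

fun phase :: "('n cpair \<Rightarrow> complex) \<Rightarrow> 'n cpair \<Rightarrow> 'n cpair \<Rightarrow> complex" where
  "phase \<Psi> (y, x') (x, y') = \<Psi> (x, y') - \<Psi> (x, x') - \<Psi> (y, y') + \<Psi> (y, x')"

text \<open>Neighborhoods of \<open>(x0, vconj x0)\<close> are taken in product form, so that all four points at which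
  the phase evaluates \<open>\<Psi>\<close> stay in the neighborhood.\<close>

definition bidisc :: "complex^'n::finite \<Rightarrow> real \<Rightarrow> 'n cpair set" where
  "bidisc x0 r = ball x0 r \<times> ball (vconj x0) r"

section \<open>Classical symbols\<close>

definition classical_symbol ::
  "'n::finite cpair set \<Rightarrow> (real \<Rightarrow> 'n cpair \<Rightarrow> complex) \<Rightarrow> (nat \<Rightarrow> 'n cpair \<Rightarrow> complex) \<Rightarrow> bool" where
  "classical_symbol W a as \<longleftrightarrow>
     (\<forall>j. smooth_on W (as j)) \<and>
     (\<forall>\<^sub>F h in at_right 0. smooth_on W (a h)) \<and>
     (\<forall>(N::nat) vs K. compact K \<and> K \<subseteq> W \<longrightarrow>
        (\<exists>C. \<forall>\<^sub>F h in at_right 0. \<forall>p\<in>K.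
           norm (iter_deriv vs (\<lambda>q. a h q - (\<Sum>j<N. of_real h ^ j * as j q)) p) \<le> C * h ^ N))"

definition admissible_symbol ::
  "complex^'n::finite \<Rightarrow> 'n cpair set \<Rightarrow> (real \<Rightarrow> 'n cpair \<Rightarrow> complex) \<Rightarrow>
     (nat \<Rightarrow> 'n cpair \<Rightarrow> complex) \<Rightarrow> bool" where
  "admissible_symbol x0 W a as \<longleftrightarrow>
     classical_symbol W a as \<and>
     (\<forall>\<^sub>F p in nhds (x0, vconj x0). as 0 p \<noteq> 0) \<and>
     (\<forall>j. almost_hol_on W (as j))"

section \<open>Good contours\<close>

text \<open>The parameter space \<open>\<real>\<^sup>2\<^sup>n\<close> is \<open>real^('n + 'n)\<close>. A family of contours is a map \<open>\<gamma>\<close> whose value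
  \<open>\<gamma> (t, p)\<close>, for \<open>t\<close> in the fixed bounded open neighborhood \<open>U\<close> of \<open>0\<close>, runs through the contour
  \<open>\<Gamma>(p)\<close>, where \<open>p = (y, x')\<close> ranges over the neighborhood \<open>Y\<close> of \<open>(x0, vconj x0)\<close>. That \<open>\<Gamma>(p)\<close> is a
  smooth contour of real dimension \<open>2n\<close> is expressed by \<open>\<gamma> (\<cdot>, p)\<close> being a smooth embedding of the
  compact set \<open>closure U\<close>; working up to the boundary makes the contour integrals converge and
  prevents the ends of the contour from returning to \<open>p\<close>.\<close>

definition good_contour ::
  "('n::finite cpair \<Rightarrow> complex) \<Rightarrow> complex^'n \<Rightarrow> 'n cpair set \<Rightarrow>
     (real^('n + 'n)) set \<Rightarrow> 'n cpair set \<Rightarrow> real \<Rightarrow>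
     ((real^('n + 'n)) \<times> 'n cpair \<Rightarrow> 'n cpair) \<Rightarrow> bool" where
  "good_contour \<Psi> x0 W U Y C \<gamma> \<longleftrightarrow>
     open U \<and> bounded U \<and> 0 \<in> U \<and> open Y \<and> (x0, vconj x0) \<in> Y \<and> C > 0 \<and>
     (\<exists>T. open T \<and> closure U \<subseteq> T \<and> smooth_on (T \<times> Y) \<gamma>) \<and>
     (\<forall>p\<in>Y.
        \<gamma> (0, p) = p \<and>
        inj_on (\<lambda>t. \<gamma> (t, p)) (closure U) \<and>
        (\<forall>t\<in>closure U.
           \<gamma> (t, p) \<in> W \<and>
           inj (frechet_derivative (\<lambda>s. \<gamma> (s, p)) (at t)) \<and>
           Re (phase \<Psi> p (\<gamma> (t, p))) \<le> - (1 / C) * (dist (\<gamma> (t, p)) p)\<^sup>2))"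

text \<open>The affine contour \<open>z \<mapsto> (y + z, x' - vconj z)\<close>, where \<open>z $ j\<close> has real part \<open>t $ Inl j\<close> and
  imaginary part \<open>t $ Inr j\<close>. This parametrization fixes the orientation: writing \<open>z = u + iv\<close>, it
  is that of \<open>du\<^sub>1 \<and> \<dots> \<and> du\<^sub>n \<and> dv\<^sub>1 \<and> \<dots> \<and> dv\<^sub>n\<close>. Renumbering the index type moves the \<open>u\<close>'s and the
  \<open>v\<close>'s simultaneously, so no ordering of \<open>'n\<close> is involved.\<close>

fun affine_contour :: "(real^('n + 'n)) \<times> 'n::finite cpair \<Rightarrow> 'n cpair" where
  "affine_contour (t, (y, x')) =
     (let z = (\<chi> j. Complex (t $ Inl j) (t $ Inr j)) in (y + z, x' - vconj z))"

text \<open>The orientation of a contour is encoded by its parametrization, and compatibility with the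
  affine contour by a smooth deformation through good contours, with a uniform constant. Since the
  orientation is already determined near the base point, the deformation may be carried out on
  smaller neighborhoods. No contour is excluded: one parametrized with the opposite
  orientation has to be reparametrized by a reflection of \<open>real^('n + 'n)\<close>.\<close>

definition deformable_to_affine ::
  "('n::finite cpair \<Rightarrow> complex) \<Rightarrow> complex^'n \<Rightarrow> 'n cpair set \<Rightarrow>
     (real^('n + 'n)) set \<Rightarrow> 'n cpair set \<Rightarrow>
     ((real^('n + 'n)) \<times> 'n cpair \<Rightarrow> 'n cpair) \<Rightarrow> bool" where
  "deformable_to_affine \<Psi> x0 W U Y \<gamma> \<longleftrightarrow>
     (\<exists>U' Y' C G. U' \<subseteq> U \<and> Y' \<subseteq> Y \<and>
        (\<exists>I T. open I \<and> {0..1} \<subseteq> I \<and> open T \<and> closure U' \<subseteq> T \<and>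
               smooth_on (I \<times> T \<times> Y') (\<lambda>(s::real, q). G s q)) \<and>
        (\<forall>s\<in>{0..1}. good_contour \<Psi> x0 W U' Y' C (G s)) \<and>
        (\<forall>q\<in>U' \<times> Y'. G 0 q = affine_contour q \<and> G 1 q = \<gamma> q))"

definition oriented_good_contour ::
  "('n::finite cpair \<Rightarrow> complex) \<Rightarrow> complex^'n \<Rightarrow> 'n cpair set \<Rightarrow>
     (real^('n + 'n)) set \<Rightarrow> 'n cpair set \<Rightarrow>
     ((real^('n + 'n)) \<times> 'n cpair \<Rightarrow> 'n cpair) \<Rightarrow> bool" where
  "oriented_good_contour \<Psi> x0 W U Y \<gamma> \<longleftrightarrow>
     (\<exists>C. good_contour \<Psi> x0 W U Y C \<gamma>) \<and> deformable_to_affine \<Psi> x0 W U Y \<gamma>"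

section \<open>The contour integral\<close>

text \<open>The coefficient of the pullback of \<open>dx\<^sub>1 \<and> \<dots> \<and> dx\<^sub>n \<and> dy'\<^sub>1 \<and> \<dots> \<and> dy'\<^sub>n\<close> under the parametrization
  \<open>t \<mapsto> \<gamma> (t, p)\<close>: the complex Jacobian, with rows indexed by the components of \<open>(x, y')\<close> and
  columns by those of \<open>t\<close>.\<close>

definition contour_jacobian ::
  "((real^('n + 'n)) \<times> 'n::finite cpair \<Rightarrow> 'n cpair) \<Rightarrow> 'n cpair \<Rightarrow> real^('n + 'n) \<Rightarrow> complex" where
  "contour_jacobian \<gamma> p t =
     det (\<chi> i k. let w = frechet_derivative (\<lambda>s. \<gamma> (s, p)) (at t) (axis k 1)
                 in case i of Inl j \<Rightarrow> fst w $ j | Inr j \<Rightarrow> snd w $ j)"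

definition contour_op ::
  "('n::finite cpair \<Rightarrow> complex) \<Rightarrow> (real^('n + 'n)) set \<Rightarrow>
     ((real^('n + 'n)) \<times> 'n cpair \<Rightarrow> 'n cpair) \<Rightarrow> (real \<Rightarrow> 'n cpair \<Rightarrow> complex) \<Rightarrow>
     real \<Rightarrow> 'n cpair \<Rightarrow> complex" where
  "contour_op \<Psi> U \<gamma> a h p =
     1 / of_real h ^ CARD('n) *
     (LINT t:U|lborel. exp (2 / of_real h * phase \<Psi> p (\<gamma> (t, p))) * a h (\<gamma> (t, p))
                       * contour_jacobian \<gamma> p t)"

text \<open>\<open>(A\<^sub>\<Gamma> a)(y, vconj y; h) = 1 + O(h\<^sup>\<infinity>)\<close>, uniformly for \<open>y\<close> in a neighborhood of \<open>x0\<close>.\<close>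

definition normalized_on_contour ::
  "('n::finite cpair \<Rightarrow> complex) \<Rightarrow> complex^'n \<Rightarrow> (real^('n + 'n)) set \<Rightarrow> 'n cpair set \<Rightarrow>
     ((real^('n + 'n)) \<times> 'n cpair \<Rightarrow> 'n cpair) \<Rightarrow> (real \<Rightarrow> 'n cpair \<Rightarrow> complex) \<Rightarrow> bool" where
  "normalized_on_contour \<Psi> x0 U Y \<gamma> a \<longleftrightarrow>
     (\<exists>V. open V \<and> x0 \<in> V \<and> (\<forall>y\<in>V. (y, vconj y) \<in> Y) \<and>
        (\<forall>N::nat. \<exists>C. \<forall>\<^sub>F h in at_right 0. \<forall>y\<in>V.
           norm (contour_op \<Psi> U \<gamma> a h (y, vconj y) - 1) \<le> C * h ^ N))"

end

theory Submission
  imports Defs "HOL-Probability.Distributions"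
begin

text \<open>At the anti-diagonal the phase vanishes to second order, with quadratic part given by the Levi matrix
  \<open>L\<close> of \<open>\<Phi>\<close>. Since phase and symbol are almost holomorphic and the real part of the phase is bounded by
  \<open>- \<bar>\<cdot>\<bar>\<^sup>2 / C\<close>, Stokes' formula replaces any good contour, up to \<open>O(h\<^sup>\<infinity>)\<close>, by the contour
  \<open>z \<mapsto> (y + z, vconj y - L\<^sup>- vconj z)\<close>, where \<open>L\<^sup>-\<close> is the inverse of \<open>L\<close>, on which the quadratic part is
  \<open>- \<bar>z\<bar>\<^sup>2\<close>. Taylor expansion and Gaussian moments turn the integral into
  \<open>\<Sum>\<^sub>m h\<^sup>m \<Sum>\<^sub>i C\<^sub>m\<^sub>-\<^sub>i a\<^sub>i\<close>, where \<open>C\<^sub>0\<close> is multiplication by a constant times \<open>1 / det L\<close>, and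
  \<open>C\<^sub>k b\<close> involves only derivatives of \<open>b\<close> on the anti-diagonal, which are determined by the restriction of \<open>b\<close>
  because \<open>b\<close> is almost holomorphic. Normalization thus is a triangular system for the \<open>a\<^sub>j\<close> on the
  anti-diagonal; it is solved recursively, and the solution is summed by Borel's argument.\<close>

section \<open>Calculus of smooth functions\<close>

text \<open>The obstacle is that nothing is holomorphic: the identities of complex analysis hold
  only up to functions that are flat on the anti-diagonal, and all errors must be uniform in the
  base point. Gaussian decay of the exponential turns flatness into powers of \<open>h\<close>; the
  prefactor of order \<open>-n\<close> in \<open>h\<close> is paid for by expanding \<open>n\<close>
  orders further. Ends of contours never enter, since the integrals are cut off near
  \<open>t = 0\<close> and what is dropped is smaller than any power of \<open>h\<close>. A given
  contour meets the adapted one at the affine contour, to which both deform; this is why one symbol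
  serves all contours. On the adapted contour the quadratic part does not depend on the base point,
  so one fixed Gaussian weight suffices and the base point enters through almost holomorphic
  coefficients only. Hence the operators of the expansion make sense off the anti-diagonal too, and
  the triangular system is solved on a full neighbourhood, which makes its solutions almost
  holomorphic without any extension argument. The constant in the formula for the leading term is
  the reciprocal of the Gaussian mass times the Jacobian of the affine contour.\<close>

definition dd :: "'a::real_normed_vector \<Rightarrow> ('a \<Rightarrow> 'b::real_normed_vector) \<Rightarrow> 'a \<Rightarrow> 'b" where
  "dd v f = (\<lambda>x. frechet_derivative f (at x) v)"

lemma iter_deriv_Cons: "iter_deriv (v # vs) f = iter_deriv vs (dd v f)"
  by (simp add: dd_def)

lemma iter_deriv_snoc: "iter_deriv (vs @ [w]) f = dd w (iter_deriv vs f)"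
  by (induction vs arbitrary: f) (simp_all add: dd_def)

lemma dd_eqI: "(f has_derivative D) (at x) \<Longrightarrow> dd v f x = D v"
  unfolding dd_def by (metis frechet_derivative_at)

lemma has_derivative_dd: "f differentiable at x \<Longrightarrow> (f has_derivative (\<lambda>v. dd v f x)) (at x)"
  unfolding dd_def using frechet_derivative_works by blast

lemma linear_dd: "f differentiable at x \<Longrightarrow> linear (\<lambda>v. dd v f x)"
  using has_derivative_dd has_derivative_linear by blast

text \<open>A measure for induction: product and chain rule express a derivative of a function of
  order \<open>Suc k\<close> through functions of order \<open>k\<close>. The count starts at
  differentiability, so \<open>ck k\<close> concerns derivatives along lists of length at most
  \<open>k\<close>, all of which are again differentiable.\<close>

primrec ck :: "nat \<Rightarrow> 'a::real_normed_vector set \<Rightarrow> ('a \<Rightarrow> 'b::real_normed_vector) \<Rightarrow> bool" where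
  "ck 0 S f = (\<forall>x\<in>S. f differentiable at x)"
| "ck (Suc k) S f = ((\<forall>x\<in>S. f differentiable at x) \<and> (\<forall>v. ck k S (dd v f)))"

lemma ck_iff: "ck k S f \<longleftrightarrow> (\<forall>vs. length vs \<le> k \<longrightarrow> (\<forall>x\<in>S. iter_deriv vs f differentiable at x))"
proof (induction k arbitrary: f)
  case 0
  then show ?case by simp
next
  case (Suc k)
  show ?case
  proof
    assume L: "ck (Suc k) S f"
    show "\<forall>vs. length vs \<le> Suc k \<longrightarrow> (\<forall>x\<in>S. iter_deriv vs f differentiable at x)"
    proof (intro allI impI ballI)
      fix vs :: "'a list" and x assume vs: "length vs \<le> Suc k" and x: "x \<in> S"
      show "iter_deriv vs f differentiable at x"
      proof (cases vs)
        case Nil then show ?thesis using L x by simp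
      next
        case (Cons v vs')
        then show ?thesis using L x vs Suc.IH[of "dd v f"] unfolding Cons iter_deriv_Cons by simp
      qed
    qed
  next
    assume R: "\<forall>vs. length vs \<le> Suc k \<longrightarrow> (\<forall>x\<in>S. iter_deriv vs f differentiable at x)"
    have "\<forall>x\<in>S. f differentiable at x" using R[rule_format, of "[]"] by simp
    moreover have "ck k S (dd v f)" for v
      unfolding Suc.IH using R[rule_format, of "v # _"] unfolding iter_deriv_Cons by simp
    ultimately show "ck (Suc k) S f" by simp
  qed
qed

lemma smooth_on_iff_ck: "smooth_on S f \<longleftrightarrow> (\<forall>k. ck k S f)"
  unfolding smooth_on_def ck_iff by auto

lemma ck_diff: "ck k S f \<Longrightarrow> x \<in> S \<Longrightarrow> f differentiable at x"
  by (cases k) auto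

lemma ck_Suc_D: "ck (Suc k) S f \<Longrightarrow> ck k S f"
  unfolding ck_iff by auto

lemma smooth_on_diff: "smooth_on S f \<Longrightarrow> x \<in> S \<Longrightarrow> f differentiable at x"
  unfolding smooth_on_iff_ck using ck_diff by blast

lemma smooth_on_dd: "smooth_on S f \<Longrightarrow> smooth_on S (dd v f)"
  unfolding smooth_on_iff_ck by (metis ck.simps(2))

lemma smooth_on_iter_deriv: "smooth_on S f \<Longrightarrow> smooth_on S (iter_deriv vs f)"
  by (induction vs arbitrary: f) (auto simp del: iter_deriv.simps(2) simp: iter_deriv_Cons smooth_on_dd)

lemma smooth_on_subset: "smooth_on S f \<Longrightarrow> T \<subseteq> S \<Longrightarrow> smooth_on T f"
  unfolding smooth_on_def by blast

lemma smooth_on_continuous: "smooth_on S f \<Longrightarrow> continuous_on S f"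
  by (meson differentiable_imp_continuous_within continuous_at_imp_continuous_on smooth_on_diff)

text \<open>No differentiability is required: \<open>frechet_derivative\<close> is a choice among
  the derivatives at the point, and functions that agree nearby have the same derivatives.\<close>

lemma dd_cong_open:
  assumes "open S" "\<And>y. y \<in> S \<Longrightarrow> f y = g y" "x \<in> S"
  shows "dd v f x = dd v g x"
proof -
  have "(f has_derivative D) (at x) \<longleftrightarrow> (g has_derivative D) (at x)" for D
    using assms has_derivative_transform_within_open[of f D x UNIV S g]
      has_derivative_transform_within_open[of g D x UNIV S f] by auto
  then show ?thesis unfolding dd_def frechet_derivative_def by simp
qed

lemma differentiable_cong_open:
  assumes "open S" "\<And>y. y \<in> S \<Longrightarrow> f y = g y" "x \<in> S" "f differentiable at x"
  shows "g differentiable at x"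
  using assms has_derivative_transform_within_open[of f _ x UNIV S g] unfolding differentiable_def by blast

lemma ck_cong:
  assumes "open S" "ck k S f" "\<And>y. y \<in> S \<Longrightarrow> f y = g y"
  shows "ck k S g"
  using assms(2,3)
proof (induction k arbitrary: f g)
  case 0
  then show ?case using differentiable_cong_open[OF assms(1)] by simp blast
next
  case (Suc k)
  have "\<forall>x\<in>S. g differentiable at x" using Suc.prems differentiable_cong_open[OF assms(1)] by simp blast
  moreover have "ck k S (dd v g)" for v
  proof (rule Suc.IH[of "dd v f"])
    show "ck k S (dd v f)" using Suc.prems(1) by simp
    show "dd v f y = dd v g y" if "y \<in> S" for y
      by (rule dd_cong_open[OF assms(1) Suc.prems(2) that])
  qed
  ultimately show ?case by simp
qed

lemma smooth_on_cong:
  assumes "open S" "smooth_on S f" "\<And>y. y \<in> S \<Longrightarrow> f y = g y"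
  shows "smooth_on S g"
  using assms ck_cong unfolding smooth_on_iff_ck by blast

lemma iter_deriv_cong:
  assumes "open S" "\<And>y. y \<in> S \<Longrightarrow> f y = g y" "x \<in> S"
  shows "iter_deriv vs f x = iter_deriv vs g x"
  using assms(2,3)
proof (induction vs arbitrary: f g)
  case Nil then show ?case by simp
next
  case (Cons v vs)
  then show ?case unfolding iter_deriv_Cons using dd_cong_open[OF assms(1)] by blast
qed

section \<open>Differentiation rules and closure properties of finite order\<close>

lemma dd_const [simp]: "dd v (\<lambda>_. c) = (\<lambda>_. 0)"
  by (rule ext, rule dd_eqI[of _ "\<lambda>_. 0", simplified]) simp

lemma dd_bounded_linear: "bounded_linear L \<Longrightarrow> dd v L = (\<lambda>_. L v)"
  by (rule ext, rule dd_eqI) (rule bounded_linear_imp_has_derivative)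

lemma ck_const [simp]: "ck k S (\<lambda>_. c)"
  by (induction k arbitrary: c) auto

lemma ck_linear: "bounded_linear L \<Longrightarrow> ck k S L"
  by (cases k) (auto simp: dd_bounded_linear bounded_linear_imp_differentiable)

lemma dd_add: "f differentiable at x \<Longrightarrow> g differentiable at x \<Longrightarrow>
    dd v (\<lambda>x. f x + g x) x = dd v f x + dd v g x"
  by (rule dd_eqI) (intro has_derivative_add has_derivative_dd)

lemma dd_linear_comp: "bounded_linear L \<Longrightarrow> f differentiable at x \<Longrightarrow> dd v (\<lambda>x. L (f x)) x = L (dd v f x)"
  by (rule dd_eqI) (erule bounded_linear.has_derivative, erule has_derivative_dd)

lemma dd_bilinear: "bounded_bilinear P \<Longrightarrow> f differentiable at x \<Longrightarrow> g differentiable at x \<Longrightarrow>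
    dd v (\<lambda>x. P (f x) (g x)) x = P (f x) (dd v g x) + P (dd v f x) (g x)"
  by (rule dd_eqI) (erule bounded_bilinear.FDERIV, erule has_derivative_dd, erule has_derivative_dd)

lemma dd_sum: "(\<And>i. i \<in> I \<Longrightarrow> f i differentiable at x) \<Longrightarrow>
    dd v (\<lambda>x. \<Sum>i\<in>I. f i x) x = (\<Sum>i\<in>I. dd v (f i) x)"
  by (rule dd_eqI) (intro has_derivative_sum has_derivative_dd)

lemma dd_compose:
  assumes "g differentiable at x" "f differentiable at (g x)"
  shows "dd v (\<lambda>x. f (g x)) x = dd (dd v g x) f (g x)"
proof (rule dd_eqI)
  show "((\<lambda>x. f (g x)) has_derivative (\<lambda>v. dd (dd v g x) f (g x))) (at x)"
    using diff_chain_at[OF has_derivative_dd[OF assms(1)] has_derivative_dd[OF assms(2)]]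
    by (simp add: o_def)
qed

lemma dd_basis:
  fixes f :: "'a::euclidean_space \<Rightarrow> 'b::real_normed_vector"
  assumes "f differentiable at x"
  shows "dd v f x = (\<Sum>b\<in>Basis. (v \<bullet> b) *\<^sub>R dd b f x)"
proof -
  interpret linear "\<lambda>v. dd v f x" by (rule linear_dd[OF assms])
  have "dd v f x = dd (\<Sum>b\<in>Basis. (v \<bullet> b) *\<^sub>R b) f x" by (simp add: euclidean_representation)
  also have "\<dots> = (\<Sum>b\<in>Basis. (v \<bullet> b) *\<^sub>R dd b f x)" by (simp add: sum scale)
  finally show ?thesis .
qed

lemma differentiable_linear_comp: "bounded_linear L \<Longrightarrow> f differentiable at x \<Longrightarrow> (\<lambda>x. L (f x)) differentiable at x"
  unfolding differentiable_def by (blast intro: bounded_linear.has_derivative)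

lemma differentiable_bilinear: "bounded_bilinear P \<Longrightarrow> f differentiable at x \<Longrightarrow> g differentiable at x \<Longrightarrow>
    (\<lambda>x. P (f x) (g x)) differentiable at x"
  unfolding differentiable_def by (blast intro: bounded_bilinear.FDERIV)

lemma ck_linear_comp:
  assumes "open S" "bounded_linear L"
  shows "ck k S f \<Longrightarrow> ck k S (\<lambda>x. L (f x))"
proof (induction k arbitrary: f)
  case 0
  then show ?case using assms(2) differentiable_linear_comp[of L f] by auto
next
  case (Suc k)
  have d: "f differentiable at x" if "x \<in> S" for x using Suc.prems that by simp
  have "ck k S (dd v (\<lambda>x. L (f x)))" for v
    by (rule ck_cong[OF assms(1), of _ "\<lambda>x. L (dd v f x)"])
       (use Suc in simp, rule dd_linear_comp[OF assms(2) d, symmetric])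
  then show ?case using d assms(2) differentiable_linear_comp[of L f] by auto
qed

lemma ck_add:
  assumes "open S"
  shows "ck k S f \<Longrightarrow> ck k S g \<Longrightarrow> ck k S (\<lambda>x. f x + g x)"
proof (induction k arbitrary: f g)
  case 0
  then show ?case by auto
next
  case (Suc k)
  have "ck k S (dd v (\<lambda>x. f x + g x))" for v
    by (rule ck_cong[OF assms(1), of _ "\<lambda>x. dd v f x + dd v g x"])
       (use Suc in simp, rule dd_add[symmetric], use Suc.prems in auto)
  then show ?case using Suc.prems by auto
qed

lemma ck_bilinear:
  assumes "open S" "bounded_bilinear P"
  shows "ck k S f \<Longrightarrow> ck k S g \<Longrightarrow> ck k S (\<lambda>x. P (f x) (g x))"
proof (induction k arbitrary: f g)
  case 0
  then show ?case by (simp add: differentiable_bilinear[OF assms(2)])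
next
  case (Suc k)
  have d: "f differentiable at x" "g differentiable at x" if "x \<in> S" for x using Suc.prems that by simp_all
  have "ck k S (dd v (\<lambda>x. P (f x) (g x)))" for v
  proof (rule ck_cong[OF assms(1), of _ "\<lambda>x. P (f x) (dd v g x) + P (dd v f x) (g x)"])
    show "ck k S (\<lambda>x. P (f x) (dd v g x) + P (dd v f x) (g x))"
      by (intro ck_add[OF assms(1)] Suc.IH) (use Suc.prems ck_Suc_D in auto)
  qed (rule dd_bilinear[OF assms(2) d, symmetric])
  moreover have "(\<lambda>x. P (f x) (g x)) differentiable at x" if "x \<in> S" for x
    by (rule differentiable_bilinear[OF assms(2) d[OF that]])
  ultimately show ?case by simp
qed

lemma ck_sum:
  assumes "open S" "\<And>i. i \<in> I \<Longrightarrow> ck k S (f i)"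
  shows "ck k S (\<lambda>x. \<Sum>i\<in>I. f i x)"
  using assms(2) by (induction I rule: infinite_finite_induct) (auto intro!: ck_add[OF assms(1)])

lemma differentiable_compose_at:
  "g differentiable at x \<Longrightarrow> f differentiable at (g x) \<Longrightarrow> (\<lambda>x. f (g x)) differentiable at x"
  using differentiable_chain_at[of g x f] by (simp add: o_def)

text \<open>The chain rule differentiates \<open>f\<close> in the direction \<open>dd v g x\<close>,
  which moves with \<open>x\<close>. Expanding it in a basis leaves fixed directions with scalar
  coefficients, to which the induction hypothesis applies; hence the Euclidean codomain of
  \<open>g\<close>.\<close>

lemma ck_compose:
  fixes g :: "'a::real_normed_vector \<Rightarrow> 'b::euclidean_space"
  assumes "open S" "open T" "g ` S \<subseteq> T"
  shows "ck k S g \<Longrightarrow> ck k T f \<Longrightarrow> ck k S (\<lambda>x. f (g x))"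
proof (induction k arbitrary: f)
  case 0
  have "(\<lambda>x. f (g x)) differentiable at x" if "x \<in> S" for x
    by (rule differentiable_compose_at[of g x f]) (use 0 that assms(3) in auto)
  then show ?case by simp
next
  case (Suc k)
  have d: "g differentiable at x" "f differentiable at (g x)" if "x \<in> S" for x
    using Suc.prems that assms(3) by auto
  have "ck k S (dd v (\<lambda>x. f (g x)))" for v
  proof (rule ck_cong[OF assms(1), of _ "\<lambda>x. \<Sum>b\<in>Basis. (dd v g x \<bullet> b) *\<^sub>R dd b f (g x)"])
    show "ck k S (\<lambda>x. \<Sum>b\<in>Basis. (dd v g x \<bullet> b) *\<^sub>R dd b f (g x))"
    proof (rule ck_sum[OF assms(1)], rule ck_bilinear[OF assms(1) bounded_bilinear_scaleR])
      fix b :: 'b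
      show "ck k S (\<lambda>x. dd v g x \<bullet> b)"
        by (rule ck_linear_comp[OF assms(1) bounded_linear_inner_left]) (use Suc.prems in simp)
      show "ck k S (\<lambda>x. dd b f (g x))"
        using Suc.IH[OF ck_Suc_D[OF Suc.prems(1)], of "dd b f"] Suc.prems by simp
    qed
  next
    fix x assume x: "x \<in> S"
    show "(\<Sum>b\<in>Basis. (dd v g x \<bullet> b) *\<^sub>R dd b f (g x)) = dd v (\<lambda>x. f (g x)) x"
      unfolding dd_compose[OF d[OF x]] by (rule dd_basis[OF d(2)[OF x], symmetric])
  qed
  moreover have "(\<lambda>x. f (g x)) differentiable at x" if "x \<in> S" for x
    by (rule differentiable_compose_at[of g x f, OF d[OF that]])
  ultimately show ?case by simp
qed

lemma dd_inverse:
  fixes f :: "'a::real_normed_vector \<Rightarrow> complex"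
  assumes "f differentiable at x" "f x \<noteq> 0"
  shows "dd v (\<lambda>x. inverse (f x)) x = - (inverse (f x) * dd v f x * inverse (f x))"
  by (rule dd_eqI) (rule Deriv.has_derivative_inverse[OF assms(2) has_derivative_dd[OF assms(1)]])

lemma ck_inverse:
  fixes f :: "'a::real_normed_vector \<Rightarrow> complex"
  assumes "open S" "\<And>x. x \<in> S \<Longrightarrow> f x \<noteq> 0"
  shows "ck k S f \<Longrightarrow> ck k S (\<lambda>x. inverse (f x))"
proof (induction k)
  case 0
  then show ?case using assms(2) by (auto intro!: differentiable_inverse)
next
  case (Suc k)
  have d: "f differentiable at x" if "x \<in> S" for x using Suc.prems that by simp
  have "ck k S (dd v (\<lambda>x. inverse (f x)))" for v
  proof (rule ck_cong[OF assms(1), of _ "\<lambda>x. - 1 * (inverse (f x) * dd v f x * inverse (f x))"])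
    show "ck k S (\<lambda>x. - 1 * (inverse (f x) * dd v f x * inverse (f x)))"
      by (intro ck_bilinear[OF assms(1) bounded_bilinear_mult] Suc.IH ck_const)
         (use Suc.prems ck_Suc_D in auto)
  qed (use dd_inverse[OF d assms(2)] in simp)
  then show ?case using d assms(2) by (auto intro!: differentiable_inverse)
qed

lemma dd_exp:
  fixes f :: "'a::real_normed_vector \<Rightarrow> complex"
  assumes "f differentiable at x"
  shows "dd v (\<lambda>x. exp (f x)) x = exp (f x) * dd v f x"
proof (rule dd_eqI)
  have "(exp has_derivative (*) (exp (f x))) (at (f x))"
    using DERIV_exp unfolding has_field_derivative_def by blast
  from diff_chain_at[OF has_derivative_dd[OF assms] this]
  show "((\<lambda>x. exp (f x)) has_derivative (\<lambda>v. exp (f x) * dd v f x)) (at x)"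
    by (simp add: o_def)
qed

lemma differentiable_cexp:
  fixes f :: "'a::real_normed_vector \<Rightarrow> complex"
  assumes "f differentiable at x"
  shows "(\<lambda>x. exp (f x)) differentiable at x"
proof -
  have "(exp has_derivative (*) (exp (f x))) (at (f x))"
    using DERIV_exp unfolding has_field_derivative_def by blast
  from diff_chain_at[OF has_derivative_dd[OF assms] this]
  show ?thesis unfolding differentiable_def o_def by blast
qed

lemma ck_exp:
  fixes f :: "'a::real_normed_vector \<Rightarrow> complex"
  assumes "open S"
  shows "ck k S f \<Longrightarrow> ck k S (\<lambda>x. exp (f x))"
proof (induction k)
  case 0
  then show ?case by (auto intro!: differentiable_cexp)
next
  case (Suc k)
  have d: "f differentiable at x" if "x \<in> S" for x using Suc.prems that by simp
  have "ck k S (dd v (\<lambda>x. exp (f x)))" for v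
  proof (rule ck_cong[OF assms(1), of _ "\<lambda>x. exp (f x) * dd v f x"])
    show "ck k S (\<lambda>x. exp (f x) * dd v f x)"
      by (intro ck_bilinear[OF assms(1) bounded_bilinear_mult] Suc.IH)
         (use Suc.prems ck_Suc_D in auto)
  qed (rule dd_exp[OF d, symmetric])
  then show ?case using d by (auto intro!: differentiable_cexp)
qed

section \<open>Closure properties of smooth functions\<close>

lemma smooth_on_const [simp]: "smooth_on S (\<lambda>_. c)"
  by (simp add: smooth_on_iff_ck)

lemma smooth_on_linear: "bounded_linear L \<Longrightarrow> smooth_on S L"
  by (simp add: smooth_on_iff_ck ck_linear)

lemma smooth_on_linear_comp:
  "open S \<Longrightarrow> bounded_linear L \<Longrightarrow> smooth_on S f \<Longrightarrow> smooth_on S (\<lambda>x. L (f x))"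
  by (simp add: smooth_on_iff_ck ck_linear_comp)

lemma smooth_on_add:
  "open S \<Longrightarrow> smooth_on S f \<Longrightarrow> smooth_on S g \<Longrightarrow> smooth_on S (\<lambda>x. f x + g x)"
  by (simp add: smooth_on_iff_ck ck_add)

lemma smooth_on_bilinear:
  "open S \<Longrightarrow> bounded_bilinear P \<Longrightarrow> smooth_on S f \<Longrightarrow> smooth_on S g \<Longrightarrow>
    smooth_on S (\<lambda>x. P (f x) (g x))"
  by (simp add: smooth_on_iff_ck ck_bilinear)

lemma smooth_on_mult:
  fixes f g :: "'a::real_normed_vector \<Rightarrow> 'b::real_normed_algebra"
  shows "open S \<Longrightarrow> smooth_on S f \<Longrightarrow> smooth_on S g \<Longrightarrow> smooth_on S (\<lambda>x. f x * g x)"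
  by (rule smooth_on_bilinear[OF _ bounded_bilinear_mult])

lemma smooth_on_scaleR:
  "open S \<Longrightarrow> smooth_on S f \<Longrightarrow> smooth_on S g \<Longrightarrow> smooth_on S (\<lambda>x. f x *\<^sub>R g x)"
  by (rule smooth_on_bilinear[OF _ bounded_bilinear_scaleR])

lemma smooth_on_minus: "open S \<Longrightarrow> smooth_on S f \<Longrightarrow> smooth_on S (\<lambda>x. - f x)"
  by (rule smooth_on_linear_comp[OF _ bounded_linear_minus[OF bounded_linear_ident]])

lemma smooth_on_sub:
  "open S \<Longrightarrow> smooth_on S f \<Longrightarrow> smooth_on S g \<Longrightarrow> smooth_on S (\<lambda>x. f x - g x)"
  using smooth_on_add[of S f "\<lambda>x. - g x"] smooth_on_minus[of S g] by simp

lemma smooth_on_sum: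
  "open S \<Longrightarrow> (\<And>i. i \<in> I \<Longrightarrow> smooth_on S (f i)) \<Longrightarrow> smooth_on S (\<lambda>x. \<Sum>i\<in>I. f i x)"
  by (simp add: smooth_on_iff_ck ck_sum)

lemma smooth_on_prod:
  fixes f :: "'i \<Rightarrow> 'a::real_normed_vector \<Rightarrow> 'b::{real_normed_algebra,comm_ring_1}"
  shows "open S \<Longrightarrow> (\<And>i. i \<in> I \<Longrightarrow> smooth_on S (f i)) \<Longrightarrow> smooth_on S (\<lambda>x. \<Prod>i\<in>I. f i x)"
  by (induction I rule: infinite_finite_induct) (auto intro!: smooth_on_mult)

lemma smooth_on_compose:
  fixes g :: "'a::real_normed_vector \<Rightarrow> 'b::euclidean_space"
  shows "open S \<Longrightarrow> open T \<Longrightarrow> smooth_on S g \<Longrightarrow> smooth_on T f \<Longrightarrow> g ` S \<subseteq> T \<Longrightarrow>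
    smooth_on S (\<lambda>x. f (g x))"
  unfolding smooth_on_iff_ck using ck_compose by blast

lemma smooth_on_inverse:
  fixes f :: "'a::real_normed_vector \<Rightarrow> complex"
  shows "open S \<Longrightarrow> smooth_on S f \<Longrightarrow> (\<And>x. x \<in> S \<Longrightarrow> f x \<noteq> 0) \<Longrightarrow> smooth_on S (\<lambda>x. inverse (f x))"
  by (simp add: smooth_on_iff_ck ck_inverse)

lemma smooth_on_exp:
  fixes f :: "'a::real_normed_vector \<Rightarrow> complex"
  shows "open S \<Longrightarrow> smooth_on S f \<Longrightarrow> smooth_on S (\<lambda>x. exp (f x))"
  by (simp add: smooth_on_iff_ck ck_exp)

lemma smooth_on_Pair:
  assumes "open S" "smooth_on S f" "smooth_on S g"
  shows "smooth_on S (\<lambda>x. (f x, g x))"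
proof -
  have l: "bounded_linear (\<lambda>a. (a, 0))" "bounded_linear (\<lambda>b. (0, b))"
    by (intro bounded_linear_Pair bounded_linear_ident bounded_linear_zero)+
  have "smooth_on S (\<lambda>x. (f x, 0) + (0, g x))"
    by (intro smooth_on_add smooth_on_linear_comp[OF _ l(1)] smooth_on_linear_comp[OF _ l(2)] assms)
  then show ?thesis by simp
qed

lemma smooth_on_vec:
  fixes f :: "'a::real_normed_vector \<Rightarrow> 'i::finite \<Rightarrow> 'b::real_normed_vector"
  assumes "open S" "\<And>i. smooth_on S (\<lambda>x. f x i)"
  shows "smooth_on S (\<lambda>x. \<chi> i. f x i)"
proof -
  have l: "bounded_linear (axis i :: 'b \<Rightarrow> 'b^'i)" for i :: 'i
  proof (rule bounded_linear_intro[of _ 1])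
    fix x :: 'b
    have "norm (axis i x) \<le> (\<Sum>j\<in>UNIV. norm (axis i x $ j))"
      unfolding norm_vec_def by (rule L2_set_le_sum) simp
    also have "\<dots> = (\<Sum>j\<in>UNIV. if j = i then norm x else 0)"
      by (rule sum.cong) (auto simp: axis_def)
    also have "\<dots> = norm x" by simp
    finally show "norm (axis i x) \<le> norm x * 1" by simp
  qed (auto simp: axis_def vec_eq_iff)
  have "smooth_on S (\<lambda>x. \<Sum>i\<in>UNIV. axis i (f x i))"
    by (intro smooth_on_sum smooth_on_linear_comp[OF _ l] assms)
  moreover have "(\<Sum>i\<in>UNIV. axis i (f x i)) = (\<chi> i. f x i)" for x
    by (simp add: vec_eq_iff axis_def)
  ultimately show ?thesis by simp
qed

lemma smooth_on_det:
  fixes f :: "'a::real_normed_vector \<Rightarrow> 'i::finite \<Rightarrow> 'i \<Rightarrow> complex"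
  assumes "open S" "\<And>i j. smooth_on S (\<lambda>x. f x i j)"
  shows "smooth_on S (\<lambda>x. det (\<chi> i j. f x i j))"
  unfolding det_def by (simp, intro smooth_on_sum smooth_on_mult smooth_on_prod smooth_on_const assms)

subsection \<open>Symmetry of second derivatives\<close>

lemma has_vector_derivative_line:
  assumes "f differentiable at (x + t *\<^sub>R v)"
  shows "((\<lambda>t. f (x + t *\<^sub>R v)) has_vector_derivative dd v f (x + t *\<^sub>R v)) (at t within T)"
proof -
  have "((\<lambda>t. x + t *\<^sub>R v) has_derivative (\<lambda>s. s *\<^sub>R v)) (at t)"
    by (auto intro!: derivative_eq_intros)
  from diff_chain_at[OF this has_derivative_dd[OF assms]]
  have "((\<lambda>t. f (x + t *\<^sub>R v)) has_derivative (\<lambda>s. dd (s *\<^sub>R v) f (x + t *\<^sub>R v))) (at t)"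
    by (simp add: o_def)
  then show ?thesis unfolding has_vector_derivative_def linear_scale[OF linear_dd[OF assms]]
    by (rule has_derivative_at_withinI)
qed

text \<open>By the fundamental theorem the increment of \<open>f\<close> along
  \<open>a *\<^sub>R v\<close> is an integral of \<open>dd v f\<close>. Differentiation along
  \<open>w\<close> under the integral sign gives a formula for the increment of
  \<open>dd w f\<close>; its derivative in \<open>a\<close> at 0 is the claim.\<close>

lemma dd_commute:
  fixes f :: "'a::real_normed_vector \<Rightarrow> 'b::banach"
  assumes "open S" "smooth_on S f" "x \<in> S"
  shows "dd v (dd w f) x = dd w (dd v f) x"
proof -
  obtain e where e: "e > 0" "ball x e \<subseteq> S" using assms(1,3) openE by blast
  \<comment> \<open>Keeps all points \<open>x + s *\<^sub>R v + b *\<^sub>R w\<close> with s and b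
    at most \<eta> in absolute value inside the ball of radius e; the summand 1 covers v = w =
    0.\<close>
  define \<eta> where "\<eta> = e / (2 * (norm v + norm w + 1))"
  have \<eta>: "\<eta> > 0" using e unfolding \<eta>_def by (simp add: add_nonneg_pos)
  have inS: "x + s *\<^sub>R v + b *\<^sub>R w \<in> S" if "\<bar>s\<bar> \<le> \<eta>" "\<bar>b\<bar> \<le> \<eta>" for s b
  proof -
    have "norm (s *\<^sub>R v + b *\<^sub>R w) \<le> \<bar>s\<bar> * norm v + \<bar>b\<bar> * norm w"
      using norm_triangle_ineq[of "s *\<^sub>R v" "b *\<^sub>R w"] by simp
    also have "\<dots> \<le> \<eta> * norm v + \<eta> * norm w" using that by (intro add_mono mult_right_mono) auto
    also have "\<dots> < \<eta> * (2 * (norm v + norm w + 1))"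
    proof -
      have "norm v + norm w < 2 * (norm v + norm w + 1)"
      proof -
        have "0 \<le> norm v + norm w" by simp
        then show ?thesis by argo
      qed
      then have "\<eta> * (norm v + norm w) < \<eta> * (2 * (norm v + norm w + 1))"
        using \<eta> mult_strict_left_mono by blast
      then show ?thesis by (simp add: algebra_simps)
    qed
    also have "\<dots> = e" unfolding \<eta>_def using add_nonneg_pos[of "norm v + norm w" 1] by simp
    finally have "norm (s *\<^sub>R v + b *\<^sub>R w) < e" .
    then have "dist (x + (s *\<^sub>R v + b *\<^sub>R w)) x < e" by (simp add: dist_norm)
    then have "dist x (x + s *\<^sub>R v + b *\<^sub>R w) < e" by (simp add: dist_commute add.assoc)
    then show ?thesis using e(2) by auto
  qed
  have inS0: "x + s *\<^sub>R v \<in> S" if "\<bar>s\<bar> \<le> \<eta>" for s using inS[OF that, of 0] \<eta> by simp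
  have df: "g differentiable at y" if "smooth_on S g" "y \<in> S" for g :: "'a \<Rightarrow> 'b" and y
    using that smooth_on_diff by blast
  define B where "B = {-\<eta>..\<eta>}"
  have cB: "convex B" "0 \<in> B" using \<eta> by (auto simp: B_def)
  have cont: "continuous_on (B \<times> cbox 0 a) (\<lambda>(b, s). g (x + s *\<^sub>R v + b *\<^sub>R w))"
    if "smooth_on S g" "a \<in> {0..\<eta>}" for a and g :: "'a \<Rightarrow> 'b"
  proof -
    have "continuous_on (B \<times> cbox 0 a) (\<lambda>z. g (x + snd z *\<^sub>R v + fst z *\<^sub>R w))"
      by (rule continuous_on_compose2[OF smooth_on_continuous[OF that(1)]])
         (use that(2) inS in \<open>auto intro!: continuous_intros simp: B_def\<close>)
    then show ?thesis by (simp add: case_prod_beta)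
  qed
  have FTC: "integral (cbox 0 a) (\<lambda>s. dd v g (x + s *\<^sub>R v + b *\<^sub>R w)) =
      g (x + a *\<^sub>R v + b *\<^sub>R w) - g (x + b *\<^sub>R w)" 
    if "a \<in> {0..\<eta>}" "b \<in> B" "smooth_on S g" for a b and g :: "'a \<Rightarrow> 'b"
  proof -
    have "((\<lambda>s. dd v g (x + s *\<^sub>R v + b *\<^sub>R w)) has_integral 
       g (x + a *\<^sub>R v + b *\<^sub>R w) - g (x + 0 *\<^sub>R v + b *\<^sub>R w)) {0..a}"
    proof (rule fundamental_theorem_of_calculus)
      fix s assume "s \<in> {0..a}"
      then have "x + b *\<^sub>R w + s *\<^sub>R v \<in> S" using inS[of s b] that by (auto simp: B_def algebra_simps)
      from has_vector_derivative_line[OF df[OF that(3) this]]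
      show "((\<lambda>s. g (x + s *\<^sub>R v + b *\<^sub>R w)) has_vector_derivative dd v g (x + s *\<^sub>R v + b *\<^sub>R w)) (at s within {0..a})"
        by (simp add: algebra_simps)
    qed (use that in auto)
    then show ?thesis by (simp add: integral_unique)
  qed
  \<comment> \<open>The same function of b, an integral by \<open>FTC\<close>, is differentiated at
    b = 0 in two ways: under the integral, and as a difference of two values of f.\<close>
  have key: "dd w f (x + a *\<^sub>R v) - dd w f x = integral (cbox 0 a) (\<lambda>s. dd w (dd v f) (x + s *\<^sub>R v))"
    if a: "a \<in> {0..\<eta>}" for a
  proof -
    let ?g = "dd v f"
    have sg: "smooth_on S ?g" using assms(2) by (rule smooth_on_dd)
    have 1: "((\<lambda>b. integral (cbox 0 a) (\<lambda>s. ?g (x + s *\<^sub>R v + b *\<^sub>R w))) has_vector_derivative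
       integral (cbox 0 a) (\<lambda>s. dd w ?g (x + s *\<^sub>R v + 0 *\<^sub>R w))) (at 0 within B)"
    proof (rule leibniz_rule_vector_derivative[OF _ _ _ cB(2,1)])
      fix b s assume "b \<in> B" "s \<in> cbox 0 a"
      then have "x + s *\<^sub>R v + b *\<^sub>R w \<in> S" using a by (auto intro!: inS simp: B_def)
      from has_vector_derivative_line[OF df[OF sg this]]
      show "((\<lambda>b. ?g (x + s *\<^sub>R v + b *\<^sub>R w)) has_vector_derivative dd w ?g (x + s *\<^sub>R v + b *\<^sub>R w)) (at b within B)" .
    next
      fix b assume "b \<in> B"
      then show "(\<lambda>s. ?g (x + s *\<^sub>R v + b *\<^sub>R w)) integrable_on cbox 0 a"
        by (intro integrable_continuous continuous_on_compose2[OF smooth_on_continuous[OF sg]])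
           (use a inS in \<open>auto intro!: continuous_intros simp: B_def\<close>)
    next
      show "continuous_on (B \<times> cbox 0 a) (\<lambda>(b, s). dd w ?g (x + s *\<^sub>R v + b *\<^sub>R w))"
        by (rule cont[OF smooth_on_dd[OF sg] a])
    qed
    have 2: "((\<lambda>b. integral (cbox 0 a) (\<lambda>s. ?g (x + s *\<^sub>R v + b *\<^sub>R w))) has_vector_derivative
       (dd w f (x + a *\<^sub>R v) - dd w f x)) (at 0 within B)"
    proof (rule has_vector_derivative_transform[OF cB(2)])
      show "((\<lambda>b. f (x + a *\<^sub>R v + b *\<^sub>R w) - f (x + b *\<^sub>R w)) has_vector_derivative
       (dd w f (x + a *\<^sub>R v) - dd w f x)) (at 0 within B)"
        using has_vector_derivative_line[OF df[OF assms(2)], of "x + a *\<^sub>R v" 0 w B]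
          has_vector_derivative_line[OF df[OF assms(2)], of "x" 0 w B] inS0[of a] a assms(3)
        by (auto intro!: has_vector_derivative_diff)
    qed (use FTC[OF a _ assms(2)] in auto)
    have nt: "at (0::real) within B \<noteq> bot"
    proof -
      have "(0::real) islimpt B" unfolding B_def using \<eta> by (simp add: islimpt_Icc)
      then show ?thesis by (simp add: trivial_limit_within)
    qed
    show ?thesis using vector_derivative_unique_within[OF nt 1 2] by simp
  qed
  have c: "continuous_on {0..\<eta>} (\<lambda>s. dd w (dd v f) (x + s *\<^sub>R v))"
    by (intro continuous_on_compose2[OF smooth_on_continuous[OF smooth_on_dd[OF smooth_on_dd[OF assms(2)]]]])
       (use inS0 in \<open>auto intro!: continuous_intros\<close>)
  have nt: "at (0::real) within {0..\<eta>} \<noteq> bot"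
  proof -
    have "(0::real) islimpt {0..\<eta>}" using \<eta> by (simp add: islimpt_Icc)
    then show ?thesis by (simp add: trivial_limit_within)
  qed
  have "((\<lambda>a. integral {0..a} (\<lambda>s. dd w (dd v f) (x + s *\<^sub>R v))) has_vector_derivative
     dd w (dd v f) (x + 0 *\<^sub>R v)) (at 0 within {0..\<eta>})"
    by (rule integral_has_vector_derivative[OF c]) (use \<eta> in auto)
  moreover have "((\<lambda>a. integral {0..a} (\<lambda>s. dd w (dd v f) (x + s *\<^sub>R v))) has_vector_derivative
     dd v (dd w f) (x + 0 *\<^sub>R v)) (at 0 within {0..\<eta>})"
  proof (rule has_vector_derivative_transform)
    show "((\<lambda>a. dd w f (x + a *\<^sub>R v) - dd w f x) has_vector_derivative dd v (dd w f) (x + 0 *\<^sub>R v)) (at 0 within {0..\<eta>})"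
      using has_vector_derivative_diff[OF has_vector_derivative_line[OF df[OF smooth_on_dd[OF assms(2)]], of x 0 v w "{0..\<eta>}"] has_vector_derivative_const[of "dd w f x"]] assms(3)
      by simp
  qed (use \<eta> key in auto)
  ultimately show ?thesis using vector_derivative_unique_within[OF nt] by fastforce
qed

subsection \<open>Bounds on iterated derivatives and Taylor's formula\<close>

lemma iter_deriv_sum:
  assumes "open S" "x \<in> S" "\<And>i. i \<in> I \<Longrightarrow> smooth_on S (f i)"
  shows "iter_deriv vs (\<lambda>x. \<Sum>i\<in>I. f i x) x = (\<Sum>i\<in>I. iter_deriv vs (f i) x)"
  using assms(3)
proof (induction vs arbitrary: f)
  case Nil then show ?case by simp
next
  case (Cons v vs)
  have "iter_deriv vs (dd v (\<lambda>x. \<Sum>i\<in>I. f i x)) x = iter_deriv vs (\<lambda>x. \<Sum>i\<in>I. dd v (f i) x) x"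
    by (rule iter_deriv_cong[OF assms(1) _ assms(2)]) (use Cons.prems smooth_on_diff in \<open>blast intro: dd_sum\<close>)
  then show ?case unfolding iter_deriv_Cons using Cons.IH[of "\<lambda>i. dd v (f i)"] Cons.prems
    by (simp add: smooth_on_dd)
qed

lemma iter_deriv_linear:
  assumes "open S" "x \<in> S" "smooth_on S f" "bounded_linear L"
  shows "iter_deriv vs (\<lambda>x. L (f x)) x = L (iter_deriv vs f x)"
  using assms(3)
proof (induction vs arbitrary: f)
  case Nil then show ?case by simp
next
  case (Cons v vs)
  have "iter_deriv vs (dd v (\<lambda>x. L (f x))) x = iter_deriv vs (\<lambda>x. L (dd v f x)) x"
    by (rule iter_deriv_cong[OF assms(1) _ assms(2)])
       (use Cons.prems smooth_on_diff in \<open>blast intro: dd_linear_comp[OF assms(4)]\<close>)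
  then show ?case unfolding iter_deriv_Cons using Cons.IH[of "dd v f"] Cons.prems
    by (simp add: smooth_on_dd)
qed

lemma prod_list_norm_nonneg: "0 \<le> prod_list (map norm (vs :: 'a::real_normed_vector list))"
  by (induction vs) auto

text \<open>Iterated derivatives are linear in each direction, so bounds along the finitely many
  basis vectors suffice. The product of norms makes the bound uniform in the directions; along
  \<open>k\<close> copies of \<open>w\<close> it is a multiple of \<open>norm w ^ k\<close>, the
  size of a Taylor remainder.\<close>

lemma iter_deriv_bound:
  fixes f :: "'a::euclidean_space \<Rightarrow> 'b::real_normed_vector"
  assumes "open W" "compact K" "K \<subseteq> W" "smooth_on W f"
  shows "\<exists>C\<ge>0. \<forall>p\<in>K. \<forall>vs. length vs \<le> k \<longrightarrow> norm (iter_deriv vs f p) \<le> C * prod_list (map norm vs)"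
  using assms(4)
proof (induction k arbitrary: f)
  case 0
  have "bounded (f ` K)" using assms(2,3) 0 
    by (meson compact_continuous_image compact_imp_bounded continuous_on_subset smooth_on_continuous)
  then obtain B where "\<forall>p\<in>K. norm (f p) \<le> B" unfolding bounded_iff by auto
  then show ?case by (intro exI[of _ "max B 0"]) force
next
  case (Suc k)
  from Suc.IH[OF Suc.prems] obtain C0 where C0: "C0 \<ge> 0"
    "\<And>p vs. p\<in>K \<Longrightarrow> length vs \<le> k \<Longrightarrow> norm (iter_deriv vs f p) \<le> C0 * prod_list (map norm vs)" by blast
  have "\<forall>b. \<exists>C\<ge>0. \<forall>p\<in>K. \<forall>vs. length vs \<le> k \<longrightarrow> norm (iter_deriv vs (dd b f) p) \<le> C * prod_list (map norm vs)"
    using Suc.IH smooth_on_dd[OF Suc.prems] by blast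
  then obtain C where C: "\<And>b. C b \<ge> 0"
    "\<And>b p vs. p\<in>K \<Longrightarrow> length vs \<le> k \<Longrightarrow> norm (iter_deriv vs (dd b f) p) \<le> C b * prod_list (map norm vs)"
    by metis
  let ?C = "C0 + (\<Sum>b\<in>Basis. C b)"
  have nn: "?C \<ge> 0" using C0 C(1) by (simp add: sum_nonneg)
  have bd: "norm (iter_deriv vs f p) \<le> ?C * prod_list (map norm vs)" if "p \<in> K" "length vs \<le> Suc k" for p vs
  proof (cases vs)
    case Nil
    then show ?thesis using C0(2)[OF that(1), of "[]"] sum_nonneg[of Basis C] C(1) by simp
  next
    case (Cons v vs')
    have l: "length vs' \<le> k" using that Cons by simp
    have pW: "p \<in> W" using that assms(3) by auto
    have "iter_deriv vs f p = iter_deriv vs' (\<lambda>x. \<Sum>b\<in>Basis. (v \<bullet> b) *\<^sub>R dd b f x) p"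
      unfolding Cons iter_deriv_Cons
      by (rule iter_deriv_cong[OF assms(1) _ pW]) (use Suc.prems smooth_on_diff dd_basis in blast)
    also have "\<dots> = (\<Sum>b\<in>Basis. (v \<bullet> b) *\<^sub>R iter_deriv vs' (dd b f) p)"
      by (subst iter_deriv_sum[OF assms(1) pW])
         (use smooth_on_dd[OF Suc.prems] in \<open>auto intro!: smooth_on_linear_comp[OF assms(1) bounded_linear_scaleR_right]
            sum.cong iter_deriv_linear[OF assms(1) pW _ bounded_linear_scaleR_right]\<close>)
    also have "norm \<dots> \<le> (\<Sum>b\<in>Basis. norm v * (C b * prod_list (map norm vs')))"
      by (intro sum_norm_le) (auto intro!: mult_mono Basis_le_norm C that l prod_list_norm_nonneg)
    also have "\<dots> = (\<Sum>b\<in>Basis. C b) * prod_list (map norm vs)"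
      unfolding Cons by (simp add: sum_distrib_left sum_distrib_right algebra_simps)
    also have "\<dots> \<le> ?C * prod_list (map norm vs)"
      by (intro mult_right_mono prod_list_norm_nonneg) (use C0 in auto)
    finally show ?thesis .
  qed
  show ?case
  proof (intro exI conjI ballI allI impI)
    show "?C \<ge> 0" by (rule nn)
    show "norm (iter_deriv vs f p) \<le> ?C * prod_list (map norm vs)" if "p \<in> K" "length vs \<le> Suc k" for p vs
      by (rule bd[OF that])
  qed
qed

text \<open>One-dimensional Taylor formula along the segment with integral remainder. Its kernel is
  simply bounded by 1, so the factor \<open>1 / fact n\<close> is given away.\<close>

lemma smooth_Taylor:
  fixes f :: "'a::real_normed_vector \<Rightarrow> 'b::banach"
  assumes "open W" "smooth_on W f" "\<And>\<tau>. \<tau> \<in> {0..1} \<Longrightarrow> p + \<tau> *\<^sub>R w \<in> W" "n > 0"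
    and B: "\<And>\<tau>. \<tau> \<in> {0..1} \<Longrightarrow> norm (iter_deriv (replicate n w) f (p + \<tau> *\<^sub>R w)) \<le> B"
  shows "norm (f (p + w) - (\<Sum>k<n. (1 / fact k) *\<^sub>R iter_deriv (replicate k w) f p)) \<le> B"
proof -
  let ?D = "\<lambda>k \<tau>. iter_deriv (replicate k w) f (p + \<tau> *\<^sub>R w)"
  have B0: "B \<ge> 0" by (rule order_trans[OF norm_ge_zero B[of 0]]) simp
  have d: "(?D m has_vector_derivative ?D (Suc m) t) (at t within {0..1})" if "0 \<le> t" "t \<le> 1" for m t
  proof -
    have "iter_deriv (replicate (Suc m) w) f = dd w (iter_deriv (replicate m w) f)"
      using iter_deriv_snoc[of "replicate m w" w f] by (metis replicate_append_same replicate_Suc)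
    then show ?thesis
      using has_vector_derivative_line[OF smooth_on_diff[OF smooth_on_iter_deriv[OF assms(2)]], of p t w "replicate m w" "{0..1}"] assms(3)[of t] that
      by simp
  qed
  have D0: "?D 0 = (\<lambda>\<tau>. f (p + \<tau> *\<^sub>R w))" by simp
  have h: "((\<lambda>x. ((1 - x) ^ (n - 1) / fact (n - 1)) *\<^sub>R ?D n x) has_integral 
     f (p + 1 *\<^sub>R w) - (\<Sum>i<n. ((1 - 0) ^ i / fact i) *\<^sub>R ?D i 0)) (cbox 0 1)"
    using Taylor_has_integral[OF assms(4), of ?D "\<lambda>\<tau>. f (p + \<tau> *\<^sub>R w)" 0 1, OF D0 d] by simp
  have "norm (f (p + 1 *\<^sub>R w) - (\<Sum>i<n. ((1 - 0) ^ i / fact i) *\<^sub>R ?D i 0)) \<le> B * measure lborel (cbox (0::real) 1)"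
  proof (rule has_integral_bound[OF B0 h])
    fix x :: real assume x: "x \<in> cbox 0 1"
    have "(1 - x) ^ (n - 1) / fact (n - 1) \<le> 1 / 1"
      by (intro frac_le power_le_one) (use x in auto)
    moreover have "(1 - x) ^ (n - 1) / fact (n - 1) \<ge> 0" using x by simp
    ultimately have "\<bar>(1 - x) ^ (n - 1) / fact (n - 1)\<bar> * norm (?D n x) \<le> 1 * B"
      by (intro mult_mono) (use B[of x] x in auto)
    then show "norm (((1 - x) ^ (n - 1) / fact (n - 1)) *\<^sub>R ?D n x) \<le> B" by simp
  qed
  then show ?thesis by simp
qed

section \<open>Almost holomorphic functions\<close>

definition crd :: "'n + 'n \<Rightarrow> 'n::finite cpair \<Rightarrow> complex" where
  "crd i p = (case i of Inl j \<Rightarrow> fst p $ j | Inr j \<Rightarrow> snd p $ j)"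

definition cbas :: "complex \<Rightarrow> 'n + 'n \<Rightarrow> 'n::finite cpair" where
  "cbas c i = (case i of Inl j \<Rightarrow> (axis j c, 0) | Inr j \<Rightarrow> (0, axis j c))"

definition dz :: "'n + 'n \<Rightarrow> ('n::finite cpair \<Rightarrow> complex) \<Rightarrow> 'n cpair \<Rightarrow> complex" where
  "dz i f p = (dd (cbas 1 i) f p - \<i> * dd (cbas \<i> i) f p) / 2"

definition dzb :: "'n + 'n \<Rightarrow> ('n::finite cpair \<Rightarrow> complex) \<Rightarrow> 'n cpair \<Rightarrow> complex" where
  "dzb i f p = (dd (cbas 1 i) f p + \<i> * dd (cbas \<i> i) f p) / 2"

definition rho :: "'n::finite cpair \<Rightarrow> real" where
  "rho p = norm (snd p - vconj (fst p))"

definition flat_on :: "'n::finite cpair set \<Rightarrow> ('n cpair \<Rightarrow> complex) \<Rightarrow> bool" where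
  "flat_on W g \<longleftrightarrow> smooth_on W g \<and>
     (\<forall>N K. compact K \<longrightarrow> K \<subseteq> W \<longrightarrow> (\<exists>C. \<forall>p\<in>K. norm (g p) \<le> C * rho p ^ N))"

text \<open>For smooth functions this is \<open>almost_hol_on\<close>, see
  \<open>almost_hol_on_AH\<close>. Smoothness is built in and all 2n conjugate variables are treated
  alike, so that the class is an algebra closed under \<open>dz\<close>.\<close>

definition AH :: "'n::finite cpair set \<Rightarrow> ('n cpair \<Rightarrow> complex) \<Rightarrow> bool" where
  "AH W f \<longleftrightarrow> smooth_on W f \<and> (\<forall>i. flat_on W (dzb i f))"

lemma crd_expansion:
  "w = (\<Sum>i\<in>UNIV. Re (crd i w) *\<^sub>R cbas 1 i + Im (crd i w) *\<^sub>R cbas \<i> i)"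
proof -
  have 1: "v = (\<Sum>j\<in>UNIV. Re (v $ j) *\<^sub>R axis j 1 + Im (v $ j) *\<^sub>R axis j \<i>)" for v :: "complex^'a"
  proof -
    have "(\<Sum>j\<in>UNIV. Re (v $ j) *\<^sub>R axis j 1 + Im (v $ j) *\<^sub>R axis j \<i>) $ k
        = (\<Sum>j\<in>UNIV. if j = k then v $ k else 0)" for k
      unfolding sum_component
      by (rule sum.cong) (auto simp: axis_def complex_eq_iff)
    then show ?thesis by (simp add: vec_eq_iff)
  qed
  have "(\<Sum>i\<in>UNIV. Re (crd i w) *\<^sub>R cbas 1 i + Im (crd i w) *\<^sub>R cbas \<i> i) =
    (\<Sum>j\<in>UNIV. (Re (fst w $ j) *\<^sub>R axis j 1 + Im (fst w $ j) *\<^sub>R axis j \<i>, 0)) +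
    (\<Sum>j\<in>UNIV. (0, Re (snd w $ j) *\<^sub>R axis j 1 + Im (snd w $ j) *\<^sub>R axis j \<i>))"
    unfolding UNIV_Plus_UNIV[symmetric] by (subst sum.Plus) (auto simp: crd_def cbas_def)
  also have "\<dots> = (fst w, snd w)"
    using 1[of "fst w"] 1[of "snd w"] by (simp add: sum_prod[symmetric] prod_eq_iff fst_sum snd_sum)
  finally show ?thesis by simp
qed

lemma dd_crd:
  assumes "f differentiable at p"
  shows "dd w f p = (\<Sum>i\<in>UNIV. crd i w * dz i f p + cnj (crd i w) * dzb i f p)"
proof -
  interpret linear "\<lambda>v. dd v f p" by (rule linear_dd[OF assms])
  have "dd w f p = dd (\<Sum>i\<in>UNIV. Re (crd i w) *\<^sub>R cbas 1 i + Im (crd i w) *\<^sub>R cbas \<i> i) f p"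
    using crd_expansion[of w] by simp
  also have "\<dots> = (\<Sum>i\<in>UNIV. Re (crd i w) *\<^sub>R dd (cbas 1 i) f p + Im (crd i w) *\<^sub>R dd (cbas \<i> i) f p)"
    by (simp add: sum add scale)
  also have "\<dots> = (\<Sum>i\<in>UNIV. crd i w * dz i f p + cnj (crd i w) * dzb i f p)"
  proof (rule sum.cong[OF refl])
    fix i
    have "c * ((a - \<i> * b) / 2) + cnj c * ((a + \<i> * b) / 2) = Re c *\<^sub>R a + Im c *\<^sub>R b" for a b c :: complex
      by (simp add: complex_eq_iff field_simps)
    then show "Re (crd i w) *\<^sub>R dd (cbas 1 i) f p + Im (crd i w) *\<^sub>R dd (cbas \<i> i) f p =
      crd i w * dz i f p + cnj (crd i w) * dzb i f p" unfolding dz_def dzb_def by simp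
  qed
  finally show ?thesis .
qed

lemma linear_vconj: "linear (vconj :: complex^'n \<Rightarrow> complex^'n::finite)"
  by (rule linearI) (auto simp: vconj_def vec_eq_iff)

lemma bounded_linear_vconj: "bounded_linear (vconj :: complex^'n \<Rightarrow> complex^'n::finite)"
  using linear_vconj linear_conv_bounded_linear by blast

lemma norm_vconj [simp]: "norm (vconj x) = norm x"
  by (simp add: vconj_def norm_vec_def)

lemma vconj_vconj [simp]: "vconj (vconj x) = x"
  by (simp add: vconj_def vec_eq_iff)

lemma vconj_add: "vconj (x + y) = vconj x + vconj y"
  and vconj_diff: "vconj (x - y) = vconj x - vconj y"
  and vconj_scaleR: "vconj (c *\<^sub>R x) = c *\<^sub>R vconj x"
  and vconj_0 [simp]: "vconj 0 = 0"
  using linear_vconj linear_add linear_diff linear_scale linear_0 by blast+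

lemma rho_nonneg [simp]: "0 \<le> rho p"
  by (simp add: rho_def)

lemma rho_antidiag [simp]: "rho (x, vconj x) = 0"
  by (simp add: rho_def)

lemma rho_le: "rho (p + w) \<le> rho p + 2 * norm w"
proof -
  have "snd (p + w) - vconj (fst (p + w)) = (snd p - vconj (fst p)) + (snd w - vconj (fst w))"
    by (simp add: vconj_add)
  then have "rho (p + w) \<le> rho p + norm (snd w - vconj (fst w))"
    unfolding rho_def using norm_triangle_ineq by metis
  also have "norm (snd w - vconj (fst w)) \<le> norm (snd w) + norm (fst w)"
    using norm_triangle_ineq4[of "snd w" "vconj (fst w)"] by simp
  also have "\<dots> \<le> 2 * norm w" using norm_fst_le[of "fst w" "snd w"] norm_snd_le[of "snd w" "fst w"] by simp
  finally show ?thesis by simp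
qed

lemma continuous_on_rho: "continuous_on S rho"
  unfolding rho_def
  by (intro continuous_intros linear_continuous_on_compose[OF _ linear_vconj])

subsection \<open>Functions vanishing to infinite order on the anti-diagonal\<close>

lemma flat_onI:
  assumes "smooth_on W g" "\<And>N K. compact K \<Longrightarrow> K \<subseteq> W \<Longrightarrow> \<exists>C. \<forall>p\<in>K. norm (g p) \<le> C * rho p ^ N"
  shows "flat_on W g"
  using assms unfolding flat_on_def by blast

lemma flat_onE:
  assumes "flat_on W g" "compact K" "K \<subseteq> W"
  obtains C where "C \<ge> 0" "\<And>p. p \<in> K \<Longrightarrow> norm (g p) \<le> C * rho p ^ N"
proof -
  obtain C where C: "\<forall>p\<in>K. norm (g p) \<le> C * rho p ^ N"
    using assms unfolding flat_on_def by blast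
  have "norm (g p) \<le> max C 0 * rho p ^ N" if "p \<in> K" for p
    using C that by (meson max.cobounded1 mult_right_mono order_trans rho_nonneg zero_le_power)
  then show ?thesis using that[of "max C 0"] by simp
qed

lemma flat_on_smooth: "flat_on W g \<Longrightarrow> smooth_on W g"
  unfolding flat_on_def by blast

lemma flat_on_cong:
  assumes "open W" "flat_on W f" "\<And>p. p \<in> W \<Longrightarrow> f p = g p"
  shows "flat_on W g"
proof (rule flat_onI)
  show "smooth_on W g" by (rule smooth_on_cong[OF assms(1) flat_on_smooth[OF assms(2)] assms(3)])
  fix N K assume K: "compact K" "K \<subseteq> W"
  obtain C where "\<And>p. p \<in> K \<Longrightarrow> norm (f p) \<le> C * rho p ^ N" using flat_onE[OF assms(2) K] by metis
  then have "\<forall>p\<in>K. norm (g p) \<le> C * rho p ^ N" using assms(3) K by (metis subsetD)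
  then show "\<exists>C. \<forall>p\<in>K. norm (g p) \<le> C * rho p ^ N" by (rule exI)
qed

lemma flat_on_0 [simp]: "flat_on W (\<lambda>_. 0)"
  by (rule flat_onI) (auto intro!: exI[of _ 0])

lemma flat_on_add:
  assumes "open W" "flat_on W f" "flat_on W g"
  shows "flat_on W (\<lambda>p. f p + g p)"
proof (rule flat_onI)
  show "smooth_on W (\<lambda>p. f p + g p)" using assms flat_on_smooth smooth_on_add by blast
  fix N K assume K: "compact K" "K \<subseteq> W"
  obtain C where C: "\<And>p. p \<in> K \<Longrightarrow> norm (f p) \<le> C * rho p ^ N" using flat_onE[OF assms(2) K] by metis
  obtain D where D: "\<And>p. p \<in> K \<Longrightarrow> norm (g p) \<le> D * rho p ^ N" using flat_onE[OF assms(3) K] by metis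
  have "norm (f p + g p) \<le> (C + D) * rho p ^ N" if "p \<in> K" for p
    unfolding distrib_right by (intro order_trans[OF norm_triangle_ineq] add_mono C D that)
  then show "\<exists>C. \<forall>p\<in>K. norm (f p + g p) \<le> C * rho p ^ N" by (intro exI[of _ "C + D"]) simp
qed

lemma flat_on_mult:
  assumes "open W" "smooth_on W f" "flat_on W g"
  shows "flat_on W (\<lambda>p. f p * g p)"
proof (rule flat_onI)
  show "smooth_on W (\<lambda>p. f p * g p)" using assms flat_on_smooth smooth_on_mult by blast
  fix N K assume K: "compact K" "K \<subseteq> W"
  obtain C where C: "\<And>p. p \<in> K \<Longrightarrow> norm (g p) \<le> C * rho p ^ N" using flat_onE[OF assms(3) K] by metis
  have "bounded (f ` K)" using assms(2) K
    by (meson compact_continuous_image compact_imp_bounded continuous_on_subset smooth_on_continuous)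
  then obtain B where B: "\<And>p. p \<in> K \<Longrightarrow> norm (f p) \<le> B" unfolding bounded_iff by auto
  have "norm (f p * g p) \<le> (B * C) * rho p ^ N" if "p \<in> K" for p
  proof -
    have "norm (f p) * norm (g p) \<le> B * (C * rho p ^ N)"
      by (intro mult_mono B C that) (auto intro: order_trans[OF norm_ge_zero B[OF that]])
    then show ?thesis by (simp add: norm_mult mult.assoc)
  qed
  then show "\<exists>C. \<forall>p\<in>K. norm (f p * g p) \<le> C * rho p ^ N" by (intro exI[of _ "B * C"]) simp
qed

lemma flat_on_sum:
  assumes "open W" "\<And>i. i \<in> I \<Longrightarrow> flat_on W (f i)"
  shows "flat_on W (\<lambda>p. \<Sum>i\<in>I. f i p)"
  using assms(2) by (induction I rule: infinite_finite_induct) (auto intro!: flat_on_add[OF assms(1)])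

lemma flat_on_cmult: "open W \<Longrightarrow> flat_on W g \<Longrightarrow> flat_on W (\<lambda>p. c * g p)"
  by (rule flat_on_mult[OF _ smooth_on_const])

lemma flat_on_subset: "flat_on W g \<Longrightarrow> V \<subseteq> W \<Longrightarrow> flat_on V g"
  unfolding flat_on_def using smooth_on_subset by (meson order_trans)

lemma flat_on_zero:
  assumes "flat_on W g" "p \<in> W" "rho p = 0"
  shows "g p = 0"
proof -
  have "compact {p}" "{p} \<subseteq> W" using assms(2) by auto
  then obtain C where "norm (g p) \<le> C * rho p ^ 1" using flat_onE[OF assms(1)] by (metis singletonI)
  then show ?thesis using assms(3) by simp
qed

lemma compact_neighbourhood:
  fixes K :: "'a::euclidean_space set"
  assumes "compact K" "K \<subseteq> W" "open W"
  obtains e K' where "e > 0" "compact K'" "K' \<subseteq> W" "K \<subseteq> K'" "\<And>p w. p \<in> K \<Longrightarrow> norm w \<le> e \<Longrightarrow> p + w \<in> K'"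
proof -
  obtain e where e: "e > 0" "(\<Union>x\<in>K. cball x e) \<subseteq> W"
    using compact_subset_open_imp_cball_epsilon_subset[OF assms(1,3,2)] by blast
  define K' where "K' = (\<Union>x\<in>K. \<Union>y\<in>cball 0 e. {x + y})"
  have "compact K'" unfolding K'_def by (rule compact_sums'[OF assms(1) compact_cball])
  moreover have "K' \<subseteq> W"
  proof
    fix q assume "q \<in> K'"
    then obtain x y where "x \<in> K" "norm y \<le> e" "q = x + y" unfolding K'_def by auto
    then have "q \<in> cball x e" by (simp add: dist_norm)
    then show "q \<in> W" using e(2) \<open>x \<in> K\<close> by blast
  qed
  moreover have "p + w \<in> K'" if "p \<in> K" "norm w \<le> e" for p w
    using that unfolding K'_def by (intro UN_I[of p] UN_I[of w]) auto
  moreover have "K \<subseteq> K'"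
  proof
    fix p assume "p \<in> K"
    then have "p + 0 \<in> K'" using e(1) unfolding K'_def by (intro UN_I[of p] UN_I[of 0]) auto
    then show "p \<in> K'" by simp
  qed
  ultimately show ?thesis using that[of e K'] e(1) by blast
qed

text \<open>A first derivative is a difference quotient up to a multiple of the step; choosing as step a power
  of the distance to the anti-diagonal makes both errors flat.\<close>

lemma flat_on_dd:
  assumes "open W" "flat_on W g"
  shows "flat_on W (dd v g)"
proof (rule flat_onI)
  show "smooth_on W (dd v g)" using assms flat_on_smooth smooth_on_dd by blast
  fix N :: nat and K :: "'a cpair set" assume K: "compact K" "K \<subseteq> W"
  have sm: "smooth_on W g" using assms flat_on_smooth by blast
  obtain e K' where e: "e > 0" and K': "compact K'" "K' \<subseteq> W" "K \<subseteq> K'" "\<And>p w. p \<in> K \<Longrightarrow> norm w \<le> e \<Longrightarrow> p + w \<in> K'"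
    using compact_neighbourhood[OF K assms(1)] by metis
  obtain B where B: "B \<ge> 0" "\<And>p vs. p \<in> K' \<Longrightarrow> length vs \<le> 2 \<Longrightarrow> norm (iter_deriv vs g p) \<le> B * prod_list (map norm vs)"
    using iter_deriv_bound[OF assms(1) K'(1,2) sm, of 2] by blast
  show "\<exists>C. \<forall>p\<in>K. norm (dd v g p) \<le> C * rho p ^ N"
  proof (cases "N = 0")
    case True
    have "norm (dd v g p) \<le> (B * norm v) * rho p ^ N" if "p \<in> K" for p
      using B(2)[of p "[v]"] that K'(3) True by (auto simp: dd_def)
    then show ?thesis by (intro exI[of _ "B * norm v"]) simp
  next
    case False
    then have N: "N \<ge> 1" by simp
    \<comment> \<open>Flatness of order \<open>2 * N\<close>, because the difference quotient
      divides by a step proportional to the N-th power of \<open>rho p\<close>.\<close>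
    obtain C where C: "C \<ge> 0" "\<And>p. p \<in> K' \<Longrightarrow> norm (g p) \<le> C * rho p ^ (2 * N)"
      using flat_onE[OF assms(2) K'(1,2)] by metis
    define \<eta> where "\<eta> = min 1 (e / (norm v + 1))"
    have nv: "norm v + 1 > 0" using norm_ge_zero[of v] by linarith
    have \<eta>: "\<eta> > 0" "\<eta> \<le> 1" "\<eta> * norm v \<le> e"
    proof -
      show "\<eta> > 0" "\<eta> \<le> 1" unfolding \<eta>_def using e nv by auto
      have "\<eta> * norm v \<le> e / (norm v + 1) * (norm v + 1)"
        unfolding \<eta>_def using e nv by (intro mult_mono) auto
      then show "\<eta> * norm v \<le> e" using nv by simp
    qed
    define c where "c = 2 * norm v"
    define B' where "B' = B * (norm v)\<^sup>2"
    have nn: "c \<ge> 0" "B' \<ge> 0" unfolding c_def B'_def using B by auto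
    \<comment> \<open>Second-order Taylor formula with free step \<tau>: the values of g at both
      ends divided by \<tau>, plus a remainder linear in \<tau>.\<close>
    have main: "norm (dd v g p) \<le> 2 * C * (rho p + c * \<tau>) ^ (2 * N) / \<tau> + B' * \<tau>"
      if p: "p \<in> K" and \<tau>: "0 < \<tau>" "\<tau> \<le> \<eta>" for p \<tau>
    proof -
      have tv: "norm (\<tau> *\<^sub>R v) \<le> e"
        using \<eta>(3) \<tau> mult_right_mono[of \<tau> \<eta> "norm v"] by simp
      have seg: "p + s *\<^sub>R \<tau> *\<^sub>R v \<in> K'" if "s \<in> {0..1}" for s
      proof (rule K'(4)[OF p])
        have "norm (s *\<^sub>R \<tau> *\<^sub>R v) = s * norm (\<tau> *\<^sub>R v)" using that by (simp add: abs_mult)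
        also have "\<dots> \<le> 1 * norm (\<tau> *\<^sub>R v)" by (rule mult_right_mono) (use that in auto)
        finally show "norm (s *\<^sub>R \<tau> *\<^sub>R v) \<le> e" using tv by simp
      qed
      have "norm (g (p + \<tau> *\<^sub>R v) - (\<Sum>k<2. (1 / fact k) *\<^sub>R iter_deriv (replicate k (\<tau> *\<^sub>R v)) g p)) \<le> B' * \<tau>\<^sup>2"
      proof (rule smooth_Taylor[OF assms(1) sm])
        fix s :: real assume s: "s \<in> {0..1}"
        show "p + s *\<^sub>R \<tau> *\<^sub>R v \<in> W" using seg[OF s] K'(2) by blast
        have "norm (iter_deriv (replicate 2 (\<tau> *\<^sub>R v)) g (p + s *\<^sub>R \<tau> *\<^sub>R v)) \<le> B * prod_list (map norm (replicate 2 (\<tau> *\<^sub>R v)))"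
          by (rule B(2)[OF seg[OF s]]) simp
        also have "\<dots> = B' * \<tau>\<^sup>2" unfolding B'_def using \<tau>
          by (simp add: numeral_2_eq_2 power2_eq_square)
        finally show "norm (iter_deriv (replicate 2 (\<tau> *\<^sub>R v)) g (p + s *\<^sub>R \<tau> *\<^sub>R v)) \<le> B' * \<tau>\<^sup>2" .
      qed simp
      moreover have "(\<Sum>k<2. (1 / fact k) *\<^sub>R iter_deriv (replicate k (\<tau> *\<^sub>R v)) g p) = g p + \<tau> *\<^sub>R dd v g p"
      proof -
        have "p \<in> W" using p K by auto
        then have "dd (\<tau> *\<^sub>R v) g p = \<tau> *\<^sub>R dd v g p"
          using linear_scale[OF linear_dd[OF smooth_on_diff[OF sm]]] by blast
        then show ?thesis by (simp add: numeral_2_eq_2 dd_def)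
      qed
      ultimately have T: "norm (g (p + \<tau> *\<^sub>R v) - (g p + \<tau> *\<^sub>R dd v g p)) \<le> B' * \<tau>\<^sup>2" by simp
      have g1: "norm (g p) \<le> C * (rho p + c * \<tau>) ^ (2 * N)"
        by (rule order_trans[OF C(2)])
           (use p K'(3) C(1) nn \<tau> in \<open>auto intro!: mult_left_mono power_mono\<close>)
      have "rho (p + \<tau> *\<^sub>R v) \<le> rho p + c * \<tau>" using rho_le[of p "\<tau> *\<^sub>R v"] \<tau> by (simp add: c_def mult.commute)
      then have g2: "norm (g (p + \<tau> *\<^sub>R v)) \<le> C * (rho p + c * \<tau>) ^ (2 * N)"
        using seg[of 1] by (intro order_trans[OF C(2)] mult_left_mono power_mono C(1)) auto
      have "\<tau> * norm (dd v g p) = norm (\<tau> *\<^sub>R dd v g p)" using \<tau> by simp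
      also have "\<tau> *\<^sub>R dd v g p = g (p + \<tau> *\<^sub>R v) - g p - (g (p + \<tau> *\<^sub>R v) - (g p + \<tau> *\<^sub>R dd v g p))" by simp
      also have "norm \<dots> \<le> norm (g (p + \<tau> *\<^sub>R v)) + norm (g p) + norm (g (p + \<tau> *\<^sub>R v) - (g p + \<tau> *\<^sub>R dd v g p))"
        by (meson add_mono norm_triangle_ineq4 order_refl order_trans)
      also have "\<dots> \<le> 2 * C * (rho p + c * \<tau>) ^ (2 * N) + B' * \<tau>\<^sup>2" using g1 g2 T by linarith
      finally have "norm (dd v g p) \<le> (2 * C * (rho p + c * \<tau>) ^ (2 * N) + B' * \<tau>\<^sup>2) / \<tau>"
        using \<tau> by (simp add: pos_le_divide_eq mult.commute)
      also have "\<dots> = 2 * C * (rho p + c * \<tau>) ^ (2 * N) / \<tau> + B' * \<tau>"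
        using \<tau> by (simp add: add_divide_distrib power2_eq_square)
      finally show ?thesis .
    qed
    have "bounded (rho ` K)" using K continuous_on_rho
      by (meson compact_continuous_image compact_imp_bounded)
    then obtain R0 where R0: "\<And>p. p \<in> K \<Longrightarrow> rho p \<le> R0" unfolding bounded_iff by auto
    define R where "R = max 1 R0"
    have R: "R \<ge> 1" "\<And>p. p \<in> K \<Longrightarrow> rho p \<le> R" unfolding R_def using R0 by (auto simp: le_max_iff_disj)
    define D where "D = 2 * C * (1 + c) ^ (2 * N) * R ^ N / \<eta> + B'"
    have "norm (dd v g p) \<le> D * rho p ^ N" if p: "p \<in> K" for p
    proof (cases "rho p = 0")
      case True
      \<comment> \<open>On the anti-diagonal itself the step tends to 0; the first error is then of
        order \<tau> to the power \<open>2 * N - 1\<close>, hence at most linear in \<tau>.\<close>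
      have "norm (dd v g p) \<le> (2 * C * c ^ (2 * N) + B') * \<tau>" if \<tau>: "0 < \<tau>" "\<tau> \<le> \<eta>" for \<tau>
      proof -
        have "\<tau> ^ (2 * N) / \<tau> = \<tau> ^ (2 * N - 1)"
          using \<tau> N by (simp add: power_diff)
        also have "\<dots> \<le> \<tau> ^ 1" by (rule power_decreasing) (use \<tau> \<eta> N in auto)
        finally have "2 * C * c ^ (2 * N) * (\<tau> ^ (2 * N) / \<tau>) \<le> 2 * C * c ^ (2 * N) * \<tau>"
          by (intro mult_left_mono) (use C(1) nn in auto)
        then show ?thesis using main[OF p \<tau>] True by (simp add: power_mult_distrib algebra_simps)
      qed
      note bd = this
      have "norm (dd v g p) \<le> 0"
      proof (rule field_le_epsilon)
        fix \<epsilon> :: real assume \<epsilon>: "\<epsilon> > 0"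
        define M where "M = 2 * C * c ^ (2 * N) + B' + 1"
        have M: "M > 0" unfolding M_def using C(1) nn by (simp add: add_nonneg_pos)
        define \<tau> where "\<tau> = min \<eta> (\<epsilon> / M)"
        have \<tau>: "0 < \<tau>" "\<tau> \<le> \<eta>" "\<tau> \<le> \<epsilon> / M" unfolding \<tau>_def using \<epsilon> M \<eta> by auto
        have "norm (dd v g p) \<le> (M - 1) * \<tau>" using bd[OF \<tau>(1,2)] unfolding M_def by simp
        also have "\<dots> \<le> M * \<tau>" using \<tau> by (simp add: algebra_simps)
        also have "\<dots> \<le> M * (\<epsilon> / M)" using \<tau> M by (intro mult_left_mono) auto
        finally show "norm (dd v g p) \<le> 0 + \<epsilon>" using M by simp
      qed
      then show ?thesis using True N by (simp add: power_0_left)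
    next
      case False
      define d where "d = rho p"
      have d: "d > 0" "d \<le> R" unfolding d_def using False rho_nonneg[of p] R(2)[OF p] by linarith+
      \<comment> \<open>Proportional to the N-th power of the distance d. Division by R, which is at
        least 1 and at least d, makes the step at most \<eta> and at most d.\<close>
      define \<tau> where "\<tau> = \<eta> * (d / R) ^ N"
      have dR: "d / R \<le> 1" "0 < d / R" using d R by auto
      have dN: "0 < (d / R) ^ N" "(d / R) ^ N \<le> 1" using dR by (simp_all add: power_le_one del: power_divide)
      have \<tau>: "0 < \<tau>" "\<tau> \<le> \<eta>" unfolding \<tau>_def using \<eta> dN
        by (auto intro!: mult_left_le simp del: power_divide)
      have "(d / R) ^ N \<le> (d / R) ^ 1" by (rule power_decreasing) (use dR N in auto)
      also have "\<dots> \<le> d" using R(1) d by (simp add: divide_le_eq)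
      finally have "(d / R) ^ N \<le> d" .
      moreover have le: "\<tau> \<le> (d / R) ^ N" unfolding \<tau>_def
        by (rule mult_left_le_one_le) (use \<eta> dN in \<open>auto simp del: power_divide\<close>)
      ultimately have \<tau>d: "\<tau> \<le> d" by simp
      have "2 * C * (d + c * \<tau>) ^ (2 * N) / \<tau> \<le> 2 * C * ((1 + c) * d) ^ (2 * N) / \<tau>"
      proof (intro divide_right_mono mult_left_mono power_mono)
        show "d + c * \<tau> \<le> (1 + c) * d" using \<tau>d nn mult_left_mono[OF \<tau>d nn(1)] by (simp add: algebra_simps)
      qed (use \<tau> C(1) d nn in auto)
      also have "\<dots> = 2 * C * (1 + c) ^ (2 * N) * R ^ N / \<eta> * d ^ N"
      proof -
        have gen: "a * (b * (x * x)) / (\<eta> * (x / y)) = a * b * y / \<eta> * x" if "x \<noteq> 0" "y \<noteq> 0" for a b x y :: real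
          using that \<eta>(1) by (simp add: field_simps)
        have pw: "x ^ (2 * N) = x ^ N * x ^ N" for x :: real by (simp add: mult_2 power_add)
        have "((1 + c) * d) ^ (2 * N) = (1 + c) ^ (2 * N) * (d ^ N * d ^ N)"
          by (simp only: power_mult_distrib pw[of d])
        moreover have "\<tau> = \<eta> * (d ^ N / R ^ N)" unfolding \<tau>_def by (simp only: power_divide)
        moreover have nz: "d ^ N \<noteq> 0" "R ^ N \<noteq> 0" using d R(1) by auto
        ultimately show ?thesis using gen[OF nz] by (simp only:)
      qed
      finally have 1: "2 * C * (d + c * \<tau>) ^ (2 * N) / \<tau> \<le> 2 * C * (1 + c) ^ (2 * N) * R ^ N / \<eta> * d ^ N" .
      have dRd: "d / R \<le> d" using R(1) d(1) by (simp add: divide_le_eq)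
      have "(d / R) ^ N \<le> d ^ N" by (rule power_mono[OF dRd]) (use dR in simp)
      then have "\<tau> \<le> d ^ N" using le by (rule order_trans[rotated])
      then have "B' * \<tau> \<le> B' * d ^ N" using nn by (intro mult_left_mono)
      moreover have "norm (dd v g p) \<le> 2 * C * (d + c * \<tau>) ^ (2 * N) / \<tau> + B' * \<tau>"
        using main[OF p \<tau>] unfolding d_def .
      ultimately show ?thesis using 1 unfolding D_def d_def[symmetric] distrib_right by linarith
    qed
    then show ?thesis by (intro exI[of _ D]) simp
  qed
qed

lemma flat_on_iter_deriv: "open W \<Longrightarrow> flat_on W g \<Longrightarrow> flat_on W (iter_deriv vs g)"
  by (induction vs arbitrary: g) (auto simp del: iter_deriv.simps(2) simp: iter_deriv_Cons flat_on_dd)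

lemma smooth_on_dz: "open W \<Longrightarrow> smooth_on W f \<Longrightarrow> smooth_on W (dz i f)"
  unfolding dz_def[abs_def]
  by (intro smooth_on_linear_comp[OF _ bounded_linear_divide] smooth_on_sub smooth_on_mult smooth_on_const smooth_on_dd)

lemma smooth_on_dzb: "open W \<Longrightarrow> smooth_on W f \<Longrightarrow> smooth_on W (dzb i f)"
  unfolding dzb_def[abs_def]
  by (intro smooth_on_linear_comp[OF _ bounded_linear_divide] smooth_on_add smooth_on_mult smooth_on_const smooth_on_dd)

lemma flat_on_dz:
  assumes "open W" "flat_on W f"
  shows "flat_on W (dz i f)"
proof -
  have "flat_on W (\<lambda>p. (1/2) * dd (cbas 1 i) f p + (- \<i> / 2) * dd (cbas \<i> i) f p)"
    by (intro flat_on_add flat_on_cmult flat_on_dd assms)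
  then show ?thesis by (rule flat_on_cong[OF assms(1)]) (simp add: dz_def field_simps)
qed

subsection \<open>The algebra of almost holomorphic functions\<close>

lemma AH_smooth: "AH W f \<Longrightarrow> smooth_on W f"
  unfolding AH_def by blast

lemma AH_dzb: "AH W f \<Longrightarrow> flat_on W (dzb i f)"
  unfolding AH_def by blast

lemma AH_diff: "AH W f \<Longrightarrow> p \<in> W \<Longrightarrow> f differentiable at p"
  using AH_smooth smooth_on_diff by blast

lemma AH_subset: "AH W f \<Longrightarrow> V \<subseteq> W \<Longrightarrow> AH V f"
  unfolding AH_def using flat_on_subset smooth_on_subset by blast

lemma AHI:
  assumes "open W" "smooth_on W f" "\<And>i. flat_on W (g i)" "\<And>i p. p \<in> W \<Longrightarrow> g i p = dzb i f p"
  shows "AH W f"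
  unfolding AH_def using assms(2) flat_on_cong[OF assms(1,3,4)] by blast

lemma AH_const [simp]: "AH W (\<lambda>_. c)"
  unfolding AH_def dzb_def by simp

lemma dzb_add:
  "f differentiable at p \<Longrightarrow> g differentiable at p \<Longrightarrow> dzb i (\<lambda>p. f p + g p) p = dzb i f p + dzb i g p"
  unfolding dzb_def by (simp add: dd_add field_simps)

lemma dzb_mult:
  "f differentiable at p \<Longrightarrow> g differentiable at p \<Longrightarrow> dzb i (\<lambda>p. f p * g p) p = f p * dzb i g p + g p * dzb i f p"
  unfolding dzb_def by (simp add: dd_bilinear[OF bounded_bilinear_mult] field_simps)

lemma AH_add: "open W \<Longrightarrow> AH W f \<Longrightarrow> AH W g \<Longrightarrow> AH W (\<lambda>p. f p + g p)"
  by (rule AHI[of _ _ "\<lambda>i p. dzb i f p + dzb i g p"])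
     (simp_all add: smooth_on_add AH_smooth flat_on_add AH_dzb dzb_add AH_diff)

lemma AH_mult: "open W \<Longrightarrow> AH W f \<Longrightarrow> AH W g \<Longrightarrow> AH W (\<lambda>p. f p * g p)"
  by (rule AHI[of _ _ "\<lambda>i p. f p * dzb i g p + g p * dzb i f p"])
     (simp_all add: smooth_on_mult AH_smooth flat_on_add flat_on_mult AH_dzb dzb_mult AH_diff)

lemma AH_cmult: "open W \<Longrightarrow> AH W f \<Longrightarrow> AH W (\<lambda>p. c * f p)"
  by (rule AH_mult) auto

lemma AH_diff_fun: "open W \<Longrightarrow> AH W f \<Longrightarrow> AH W g \<Longrightarrow> AH W (\<lambda>p. f p - g p)"
  using AH_add[of W f "\<lambda>p. (-1) * g p"] AH_cmult[of W g "-1"] by simp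

lemma AH_sum: "open W \<Longrightarrow> (\<And>i. i \<in> I \<Longrightarrow> AH W (f i)) \<Longrightarrow> AH W (\<lambda>p. \<Sum>i\<in>I. f i p)"
  by (induction I rule: infinite_finite_induct) (auto intro!: AH_add)

lemma AH_prod: "open W \<Longrightarrow> (\<And>i. i \<in> I \<Longrightarrow> AH W (f i)) \<Longrightarrow> AH W (\<lambda>p. \<Prod>i\<in>I. f i p)"
  by (induction I rule: infinite_finite_induct) (auto intro!: AH_mult)

lemma AH_det:
  fixes f :: "'n::finite cpair \<Rightarrow> 'i::finite \<Rightarrow> 'i \<Rightarrow> complex"
  assumes "open W" "\<And>i j. AH W (\<lambda>x. f x i j)"
  shows "AH W (\<lambda>x. det (\<chi> i j. f x i j))"
  unfolding det_def by (simp, intro AH_sum AH_mult AH_prod AH_const assms)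

lemma AH_inverse:
  assumes "open W" "AH W f" "\<And>p. p \<in> W \<Longrightarrow> f p \<noteq> 0"
  shows "AH W (\<lambda>p. inverse (f p))"
proof (rule AHI[OF assms(1), of _ "\<lambda>i p. (- 1 * (inverse (f p) * inverse (f p))) * dzb i f p"])
  show sm: "smooth_on W (\<lambda>p. inverse (f p))" using smooth_on_inverse[OF assms(1) AH_smooth[OF assms(2)]] assms(3) by blast
  show "flat_on W (\<lambda>p. (- 1 * (inverse (f p) * inverse (f p))) * dzb i f p)" for i
    by (intro flat_on_mult smooth_on_mult smooth_on_const sm assms(1) AH_dzb[OF assms(2)])
  show "(- 1 * (inverse (f p) * inverse (f p))) * dzb i f p = dzb i (\<lambda>p. inverse (f p)) p" if "p \<in> W" for i p
  proof -
    have "(- 1 * (a * a)) * ((X + c * Y) / 2) = (- (a * X * a) + c * - (a * Y * a)) / 2" for a X Y c :: complex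
      by (simp add: algebra_simps)
    then show ?thesis
      unfolding dzb_def dd_inverse[OF AH_diff[OF assms(2) that] assms(3)[OF that]] by blast
  qed
qed

lemma dzb_dz_commute:
  assumes "open W" "smooth_on W f" "p \<in> W"
  shows "dzb i (dz k f) p = dz k (dzb i f) p"
proof -
  have d: "dd v f differentiable at p" for v using smooth_on_diff[OF smooth_on_dd[OF assms(2)] assms(3)] .
  have l: "dd w (\<lambda>q. (dd u f q + c * dd v f q) / 2) p = (dd w (dd u f) p + c * dd w (dd v f) p) / 2" for w u v c
  proof (rule dd_eqI)
    show "((\<lambda>q. (dd u f q + c * dd v f q) / 2) has_derivative (\<lambda>w. (dd w (dd u f) p + c * dd w (dd v f) p) / 2)) (at p)"
      by (auto intro!: derivative_eq_intros has_derivative_dd d)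
  qed
  have l1: "dd w (dz k f) p = (dd w (dd (cbas 1 k) f) p + (-\<i>) * dd w (dd (cbas \<i> k) f) p) / 2" for w
    using l[of w "cbas 1 k" "-\<i>" "cbas \<i> k"] unfolding dz_def[abs_def] by simp
  have l2: "dd w (dzb i f) p = (dd w (dd (cbas 1 i) f) p + \<i> * dd w (dd (cbas \<i> i) f) p) / 2" for w
    using l[of w "cbas 1 i" "\<i>" "cbas \<i> i"] unfolding dzb_def[abs_def] by simp
  have c: "dd v (dd w f) p = dd w (dd v f) p" for v w by (rule dd_commute[OF assms])
  show ?thesis
    unfolding dzb_def[of i "dz k f"] dz_def[of k "dzb i f"] l1 l2
    unfolding c[of "cbas 1 i"] c[of "cbas \<i> i"]
    by (simp add: field_simps)
qed

text \<open>Symmetry of second derivatives moves \<open>dzb\<close> inside, and \<open>dz\<close> of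
  a flat function is flat by \<open>flat_on_dd\<close>.\<close>

lemma AH_dz: "open W \<Longrightarrow> AH W f \<Longrightarrow> AH W (dz k f)"
  by (rule AHI[of _ _ "\<lambda>i. dz k (dzb i f)"])
     (simp_all add: smooth_on_dz AH_smooth flat_on_dz AH_dzb dzb_dz_commute)

lemma almost_hol_on_AH:
  assumes "open W" "smooth_on W f"
  shows "almost_hol_on W f \<longleftrightarrow> AH W f"
proof -
  have 1: "dd v (\<lambda>x'. f (x', y)) x = dd (v, 0) f (x, y)" if "(x, y) \<in> W" for v x y
  proof (rule dd_eqI)
    have "((\<lambda>x'. (x', y)) has_derivative (\<lambda>v. (v, 0))) (at x)" by (auto intro!: derivative_eq_intros)
    from diff_chain_at[OF this has_derivative_dd[OF smooth_on_diff[OF assms(2) that]]]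
    show "((\<lambda>x'. f (x', y)) has_derivative (\<lambda>v. dd (v, 0) f (x, y))) (at x)" by (simp add: o_def)
  qed
  have 2: "dd v (\<lambda>y'. f (x, y')) y = dd (0, v) f (x, y)" if "(x, y) \<in> W" for v x y
  proof (rule dd_eqI)
    have "((\<lambda>y'. (x, y')) has_derivative (\<lambda>v. (0, v))) (at y)" by (auto intro!: derivative_eq_intros)
    from diff_chain_at[OF this has_derivative_dd[OF smooth_on_diff[OF assms(2) that]]]
    show "((\<lambda>y'. f (x, y')) has_derivative (\<lambda>v. dd (0, v) f (x, y))) (at y)" by (simp add: o_def)
  qed
  have b1: "d_bar j (\<lambda>x'. f (x', y)) x = dzb (Inl j) f (x, y)" if "(x, y) \<in> W" for j x y
    using 1[OF that] unfolding d_bar_def dzb_def cbas_def dd_def by simp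
  have b2: "d_bar j (\<lambda>y'. f (x, y')) y = dzb (Inr j) f (x, y)" if "(x, y) \<in> W" for j x y
    using 2[OF that] unfolding d_bar_def dzb_def cbas_def dd_def by simp
  show ?thesis
  proof
    assume L: "almost_hol_on W f"
    have "flat_on W (dzb i f)" for i
    proof (rule flat_onI)
      show "smooth_on W (dzb i f)" by (rule smooth_on_dzb[OF assms])
      fix N :: nat and K :: "'a cpair set" assume K: "compact K" "K \<subseteq> W"
      obtain j where j: "i = Inl j \<or> i = Inr j" by (metis sum.exhaust)
      obtain C where C: "\<forall>(x, y)\<in>K. norm (d_bar j (\<lambda>x'. f (x', y)) x) \<le> C * norm (y - vconj x) ^ N \<and>
           norm (d_bar j (\<lambda>y'. f (x, y')) y) \<le> C * norm (y - vconj x) ^ N"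
        using L K unfolding almost_hol_on_def by blast
      have "norm (dzb i f p) \<le> C * rho p ^ N" if "p \<in> K" for p
      proof -
        obtain x y where xy: "p = (x, y)" by (cases p)
        have "(x, y) \<in> W" using that K xy by auto
        from b1[OF this] b2[OF this] show ?thesis using C[rule_format, OF that] j unfolding xy rho_def by auto
      qed
      then show "\<exists>C. \<forall>p\<in>K. norm (dzb i f p) \<le> C * rho p ^ N" by (intro exI[of _ C]) simp
    qed
    then show "AH W f" unfolding AH_def using assms(2) by simp
  next
    assume R: "AH W f"
    show "almost_hol_on W f"
      unfolding almost_hol_on_def
    proof (intro allI impI)
      fix N :: nat and j and K :: "'a cpair set" assume K: "compact K \<and> K \<subseteq> W"
      obtain C where C: "\<And>p. p \<in> K \<Longrightarrow> norm (dzb (Inl j) f p) \<le> C * rho p ^ N"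
        using flat_onE[OF AH_dzb[OF R]] K by metis
      obtain D where D: "\<And>p. p \<in> K \<Longrightarrow> norm (dzb (Inr j) f p) \<le> D * rho p ^ N"
        using flat_onE[OF AH_dzb[OF R]] K by metis
      have "norm (d_bar j (\<lambda>x'. f (x', y)) x) \<le> max C D * norm (y - vconj x) ^ N \<and>
           norm (d_bar j (\<lambda>y'. f (x, y')) y) \<le> max C D * norm (y - vconj x) ^ N" if "(x, y) \<in> K" for x y
      proof -
        have W: "(x, y) \<in> W" using that K by auto
        have "C * rho (x, y) ^ N \<le> max C D * rho (x, y) ^ N" "D * rho (x, y) ^ N \<le> max C D * rho (x, y) ^ N"
          by (auto intro!: mult_right_mono)
        then show ?thesis using C[OF that] D[OF that] unfolding b1[OF W] b2[OF W] rho_def by auto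
      qed
      then show "\<exists>C. \<forall>(x, y)\<in>K. norm (d_bar j (\<lambda>x'. f (x', y)) x) \<le> C * norm (y - vconj x) ^ N \<and>
           norm (d_bar j (\<lambda>y'. f (x, y')) y) \<le> C * norm (y - vconj x) ^ N"
        by (intro exI[of _ "max C D"]) auto
    qed
  qed
qed

subsection \<open>Taylor's formula at the anti-diagonal\<close>

text \<open>For almost holomorphic \<open>f\<close> this is, at anti-diagonal points, the \<open>k\<close>-th derivative in direction \<open>w\<close>.\<close>

primrec hX :: "nat \<Rightarrow> 'n::finite cpair \<Rightarrow> ('n cpair \<Rightarrow> complex) \<Rightarrow> 'n cpair \<Rightarrow> complex" where
  "hX 0 w f p = f p"
| "hX (Suc k) w f p = (\<Sum>i\<in>UNIV. crd i w * hX k w (dz i f) p)"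

text \<open>Each real derivative splits by \<open>dd_crd\<close> into a holomorphic and an
  antiholomorphic part. The latter is flat and stays flat under all later derivatives, so only the
  iterated holomorphic part survives.\<close>

lemma flat_on_iter_deriv_hX:
  assumes "open W"
  shows "AH W f \<Longrightarrow> flat_on W (\<lambda>p. iter_deriv (replicate k w) f p - hX k w f p)"
proof (induction k arbitrary: f)
  case 0
  then show ?case by simp
next
  case (Suc k)
  let ?I = "iter_deriv (replicate k w)"
  have sm: "smooth_on W f" using Suc.prems AH_smooth by blast
  have "flat_on W (\<lambda>p. (\<Sum>i\<in>UNIV. crd i w * (?I (dz i f) p - hX k w (dz i f) p)) +
     (\<Sum>i\<in>UNIV. cnj (crd i w) * ?I (dzb i f) p))"
    by (intro flat_on_add flat_on_sum flat_on_cmult assms flat_on_iter_deriv AH_dzb[OF Suc.prems]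
         Suc.IH[OF AH_dz[OF assms Suc.prems]])
  then show ?case
  proof (rule flat_on_cong[OF assms])
    fix p assume p: "p \<in> W"
    have s1: "smooth_on W (\<lambda>p. crd i w * dz i f p)" "smooth_on W (\<lambda>p. cnj (crd i w) * dzb i f p)" for i
      by (intro smooth_on_mult smooth_on_const smooth_on_dz smooth_on_dzb assms sm)+
    have "?I (dd w f) p = ?I (\<lambda>p. \<Sum>i\<in>UNIV. crd i w * dz i f p + cnj (crd i w) * dzb i f p) p"
      by (rule iter_deriv_cong[OF assms _ p]) (rule dd_crd[OF smooth_on_diff[OF sm]])
    also have "\<dots> = (\<Sum>i\<in>UNIV. ?I (\<lambda>p. crd i w * dz i f p + cnj (crd i w) * dzb i f p) p)"
      by (rule iter_deriv_sum[OF assms p]) (intro smooth_on_add assms s1)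
    also have "\<dots> = (\<Sum>i\<in>UNIV. crd i w * ?I (dz i f) p + cnj (crd i w) * ?I (dzb i f) p)"
    proof (rule sum.cong[OF refl])
      fix i
      \<comment> \<open>Two summands are written as a sum over \<open>bool\<close> to bring them
        under \<open>iter_deriv_sum\<close>.\<close>
      have "?I (\<lambda>p. crd i w * dz i f p + cnj (crd i w) * dzb i f p) p =
         ?I (\<lambda>p. \<Sum>b\<in>(UNIV::bool set). if b then crd i w * dz i f p else cnj (crd i w) * dzb i f p) p"
        by (simp add: UNIV_bool add.commute)
      also have "\<dots> = (\<Sum>b\<in>(UNIV::bool set). ?I (\<lambda>p. if b then crd i w * dz i f p else cnj (crd i w) * dzb i f p) p)"
      proof (rule iter_deriv_sum[OF assms p])
        fix b :: bool
        show "smooth_on W (\<lambda>p. if b then crd i w * dz i f p else cnj (crd i w) * dzb i f p)"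
          using s1 by (cases b) auto
      qed
      also have "\<dots> = ?I (\<lambda>p. crd i w * dz i f p) p + ?I (\<lambda>p. cnj (crd i w) * dzb i f p) p"
        by (simp add: UNIV_bool)
      also have "\<dots> = crd i w * ?I (dz i f) p + cnj (crd i w) * ?I (dzb i f) p"
        by (simp add: iter_deriv_linear[OF assms p smooth_on_dz[OF assms sm] bounded_linear_mult_right]
              iter_deriv_linear[OF assms p smooth_on_dzb[OF assms sm] bounded_linear_mult_right])
      finally show "?I (\<lambda>p. crd i w * dz i f p + cnj (crd i w) * dzb i f p) p =
        crd i w * ?I (dz i f) p + cnj (crd i w) * ?I (dzb i f) p" .
    qed
    finally have "?I (dd w f) p = (\<Sum>i\<in>UNIV. crd i w * ?I (dz i f) p + cnj (crd i w) * ?I (dzb i f) p)" .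
    then show "(\<Sum>i\<in>UNIV. crd i w * (?I (dz i f) p - hX k w (dz i f) p)) +
     (\<Sum>i\<in>UNIV. cnj (crd i w) * ?I (dzb i f) p) = iter_deriv (replicate (Suc k) w) f p - hX (Suc k) w f p"
      by (simp add: iter_deriv_Cons[unfolded iter_deriv.simps] dd_def[symmetric] sum.distrib sum_subtractf algebra_simps)
  qed
qed

lemma iter_deriv_hX:
  "open W \<Longrightarrow> AH W f \<Longrightarrow> p \<in> W \<Longrightarrow> rho p = 0 \<Longrightarrow> iter_deriv (replicate k w) f p = hX k w f p"
  using flat_on_zero[OF flat_on_iter_deriv_hX] by fastforce

text \<open>At a point with \<open>rho p = 0\<close> the real Taylor polynomial equals the
  holomorphic one, since their difference is flat. The constant depends on K only, not on the point
  or the increment.\<close>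

lemma AH_Taylor:
  assumes "open W" "AH W f" "compact K" "K \<subseteq> W"
  shows "\<exists>C\<ge>0. \<forall>p\<in>K. \<forall>w. rho p = 0 \<longrightarrow> (\<forall>\<tau>\<in>{0..1}. p + \<tau> *\<^sub>R w \<in> K) \<longrightarrow>
     norm (f (p + w) - (\<Sum>k<n. hX k w f p / fact k)) \<le> C * norm w ^ n"
proof -
  obtain C where C: "C \<ge> 0" "\<And>p vs. p \<in> K \<Longrightarrow> length vs \<le> n \<Longrightarrow> norm (iter_deriv vs f p) \<le> C * prod_list (map norm vs)"
    using iter_deriv_bound[OF assms(1,3,4) AH_smooth[OF assms(2)], of n] by blast
  have pl: "prod_list (map norm (replicate m w)) = norm w ^ m" for m and w :: "'a cpair"
    by (induction m) auto
  show ?thesis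
  proof (intro exI[of _ C] conjI C(1) ballI allI impI)
    fix p w assume p: "p \<in> K" "rho p = 0" and seg: "\<forall>\<tau>\<in>{0..1}. p + \<tau> *\<^sub>R w \<in> K"
    show "norm (f (p + w) - (\<Sum>k<n. hX k w f p / fact k)) \<le> C * norm w ^ n"
    proof (cases "n = 0")
      case True
      then show ?thesis using C(2)[of "p + w" "[]"] seg[rule_format, of 1] by simp
    next
      case False
      have "norm (f (p + w) - (\<Sum>k<n. (1 / fact k) *\<^sub>R iter_deriv (replicate k w) f p)) \<le> C * norm w ^ n"
      proof (rule smooth_Taylor[OF assms(1) AH_smooth[OF assms(2)]])
        show "p + \<tau> *\<^sub>R w \<in> W" if "\<tau> \<in> {0..1}" for \<tau> using seg that assms(4) by blast
        show "norm (iter_deriv (replicate n w) f (p + \<tau> *\<^sub>R w)) \<le> C * norm w ^ n" if "\<tau> \<in> {0..1}" for \<tau>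
          using C(2)[of "p + \<tau> *\<^sub>R w" "replicate n w"] seg[rule_format, OF that] unfolding pl by simp
      qed (use False in simp)
      moreover have "p \<in> W" using p assms(4) by blast
      moreover have "(1 / fact k) *\<^sub>R z = z / fact k" for k and z :: complex
        by (simp add: scaleR_conv_of_real)
      ultimately show ?thesis by (simp add: iter_deriv_hX[OF assms(1,2) _ p(2)])
    qed
  qed
qed

text \<open>Along the anti-diagonal the direction \<open>v\<close> becomes
  \<open>(v, vconj v)\<close>, and the antiholomorphic derivatives of f vanish there. What remains
  is complex linear in \<open>v\<close> through the first group of variables and antilinear through
  the second, so the two Wirtinger derivatives of the restriction separate the two groups.\<close>

lemma AH_antidiag:
  assumes "open W" "AH W f" "(x, vconj x) \<in> W"
  shows "d_hol j (\<lambda>x. f (x, vconj x)) x = dz (Inl j) f (x, vconj x)"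
    and "d_bar j (\<lambda>x. f (x, vconj x)) x = dz (Inr j) f (x, vconj x)"
proof -
  let ?p = "(x, vconj x)"
  have d: "f differentiable at ?p" using AH_diff[OF assms(2,3)] .
  have D: "dd v (\<lambda>x. f (x, vconj x)) x = dd (v, vconj v) f ?p" for v
  proof (rule dd_eqI)
    have "((\<lambda>x. (x, vconj x)) has_derivative (\<lambda>v. (v, vconj v))) (at x)"
      by (intro has_derivative_Pair has_derivative_ident bounded_linear_imp_has_derivative bounded_linear_vconj)
    from diff_chain_at[OF this has_derivative_dd[OF d]]
    show "((\<lambda>x. f (x, vconj x)) has_derivative (\<lambda>v. dd (v, vconj v) f ?p)) (at x)" by (simp add: o_def)
  qed
  have z: "dzb i f ?p = 0" for i using flat_on_zero[OF AH_dzb[OF assms(2)] assms(3)] by simp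
  have E: "dd (axis j c) (\<lambda>x. f (x, vconj x)) x = c * dz (Inl j) f ?p + cnj c * dz (Inr j) f ?p" for c
  proof -
    have "dd (axis j c) (\<lambda>x. f (x, vconj x)) x = (\<Sum>i\<in>UNIV. crd i (axis j c, vconj (axis j c)) * dz i f ?p)"
      unfolding D dd_crd[OF d] z by simp
    also have "\<dots> = (\<Sum>k\<in>UNIV. axis j c $ k * dz (Inl k) f ?p) + (\<Sum>k\<in>UNIV. vconj (axis j c) $ k * dz (Inr k) f ?p)"
      unfolding UNIV_Plus_UNIV[symmetric] by (subst sum.Plus) (auto simp: crd_def)
    also have "\<dots> = (\<Sum>k\<in>UNIV. if k = j then c * dz (Inl j) f ?p else 0) + (\<Sum>k\<in>UNIV. if k = j then cnj c * dz (Inr j) f ?p else 0)"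
      by (intro arg_cong2[where f="(+)"] sum.cong) (auto simp: axis_def vconj_def)
    also have "\<dots> = c * dz (Inl j) f ?p + cnj c * dz (Inr j) f ?p" by simp
    finally show ?thesis .
  qed
  show "d_hol j (\<lambda>x. f (x, vconj x)) x = dz (Inl j) f ?p" "d_bar j (\<lambda>x. f (x, vconj x)) x = dz (Inr j) f ?p"
    unfolding d_hol_def d_bar_def by (simp_all add: E[unfolded dd_def] algebra_simps)
qed

lemma d_hol_cong:
  assumes "open V" "x \<in> V" "\<And>y. y \<in> V \<Longrightarrow> f y = g y"
  shows "d_hol j f x = d_hol j g x" "d_bar j f x = d_bar j g x"
  using dd_cong_open[OF assms(1,3,2)] unfolding d_hol_def d_bar_def dd_def by simp_all

text \<open>By \<open>AH_antidiag\<close> the restriction to the anti-diagonal determines the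
  restrictions of all first holomorphic derivatives, and by iteration the whole holomorphic jet.
  Agreement on an open set of base points is needed to differentiate again.\<close>

lemma hX_antidiag_cong:
  assumes W: "open W" and V: "open V" "\<And>x. x \<in> V \<Longrightarrow> (x, vconj x) \<in> W"
  shows "AH W f \<Longrightarrow> AH W g \<Longrightarrow> (\<And>x. x \<in> V \<Longrightarrow> f (x, vconj x) = g (x, vconj x)) \<Longrightarrow> x \<in> V \<Longrightarrow>
    hX k w f (x, vconj x) = hX k w g (x, vconj x)"
proof (induction k arbitrary: f g x)
  case 0
  then show ?case by simp
next
  case (Suc k)
  have z: "dz i f (y, vconj y) = dz i g (y, vconj y)" if y: "y \<in> V" for i y
  proof -
    have "d_hol j (\<lambda>x. f (x, vconj x)) y = d_hol j (\<lambda>x. g (x, vconj x)) y"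
      "d_bar j (\<lambda>x. f (x, vconj x)) y = d_bar j (\<lambda>x. g (x, vconj x)) y" for j
      by (rule d_hol_cong[OF V(1) y Suc.prems(3)], assumption)+
    then show ?thesis using AH_antidiag[OF W Suc.prems(1) V(2)[OF y]] AH_antidiag[OF W Suc.prems(2) V(2)[OF y]] by (cases i) auto
  qed
  have "hX k w (dz i f) (x, vconj x) = hX k w (dz i g) (x, vconj x)" for i
    by (rule Suc.IH[OF AH_dz[OF W Suc.prems(1)] AH_dz[OF W Suc.prems(2)] z Suc.prems(4)])
  then show ?case by simp
qed

section \<open>Determinants with a replaced row\<close>

text \<open>Two forms of the same cofactor: permutations that send \<open>k\<close> to
  \<open>j\<close> contribute equally, all others contribute nothing.\<close>

lemma det_replace_row_column:
  fixes A :: "complex^'k^'k::finite"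
  shows "det (\<chi> i. if i = k then axis j 1 else A $ i) =
    det (\<chi> i l. if l = j then axis k 1 $ i else A $ i $ l)"
  unfolding det_def
proof (rule sum.cong[OF refl])
  fix p assume "p \<in> {p. p permutes (UNIV :: 'k set)}"
  then have p: "p permutes UNIV" by simp
  have inj: "p i = p l \<longleftrightarrow> i = l" for i l using permutes_inj[OF p] by (auto simp: inj_def)
  have "(\<Prod>i\<in>UNIV. (\<chi> i. if i = k then axis j 1 else A $ i) $ i $ p i) =
    (\<Prod>i\<in>UNIV. (\<chi> i l. if l = j then axis k 1 $ i else A $ i $ l) $ i $ p i)"
  proof (cases "p k = j")
    case True
    show ?thesis
      by (rule prod.cong[OF refl]) (use True inj in \<open>auto simp: axis_def\<close>)
  next
    case False
    obtain i0 where i0: "p i0 = j" using permutes_surj[OF p] by (metis surjD)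
    have A0: "(\<Prod>i\<in>UNIV. (\<chi> i. if i = k then axis j 1 else A $ i) $ i $ p i) = 0"
      by (rule prod_zero) (use False in \<open>auto intro!: bexI[of _ k] simp: axis_def\<close>)
    have B0: "(\<Prod>i\<in>UNIV. (\<chi> i l. if l = j then axis k 1 $ i else A $ i $ l) $ i $ p i) = 0"
      by (rule prod_zero) (use False i0 in \<open>auto intro!: bexI[of _ i0] simp: axis_def\<close>)
    show ?thesis by (rule trans[OF A0 B0[symmetric]])
  qed
  then show "of_int (sign p) * (\<Prod>i\<in>UNIV. (\<chi> i. if i = k then axis j 1 else A $ i) $ i $ p i) =
    of_int (sign p) * (\<Prod>i\<in>UNIV. (\<chi> i l. if l = j then axis k 1 $ i else A $ i $ l) $ i $ p i)" by simp
qed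

lemma det_replace_row_sum:
  fixes c :: "'k::finite \<Rightarrow> 'a::comm_ring_1^'k"
  assumes "finite S"
  shows "det (\<chi> i. if i = k then \<Sum>j\<in>S. x j *s u j else c i) =
    (\<Sum>j\<in>S. x j * det (\<chi> i. if i = k then u j else c i))"
  using det_linear_row_sum[OF assms, of k "\<lambda>_ j. x j *s u j" c]
    det_row_mul[of k _ "\<lambda>_. u _" c] by simp

lemma det_replace_column_sum:
  fixes A :: "complex^'k^'k::finite"
  shows "(\<Sum>k\<in>UNIV. w $ k * det (\<chi> i l. if l = j then axis k 1 $ i else A $ i $ l)) =
    det (\<chi> i l. if l = j then w $ i else A $ i $ l)"
proof -
  have tr: "det (\<chi> i l. if l = j then v $ i else A $ i $ l) = det (\<chi> i. if i = j then v else transpose A $ i)" for v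
  proof -
    have "transpose (\<chi> i l. if l = j then v $ i else A $ i $ l) = (\<chi> i. if i = j then v else transpose A $ i)"
      by (simp add: vec_eq_iff transpose_def)
    from arg_cong[OF this, of det] show ?thesis unfolding det_transpose .
  qed
  have "det (\<chi> i. if i = j then w else transpose A $ i) =
    (\<Sum>k\<in>UNIV. w $ k * det (\<chi> i. if i = j then axis k 1 else transpose A $ i))"
    using det_replace_row_sum[of UNIV j "\<lambda>k. w $ k" "\<lambda>k. axis k 1" "\<lambda>i. transpose A $ i", unfolded basis_expansion] by simp
  then show ?thesis unfolding tr by simp
qed

text \<open>The product of a matrix with its adjugate, tested on \<open>v\<close>. In contrast to
  Cramer's rule for solving equations, \<open>A\<close> may be singular, so nothing has to be known
  about the Jacobian of a contour.\<close>

lemma cramer_adjugate: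
  fixes A :: "complex^'k^'k::finite"
  shows "(\<Sum>k\<in>UNIV. A $ k $ i * det (\<chi> l. if l = k then v else A $ l)) = v $ i * det A"
proof -
  have C: "(\<Sum>k\<in>UNIV. A $ k $ i * det (\<chi> l. if l = k then axis j 1 else A $ l)) = (if i = j then det A else 0)" for j
  proof -
    have "(\<Sum>k\<in>UNIV. A $ k $ i * det (\<chi> l. if l = k then axis j 1 else A $ l)) =
      det (\<chi> m l. if l = j then (\<chi> k. A $ k $ i) $ m else A $ m $ l)"
      unfolding det_replace_row_column using det_replace_column_sum[of "\<chi> k. A $ k $ i" j A] by simp
    also have "\<dots> = (if i = j then det A else 0)"
    proof (cases "i = j")
      case True
      then have "(\<chi> m l. if l = j then (\<chi> k. A $ k $ i) $ m else A $ m $ l) = A" by (simp add: vec_eq_iff)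
      then show ?thesis using True by simp
    next
      case False
      then show ?thesis
        by (subst det_identical_columns[of i j]) (auto simp: column_def)
    qed
    finally show ?thesis .
  qed
  have "(\<Sum>k\<in>UNIV. A $ k $ i * det (\<chi> l. if l = k then v else A $ l)) =
    (\<Sum>k\<in>UNIV. A $ k $ i * (\<Sum>j\<in>UNIV. v $ j * det (\<chi> l. if l = k then axis j 1 else A $ l)))"
    using det_replace_row_sum[of UNIV _ "\<lambda>k. v $ k" "\<lambda>k. axis k 1" "\<lambda>i. A $ i", unfolded basis_expansion] by simp
  also have "\<dots> = (\<Sum>j\<in>UNIV. v $ j * (\<Sum>k\<in>UNIV. A $ k $ i * det (\<chi> l. if l = k then axis j 1 else A $ l)))"
    unfolding sum_distrib_left by (subst sum.swap) (simp add: mult_ac)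
  also have "\<dots> = (\<Sum>j\<in>UNIV. if i = j then v $ j * det A else 0)" unfolding C by (intro sum.cong) auto
  also have "\<dots> = v $ i * det A" by simp
  finally show ?thesis .
qed

lemma has_derivative_det_rows:
  fixes M :: "'a::real_normed_vector \<Rightarrow> 'k::finite \<Rightarrow> complex^'k"
  assumes "\<And>i. ((\<lambda>x. M x i) has_derivative M' i) (at x)"
  shows "((\<lambda>x. det (\<chi> i. M x i)) has_derivative
    (\<lambda>w. \<Sum>k\<in>UNIV. det (\<chi> i. if i = k then M' k w else M x i))) (at x)"
proof -
  have c: "((\<lambda>x. M x i $ j) has_derivative (\<lambda>w. M' i w $ j)) (at x)" for i j
    by (rule bounded_linear.has_derivative[OF bounded_linear_vec_nth assms])
  have "((\<lambda>x. \<Sum>p\<in>{p. p permutes (UNIV::'k set)}. of_int (sign p) * (\<Prod>i\<in>UNIV. M x i $ p i)) has_derivative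
    (\<lambda>w. \<Sum>p\<in>{p. p permutes (UNIV::'k set)}. of_int (sign p) * (\<Sum>k\<in>UNIV. M' k w $ p k * (\<Prod>i\<in>UNIV - {k}. M x i $ p i)))) (at x)"
    by (intro has_derivative_sum has_derivative_mult_right has_derivative_prod c)
  moreover have "(\<Sum>p\<in>{p. p permutes (UNIV::'k set)}. of_int (sign p) * (\<Sum>k\<in>UNIV. M' k w $ p k * (\<Prod>i\<in>UNIV - {k}. M x i $ p i))) =
    (\<Sum>k\<in>UNIV. det (\<chi> i. if i = k then M' k w else M x i))" for w
  proof -
    have pr: "(\<Prod>i\<in>UNIV. (if i = k then M' k w else M x i) $ p i) = M' k w $ p k * (\<Prod>i\<in>UNIV - {k}. M x i $ p i)" for k p
      by (subst prod.remove[of _ k]) (auto intro!: prod.cong)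
    show ?thesis unfolding det_def sum_distrib_left vec_lambda_beta pr by (rule sum.swap)
  qed
  ultimately show ?thesis unfolding det_def by simp
qed

text \<open>The terms \<open>(k, l)\<close> and \<open>(l, k)\<close> differ by the exchange of two
  rows and cancel. In \<open>pullback_closed\<close> the symmetric \<open>w\<close> consists of
  second derivatives of the contour.\<close>

lemma sum_det_two_rows_zero:
  fixes A :: "'k::finite \<Rightarrow> complex^'k"
  assumes "\<And>k l. w k l = w l k"
  shows "(\<Sum>k\<in>UNIV. \<Sum>l\<in>UNIV - {k}. det (\<chi> m. if m = l then w k l else if m = k then v else A m)) = 0"
proof -
  define X where "X k l = det (\<chi> m. if m = l then w k l else if m = k then v else A m)" for k l
  have X: "X l k = - X k l" if "k \<noteq> l" for k l
  proof -
    let ?M = "\<chi> m. if m = l then w k l else if m = k then v else A m"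
    have "(\<chi> m. if m = k then w l k else if m = l then v else A m) = (\<chi> m. ?M $ Transposition.transpose k l m)"
      using that assms[of k l] by (auto simp: vec_eq_iff Transposition.transpose_def)
    then have "X l k = det (\<chi> m. ?M $ Transposition.transpose k l m)" unfolding X_def by (rule arg_cong)
    also have "\<dots> = of_int (sign (Transposition.transpose k l)) * det ?M"
      by (rule det_permute_rows) (simp add: permutes_swap_id)
    finally have "X l k = of_int (sign (Transposition.transpose k l)) * X k l" unfolding X_def .
    then show ?thesis using that by (simp add: sign_swap_id)
  qed
  have "(\<Sum>k\<in>UNIV. \<Sum>l\<in>UNIV - {k}. X k l) = (\<Sum>k\<in>UNIV. \<Sum>l\<in>UNIV. if k = l then 0 else X k l)"
    by (intro sum.cong refl sum.mono_neutral_cong_left) auto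
  moreover have "(\<Sum>k\<in>UNIV. \<Sum>l\<in>UNIV. if k = l then 0 else X k l) = - (\<Sum>k\<in>UNIV. \<Sum>l\<in>UNIV. if k = l then 0 else X k l)"
  proof -
    have "(\<Sum>k\<in>UNIV. \<Sum>l\<in>UNIV. if k = l then 0 else X k l) = (\<Sum>l\<in>UNIV. \<Sum>k\<in>UNIV. if k = l then 0 else X k l)"
      by (rule sum.swap)
    also have "\<dots> = (\<Sum>l\<in>UNIV. \<Sum>k\<in>UNIV. - (if l = k then 0 else X l k))"
    proof (intro sum.cong refl)
      fix l k show "(if k = l then 0 else X k l) = - (if l = k then 0 else X l k)"
        by (cases "l = k") (use X[of l k] in simp_all)
    qed
    finally show ?thesis by (simp add: sum_negf)
  qed
  ultimately show ?thesis unfolding X_def by simp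
qed

section \<open>Stokes' theorem for contour integrals\<close>

text \<open>Rows of the Jacobian belong to real directions and columns to complex coordinates,
  transposed to \<open>contour_jacobian\<close>: differentiating the determinant then replaces
  rows.\<close>

definition rv :: "('a::real_normed_vector \<Rightarrow> 'n::finite cpair) \<Rightarrow> 'a \<Rightarrow> 'a \<Rightarrow> complex^('n + 'n)" where
  "rv \<Gamma> e x = (\<chi> i. crd i (dd e \<Gamma> x))"

lemma bounded_linear_crd: "bounded_linear (crd i)"
proof (cases i)
  case (Inl j)
  then show ?thesis unfolding crd_def[abs_def] by (simp add: bounded_linear_compose[OF bounded_linear_vec_nth bounded_linear_fst])
next
  case (Inr j)
  then show ?thesis unfolding crd_def[abs_def] by (simp add: bounded_linear_compose[OF bounded_linear_vec_nth bounded_linear_snd])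
qed

lemma bounded_linear_crds: "bounded_linear (\<lambda>p :: 'n::finite cpair. \<chi> i. crd i p)"
proof -
  have "linear (\<lambda>p :: 'n cpair. \<chi> i. crd i p)"
    by (intro linearI) (simp_all add: vec_eq_iff linear_add[OF bounded_linear.linear[OF bounded_linear_crd]]
      linear_scale[OF bounded_linear.linear[OF bounded_linear_crd]])
  then show ?thesis by (simp add: linear_conv_bounded_linear)
qed

lemma smooth_on_rv: "open S \<Longrightarrow> smooth_on S \<Gamma> \<Longrightarrow> smooth_on S (rv \<Gamma> e)"
  unfolding rv_def[abs_def] by (intro smooth_on_linear_comp[OF _ bounded_linear_crds] smooth_on_dd)

lemma smooth_on_det_rows:
  fixes M :: "'a::real_normed_vector \<Rightarrow> 'k::finite \<Rightarrow> complex^'k"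
  assumes "open S" "\<And>i. smooth_on S (\<lambda>x. M x i)"
  shows "smooth_on S (\<lambda>x. det (\<chi> i. M x i))"
proof -
  have "smooth_on S (\<lambda>x. det (\<chi> i j. M x i $ j))"
    by (intro smooth_on_det assms smooth_on_linear_comp[OF _ bounded_linear_vec_nth])
  then show ?thesis by simp
qed

definition pull_jac :: "('a::real_normed_vector \<Rightarrow> 'n::finite cpair) \<Rightarrow> ('n + 'n \<Rightarrow> 'a) \<Rightarrow> 'a \<Rightarrow> complex" where
  "pull_jac \<Gamma> e x = det (\<chi> k. rv \<Gamma> (e k) x)"

text \<open>The remaining coefficients of the pulled-back top form: on a parameter space with one
  extra direction \<open>e0\<close>, row \<open>k\<close> gives way to that direction. Closedness of
  the form says that the \<open>e0\<close>-derivative of \<open>pull_jac\<close> is the divergence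
  of these.\<close>

definition pull_jac_repl :: "('a::real_normed_vector \<Rightarrow> 'n::finite cpair) \<Rightarrow> ('n + 'n \<Rightarrow> 'a) \<Rightarrow> 'a \<Rightarrow> 'n + 'n \<Rightarrow> 'a \<Rightarrow> complex" where
  "pull_jac_repl \<Gamma> e e0 k x = det (\<chi> l. if l = k then rv \<Gamma> e0 x else rv \<Gamma> (e l) x)"

lemma smooth_on_pull_jac: "open S \<Longrightarrow> smooth_on S \<Gamma> \<Longrightarrow> smooth_on S (pull_jac \<Gamma> e)"
  unfolding pull_jac_def[abs_def] by (intro smooth_on_det_rows smooth_on_rv)

lemma smooth_on_pull_jac_repl: "open S \<Longrightarrow> smooth_on S \<Gamma> \<Longrightarrow> smooth_on S (pull_jac_repl \<Gamma> e e0 k)"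
proof -
  assume a: "open S" "smooth_on S \<Gamma>"
  have "smooth_on S (\<lambda>x. if l = k then rv \<Gamma> e0 x else rv \<Gamma> (e l) x)" for l
    using smooth_on_rv[OF a, of e0] smooth_on_rv[OF a, of "e l"] by (cases "l = k") simp_all
  then show ?thesis unfolding pull_jac_repl_def[abs_def] by (intro smooth_on_det_rows a)
qed

text \<open>The exterior derivative of \<open>f dz\<^sub>1 \<and> \<dots> \<and> dz\<^sub>m\<close> only involves the antiholomorphic derivatives of \<open>f\<close>.\<close>

lemma pullback_closed:
  fixes \<Gamma> :: "'a::real_normed_vector \<Rightarrow> 'n::finite cpair"
  assumes S: "open S" "smooth_on S \<Gamma>" "x \<in> S" and f: "f differentiable at (\<Gamma> x)"
  shows "dd e0 (\<lambda>x. f (\<Gamma> x) * pull_jac \<Gamma> e x) x - (\<Sum>k\<in>UNIV. dd (e k) (\<lambda>x. f (\<Gamma> x) * pull_jac_repl \<Gamma> e e0 k x) x) =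
    (\<Sum>i\<in>UNIV. dzb i f (\<Gamma> x) * (cnj (rv \<Gamma> e0 x $ i) * pull_jac \<Gamma> e x - (\<Sum>k\<in>UNIV. cnj (rv \<Gamma> (e k) x $ i) * pull_jac_repl \<Gamma> e e0 k x)))"
proof -
  have d\<Gamma>: "\<Gamma> differentiable at x" using smooth_on_diff[OF S(2,3)] .
  define H where "H u v = (\<chi> i. crd i (dd u (dd v \<Gamma>) x))" for u v
  have Hsym: "H u v = H v u" for u v unfolding H_def using dd_commute[OF S] by simp
  have drv: "((\<lambda>x. rv \<Gamma> v x) has_derivative (\<lambda>u. H u v)) (at x)" for v
    unfolding rv_def H_def
    by (rule bounded_linear.has_derivative[OF bounded_linear_crds has_derivative_dd[OF smooth_on_diff[OF smooth_on_dd[OF S(2)] S(3)]]])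
  have dJ: "dd u (pull_jac \<Gamma> e) x = (\<Sum>l\<in>UNIV. det (\<chi> m. if m = l then H u (e l) else rv \<Gamma> (e m) x))" for u
    unfolding pull_jac_def[abs_def] by (rule dd_eqI[OF has_derivative_det_rows[OF drv]])
  have dJR: "dd u (pull_jac_repl \<Gamma> e e0 k) x = (\<Sum>l\<in>UNIV. det (\<chi> m. if m = l then H u (if l = k then e0 else e l)
     else if m = k then rv \<Gamma> e0 x else rv \<Gamma> (e m) x))" for u k
  proof -
    have "((\<lambda>x. if l = k then rv \<Gamma> e0 x else rv \<Gamma> (e l) x) has_derivative (\<lambda>u. H u (if l = k then e0 else e l))) (at x)" for l
      using drv by (cases "l = k") auto
    from has_derivative_det_rows[OF this] show ?thesis unfolding pull_jac_repl_def[abs_def] by (rule dd_eqI)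
  qed
  \<comment> \<open>The row with \<open>l = k\<close> yields, after exchange of the derivatives, a
    term of the \<open>e0\<close>-derivative of \<open>pull_jac\<close>; the other rows form the sum
    that cancels in pairs.\<close>
  have "(\<Sum>k\<in>UNIV. dd (e k) (pull_jac_repl \<Gamma> e e0 k) x) = (\<Sum>k\<in>UNIV. det (\<chi> m. if m = k then H (e k) e0 else rv \<Gamma> (e m) x) +
     (\<Sum>l\<in>UNIV - {k}. det (\<chi> m. if m = l then H (e k) (e l) else if m = k then rv \<Gamma> e0 x else rv \<Gamma> (e m) x)))"
  proof (rule sum.cong[OF refl])
    fix k
    show "dd (e k) (pull_jac_repl \<Gamma> e e0 k) x = det (\<chi> m. if m = k then H (e k) e0 else rv \<Gamma> (e m) x) +
     (\<Sum>l\<in>UNIV - {k}. det (\<chi> m. if m = l then H (e k) (e l) else if m = k then rv \<Gamma> e0 x else rv \<Gamma> (e m) x))"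
    proof -
      have 2: "(\<Sum>l\<in>UNIV - {k}. det (\<chi> m. if m = l then H (e k) (if l = k then e0 else e l)
          else if m = k then rv \<Gamma> e0 x else rv \<Gamma> (e m) x)) =
        (\<Sum>l\<in>UNIV - {k}. det (\<chi> m. if m = l then H (e k) (e l) else if m = k then rv \<Gamma> e0 x else rv \<Gamma> (e m) x))"
      proof (rule sum.cong[OF refl])
        fix l assume "l \<in> UNIV - {k}"
        then have "(if l = k then e0 else e l) = e l" by simp
        then show "det (\<chi> m. if m = l then H (e k) (if l = k then e0 else e l)
          else if m = k then rv \<Gamma> e0 x else rv \<Gamma> (e m) x) =
          det (\<chi> m. if m = l then H (e k) (e l) else if m = k then rv \<Gamma> e0 x else rv \<Gamma> (e m) x)" by (simp only:)
      qed
      have 3: "(\<chi> m. if m = k then H (e k) (if k = k then e0 else e k) else if m = k then rv \<Gamma> e0 x else rv \<Gamma> (e m) x)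
        = (\<chi> m. if m = k then H (e k) e0 else rv \<Gamma> (e m) x)" by (simp add: vec_eq_iff)
      show ?thesis unfolding dJR by (subst sum.remove[of UNIV k]) (simp_all only: 2 3 finite UNIV_I)
    qed
  qed
  also have "\<dots> = dd e0 (pull_jac \<Gamma> e) x"
    unfolding sum.distrib dJ Hsym[of "e _" e0]
    using sum_det_two_rows_zero[of "\<lambda>k l. H (e k) (e l)" "rv \<Gamma> e0 x" "\<lambda>m. rv \<Gamma> (e m) x", OF Hsym]
    by (simp only: add_0_right)
  finally have div: "(\<Sum>k\<in>UNIV. dd (e k) (pull_jac_repl \<Gamma> e e0 k) x) = dd e0 (pull_jac \<Gamma> e) x" .
  have df: "dd u (\<lambda>x. f (\<Gamma> x)) x = (\<Sum>i\<in>UNIV. rv \<Gamma> u x $ i * dz i f (\<Gamma> x) + cnj (rv \<Gamma> u x $ i) * dzb i f (\<Gamma> x))" for u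
    unfolding dd_compose[OF d\<Gamma> f] dd_crd[OF f] rv_def by simp
  have dif: "(\<lambda>x. f (\<Gamma> x)) differentiable at x" by (rule differentiable_compose_at[of \<Gamma> x f, OF d\<Gamma> f])
  have difJ: "pull_jac \<Gamma> e differentiable at x" "pull_jac_repl \<Gamma> e e0 k differentiable at x" for k
    using smooth_on_diff[OF smooth_on_pull_jac[OF S(1,2)] S(3)] smooth_on_diff[OF smooth_on_pull_jac_repl[OF S(1,2)] S(3)] by blast+
  \<comment> \<open>The adjugate identity makes the terms with \<open>dz\<close> on both sides
    equal, so that only \<open>dzb\<close> is left.\<close>
  have cr: "(\<Sum>k\<in>UNIV. rv \<Gamma> (e k) x $ i * pull_jac_repl \<Gamma> e e0 k x) = rv \<Gamma> e0 x $ i * pull_jac \<Gamma> e x" for i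
    using cramer_adjugate[of "\<chi> k. rv \<Gamma> (e k) x" i "rv \<Gamma> e0 x"] unfolding pull_jac_repl_def pull_jac_def vec_lambda_beta .
  have "(\<Sum>k\<in>UNIV. dd (e k) (\<lambda>x. f (\<Gamma> x) * pull_jac_repl \<Gamma> e e0 k x) x) =
    f (\<Gamma> x) * dd e0 (pull_jac \<Gamma> e) x + (\<Sum>k\<in>UNIV. (\<Sum>i\<in>UNIV. rv \<Gamma> (e k) x $ i * dz i f (\<Gamma> x) + cnj (rv \<Gamma> (e k) x $ i) * dzb i f (\<Gamma> x)) * pull_jac_repl \<Gamma> e e0 k x)"
    unfolding dd_bilinear[OF bounded_bilinear_mult dif difJ(2)] df sum.distrib div[symmetric] sum_distrib_left ..
  also have "(\<Sum>k\<in>UNIV. (\<Sum>i\<in>UNIV. rv \<Gamma> (e k) x $ i * dz i f (\<Gamma> x) + cnj (rv \<Gamma> (e k) x $ i) * dzb i f (\<Gamma> x)) * pull_jac_repl \<Gamma> e e0 k x)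
    = (\<Sum>i\<in>UNIV. \<Sum>k\<in>UNIV. (rv \<Gamma> (e k) x $ i * dz i f (\<Gamma> x) + cnj (rv \<Gamma> (e k) x $ i) * dzb i f (\<Gamma> x)) * pull_jac_repl \<Gamma> e e0 k x)"
    unfolding sum_distrib_right by (rule sum.swap)
  also have "\<dots> = (\<Sum>i\<in>UNIV. dz i f (\<Gamma> x) * (\<Sum>k\<in>UNIV. rv \<Gamma> (e k) x $ i * pull_jac_repl \<Gamma> e e0 k x) +
     dzb i f (\<Gamma> x) * (\<Sum>k\<in>UNIV. cnj (rv \<Gamma> (e k) x $ i) * pull_jac_repl \<Gamma> e e0 k x))"
    unfolding sum_distrib_left sum.distrib[symmetric] by (intro sum.cong refl) (simp add: algebra_simps)
  finally have R: "(\<Sum>k\<in>UNIV. dd (e k) (\<lambda>x. f (\<Gamma> x) * pull_jac_repl \<Gamma> e e0 k x) x) = f (\<Gamma> x) * dd e0 (pull_jac \<Gamma> e) x +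
     (\<Sum>i\<in>UNIV. dz i f (\<Gamma> x) * (rv \<Gamma> e0 x $ i * pull_jac \<Gamma> e x) + dzb i f (\<Gamma> x) * (\<Sum>k\<in>UNIV. cnj (rv \<Gamma> (e k) x $ i) * pull_jac_repl \<Gamma> e e0 k x))"
    unfolding cr .
  show ?thesis
    unfolding R dd_bilinear[OF bounded_bilinear_mult dif difJ(1)] df
    by (simp add: sum_distrib_left sum_distrib_right sum_subtractf sum.distrib algebra_simps)
qed

subsection \<open>A cut-off function\<close>

text \<open>The square of the positive part is once continuously differentiable. That suffices for a
  cut-off, since integration by parts uses only its first derivative.\<close>

definition sqp :: "real \<Rightarrow> real" where "sqp u = (max 0 u)\<^sup>2"

lemma DERIV_sqp: "(sqp has_real_derivative 2 * max 0 u) (at u)"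
proof -
  consider "u > 0" | "u < 0" | "u = 0" by linarith
  then show ?thesis
  proof cases
    case 1
    have "((\<lambda>u. u\<^sup>2) has_real_derivative 2 * max 0 u) (at u)"
      by (rule derivative_eq_intros | use 1 in simp)+
    then show ?thesis
      by (rule has_field_derivative_transform_within_open[where S="{0<..}"]) (use 1 in \<open>auto simp: sqp_def\<close>)
  next
    case 2
    have "((\<lambda>u. 0) has_real_derivative 2 * max 0 u) (at u)"
      by (rule derivative_eq_intros | use 2 in simp)+
    then show ?thesis
      by (rule has_field_derivative_transform_within_open[where S="{..<0}"]) (use 2 in \<open>auto simp: sqp_def\<close>)
  next
    case 3
    have "(\<lambda>h. (sqp (0 + h) - sqp 0) / h) \<midarrow>0\<rightarrow> 0"
    proof (rule Lim_null_comparison)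
      have "norm ((sqp (0 + h) - sqp 0) / h) \<le> \<bar>h\<bar>" for h
        by (cases "h > 0") (auto simp: sqp_def max_def power2_eq_square)
      then show "\<forall>\<^sub>F h in at 0. norm ((sqp (0 + h) - sqp 0) / h) \<le> \<bar>h\<bar>" by simp
      show "((\<lambda>h::real. \<bar>h\<bar>) \<longlongrightarrow> 0) (at 0)" by (rule tendsto_rabs_zero) (rule tendsto_ident_at)
    qed
    then show ?thesis using 3 by (simp add: DERIV_def)
  qed
qed

text \<open>The argument of the inner \<open>sqp\<close> is affine in the squared norm, 0 at radius
  \<delta> / 2 and 3 / 2 at radius \<delta>; so the cut-off is 1 up to the first radius and 0 from
  the second on.\<close>

definition cut :: "real \<Rightarrow> 'a::real_inner \<Rightarrow> real" where
  "cut \<delta> t = sqp (1 - sqp ((t \<bullet> t - \<delta>\<^sup>2 / 4) * (2 / \<delta>\<^sup>2)))"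

definition cut' :: "real \<Rightarrow> 'a::real_inner \<Rightarrow> 'a \<Rightarrow> real" where
  "cut' \<delta> v t = 2 * max 0 (1 - sqp ((t \<bullet> t - \<delta>\<^sup>2 / 4) * (2 / \<delta>\<^sup>2))) *
     - (2 * max 0 ((t \<bullet> t - \<delta>\<^sup>2 / 4) * (2 / \<delta>\<^sup>2)) * (2 * (t \<bullet> v) * (2 / \<delta>\<^sup>2)))"

lemma has_derivative_cut: "(cut \<delta> has_derivative (\<lambda>v. cut' \<delta> v t)) (at t)"
proof -
  let ?U = "\<lambda>t. (t \<bullet> t - \<delta>\<^sup>2 / 4) * (2 / \<delta>\<^sup>2)"
  have s: "(sqp has_derivative (*) (2 * max 0 u)) (at u)" for u
    using DERIV_sqp[of u] by (simp add: has_field_derivative_def)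
  have U: "(?U has_derivative (\<lambda>v. 2 * (t \<bullet> v) * (2 / \<delta>\<^sup>2))) (at t)"
  proof -
    have "((\<lambda>t. (t \<bullet> t - c) * d) has_derivative (\<lambda>v. 2 * (t \<bullet> v) * d)) (at t)" for c d
      by (auto intro!: derivative_eq_intros simp: inner_commute algebra_simps)
    then show ?thesis .
  qed
  have 1: "((\<lambda>t. sqp (?U t)) has_derivative (\<lambda>v. 2 * max 0 (?U t) * (2 * (t \<bullet> v) * (2 / \<delta>\<^sup>2)))) (at t)"
    using diff_chain_at[OF U s] by (simp add: o_def)
  have 2: "((\<lambda>t. 1 - sqp (?U t)) has_derivative (\<lambda>v. - (2 * max 0 (?U t) * (2 * (t \<bullet> v) * (2 / \<delta>\<^sup>2))))) (at t)"
    using has_derivative_diff[OF has_derivative_const[of 1] 1] by simp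
  show ?thesis using diff_chain_at[OF 2 s] unfolding cut_def[abs_def] cut'_def by (simp add: o_def)
qed

lemma cut_continuous: "continuous_on S (cut \<delta>)"
  using has_derivative_continuous[OF has_derivative_cut] continuous_at_imp_continuous_on by blast

lemma cut'_continuous: "continuous_on S (cut' \<delta> v)"
  unfolding cut'_def sqp_def by (intro continuous_intros)

lemma cut_bounds: "0 \<le> cut \<delta> t" "cut \<delta> t \<le> 1"
proof -
  show "0 \<le> cut \<delta> t" by (simp add: cut_def sqp_def)
  have "max 0 (1 - sqp u) \<le> 1" for u by (simp add: sqp_def)
  then have "sqp (1 - sqp u) \<le> 1" for u unfolding sqp_def[of "1 - _"] by (rule power_le_one[rotated]) simp
  then show "cut \<delta> t \<le> 1" unfolding cut_def .
qed

lemma cut_inside: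
  assumes "\<delta> > 0" "norm t \<le> \<delta> / 2"
  shows "cut \<delta> t = 1" "cut' \<delta> v t = 0"
proof -
  have "t \<bullet> t = (norm t)\<^sup>2" by (simp add: power2_norm_eq_inner)
  also have "\<dots> \<le> (\<delta> / 2)\<^sup>2" using assms by (intro power_mono) auto
  finally have "(t \<bullet> t - \<delta>\<^sup>2 / 4) * (2 / \<delta>\<^sup>2) \<le> 0" using assms(1)
    by (intro mult_nonpos_nonneg) (simp_all add: power_divide)
  then have "max 0 ((t \<bullet> t - \<delta>\<^sup>2 / 4) * (2 / \<delta>\<^sup>2)) = 0" by simp
  then show "cut \<delta> t = 1" "cut' \<delta> v t = 0" unfolding cut_def cut'_def sqp_def by simp_all
qed

lemma cut_outside:
  assumes "\<delta> > 0" "norm t \<ge> \<delta>"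
  shows "cut \<delta> t = 0" "cut' \<delta> v t = 0"
proof -
  have "\<delta>\<^sup>2 \<le> (norm t)\<^sup>2" using assms by (intro power_mono) auto
  then have "\<delta>\<^sup>2 * 3 / 4 \<le> t \<bullet> t - \<delta>\<^sup>2 / 4" by (simp add: power2_norm_eq_inner)
  then have "\<delta>\<^sup>2 * 3 / 4 * (2 / \<delta>\<^sup>2) \<le> (t \<bullet> t - \<delta>\<^sup>2 / 4) * (2 / \<delta>\<^sup>2)"
    using assms(1) by (intro mult_right_mono) auto
  moreover have "\<delta>\<^sup>2 * 3 / 4 * (2 / \<delta>\<^sup>2) = 3 / 2" using assms(1) by simp
  ultimately have "(t \<bullet> t - \<delta>\<^sup>2 / 4) * (2 / \<delta>\<^sup>2) \<ge> 1" by linarith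
  then have "sqp ((t \<bullet> t - \<delta>\<^sup>2 / 4) * (2 / \<delta>\<^sup>2)) \<ge> 1" unfolding sqp_def by simp
  then have "max 0 (1 - sqp ((t \<bullet> t - \<delta>\<^sup>2 / 4) * (2 / \<delta>\<^sup>2))) = 0" by simp
  then show "cut \<delta> t = 0" "cut' \<delta> v t = 0" unfolding cut_def cut'_def by (simp_all add: sqp_def[of "1 - _"])
qed

subsection \<open>Integrals of compactly supported functions\<close>

text \<open>The link between two integrals: differentiation under the integral and uniform bounds
  are carried out on a box, translation and scaling for the Lebesgue measure.\<close>

lemma compact_support_integral:
  fixes \<phi> :: "'a::euclidean_space \<Rightarrow> complex"
  assumes "continuous_on (cbox a b) \<phi>" "\<And>t. t \<notin> cbox a b \<Longrightarrow> \<phi> t = 0"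
  shows "integrable lborel \<phi>" "integral (cbox a b) \<phi> = (LINT t|lborel. \<phi> t)"
proof -
  have eq: "indicator (cbox a b) t *\<^sub>R \<phi> t = \<phi> t" for t
    using assms(2)[of t] by (cases "t \<in> cbox a b") auto
  have i: "integrable lborel (\<lambda>t. indicator (cbox a b) t *\<^sub>R \<phi> t)"
    by (rule borel_integrable_compact[OF compact_cbox assms(1)])
  then show "integrable lborel \<phi>" unfolding eq .
  have "set_integrable lborel (cbox a b) \<phi>" using i unfolding set_integrable_def .
  from set_borel_integral_eq_integral(2)[OF this]
  show "integral (cbox a b) \<phi> = (LINT t|lborel. \<phi> t)" unfolding set_lebesgue_integral_def eq by simp
qed

text \<open>\<open>g\<close> is controlled only over the closed ball; the product is glued along two
  closed sets, on the second of which it vanishes.\<close>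

lemma continuous_on_cutoff:
  fixes g :: "'s::topological_space \<times> 'a::real_normed_vector \<Rightarrow> 'b::real_normed_vector"
  assumes "closed S" "continuous_on (S \<times> cball 0 \<delta>) g" "continuous_on UNIV \<kappa>" "\<And>t. norm t \<ge> \<delta> \<Longrightarrow> \<kappa> t = 0"
  shows "continuous_on (S \<times> UNIV) (\<lambda>(s, t). (\<kappa> t :: real) *\<^sub>R g (s, t))"
proof -
  have U: "S \<times> UNIV = S \<times> cball 0 \<delta> \<union> S \<times> {t :: 'a. \<delta> \<le> norm t}" by auto
  have c1: "continuous_on (S \<times> cball 0 \<delta>) (\<lambda>x. \<kappa> (snd x) *\<^sub>R g x)"
    by (intro continuous_on_scaleR assms(2) continuous_on_compose2[OF assms(3)] continuous_on_snd) auto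
  have c2: "continuous_on (S \<times> {t :: 'a. \<delta> \<le> norm t}) (\<lambda>x. \<kappa> (snd x) *\<^sub>R g x)"
    by (rule continuous_on_eq[of _ "\<lambda>_. 0"]) (use assms(4) in auto)
  have cl: "closed (S \<times> cball (0::'a) \<delta>)" "closed (S \<times> {t :: 'a. \<delta> \<le> norm t})"
    by (intro closed_Times assms(1) closed_cball closed_Collect_le continuous_intros)+
  have "continuous_on (S \<times> UNIV) (\<lambda>x. \<kappa> (snd x) *\<^sub>R g x)"
    unfolding U by (rule continuous_on_closed_Un[OF cl c1 c2])
  then show ?thesis by (simp add: case_prod_beta)
qed

text \<open>The integral of the translate by \<open>\<tau> *\<^sub>R e\<close> does not depend on
  \<tau>; differentiate at \<tau> = 0.\<close>

lemma integral_derivative_zero: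
  fixes \<phi> :: "'a::euclidean_space \<Rightarrow> complex"
  assumes d: "\<And>t. ((\<lambda>\<tau>. \<phi> (t + \<tau> *\<^sub>R e)) has_vector_derivative \<phi>' t) (at 0)"
    and c: "continuous_on UNIV \<phi>" "continuous_on UNIV \<phi>'"
    and z: "\<And>t. norm t \<ge> \<delta> \<Longrightarrow> \<phi> t = 0"
  shows "(LINT t|lborel. \<phi>' t) = 0"
proof -
  \<comment> \<open>The margin \<open>norm e\<close> keeps the supports of all translates with
    \<tau> between -1 and 1 in one box.\<close>
  obtain a where a: "cball (0::'a) (\<delta> + norm e) \<subseteq> cbox (- a) a"
    using bounded_subset_cbox_symmetric[OF bounded_cball] by blast
  have tr: "(LINT t|lborel. \<phi> (t + \<tau> *\<^sub>R e)) = (LINT t|lborel. \<phi> t)" for \<tau>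
  proof -
    have m: "\<phi> \<in> borel_measurable borel" by (rule borel_measurable_continuous_onI[OF c(1)])
    have "(LINT t|distr lborel borel ((+) (\<tau> *\<^sub>R e)). \<phi> t) = (LINT t|lborel. \<phi> (\<tau> *\<^sub>R e + t))"
      by (rule integral_distr) (use m in auto)
    then show ?thesis by (simp add: lborel_distr_plus add.commute)
  qed
  have out: "\<phi> (t + \<tau> *\<^sub>R e) = 0" if "\<bar>\<tau>\<bar> \<le> 1" "t \<notin> cbox (- a) a" for t \<tau>
  proof (rule z)
    have "norm t > \<delta> + norm e" using a that(2) by (metis mem_cball_0 not_le subsetD)
    moreover have "norm t \<le> norm (t + \<tau> *\<^sub>R e) + norm (\<tau> *\<^sub>R e)" using norm_triangle_ineq4[of "t + \<tau> *\<^sub>R e" "\<tau> *\<^sub>R e"] by simp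
    moreover have "norm (\<tau> *\<^sub>R e) \<le> 1 * norm e" unfolding norm_scaleR using that(1) by (intro mult_right_mono) auto
    ultimately show "\<delta> \<le> norm (t + \<tau> *\<^sub>R e)" by linarith
  qed
  have dd: "((\<lambda>\<tau>. \<phi> (t + \<tau> *\<^sub>R e)) has_vector_derivative \<phi>' (t + \<tau>0 *\<^sub>R e)) (at \<tau>0 within B)" for t \<tau>0 B
  proof -
    have sh: "((\<lambda>\<tau>. \<tau> - \<tau>0) has_vector_derivative 1) (at \<tau>0)" by (auto intro!: derivative_eq_intros)
    have "((\<lambda>\<tau>. \<phi> ((t + \<tau>0 *\<^sub>R e) + \<tau> *\<^sub>R e)) has_vector_derivative \<phi>' (t + \<tau>0 *\<^sub>R e)) (at (\<tau>0 - \<tau>0))"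
      using d[of "t + \<tau>0 *\<^sub>R e"] by simp
    from vector_diff_chain_at[OF sh this]
    have "((\<lambda>\<tau>. \<phi> (t + \<tau> *\<^sub>R e)) has_vector_derivative \<phi>' (t + \<tau>0 *\<^sub>R e)) (at \<tau>0)"
      by (simp add: o_def algebra_simps)
    then show ?thesis by (rule has_vector_derivative_at_within)
  qed
  let ?B = "{-1..1::real}"
  have cc: "continuous_on X (\<lambda>t. g (t + \<tau> *\<^sub>R e))" if "continuous_on UNIV g" for g :: "'a \<Rightarrow> complex" and X \<tau>
    by (rule continuous_on_compose2[OF that]) (auto intro!: continuous_intros)
  have I: "integral (cbox (-a) a) (\<lambda>t. \<phi> (t + \<tau> *\<^sub>R e)) = (LINT t|lborel. \<phi> t)" if "\<tau> \<in> ?B" for \<tau>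
    unfolding tr[of \<tau>, symmetric]
    by (rule compact_support_integral(2)[OF cc[OF c(1)]]) (use out[of \<tau>] that in auto)
  have "((\<lambda>\<tau>. integral (cbox (-a) a) (\<lambda>t. \<phi> (t + \<tau> *\<^sub>R e))) has_vector_derivative
     integral (cbox (-a) a) (\<lambda>t. \<phi>' (t + 0 *\<^sub>R e))) (at 0 within ?B)"
  proof (rule leibniz_rule_vector_derivative[OF dd])
    show "(\<lambda>t. \<phi> (t + \<tau> *\<^sub>R e)) integrable_on cbox (- a) a" for \<tau> by (intro integrable_continuous cc c)
    show "continuous_on (?B \<times> cbox (- a) a) (\<lambda>(\<tau>, t). \<phi>' (t + \<tau> *\<^sub>R e))"
      unfolding case_prod_beta by (rule continuous_on_compose2[OF c(2)]) (auto intro!: continuous_intros)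
  qed auto
  moreover have "((\<lambda>\<tau>. integral (cbox (-a) a) (\<lambda>t. \<phi> (t + \<tau> *\<^sub>R e))) has_vector_derivative 0) (at 0 within ?B)"
    by (rule has_vector_derivative_transform[OF _ _ has_vector_derivative_const[of "LINT t|lborel. \<phi> t"]]) (use I in auto)
  moreover have "at (0::real) within ?B \<noteq> bot"
  proof -
    have "(0::real) islimpt {-1..1}" by (simp add: islimpt_Icc)
    then show ?thesis by (simp add: trivial_limit_within)
  qed
  ultimately have "integral (cbox (-a) a) (\<lambda>t. \<phi>' (t + 0 *\<^sub>R e)) = 0"
    using vector_derivative_unique_within by blast
  moreover have "integral (cbox (-a) a) \<phi>' = (LINT t|lborel. \<phi>' t)"
  proof (rule compact_support_integral(2))
    show "continuous_on (cbox (- a) a) \<phi>'" using c(2) continuous_on_subset by blast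
    fix t assume t: "t \<notin> cbox (- a) a"
    have "((\<lambda>\<tau>. \<phi> (t + \<tau> *\<^sub>R e)) has_vector_derivative 0) (at 0 within ?B)"
      by (rule has_vector_derivative_transform[OF _ _ has_vector_derivative_const[of 0]]) (use out t in auto)
    moreover have "((\<lambda>\<tau>. \<phi> (t + \<tau> *\<^sub>R e)) has_vector_derivative \<phi>' t) (at 0 within ?B)"
      using dd[of t 0] by simp
    ultimately show "\<phi>' t = 0" using vector_derivative_unique_within \<open>at (0::real) within ?B \<noteq> bot\<close> by blast
  qed
  ultimately show ?thesis by simp
qed

text \<open>Stokes' formula in coordinates. Each derivative of \<open>cut\<close> times
  \<open>w k\<close> along \<open>e k\<close> integrates to zero; subtracting these from the
  s-derivative of the cut-off integral leaves exactly the expression bounded by M. Its two parts are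
  the defect of closedness and the terms in which the cut-off is differentiated.\<close>

lemma homotopy_integral_bound:
  fixes u :: "real \<times> 'a::euclidean_space \<Rightarrow> complex" and w :: "'k::finite \<Rightarrow> real \<times> 'a \<Rightarrow> complex"
  assumes S: "open S" "{0..1} \<times> cball 0 \<delta> \<subseteq> S" and \<delta>: "\<delta> > 0"
    and u: "smooth_on S u" "\<And>k. smooth_on S (w k)"
    and bd: "\<And>s t. s \<in> {0..1} \<Longrightarrow> norm t \<le> \<delta> \<Longrightarrow>
      norm (cut \<delta> t *\<^sub>R (dd (1, 0) u (s, t) - (\<Sum>k\<in>UNIV. dd (0, e k) (w k) (s, t)))
        - (\<Sum>k\<in>UNIV. cut' \<delta> (e k) t *\<^sub>R w k (s, t))) \<le> M"
    and box: "cball 0 \<delta> \<subseteq> cbox a (b :: 'a)"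
  shows "norm ((LINT t|lborel. cut \<delta> t *\<^sub>R u (1, t)) - (LINT t|lborel. cut \<delta> t *\<^sub>R u (0, t))) \<le> M * measure lborel (cbox a b)"
proof -
  have M: "M \<ge> 0" by (rule order_trans[OF norm_ge_zero bd[of 0 0]]) (use \<delta> in auto)
  have cs: "continuous_on ({0..1} \<times> UNIV) (\<lambda>(s, t). (\<kappa> t :: real) *\<^sub>R g (s, t))"
    if "smooth_on S g" "continuous_on UNIV \<kappa>" "\<And>t. norm t \<ge> \<delta> \<Longrightarrow> \<kappa> t = 0" for g :: "real \<times> 'a \<Rightarrow> complex" and \<kappa>
    by (rule continuous_on_cutoff[OF _ continuous_on_subset[OF smooth_on_continuous[OF that(1)] S(2)] that(2,3)]) auto
  have cs1: "continuous_on X (\<lambda>t. (\<kappa> t :: real) *\<^sub>R g (s, t))"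
    if "smooth_on S g" "continuous_on UNIV \<kappa>" "\<And>t. norm t \<ge> \<delta> \<Longrightarrow> \<kappa> t = 0" "s \<in> {0..1}" for g :: "real \<times> 'a \<Rightarrow> complex" and \<kappa> s X
  proof -
    have "continuous_on X (\<lambda>t. (\<lambda>(s, t). \<kappa> t *\<^sub>R g (s, t)) (s, t))"
      by (rule continuous_on_compose2[OF cs[OF that(1-3)]]) (use that(4) in \<open>auto intro!: continuous_on_Pair continuous_on_const continuous_on_id\<close>)
    then show ?thesis by simp
  qed
  have out: "norm t \<ge> \<delta>" if "t \<notin> cbox a b" for t using that box by (meson linorder_le_cases mem_cball_0 subsetD)
  note co = cut_outside[OF \<delta>]
  have L: "(LINT t|lborel. cut \<delta> t *\<^sub>R g (s, t)) = integral (cbox a b) (\<lambda>t. cut \<delta> t *\<^sub>R g (s, t))"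
    "(LINT t|lborel. cut' \<delta> v t *\<^sub>R g (s, t)) = integral (cbox a b) (\<lambda>t. cut' \<delta> v t *\<^sub>R g (s, t))"
    "integrable lborel (\<lambda>t. cut \<delta> t *\<^sub>R g (s, t))" "integrable lborel (\<lambda>t. cut' \<delta> v t *\<^sub>R g (s, t))"
    if "smooth_on S g" "s \<in> {0..1}" for g :: "real \<times> 'a \<Rightarrow> complex" and s v
  proof -
    have z: "cut \<delta> t *\<^sub>R g (s, t) = 0" "cut' \<delta> v t *\<^sub>R g (s, t) = 0" if "t \<notin> cbox a b" for t
      using co[OF out[OF that]] by simp_all
    note c = compact_support_integral[OF cs1[OF that(1) cut_continuous co(1) that(2)] z(1)]
      compact_support_integral[OF cs1[OF that(1) cut'_continuous co(2) that(2)] z(2)]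
    show "(LINT t|lborel. cut \<delta> t *\<^sub>R g (s, t)) = integral (cbox a b) (\<lambda>t. cut \<delta> t *\<^sub>R g (s, t))"
      "(LINT t|lborel. cut' \<delta> v t *\<^sub>R g (s, t)) = integral (cbox a b) (\<lambda>t. cut' \<delta> v t *\<^sub>R g (s, t))"
      "integrable lborel (\<lambda>t. cut \<delta> t *\<^sub>R g (s, t))" "integrable lborel (\<lambda>t. cut' \<delta> v t *\<^sub>R g (s, t))"
      using c by auto
  qed
  have dfs: "((\<lambda>s. g (s, t)) has_vector_derivative dd (1, 0) g (s, t)) (at s within {0..1})"
    if "smooth_on S g" "s \<in> {0..1}" "norm t \<le> \<delta>" for g :: "real \<times> 'a \<Rightarrow> complex" and s t
  proof -
    have "(s, t) \<in> S" using S(2) that(2,3) by auto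
    then have "((\<lambda>s. g ((0, t) + s *\<^sub>R (1, 0))) has_vector_derivative dd (1, 0) g ((0, t) + s *\<^sub>R (1, 0))) (at s within {0..1})"
      by (intro has_vector_derivative_line smooth_on_diff[OF that(1)]) simp
    then show ?thesis by simp
  qed
  have der: "((\<lambda>s. integral (cbox a b) (\<lambda>t. cut \<delta> t *\<^sub>R u (s, t))) has_vector_derivative
      integral (cbox a b) (\<lambda>t. cut \<delta> t *\<^sub>R dd (1, 0) u (s, t))) (at s within {0..1})" if s: "s \<in> {0..1}" for s
  proof (rule leibniz_rule_vector_derivative)
    fix s :: real and t :: 'a assume st: "s \<in> {0..1}"
    show "((\<lambda>s. cut \<delta> t *\<^sub>R u (s, t)) has_vector_derivative cut \<delta> t *\<^sub>R dd (1, 0) u (s, t)) (at s within {0..1})"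
    proof (cases "norm t \<le> \<delta>")
      case True
      then show ?thesis using dfs[OF u(1) st True] bounded_linear.has_vector_derivative[OF bounded_linear_scaleR_right] by blast
    next
      case False
      then show ?thesis using co(1)[of t] by simp
    qed
    show "(\<lambda>t. cut \<delta> t *\<^sub>R u (s, t)) integrable_on cbox a b"
      by (intro integrable_continuous cs1[OF u(1) cut_continuous co(1)] st)
  next
    show "continuous_on ({0..1} \<times> cbox a b) (\<lambda>(s, t). cut \<delta> t *\<^sub>R dd (1, 0) u (s, t))"
      by (rule continuous_on_subset[OF cs[OF smooth_on_dd[OF u(1)] cut_continuous co(1)]]) auto
  qed (use s in auto)
  have div: "(LINT t|lborel. cut \<delta> t *\<^sub>R dd (0, e k) (w k) (s, t) + cut' \<delta> (e k) t *\<^sub>R w k (s, t)) = 0" if s: "s \<in> {0..1}" for k s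
  proof (rule integral_derivative_zero[where \<phi>="\<lambda>t. cut \<delta> t *\<^sub>R w k (s, t)" and e="e k" and \<delta>=\<delta>])
    fix t
    show "((\<lambda>\<tau>. cut \<delta> (t + \<tau> *\<^sub>R e k) *\<^sub>R w k (s, t + \<tau> *\<^sub>R e k)) has_vector_derivative
        cut \<delta> t *\<^sub>R dd (0, e k) (w k) (s, t) + cut' \<delta> (e k) t *\<^sub>R w k (s, t)) (at 0)"
    proof (cases "norm t \<le> \<delta>")
      case True
      have st: "(s, t) \<in> S" using S(2) s True by auto
      have "((\<lambda>\<tau>. w k ((s, t) + \<tau> *\<^sub>R (0, e k))) has_vector_derivative dd (0, e k) (w k) ((s, t) + 0 *\<^sub>R (0, e k))) (at 0)"
        by (rule has_vector_derivative_line) (use smooth_on_diff[OF u(2) st] in simp)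
      then have 1: "((\<lambda>\<tau>. w k (s, t + \<tau> *\<^sub>R e k)) has_vector_derivative dd (0, e k) (w k) (s, t)) (at 0)" by simp
      have dc: "cut \<delta> differentiable at (t + 0 *\<^sub>R e k)" using has_derivative_cut differentiable_def by blast
      have "((\<lambda>\<tau>. cut \<delta> (t + \<tau> *\<^sub>R e k)) has_vector_derivative dd (e k) (cut \<delta>) (t + 0 *\<^sub>R e k)) (at 0)"
        by (rule has_vector_derivative_line[OF dc])
      then have 2: "((\<lambda>\<tau>. cut \<delta> (t + \<tau> *\<^sub>R e k)) has_vector_derivative cut' \<delta> (e k) t) (at 0)"
        by (simp add: dd_eqI[OF has_derivative_cut])
      show ?thesis
        using bounded_bilinear.has_vector_derivative[OF bounded_bilinear_scaleR 2 1] by simp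
    next
      case False
      have "((\<lambda>\<tau>. cut \<delta> (t + \<tau> *\<^sub>R e k) *\<^sub>R w k (s, t + \<tau> *\<^sub>R e k)) has_vector_derivative 0) (at 0)"
      proof (rule has_vector_derivative_transform_within_open[OF has_vector_derivative_const[of 0]])
        show "open ((\<lambda>\<tau>. t + \<tau> *\<^sub>R e k) -` {x. norm x > \<delta>})"
          by (intro open_vimage open_Collect_less continuous_intros)
        show "0 = cut \<delta> (t + \<tau> *\<^sub>R e k) *\<^sub>R w k (s, t + \<tau> *\<^sub>R e k)" if "\<tau> \<in> (\<lambda>\<tau>. t + \<tau> *\<^sub>R e k) -` {x. norm x > \<delta>}" for \<tau>
          using that co(1)[of "t + \<tau> *\<^sub>R e k"] by simp
      qed (use False in simp)
      then show ?thesis using co[of t] False by simp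
    qed
  next
    show "continuous_on UNIV (\<lambda>t. cut \<delta> t *\<^sub>R w k (s, t))" by (rule cs1[OF u(2) cut_continuous co(1) s])
    show "continuous_on UNIV (\<lambda>t. cut \<delta> t *\<^sub>R dd (0, e k) (w k) (s, t) + cut' \<delta> (e k) t *\<^sub>R w k (s, t))"
      by (intro continuous_on_add cs1[OF u(2) cut'_continuous co(2) s] cs1[OF smooth_on_dd[OF u(2)] cut_continuous co(1) s])
    show "cut \<delta> t *\<^sub>R w k (s, t) = 0" if "\<delta> \<le> norm t" for t using co(1)[OF that] by simp
  qed
  have main: "norm (integral (cbox a b) (\<lambda>t. cut \<delta> t *\<^sub>R dd (1, 0) u (s, t))) \<le> M * measure lborel (cbox a b)"
    if s: "s \<in> {0..1}" for s
  proof -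
    let ?r = "\<lambda>t. cut \<delta> t *\<^sub>R (dd (1, 0) u (s, t) - (\<Sum>k\<in>UNIV. dd (0, e k) (w k) (s, t)))
        - (\<Sum>k\<in>UNIV. cut' \<delta> (e k) t *\<^sub>R w k (s, t))"
    have req: "?r t = cut \<delta> t *\<^sub>R dd (1, 0) u (s, t) - (\<Sum>k\<in>UNIV. cut \<delta> t *\<^sub>R dd (0, e k) (w k) (s, t) + cut' \<delta> (e k) t *\<^sub>R w k (s, t))" for t
      by (simp add: sum.distrib scaleR_sum_right scaleR_diff_right)
    have i1: "integrable lborel (\<lambda>t. cut \<delta> t *\<^sub>R dd (1, 0) u (s, t))" by (rule L(3)[OF smooth_on_dd[OF u(1)] s])
    have i2: "integrable lborel (\<lambda>t. cut \<delta> t *\<^sub>R dd (0, e k) (w k) (s, t) + cut' \<delta> (e k) t *\<^sub>R w k (s, t))" for k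
      by (intro Bochner_Integration.integrable_add L(3)[OF smooth_on_dd[OF u(2)] s] L(4)[OF u(2) s])
    have "(LINT t|lborel. ?r t) = (LINT t|lborel. cut \<delta> t *\<^sub>R dd (1, 0) u (s, t))
       - (\<Sum>k\<in>UNIV. LINT t|lborel. cut \<delta> t *\<^sub>R dd (0, e k) (w k) (s, t) + cut' \<delta> (e k) t *\<^sub>R w k (s, t))"
      unfolding req using i1 i2 by (simp add: Bochner_Integration.integral_diff Bochner_Integration.integral_sum)
    then have "integral (cbox a b) (\<lambda>t. cut \<delta> t *\<^sub>R dd (1, 0) u (s, t)) = (LINT t|lborel. ?r t)"
      unfolding div[OF s] using L(1)[OF smooth_on_dd[OF u(1)] s] by simp
    also have "(LINT t|lborel. ?r t) = integral (cbox a b) ?r"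
    proof (rule compact_support_integral(2)[symmetric])
      show "continuous_on (cbox a b) ?r" unfolding req
        by (intro continuous_on_diff continuous_on_sum continuous_on_add cs1[OF u(2) cut'_continuous co(2) s] cs1[OF smooth_on_dd[OF u(2)] cut_continuous co(1) s]
             cs1[OF smooth_on_dd[OF u(1)] cut_continuous co(1) s])
      show "?r t = 0" if "t \<notin> cbox a b" for t using co[OF out[OF that]] by simp
    qed
    also have "norm \<dots> \<le> M * measure lborel (cbox a b)"
    proof (rule has_integral_bound[OF M integrable_integral])
      show "?r integrable_on cbox a b"
        unfolding req by (intro integrable_continuous continuous_on_diff continuous_on_sum continuous_on_add cs1[OF u(2) cut'_continuous co(2) s] cs1[OF smooth_on_dd[OF u(2)] cut_continuous co(1) s]
             cs1[OF smooth_on_dd[OF u(1)] cut_continuous co(1) s])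
      show "norm (?r t) \<le> M" if "t \<in> cbox a b" for t
      proof (cases "norm t \<le> \<delta>")
        case True show ?thesis by (rule bd[OF s True])
      next
        case False then show ?thesis using co[of t] M by simp
      qed
    qed
    finally show ?thesis .
  qed
  let ?F = "\<lambda>s. integral (cbox a b) (\<lambda>t. cut \<delta> t *\<^sub>R u (s, t))"
  let ?F' = "\<lambda>s. integral (cbox a b) (\<lambda>t. cut \<delta> t *\<^sub>R dd (1, 0) u (s, t))"
  have "norm (?F 1 - ?F 0) \<le> (M * measure lborel (cbox a b)) * norm (1 - (0::real))"
  proof (rule differentiable_bound[of "{0..1}" ?F "\<lambda>s d. d *\<^sub>R ?F' s"])
    show "(?F has_derivative (\<lambda>d. d *\<^sub>R ?F' s)) (at s within {0..1})" if "s \<in> {0..1}" for s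
      using der[OF that] unfolding has_vector_derivative_def .
    show "onorm (\<lambda>d. d *\<^sub>R ?F' s) \<le> M * measure lborel (cbox a b)" if "s \<in> {0..1}" for s
      by (rule onorm_bound) (use M main[OF that] in \<open>auto simp: mult.commute intro!: mult_left_mono\<close>)
  qed auto
  then show ?thesis using L(1)[OF u(1)] by simp
qed

section \<open>Invariance of the contour integral under deformation\<close>

lemma power_le_fact_exp:
  fixes x :: real
  assumes "x \<ge> 0"
  shows "x ^ M \<le> fact M * exp x"
proof -
  have s: "(\<lambda>n. x ^ n /\<^sub>R fact n) sums exp x" by (rule exp_converges)
  have "(\<Sum>n\<in>{M}. x ^ n /\<^sub>R fact n) \<le> (\<Sum>n. x ^ n /\<^sub>R fact n)"
    by (rule sum_le_suminf) (use s assms in \<open>auto simp: sums_iff\<close>)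
  then have "x ^ M / fact M \<le> exp x" using s by (simp add: sums_iff divide_inverse mult.commute)
  then show ?thesis by (simp add: divide_le_eq mult.commute)
qed

text \<open>With \<open>u\<close> the squared distance to the base point, vanishing of order
  \<open>2 * M\<close> there is worth the power M of \<open>h\<close>. With \<open>u = 1\<close> it
  turns exponential smallness into a power of \<open>h\<close>.\<close>

lemma power_exp_bound:
  fixes u c h :: real
  assumes "u \<ge> 0" "c > 0" "h > 0"
  shows "u ^ M * exp (- (c * u / h)) \<le> fact M / c ^ M * h ^ M"
proof -
  have "(c * u / h) ^ M \<le> fact M * exp (c * u / h)" by (rule power_le_fact_exp) (use assms in auto)
  then have "(c * u / h) ^ M * exp (- (c * u / h)) \<le> fact M * exp (c * u / h) * exp (- (c * u / h))"
    by (rule mult_right_mono) simp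
  also have "\<dots> = fact M" by (simp add: exp_minus)
  finally have "c ^ M * u ^ M / h ^ M * exp (- (c * u / h)) \<le> fact M" by (simp add: power_divide power_mult_distrib)
  moreover have gen: "b * e \<le> F / a * d" if "a * b / d * e \<le> F" "a > 0" "d > 0" for a b d e F :: real
    using that by (simp add: field_simps)
  moreover have "c ^ M > 0" "h ^ M > 0" using assms by simp_all
  ultimately show ?thesis by blast
qed

section \<open>The anti-diagonal, and the phase based at its points\<close>

definition adiag :: "complex^'n \<Rightarrow> 'n::finite cpair" where
  "adiag y = (y, vconj y)"

lemma fst_adiag [simp]: "fst (adiag y) = y" and snd_adiag [simp]: "snd (adiag y) = vconj y"
  and rho_adiag [simp]: "rho (adiag y) = 0"
  by (simp_all add: adiag_def)

lemma bounded_linear_adiag: "bounded_linear adiag"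
  unfolding adiag_def by (intro bounded_linear_Pair bounded_linear_ident bounded_linear_vconj)

lemma open_bidisc [simp]: "open (bidisc x0 r)"
  unfolding bidisc_def by (intro open_Times open_ball)

lemma mem_bidisc: "p \<in> bidisc x0 r \<longleftrightarrow> norm (fst p - x0) < r \<and> norm (snd p - vconj x0) < r"
  unfolding bidisc_def by (cases p) (auto simp: dist_norm norm_minus_commute)

lemma norm_vconj_diff: "norm (vconj x - vconj y) = norm (x - y)"
  by (metis norm_vconj vconj_diff)

lemma bidisc_mixed:
  assumes "q \<in> bidisc x0 r" "y \<in> ball x0 r"
  shows "(fst q, vconj y) \<in> bidisc x0 r" "(y, snd q) \<in> bidisc x0 r" "adiag y \<in> bidisc x0 r"
  using assms unfolding mem_bidisc by (auto simp: norm_vconj_diff dist_norm norm_minus_commute)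

lemma phase_adiag:
  "phase \<Psi> (adiag y) q = \<Psi> q - \<Psi> (fst q, vconj y) - \<Psi> (y, snd q) + \<Psi> (adiag y)"
  unfolding adiag_def by (cases q) simp

lemma smooth_on_mixed:
  assumes "smooth_on (bidisc x0 r) \<Psi>" "y \<in> ball x0 r"
  shows "smooth_on (bidisc x0 r) (\<lambda>q. \<Psi> (fst q, vconj y))" "smooth_on (bidisc x0 r) (\<lambda>q. \<Psi> (y, snd q))"
proof -
  show "smooth_on (bidisc x0 r) (\<lambda>q. \<Psi> (fst q, vconj y))"
    by (rule smooth_on_compose[OF open_bidisc open_bidisc smooth_on_Pair[OF open_bidisc smooth_on_linear[OF bounded_linear_fst] smooth_on_const] assms(1)])
       (rule image_subsetI, erule bidisc_mixed(1)[OF _ assms(2)])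
  show "smooth_on (bidisc x0 r) (\<lambda>q. \<Psi> (y, snd q))"
    by (rule smooth_on_compose[OF open_bidisc open_bidisc smooth_on_Pair[OF open_bidisc smooth_on_const smooth_on_linear[OF bounded_linear_snd]] assms(1)])
       (rule image_subsetI, erule bidisc_mixed(2)[OF _ assms(2)])
qed

lemma smooth_on_phase:
  assumes "smooth_on (bidisc x0 r) \<Psi>" "y \<in> ball x0 r"
  shows "smooth_on (bidisc x0 r) (phase \<Psi> (adiag y))"
proof -
  have "smooth_on (bidisc x0 r) (\<lambda>q. \<Psi> q - \<Psi> (fst q, vconj y) - \<Psi> (y, snd q) + \<Psi> (adiag y))"
    by (rule smooth_on_add[OF open_bidisc smooth_on_sub[OF open_bidisc smooth_on_sub[OF open_bidisc
          assms(1) smooth_on_mixed(1)[OF assms]] smooth_on_mixed(2)[OF assms]] smooth_on_const])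
  then show ?thesis by (rule smooth_on_cong[OF open_bidisc]) (simp add: phase_adiag)
qed

text \<open>The two terms of the phase with a frozen argument depend on one group of variables each,
  so in every coordinate exactly one of them contributes. The result is a difference of two values
  of the flat function \<open>dzb i \<Psi>\<close>.\<close>

lemma dzb_phase:
  assumes "smooth_on (bidisc x0 r) \<Psi>" "y \<in> ball x0 r" "q \<in> bidisc x0 r"
  shows "dzb i (phase \<Psi> (adiag y)) q =
    dzb i \<Psi> q - (case i of Inl _ \<Rightarrow> dzb i \<Psi> (fst q, vconj y) | Inr _ \<Rightarrow> dzb i \<Psi> (y, snd q))"
proof -
  let ?W = "bidisc x0 r"
  note mx = bidisc_mixed[OF assms(3,2)]
  have d: "\<Psi> differentiable at p" if "p \<in> ?W" for p using smooth_on_diff[OF assms(1) that] .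
  have D1: "((\<lambda>q. \<Psi> (fst q, vconj y)) has_derivative (\<lambda>v. dd (fst v, 0) \<Psi> (fst q, vconj y))) (at q)"
  proof -
    have "((\<lambda>q. (fst q, vconj y)) has_derivative (\<lambda>v. (fst v, 0))) (at q)"
      by (auto intro!: derivative_eq_intros)
    from diff_chain_at[OF this has_derivative_dd[OF d[OF mx(1)]]] show ?thesis by (simp add: o_def)
  qed
  have D2: "((\<lambda>q. \<Psi> (y, snd q)) has_derivative (\<lambda>v. dd (0, snd v) \<Psi> (y, snd q))) (at q)"
  proof -
    have "((\<lambda>q. (y, snd q)) has_derivative (\<lambda>v. (0, snd v))) (at q)"
      by (auto intro!: derivative_eq_intros)
    from diff_chain_at[OF this has_derivative_dd[OF d[OF mx(2)]]] show ?thesis by (simp add: o_def)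
  qed
  have D: "dd v (phase \<Psi> (adiag y)) q = dd v \<Psi> q - dd (fst v, 0) \<Psi> (fst q, vconj y) - dd (0, snd v) \<Psi> (y, snd q)" for v
  proof (rule dd_eqI)
    have "((\<lambda>q. \<Psi> q - \<Psi> (fst q, vconj y) - \<Psi> (y, snd q) + \<Psi> (adiag y)) has_derivative
      (\<lambda>v. dd v \<Psi> q - dd (fst v, 0) \<Psi> (fst q, vconj y) - dd (0, snd v) \<Psi> (y, snd q) + 0)) (at q)"
      by (intro has_derivative_add has_derivative_diff D1 D2 has_derivative_dd d assms has_derivative_const)
    then show "(phase \<Psi> (adiag y) has_derivative
      (\<lambda>v. dd v \<Psi> q - dd (fst v, 0) \<Psi> (fst q, vconj y) - dd (0, snd v) \<Psi> (y, snd q))) (at q)"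
      unfolding phase_adiag[abs_def] by simp
  qed
  have z: "dd (0, 0) \<Psi> p = 0" if "p \<in> ?W" for p
    using linear_0[OF linear_dd[OF d[OF that]]] by (simp add: zero_prod_def)
  show ?thesis
    unfolding dzb_def D by (cases i) (simp_all add: cbas_def z mx field_simps)
qed

lemma dzb_exp_mult:
  assumes "g differentiable at q" "b differentiable at q"
  shows "dzb i (\<lambda>q. exp (c * g q) * b q) q = exp (c * g q) * (c * dzb i g q * b q + dzb i b q)"
proof -
  have d1: "(\<lambda>q. c * g q) differentiable at q" using assms(1) by simp
  have d2: "(\<lambda>q. exp (c * g q)) differentiable at q" by (rule differentiable_cexp[OF d1])
  have cg: "dd v (\<lambda>q. c * g q) q = c * dd v g q" for v
    by (rule dd_linear_comp[OF bounded_linear_mult_right assms(1)])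
  have D: "dd v (\<lambda>q. exp (c * g q) * b q) q = exp (c * g q) * dd v b q + exp (c * g q) * (c * dd v g q) * b q" for v
    unfolding dd_bilinear[OF bounded_bilinear_mult d2 assms(2)] dd_exp[OF d1] cg ..
  show ?thesis unfolding dzb_def D by (simp add: field_simps)
qed

section \<open>Uniform bounds on compact sets\<close>

lemma compact_pos_lower_bound:
  fixes f :: "'a::topological_space \<Rightarrow> real"
  assumes "compact Z" "continuous_on Z f" "\<And>z. z \<in> Z \<Longrightarrow> f z > 0"
  obtains \<mu> where "\<mu> > 0" "\<And>z. z \<in> Z \<Longrightarrow> f z \<ge> \<mu>"
proof (cases "Z = {}")
  case True then show ?thesis using that[of 1] by simp
next
  case False
  from continuous_attains_inf[OF assms(1) False assms(2)] obtain z where "z \<in> Z" "\<forall>y\<in>Z. f z \<le> f y" by blast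
  then show ?thesis using that[of "f z"] assms(3) by simp
qed

lemma compact_norm_bound:
  fixes f :: "'a::topological_space \<Rightarrow> 'b::real_normed_vector"
  assumes "compact Z" "continuous_on Z f"
  obtains B where "B > 0" "\<And>z. z \<in> Z \<Longrightarrow> norm (f z) \<le> B"
proof -
  have "bounded (f ` Z)" using assms by (meson compact_continuous_image compact_imp_bounded)
  then obtain B where "\<And>z. z \<in> Z \<Longrightarrow> norm (f z) \<le> B" unfolding bounded_iff by auto
  then have "norm (f z) \<le> max B 1" if "z \<in> Z" for z using that by (meson max.coboundedI1)
  then show ?thesis using that[of "max B 1"] by simp
qed

lemma compact_norm_bound_finite:
  fixes f :: "'i::finite \<Rightarrow> 'a::topological_space \<Rightarrow> 'b::real_normed_vector"
  assumes "compact Z" "\<And>i. continuous_on Z (f i)"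
  obtains B where "B > 0" "\<And>i z. z \<in> Z \<Longrightarrow> norm (f i z) \<le> B"
proof -
  have "\<forall>i. \<exists>B>0. \<forall>z\<in>Z. norm (f i z) \<le> B" using compact_norm_bound[OF assms] by metis
  then obtain B where B: "\<And>i. B i > 0" "\<And>i z. z \<in> Z \<Longrightarrow> norm (f i z) \<le> B i" by metis
  have "norm (f i z) \<le> (\<Sum>i\<in>UNIV. B i)" if "z \<in> Z" for i z
    using B(2)[OF that, of i] member_le_sum[of i UNIV B] B(1) by (meson UNIV_I finite less_imp_le order_trans)
  moreover have "(\<Sum>i\<in>UNIV. B i) > 0" using B(1) by (intro sum_pos) auto
  ultimately show ?thesis using that by blast
qed

text \<open>Families of contours are maps of \<open>(s, t, y)\<close>: a deformation parameter \<open>s\<close>, the parameter \<open>t\<close> on the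
  contour, and the base point \<open>y\<close> on the anti-diagonal.\<close>

definition cdir :: "'n::finite + 'n \<Rightarrow> real \<times> (real^('n + 'n)) \<times> (complex^'n)" where
  "cdir k = (0, axis k 1, 0)"

lemma slice_contour:
  fixes \<Gamma> :: "real \<times> (real^('n + 'n)) \<times> (complex^'n) \<Rightarrow> 'n::finite cpair"
  assumes "\<Gamma> differentiable at (s, t, y)"
  shows "dd v (\<lambda>z. \<Gamma> (fst z, snd z, y)) (s, t) = dd (fst v, snd v, 0) \<Gamma> (s, t, y)"
proof (rule dd_eqI)
  have 1: "((\<lambda>z. (fst z, snd z, y)) has_derivative (\<lambda>v. (fst v, snd v, 0))) (at (s, t))"
    by (auto intro!: derivative_eq_intros)
  have 2: "(\<Gamma> has_derivative (\<lambda>v. dd v \<Gamma> (s, t, y))) (at ((\<lambda>z. (fst z, snd z, y)) (s, t)))"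
    using has_derivative_dd[OF assms] by simp
  show "((\<lambda>z. \<Gamma> (fst z, snd z, y)) has_derivative (\<lambda>v. dd (fst v, snd v, 0) \<Gamma> (s, t, y))) (at (s, t))"
    using diff_chain_at[OF 1 2] by (simp only: o_def)
qed

text \<open>Flatness is measured by \<open>rho\<close>, Gaussian decay by the distance to the base
  point. The former is at most twice the latter, at the contour point as well as at the two mixed
  points that occur in the derivative of the phase.\<close>

lemma uniform_flat_estimates:
  fixes \<Gamma> :: "real \<times> (real^('n + 'n)) \<times> (complex^'n) \<Rightarrow> 'n::finite cpair"
  assumes \<Psi>: "AH (bidisc x0 r) \<Psi>" and b: "AH (bidisc x0 r) b"
    and Z: "compact Z" "continuous_on Z \<Gamma>" "\<Gamma> ` Z \<subseteq> bidisc x0 r" "snd ` snd ` Z \<subseteq> ball x0 r"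
  shows "\<exists>C\<ge>0. \<forall>s t y i. (s, t, y) \<in> Z \<longrightarrow>
    norm (dzb i (phase \<Psi> (adiag y)) (\<Gamma> (s, t, y))) \<le> C * norm (\<Gamma> (s, t, y) - adiag y) ^ N \<and>
    norm (dzb i b (\<Gamma> (s, t, y))) \<le> C * norm (\<Gamma> (s, t, y) - adiag y) ^ N"
proof -
  let ?W = "bidisc x0 r"
  \<comment> \<open>The mixed points have to be covered as well; as continuous images of Z all three
    families lie in one compact set, which makes the constants uniform.\<close>
  define K1 where "K1 = (\<lambda>\<zeta>. (fst (\<Gamma> \<zeta>), vconj (snd (snd \<zeta>)))) ` Z"
  define K2 where "K2 = (\<lambda>\<zeta>. (snd (snd \<zeta>), snd (\<Gamma> \<zeta>))) ` Z"
  define K where "K = \<Gamma> ` Z \<union> K1 \<union> K2"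
  have "compact K1" "compact K2" unfolding K1_def K2_def
    by (intro compact_continuous_image Z(1) continuous_intros Z(2) linear_continuous_on_compose[OF _ linear_vconj])+
  moreover have "compact (\<Gamma> ` Z)" using Z by (intro compact_continuous_image)
  ultimately have K: "compact K" unfolding K_def by (intro compact_Un)
  have yb: "y \<in> ball x0 r" if "(s, t, y) \<in> Z" for s t y using Z(4) that by force
  have KW: "K \<subseteq> ?W" unfolding K_def K1_def K2_def
  proof (intro Un_least Z(3) image_subsetI)
    fix \<zeta> assume \<zeta>: "\<zeta> \<in> Z"
    obtain s t y where e: "\<zeta> = (s, t, y)" by (cases \<zeta>)
    have "\<Gamma> \<zeta> \<in> ?W" "y \<in> ball x0 r" using Z(3) \<zeta> yb e by auto
    from bidisc_mixed[OF this] show "(fst (\<Gamma> \<zeta>), vconj (snd (snd \<zeta>))) \<in> ?W" "(snd (snd \<zeta>), snd (\<Gamma> \<zeta>)) \<in> ?W" by (simp_all add: e)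
  qed
  have "\<exists>C\<ge>0. \<forall>p\<in>K. norm (dzb i f p) \<le> C * rho p ^ N" if "AH ?W f" for f i
    using flat_onE[OF AH_dzb[OF that] K KW] by metis
  then obtain C1 C2 where C1: "\<And>i. C1 i \<ge> 0" "\<And>i p. p \<in> K \<Longrightarrow> norm (dzb i \<Psi> p) \<le> C1 i * rho p ^ N"
    and C2: "\<And>i. C2 i \<ge> 0" "\<And>i p. p \<in> K \<Longrightarrow> norm (dzb i b p) \<le> C2 i * rho p ^ N"
    using \<Psi> b by metis
  define C where "C = (\<Sum>i\<in>UNIV. C1 i + C2 i)"
  have Ci: "C1 i \<le> C" "C2 i \<le> C" for i
  proof -
    have "C1 i + C2 i \<le> C" unfolding C_def by (rule member_le_sum) (use C1(1) C2(1) in auto)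
    then show "C1 i \<le> C" "C2 i \<le> C" using C1(1)[of i] C2(1)[of i] by linarith+
  qed
  have C0: "C \<ge> 0" using Ci(1) C1(1) order_trans by blast
  have "norm (dzb i (phase \<Psi> (adiag y)) (\<Gamma> (s, t, y))) \<le> (2 * C * 2 ^ N) * norm (\<Gamma> (s, t, y) - adiag y) ^ N \<and>
    norm (dzb i b (\<Gamma> (s, t, y))) \<le> (2 * C * 2 ^ N) * norm (\<Gamma> (s, t, y) - adiag y) ^ N"
    if z: "(s, t, y) \<in> Z" for s t y i
  proof -
    define q where "q = \<Gamma> (s, t, y)"
    define \<nu> where "\<nu> = norm (q - adiag y)"
    have qW: "q \<in> ?W" using z Z(3) unfolding q_def by auto
    have qK: "q \<in> K" "(fst q, vconj y) \<in> K" "(y, snd q) \<in> K" using z unfolding q_def K_def K1_def K2_def by force+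
    have r0: "rho q \<le> 2 * \<nu>" using rho_le[of "adiag y" "q - adiag y"] unfolding \<nu>_def by simp
    have r1: "rho (fst q, vconj y) \<le> 2 * \<nu>"
    proof -
      have "rho (fst q, vconj y) = norm (fst (q - adiag y))" unfolding rho_def by (simp add: norm_vconj_diff norm_minus_commute)
      also have "\<dots> \<le> \<nu>" unfolding \<nu>_def by (cases "q - adiag y") (simp add: norm_fst_le)
      finally show ?thesis unfolding \<nu>_def using norm_ge_zero[of "q - adiag y"] by linarith
    qed
    have r2: "rho (y, snd q) \<le> 2 * \<nu>"
    proof -
      have "rho (y, snd q) = norm (snd (q - adiag y))" unfolding rho_def by simp
      also have "\<dots> \<le> \<nu>" unfolding \<nu>_def by (cases "q - adiag y") (simp add: norm_snd_le)
      finally show ?thesis unfolding \<nu>_def using norm_ge_zero[of "q - adiag y"] by linarith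
    qed
    have e: "c * rho p ^ N \<le> C * 2 ^ N * \<nu> ^ N" if "rho p \<le> 2 * \<nu>" "c \<le> C" for p c
    proof -
      have "c * rho p ^ N \<le> C * (2 * \<nu>) ^ N"
        by (intro mult_mono that power_mono C0) auto
      then show ?thesis by (simp add: power_mult_distrib)
    qed
    have b1: "norm (dzb i \<Psi> q) \<le> C * 2 ^ N * \<nu> ^ N" by (rule order_trans[OF C1(2)[OF qK(1)] e[OF r0 Ci(1)]])
    have b2: "norm (dzb i \<Psi> (fst q, vconj y)) \<le> C * 2 ^ N * \<nu> ^ N" by (rule order_trans[OF C1(2)[OF qK(2)] e[OF r1 Ci(1)]])
    have b3: "norm (dzb i \<Psi> (y, snd q)) \<le> C * 2 ^ N * \<nu> ^ N" by (rule order_trans[OF C1(2)[OF qK(3)] e[OF r2 Ci(1)]])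
    have b4: "norm (dzb i b q) \<le> C * 2 ^ N * \<nu> ^ N" by (rule order_trans[OF C2(2)[OF qK(1)] e[OF r0 Ci(2)]])
    have nn: "C * 2 ^ N * \<nu> ^ N \<ge> 0" using C0 unfolding \<nu>_def by simp
    have "norm (dzb i (phase \<Psi> (adiag y)) q) \<le> 2 * (C * 2 ^ N * \<nu> ^ N)"
      unfolding dzb_phase[OF AH_smooth[OF \<Psi>] yb[OF z] qW]
      by (rule order_trans[OF norm_triangle_ineq4]) (use b1 b2 b3 in \<open>cases i; simp\<close>)
    then show ?thesis using b4 nn unfolding q_def[symmetric] \<nu>_def[symmetric] by simp
  qed
  then show ?thesis using C0 by (intro exI[of _ "2 * C * 2 ^ N"]) auto
qed

text \<open>The power of \<open>h\<close> in front is left out here, so that errors can be compared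
  without it; it returns in \<open>model_int\<close>.\<close>

definition cut_int :: "('n::finite cpair \<Rightarrow> complex) \<Rightarrow> (real \<times> (real^('n + 'n)) \<times> (complex^'n) \<Rightarrow> 'n cpair) \<Rightarrow>
    real \<Rightarrow> ('n cpair \<Rightarrow> complex) \<Rightarrow> real \<Rightarrow> real \<Rightarrow> complex^'n \<Rightarrow> complex" where
  "cut_int \<Psi> \<Gamma> \<delta> b h s y = (LINT t|lborel. cut \<delta> t *\<^sub>R
     (exp (2 / of_real h * phase \<Psi> (adiag y) (\<Gamma> (s, t, y))) * b (\<Gamma> (s, t, y)) * pull_jac \<Gamma> cdir (s, t, y)))"

text \<open>Where the cut-off is differentiated, the contour keeps a positive distance from its base
  point and the exponential is small beyond all orders. Elsewhere the defect of closedness is flat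
  in this distance, and Gaussian decay turns that into a power of \<open>h\<close>. Compactness in
  s, t and y makes both uniform.\<close>

lemma uniform_stokes:
  fixes \<Gamma> :: "real \<times> (real^('n + 'n)) \<times> (complex^'n) \<Rightarrow> 'n::finite cpair"
  assumes \<Psi>: "AH (bidisc x0 r) \<Psi>" and b: "AH (bidisc x0 r) b"
    and S: "open S" "smooth_on S \<Gamma>" "{0..1} \<times> cball 0 \<delta> \<times> V \<subseteq> S" "\<Gamma> ` S \<subseteq> bidisc x0 r"
    and \<delta>: "\<delta> > 0" and V: "compact V" "V \<subseteq> ball x0 r" and c: "c > 0"
    and ph: "\<And>s t y. s \<in> {0..1} \<Longrightarrow> norm t \<le> \<delta> \<Longrightarrow> y \<in> V \<Longrightarrow>
      Re (phase \<Psi> (adiag y) (\<Gamma> (s, t, y))) \<le> - c * (norm (\<Gamma> (s, t, y) - adiag y))\<^sup>2"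
    and far: "\<And>s t y. s \<in> {0..1} \<Longrightarrow> norm t \<le> \<delta> \<Longrightarrow> y \<in> V \<Longrightarrow> t \<noteq> 0 \<Longrightarrow> \<Gamma> (s, t, y) \<noteq> adiag y"
  shows "\<exists>C. \<forall>h\<in>{0<..1}. \<forall>y\<in>V. norm (cut_int \<Psi> \<Gamma> \<delta> b h 1 y - cut_int \<Psi> \<Gamma> \<delta> b h 0 y) \<le> C * h ^ N"
proof -
  let ?W = "bidisc x0 r"
  let ?Z = "{0..1::real} \<times> cball (0::real^('n+'n)) \<delta> \<times> V"
  let ?e0 = "(1, 0, 0) :: real \<times> (real^('n + 'n)) \<times> (complex^'n)"
  have Zc: "compact ?Z" by (intro compact_Times compact_Icc compact_cball V)
  have c\<Gamma>: "continuous_on ?Z \<Gamma>" by (rule continuous_on_subset[OF smooth_on_continuous[OF S(2)] S(3)])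
  have \<Gamma>W: "\<Gamma> ` ?Z \<subseteq> ?W" using S(3,4) by blast
  have sV: "snd ` snd ` ?Z \<subseteq> ball x0 r" using V(2) by auto
  obtain Cf where Cf: "Cf \<ge> 0" "\<And>s t y i. (s, t, y) \<in> ?Z \<Longrightarrow>
      norm (dzb i (phase \<Psi> (adiag y)) (\<Gamma> (s, t, y))) \<le> Cf * norm (\<Gamma> (s, t, y) - adiag y) ^ (2 * Suc N)"
      "\<And>s t y i. (s, t, y) \<in> ?Z \<Longrightarrow> norm (dzb i b (\<Gamma> (s, t, y))) \<le> Cf * norm (\<Gamma> (s, t, y) - adiag y) ^ (2 * Suc N)"
    using uniform_flat_estimates[OF \<Psi> b Zc c\<Gamma> \<Gamma>W sV, of "2 * Suc N"] by blast
  have cb: "continuous_on ?Z (\<lambda>\<zeta>. b (\<Gamma> \<zeta>))"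
    by (rule continuous_on_compose2[OF smooth_on_continuous[OF AH_smooth[OF b]] c\<Gamma> \<Gamma>W])
  obtain Bb where Bb: "Bb > 0" "\<And>\<zeta>. \<zeta> \<in> ?Z \<Longrightarrow> norm (b (\<Gamma> \<zeta>)) \<le> Bb" by (rule compact_norm_bound[OF Zc cb]) (rule that)
  have cJR: "continuous_on ?Z (pull_jac_repl \<Gamma> cdir ?e0 k)" for k
    by (rule continuous_on_subset[OF smooth_on_continuous[OF smooth_on_pull_jac_repl[OF S(1,2)]] S(3)])
  obtain BR where BR: "BR > 0" "\<And>k \<zeta>. \<zeta> \<in> ?Z \<Longrightarrow> norm (pull_jac_repl \<Gamma> cdir ?e0 k \<zeta>) \<le> BR"
    by (rule compact_norm_bound_finite[OF Zc cJR]) (rule that)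
  define E where "E i \<zeta> = cnj (rv \<Gamma> ?e0 \<zeta> $ i) * pull_jac \<Gamma> cdir \<zeta> - (\<Sum>k\<in>UNIV. cnj (rv \<Gamma> (cdir k) \<zeta> $ i) * pull_jac_repl \<Gamma> cdir ?e0 k \<zeta>)" for i \<zeta>
  have cE: "continuous_on ?Z (E i)" for i
  proof -
    have "continuous_on ?Z (rv \<Gamma> v)" for v
      by (rule continuous_on_subset[OF smooth_on_continuous[OF smooth_on_rv[OF S(1,2)]] S(3)])
    moreover have "continuous_on ?Z (pull_jac \<Gamma> cdir)"
      by (rule continuous_on_subset[OF smooth_on_continuous[OF smooth_on_pull_jac[OF S(1,2)]] S(3)])
    ultimately show ?thesis unfolding E_def[abs_def] by (intro continuous_intros cJR)
  qed
  obtain BE where BE: "BE > 0" "\<And>i \<zeta>. \<zeta> \<in> ?Z \<Longrightarrow> norm (E i \<zeta>) \<le> BE"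
    by (rule compact_norm_bound_finite[OF Zc cE]) (rule that)
  have "\<exists>Bc>0. \<forall>k. \<forall>t\<in>cball 0 \<delta>. norm (cut' \<delta> (axis k (1::real) :: real^('n+'n)) t) \<le> Bc"
  proof (rule compact_norm_bound_finite[where f="\<lambda>k. cut' \<delta> (axis k 1)", OF compact_cball[of "0::real^('n+'n)" \<delta>] cut'_continuous])
    fix B assume "B > 0" and B: "\<And>k t. t \<in> cball 0 \<delta> \<Longrightarrow> norm (cut' \<delta> (axis k (1::real) :: real^('n+'n)) t) \<le> B"
    then show ?thesis by (intro exI[of _ B]) simp
  qed
  then obtain Bc where Bc0: "Bc > 0" "\<forall>k. \<forall>t\<in>cball 0 \<delta>. norm (cut' \<delta> (axis k (1::real) :: real^('n+'n)) t) \<le> Bc"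
    by (elim exE conjE)
  have Bc: "Bc > 0" "\<And>k t. t \<in> cball 0 \<delta> \<Longrightarrow> norm (cut' \<delta> (axis k (1::real) :: real^('n+'n)) t) \<le> Bc"
    using Bc0 by simp_all
  \<comment> \<open>A closed annulus that contains the support of \<open>cut'\<close>; being compact
    and free of t = 0, it yields the lower bound \<mu> for the squared distance to the base
    point.\<close>
  let ?A = "{0..1::real} \<times> (cball (0::real^('n+'n)) \<delta> - ball 0 (\<delta> / 2)) \<times> V"
  have "\<exists>\<mu>>0. \<forall>\<zeta>\<in>?A. (norm (\<Gamma> \<zeta> - adiag (snd (snd \<zeta>))))\<^sup>2 \<ge> \<mu>"
  proof -
    have AZ: "?A \<subseteq> ?Z" by auto
    have ac: "compact ?A" by (intro compact_Times compact_Icc compact_diff compact_cball open_ball V)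
    have ca: "continuous_on ?A (\<lambda>\<zeta>. (norm (\<Gamma> \<zeta> - adiag (snd (snd \<zeta>))))\<^sup>2)"
      by (intro continuous_intros continuous_on_subset[OF c\<Gamma> AZ] linear_continuous_on_compose[OF _ bounded_linear.linear[OF bounded_linear_adiag]])
    have pa: "(norm (\<Gamma> \<zeta> - adiag (snd (snd \<zeta>))))\<^sup>2 > 0" if "\<zeta> \<in> ?A" for \<zeta>
    proof -
      obtain s t y where e: "\<zeta> = (s, t, y)" by (cases \<zeta>)
      have "t \<noteq> 0" using that e \<delta> by auto
      then show ?thesis using far[of s t y] that unfolding e by auto
    qed
    obtain \<mu> where "\<mu> > 0" "\<And>\<zeta>. \<zeta> \<in> ?A \<Longrightarrow> (norm (\<Gamma> \<zeta> - adiag (snd (snd \<zeta>))))\<^sup>2 \<ge> \<mu>"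
      by (rule compact_pos_lower_bound[OF ac ca pa]) (assumption, rule that)
    then show ?thesis by (intro exI[of _ \<mu>] conjI ballI)
  qed
  then obtain \<mu> where \<mu>0: "\<mu> > 0" "\<forall>\<zeta>\<in>?A. \<mu> \<le> (norm (\<Gamma> \<zeta> - adiag (snd (snd \<zeta>))))\<^sup>2"
    by (elim exE conjE)
  have \<mu>: "\<mu> > 0" "\<And>s t y. (s, t, y) \<in> ?A \<Longrightarrow> (norm (\<Gamma> (s, t, y) - adiag y))\<^sup>2 \<ge> \<mu>"
  proof -
    show "\<mu> > 0" by (rule \<mu>0(1))
    show "\<mu> \<le> (norm (\<Gamma> (s, t, y) - adiag y))\<^sup>2" if "(s, t, y) \<in> ?A" for s t y
      using \<mu>0(2)[rule_format, OF that] by simp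
  qed
  define m where "m = real (CARD('n + 'n))"
  define C1 where "C1 = m * (Cf * (2 * Bb + 1) * (fact (Suc N) / (2 * c) ^ Suc N) * BE)"
  define C2 where "C2 = m * (Bc * (Bb * (fact N / (2 * c * \<mu>) ^ N) * BR))"
  obtain a where box: "cball (0 :: real^('n+'n)) \<delta> \<subseteq> cbox (- a) a"
    using bounded_subset_cbox_symmetric[OF bounded_cball] by blast
  have m0: "m \<ge> 0" unfolding m_def by simp
  have main: "norm (cut_int \<Psi> \<Gamma> \<delta> b h 1 y - cut_int \<Psi> \<Gamma> \<delta> b h 0 y) \<le> ((C1 + C2) * h ^ N) * measure lborel (cbox (- a) a)"
    if h: "h \<in> {0<..1}" and y: "y \<in> V" for h y
  proof -
    define f where "f q = exp (2 / of_real h * phase \<Psi> (adiag y) q) * b q" for q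
    have h0: "h > 0" "h \<le> 1" using h by auto
    have yb: "y \<in> ball x0 r" using V(2) y by auto
    have sp: "smooth_on ?W (phase \<Psi> (adiag y))" by (rule smooth_on_phase[OF AH_smooth[OF \<Psi>] yb])
    have sf: "smooth_on ?W f" unfolding f_def[abs_def]
      by (intro smooth_on_mult smooth_on_exp open_bidisc smooth_on_const sp AH_smooth[OF b])
    \<comment> \<open>Stokes' formula is applied for one base point at a time, in the variables s
      and t; the constants were fixed before y was chosen.\<close>
    define \<Gamma>y where "\<Gamma>y z = \<Gamma> (fst z, snd z, y)" for z :: "real \<times> (real^('n + 'n))"
    define Sy where "Sy = (\<lambda>z :: real \<times> (real^('n + 'n)). (fst z, snd z, y)) -` S"
    have oS: "open Sy" unfolding Sy_def by (intro open_vimage S(1) continuous_intros)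
    have sl: "smooth_on UNIV (\<lambda>z :: real \<times> (real^('n + 'n)). (fst z, snd z, y))"
      by (intro smooth_on_Pair smooth_on_const open_UNIV smooth_on_linear bounded_linear_fst bounded_linear_snd)
    have s\<Gamma>y: "smooth_on Sy \<Gamma>y" unfolding \<Gamma>y_def[abs_def]
      by (rule smooth_on_compose[OF oS S(1) smooth_on_subset[OF sl] S(2)]) (auto simp: Sy_def)
    have \<Gamma>yW: "\<Gamma>y ` Sy \<subseteq> ?W" using S(4) by (auto simp: \<Gamma>y_def Sy_def)
    have sub: "{0..1} \<times> cball 0 \<delta> \<subseteq> Sy" using S(3) y by (auto simp: Sy_def)
    define e where "e k = ((0, axis k 1) :: real \<times> (real^('n + 'n)))" for k
    have rvy: "rv \<Gamma>y v (s, t) = rv \<Gamma> (fst v, snd v, 0) (s, t, y)" if "(s, t) \<in> Sy" for v s t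
      using slice_contour[of \<Gamma> s t y v] smooth_on_diff[OF S(2), of "(s, t, y)"] that
      unfolding rv_def \<Gamma>y_def[abs_def] Sy_def by simp
    have JJy: "pull_jac \<Gamma>y e (s, t) = pull_jac \<Gamma> cdir (s, t, y)" if "(s, t) \<in> Sy" for s t
      unfolding pull_jac_def rvy[OF that] by (simp add: e_def cdir_def)
    have JRy: "pull_jac_repl \<Gamma>y e (1, 0) k (s, t) = pull_jac_repl \<Gamma> cdir ?e0 k (s, t, y)" if "(s, t) \<in> Sy" for s t k
      unfolding pull_jac_repl_def rvy[OF that] e_def cdir_def fst_conv snd_conv ..
    define u where "u z = f (\<Gamma>y z) * pull_jac \<Gamma>y e z" for z
    define w where "w k z = f (\<Gamma>y z) * pull_jac_repl \<Gamma>y e (1, 0) k z" for k z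
    have sfG: "smooth_on Sy (\<lambda>z. f (\<Gamma>y z))" by (rule smooth_on_compose[OF oS open_bidisc s\<Gamma>y sf \<Gamma>yW])
    have su: "smooth_on Sy u" "smooth_on Sy (w k)" for k unfolding u_def[abs_def] w_def[abs_def]
      by (intro smooth_on_mult oS sfG smooth_on_pull_jac smooth_on_pull_jac_repl s\<Gamma>y)+
    have bd: "norm (cut \<delta> t *\<^sub>R (dd (1, 0) u (s, t) - (\<Sum>k\<in>UNIV. dd (0, axis k 1) (w k) (s, t)))
        - (\<Sum>k\<in>UNIV. cut' \<delta> (axis k 1) t *\<^sub>R w k (s, t))) \<le> (C1 + C2) * h ^ N"
      if s: "s \<in> {0..1}" and t: "norm t \<le> \<delta>" for s t
    proof -
      have z: "(s, t) \<in> Sy" using sub s t by auto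
      have zZ: "(s, t, y) \<in> ?Z" using s t y by auto
      define q where "q = \<Gamma> (s, t, y)"
      have qy: "\<Gamma>y (s, t) = q" by (simp add: \<Gamma>y_def q_def)
      have qW: "q \<in> ?W" using \<Gamma>W zZ unfolding q_def by blast
      define \<nu> where "\<nu> = norm (q - adiag y)"
      have \<nu>0: "\<nu> \<ge> 0" unfolding \<nu>_def by simp
      have ex: "norm (exp (2 / of_real h * phase \<Psi> (adiag y) q)) \<le> exp (- (2 * c * \<nu>\<^sup>2 / h))"
      proof -
        have "Re (2 / of_real h * phase \<Psi> (adiag y) q) = 2 / h * Re (phase \<Psi> (adiag y) q)"
          by (simp flip: of_real_divide add: Re_divide_of_real mult.commute)
        also have "\<dots> \<le> 2 / h * (- c * \<nu>\<^sup>2)"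
          by (intro mult_left_mono) (use ph[OF s t y] h0 in \<open>auto simp: q_def \<nu>_def\<close>)
        finally show ?thesis by (simp add: norm_exp_eq_Re)
      qed
      have D: "dd (1, 0) u (s, t) - (\<Sum>k\<in>UNIV. dd (0, axis k 1) (w k) (s, t)) = (\<Sum>i\<in>UNIV. dzb i f q * E i (s, t, y))"
      proof -
        have fd: "f differentiable at (\<Gamma>y (s, t))" using smooth_on_diff[OF sf qW] qy by simp
        show ?thesis
          using pullback_closed[OF oS s\<Gamma>y z fd, of "(1, 0)" e] unfolding u_def[abs_def] w_def[abs_def] e_def[symmetric]
          by (simp add: qy rvy[OF z] JJy[OF z] JRy[OF z] E_def) (simp add: e_def cdir_def)
      qed
      \<comment> \<open>Differentiating the exponent costs a factor \<open>2 / h\<close>; this is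
        why flatness of order \<open>2 * Suc N\<close> is used, which supplies one power of
        \<open>h\<close> more than claimed. Since \<open>h \<le> 1\<close>, the derivative of b may
        carry the factor \<open>1 / h\<close> as well.\<close>
      have bf: "norm (dzb i f q) \<le> Cf * (2 * Bb + 1) * (fact (Suc N) / (2 * c) ^ Suc N) * h ^ N" for i
      proof -
        have dz: "dzb i f q = exp (2 / of_real h * phase \<Psi> (adiag y) q) *
          (2 / of_real h * dzb i (phase \<Psi> (adiag y)) q * b q + dzb i b q)"
          unfolding f_def[abs_def] by (rule dzb_exp_mult[OF smooth_on_diff[OF sp qW] AH_diff[OF b qW]])
        have "norm (2 / of_real h * dzb i (phase \<Psi> (adiag y)) q * b q + dzb i b q) \<le>
          norm (2 / of_real h * dzb i (phase \<Psi> (adiag y)) q * b q) + norm (dzb i b q)" by (rule norm_triangle_ineq)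
        also have "\<dots> = 2 / h * norm (dzb i (phase \<Psi> (adiag y)) q) * norm (b q) + norm (dzb i b q)"
          using h0 by (simp add: norm_mult norm_divide)
        also have "\<dots> \<le> 2 / h * (Cf * \<nu> ^ (2 * Suc N)) * Bb + (1 / h) * (Cf * \<nu> ^ (2 * Suc N))"
        proof (rule add_mono)
          show "2 / h * norm (dzb i (phase \<Psi> (adiag y)) q) * norm (b q) \<le> 2 / h * (Cf * \<nu> ^ (2 * Suc N)) * Bb"
            using Cf(2)[OF zZ, of i] Bb(2)[OF zZ] h0 Cf(1) \<nu>0 unfolding q_def \<nu>_def by (intro mult_mono) auto
          have "norm (dzb i b q) \<le> 1 * (Cf * \<nu> ^ (2 * Suc N))" using Cf(3)[OF zZ, of i] unfolding q_def \<nu>_def by simp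
          also have "\<dots> \<le> (1 / h) * (Cf * \<nu> ^ (2 * Suc N))"
            using h0 Cf(1) \<nu>0 by (intro mult_right_mono) auto
          finally show "norm (dzb i b q) \<le> (1 / h) * (Cf * \<nu> ^ (2 * Suc N))" .
        qed
        also have "\<dots> = Cf * (2 * Bb + 1) / h * (\<nu>\<^sup>2) ^ Suc N" 
        proof -
          have "2 / h * (a * x) * b' + 1 / h * (a * x) = a * (2 * b' + 1) / h * x" for a x b'
            by (cases "h = 0") (auto simp: field_simps)
          then show ?thesis unfolding power_mult .
        qed
        finally have 1: "norm (2 / of_real h * dzb i (phase \<Psi> (adiag y)) q * b q + dzb i b q) \<le> Cf * (2 * Bb + 1) / h * (\<nu>\<^sup>2) ^ Suc N" .
        have "norm (dzb i f q) \<le> exp (- (2 * c * \<nu>\<^sup>2 / h)) * (Cf * (2 * Bb + 1) / h * (\<nu>\<^sup>2) ^ Suc N)"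
          unfolding dz norm_mult by (intro mult_mono ex 1) auto
        also have "\<dots> = Cf * (2 * Bb + 1) / h * ((\<nu>\<^sup>2) ^ Suc N * exp (- (2 * c * \<nu>\<^sup>2 / h)))" by simp
        also have "\<dots> \<le> Cf * (2 * Bb + 1) / h * (fact (Suc N) / (2 * c) ^ Suc N * h ^ Suc N)"
          by (intro mult_left_mono power_exp_bound) (use c h0 Cf(1) Bb(1) in auto)
        also have "\<dots> = Cf * (2 * Bb + 1) * (fact (Suc N) / (2 * c) ^ Suc N) * h ^ N" using h0 by simp
        finally show ?thesis .
      qed
      have p1: "norm (cut \<delta> t *\<^sub>R (\<Sum>i\<in>UNIV. dzb i f q * E i (s, t, y))) \<le> C1 * h ^ N"
      proof -
        have "norm (\<Sum>i\<in>UNIV. dzb i f q * E i (s, t, y)) \<le>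
          (\<Sum>i\<in>(UNIV::('n+'n) set). Cf * (2 * Bb + 1) * (fact (Suc N) / (2 * c) ^ Suc N) * h ^ N * BE)"
        proof (intro sum_norm_le)
          show "norm (dzb i f q * E i (s, t, y)) \<le> Cf * (2 * Bb + 1) * (fact (Suc N) / (2 * c) ^ Suc N) * h ^ N * BE" for i
            unfolding norm_mult by (intro mult_mono bf BE(2)[OF zZ] order_trans[OF norm_ge_zero bf] norm_ge_zero)
        qed
        also have "\<dots> = C1 * h ^ N" unfolding C1_def m_def by (simp add: algebra_simps)
        finally have x: "norm (\<Sum>i\<in>UNIV. dzb i f q * E i (s, t, y)) \<le> C1 * h ^ N" .
        have "norm (cut \<delta> t *\<^sub>R (\<Sum>i\<in>UNIV. dzb i f q * E i (s, t, y))) \<le> 1 * norm (\<Sum>i\<in>UNIV. dzb i f q * E i (s, t, y))"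
          unfolding norm_scaleR by (rule mult_right_mono) (use cut_bounds[of \<delta> t] in auto)
        then show ?thesis using x by simp
      qed
      have p2: "norm (\<Sum>k\<in>UNIV. cut' \<delta> (axis k 1) t *\<^sub>R w k (s, t)) \<le> C2 * h ^ N"
      proof (cases "norm t < \<delta> / 2")
        case True
        then have "norm t \<le> \<delta> / 2" by simp
        then have "cut' \<delta> (axis k 1) t = 0" for k by (rule cut_inside(2)[OF \<delta>])
        moreover have "C2 * h ^ N \<ge> 0" unfolding C2_def using m0 Bc(1) Bb(1) c \<mu>(1) BR(1) h0 by (intro mult_nonneg_nonneg) auto
        ultimately show ?thesis by simp
      next
        case False
        then have A: "(s, t, y) \<in> ?A" using s t y by auto
        have "norm (exp (2 / of_real h * phase \<Psi> (adiag y) q)) \<le> exp (- (2 * c * \<mu> * 1 / h))"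
          by (rule order_trans[OF ex]) (use \<mu>(2)[OF A] c h0 in \<open>auto simp: q_def \<nu>_def divide_right_mono\<close>)
        also have "\<dots> = 1 ^ N * exp (- (2 * c * \<mu> * 1 / h))" by simp
        also have "\<dots> \<le> fact N / (2 * c * \<mu>) ^ N * h ^ N" by (rule power_exp_bound) (use c \<mu> h0 in auto)
        finally have x: "norm (f q) \<le> (fact N / (2 * c * \<mu>) ^ N * h ^ N) * Bb"
          unfolding f_def norm_mult by (intro mult_mono) (use Bb(2)[OF zZ] c \<mu>(1) h0 in \<open>auto simp: q_def\<close>)
        have "norm (\<Sum>k\<in>UNIV. cut' \<delta> (axis k 1) t *\<^sub>R w k (s, t)) \<le>
          (\<Sum>k\<in>(UNIV::('n+'n) set). Bc * ((fact N / (2 * c * \<mu>) ^ N * h ^ N) * Bb * BR))"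
        proof (intro sum_norm_le)
          fix k
          have "norm (w k (s, t)) \<le> (fact N / (2 * c * \<mu>) ^ N * h ^ N) * Bb * BR"
            unfolding w_def qy JRy[OF z] norm_mult by (intro mult_mono x BR(2)[OF zZ] order_trans[OF norm_ge_zero x]) auto
          then show "norm (cut' \<delta> (axis k 1) t *\<^sub>R w k (s, t)) \<le> Bc * ((fact N / (2 * c * \<mu>) ^ N * h ^ N) * Bb * BR)"
            unfolding norm_scaleR by (intro mult_mono) (use Bc(2)[of t k] t Bc(1) in auto)
        qed
        also have "\<dots> = C2 * h ^ N" unfolding C2_def m_def by (simp add: algebra_simps)
        finally show ?thesis .
      qed
      show ?thesis unfolding D distrib_right
        by (rule order_trans[OF norm_triangle_ineq4]) (intro add_mono p1 p2)
    qed
    have eq: "cut \<delta> t *\<^sub>R u (s, t) = cut \<delta> t *\<^sub>R (exp (2 / of_real h * phase \<Psi> (adiag y) (\<Gamma> (s, t, y))) * b (\<Gamma> (s, t, y)) * pull_jac \<Gamma> cdir (s, t, y))"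
      if "s \<in> {0..1}" for s t
    proof (cases "norm t \<le> \<delta>")
      case True
      then have "(s, t) \<in> Sy" using sub that by auto
      then show ?thesis unfolding u_def f_def JJy[OF \<open>(s, t) \<in> Sy\<close>] by (simp add: \<Gamma>y_def)
    next
      case False then show ?thesis using cut_outside(1)[OF \<delta>, of t] by simp
    qed
    have "norm ((LINT t|lborel. cut \<delta> t *\<^sub>R u (1, t)) - (LINT t|lborel. cut \<delta> t *\<^sub>R u (0, t))) \<le> ((C1 + C2) * h ^ N) * measure lborel (cbox (- a) a)"
      by (rule homotopy_integral_bound[OF oS sub \<delta> su bd box])
    then show ?thesis unfolding cut_int_def using eq[of 1] eq[of 0] by simp
  qed
  show ?thesis
    by (rule exI[of _ "(C1 + C2) * measure lborel (cbox (- a) a)"]) (use main in \<open>simp add: mult_ac\<close>)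
qed

section \<open>The phase near the anti-diagonal\<close>

text \<open>On the anti-diagonal, for the polarization of \<Phi>, this is the Levi matrix; its
  entries off the anti-diagonal are an almost holomorphic continuation.\<close>

definition Lam :: "('n::finite cpair \<Rightarrow> complex) \<Rightarrow> 'n cpair \<Rightarrow> complex^'n^'n" where
  "Lam \<Psi> p = (\<chi> j k. dz (Inl j) (dz (Inr k) \<Psi>) p)"

text \<open>Cramer's rule for the inverse of \<open>Lam\<close>, so that the entries are visibly almost holomorphic.\<close>

definition Lam_inv :: "('n::finite cpair \<Rightarrow> complex) \<Rightarrow> 'n cpair \<Rightarrow> complex^'n^'n" where
  "Lam_inv \<Psi> p = (\<chi> k l. det (\<chi> i j. if j = k then axis l 1 $ i else Lam \<Psi> p $ i $ j) / det (Lam \<Psi> p))"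

definition zvec :: "real^('n + 'n) \<Rightarrow> complex^'n::finite" where
  "zvec t = (\<chi> j. Complex (t $ Inl j) (t $ Inr j))"

lemma Lam_Lam_inv:
  assumes "det (Lam \<Psi> p) \<noteq> 0"
  shows "Lam \<Psi> p ** Lam_inv \<Psi> p = mat 1"
proof -
  have "(Lam \<Psi> p ** Lam_inv \<Psi> p) $ i $ l = mat 1 $ i $ l" for i l
  proof -
    have "Lam \<Psi> p *v (\<chi> k. det (\<chi> i j. if j = k then axis l 1 $ i else Lam \<Psi> p $ i $ j) / det (Lam \<Psi> p)) = axis l 1"
      using cramer[OF assms] by blast
    then have "(Lam \<Psi> p *v (\<chi> k. Lam_inv \<Psi> p $ k $ l)) $ i = axis l 1 $ i" unfolding Lam_inv_def by simp
    then show ?thesis by (simp add: matrix_matrix_mult_def matrix_vector_mult_def mat_def axis_def eq_commute)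
  qed
  then show ?thesis by (simp add: vec_eq_iff)
qed

lemma AH_Lam: "open W \<Longrightarrow> AH W \<Psi> \<Longrightarrow> AH W (\<lambda>p. Lam \<Psi> p $ j $ k)"
  unfolding Lam_def by (simp add: AH_dz)

lemma AH_det_Lam:
  assumes "open W" "AH W \<Psi>"
  shows "AH W (\<lambda>p. det (Lam \<Psi> p))"
proof -
  have "AH W (\<lambda>p. det (\<chi> i j. Lam \<Psi> p $ i $ j))" by (intro AH_det AH_Lam assms)
  then show ?thesis by simp
qed

lemma AH_Lam_inv:
  assumes "open W" "AH W \<Psi>" "\<And>p. p \<in> W \<Longrightarrow> det (Lam \<Psi> p) \<noteq> 0"
  shows "AH W (\<lambda>p. Lam_inv \<Psi> p $ k $ l)"
proof -
  have 1: "AH W (\<lambda>p. if j = k then axis l 1 $ i else Lam \<Psi> p $ i $ j)" for i j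
    using AH_Lam[OF assms(1,2)] by (cases "j = k") simp_all
  have "AH W (\<lambda>p. det (\<chi> i j. if j = k then axis l 1 $ i else Lam \<Psi> p $ i $ j) * inverse (det (Lam \<Psi> p)))"
    by (intro AH_mult AH_inverse AH_det AH_det_Lam assms 1)
  then show ?thesis by (simp add: Lam_inv_def divide_inverse)
qed

lemma linear_zvec: "linear zvec"
  by (rule linearI) (auto simp: zvec_def vec_eq_iff complex_eq_iff)

lemma bounded_linear_zvec: "bounded_linear zvec"
  using linear_zvec linear_conv_bounded_linear by blast

lemma zvec_scaleR: "zvec (c *\<^sub>R t) = c *\<^sub>R zvec t" and zvec_0 [simp]: "zvec 0 = 0"
  using linear_zvec linear_scale linear_0 by blast+

lemma norm_zvec [simp]: "norm (zvec t) = norm t"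
proof -
  have e: "(\<Sum>i\<in>UNIV. (t $ i)\<^sup>2) = (\<Sum>j\<in>UNIV. (t $ Inl j)\<^sup>2) + (\<Sum>j\<in>UNIV. (t $ Inr j)\<^sup>2)"
    unfolding UNIV_Plus_UNIV[symmetric] by (subst sum.Plus) auto
  show ?thesis unfolding norm_vec_def L2_set_def zvec_def by (simp add: cmod_power2 sum.distrib e)
qed

lemma sum_mult_cnj: "(\<Sum>j\<in>UNIV. z $ j * cnj (z $ j)) = of_real ((norm z)\<^sup>2)" for z :: "complex^'n::finite"
  unfolding norm_vec_def L2_set_def
  by (simp add: sum_nonneg complex_norm_square[symmetric] del: of_real_power)

lemma norm_matrix_vector_le:
  fixes A :: "complex^'n^'n::finite"
  assumes "\<And>k l. norm (A $ k $ l) \<le> B"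
  shows "norm (A *v x) \<le> (real CARD('n))\<^sup>2 * B * norm x"
proof -
  have "norm (A *v x) \<le> (\<Sum>k\<in>UNIV. norm ((A *v x) $ k))" unfolding norm_vec_def by (rule L2_set_le_sum) simp
  also have "\<dots> \<le> (\<Sum>k\<in>(UNIV::'n set). real CARD('n) * (B * norm x))"
  proof (rule sum_mono)
    fix k
    have "(A *v x) $ k = (\<Sum>l\<in>UNIV. A $ k $ l * x $ l)" by (simp add: matrix_vector_mult_def)
    also have "norm \<dots> \<le> (\<Sum>l\<in>(UNIV::'n set). B * norm x)"
    proof (rule sum_norm_le)
      show "norm (A $ k $ l * x $ l) \<le> B * norm x" for l
        unfolding norm_mult by (intro mult_mono assms Finite_Cartesian_Product.norm_nth_le order_trans[OF norm_ge_zero assms] norm_ge_zero)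
    qed
    finally have "norm ((A *v x) $ k) \<le> (\<Sum>l\<in>(UNIV::'n set). B * norm x)" .
    then show "norm ((A *v x) $ k) \<le> real CARD('n) * (B * norm x)" by simp
  qed
  finally show ?thesis by (simp add: power2_eq_square mult.assoc)
qed

text \<open>Up to \<open>fact k\<close> the part of degree \<open>k\<close> in the Taylor expansion
  at \<open>p\<close> of the four-term difference that makes up the phase. The value of \<Psi> at
  the base point contributes to degree 0 only.\<close>

definition phase_hX :: "('n::finite cpair \<Rightarrow> complex) \<Rightarrow> nat \<Rightarrow> 'n cpair \<Rightarrow> 'n cpair \<Rightarrow> complex" where
  "phase_hX \<Psi> k w p = hX k w \<Psi> p - hX k (fst w, 0) \<Psi> p - hX k (0, snd w) \<Psi> p + (if k = 0 then \<Psi> p else 0)"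

lemma sum_UNIV_Plus: "(\<Sum>i\<in>UNIV. f i) = (\<Sum>j\<in>UNIV. f (Inl j)) + (\<Sum>j\<in>UNIV. f (Inr j))"
  for f :: "'a::finite + 'b::finite \<Rightarrow> 'c::comm_monoid_add"
  unfolding UNIV_Plus_UNIV[symmetric] by (subst sum.Plus) auto

lemma dz_commute:
  assumes "open W" "smooth_on W f" "p \<in> W"
  shows "dz i (dz k f) p = dz k (dz i f) p"
proof -
  have d: "dd v f differentiable at p" for v using smooth_on_diff[OF smooth_on_dd[OF assms(2)] assms(3)] .
  have l: "dd w (dz j f) p = (dd w (dd (cbas 1 j) f) p + (-\<i>) * dd w (dd (cbas \<i> j) f) p) / 2" for w j
  proof -
    have "dd w (\<lambda>q. (dd u f q + c * dd v f q) / 2) p = (dd w (dd u f) p + c * dd w (dd v f) p) / 2" for u v c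
    proof (rule dd_eqI)
      show "((\<lambda>q. (dd u f q + c * dd v f q) / 2) has_derivative (\<lambda>w. (dd w (dd u f) p + c * dd w (dd v f) p) / 2)) (at p)"
        by (auto intro!: derivative_eq_intros has_derivative_dd d)
    qed
    from this[of "cbas 1 j" "-\<i>" "cbas \<i> j"] show ?thesis unfolding dz_def[abs_def] by simp
  qed
  have c: "dd v (dd w f) p = dd w (dd v f) p" for v w by (rule dd_commute[OF assms])
  show ?thesis
    unfolding dz_def[of i "dz k f"] dz_def[of k "dz i f"] l
    unfolding c[of "cbas 1 i"] c[of "cbas \<i> i"]
    by (simp add: field_simps)
qed

text \<open>The four-term difference annihilates everything that depends on one group of variables
  only. In degree 2 the mixed derivatives remain, and by symmetry each is counted twice.\<close>

lemma phase_hX_low: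
  assumes "open W" "smooth_on W \<Psi>" "p \<in> W"
  shows "phase_hX \<Psi> 0 w p = 0" "phase_hX \<Psi> (Suc 0) w p = 0"
    "phase_hX \<Psi> (Suc (Suc 0)) w p = 2 * (\<Sum>j\<in>UNIV. \<Sum>k\<in>UNIV. Lam \<Psi> p $ j $ k * (fst w $ j * snd w $ k))"
proof -
  show "phase_hX \<Psi> 0 w p = 0" by (simp add: phase_hX_def)
  show "phase_hX \<Psi> (Suc 0) w p = 0" by (simp add: phase_hX_def sum_UNIV_Plus crd_def)
  have c: "dz (Inr k) (dz (Inl j) \<Psi>) p = Lam \<Psi> p $ j $ k" for j k
    unfolding Lam_def using dz_commute[OF assms] by simp
  have sw: "(\<Sum>k\<in>UNIV. \<Sum>j\<in>UNIV. snd w $ k * (fst w $ j * Lam \<Psi> p $ j $ k)) =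
    (\<Sum>j\<in>UNIV. \<Sum>k\<in>UNIV. Lam \<Psi> p $ j $ k * (fst w $ j * snd w $ k))"
    by (subst sum.swap) (simp add: mult_ac)
  have sw2: "(\<Sum>j\<in>UNIV. \<Sum>k\<in>UNIV. fst w $ j * (snd w $ k * Lam \<Psi> p $ j $ k)) =
    (\<Sum>j\<in>UNIV. \<Sum>k\<in>UNIV. Lam \<Psi> p $ j $ k * (fst w $ j * snd w $ k))"
    by (simp add: mult_ac)
  have L: "dz (Inl j) (dz (Inr k) \<Psi>) p = Lam \<Psi> p $ j $ k" for j k unfolding Lam_def by simp
  show "phase_hX \<Psi> (Suc (Suc 0)) w p = 2 * (\<Sum>j\<in>UNIV. \<Sum>k\<in>UNIV. Lam \<Psi> p $ j $ k * (fst w $ j * snd w $ k))"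
    unfolding phase_hX_def hX.simps sum_UNIV_Plus
    by (simp add: crd_def c L sum_distrib_left distrib_left sum.distrib sw sw2)
qed

lemma adiag_add_in_cbidisc:
  assumes "norm (y - x0) \<le> r / 2" "norm w \<le> r / 2"
  shows "adiag y + w \<in> cball x0 r \<times> cball (vconj x0) r"
proof -
  have "norm (y + fst w - x0) \<le> norm (y - x0) + norm (fst w)"
    using norm_triangle_ineq[of "y - x0" "fst w"] by (simp add: algebra_simps)
  moreover have "norm (vconj y + snd w - vconj x0) \<le> norm (y - x0) + norm (snd w)"
    using norm_triangle_ineq[of "vconj y - vconj x0" "snd w"] by (simp add: algebra_simps norm_vconj_diff)
  moreover have "norm (fst w) \<le> norm w" "norm (snd w) \<le> norm w"
    using norm_fst_le[of "fst w" "snd w"] norm_snd_le[of "snd w" "fst w"] by simp_all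
  ultimately show ?thesis using assms unfolding mem_Times_iff by (simp add: dist_norm norm_minus_commute)
qed

text \<open>With base point and increment each within half of r, the segment between them stays in
  the closed product of radius r, a compact subset of the bidisc of radius R.\<close>

lemma AH_Taylor_adiag:
  assumes "AH (bidisc x0 R) f" "r < R"
  shows "\<exists>C\<ge>0. \<forall>y w. norm (y - x0) \<le> r / 2 \<longrightarrow> norm w \<le> r / 2 \<longrightarrow>
     norm (f (adiag y + w) - (\<Sum>k<n. hX k w f (adiag y) / fact k)) \<le> C * norm w ^ n"
proof -
  let ?K = "cball x0 r \<times> cball (vconj x0) r"
  have K: "compact ?K" "?K \<subseteq> bidisc x0 R" using assms(2) by (auto intro!: compact_Times simp: bidisc_def)
  obtain C where C: "C \<ge> 0" "\<And>p w. p \<in> ?K \<Longrightarrow> rho p = 0 \<Longrightarrow> (\<forall>\<tau>\<in>{0..1}. p + \<tau> *\<^sub>R w \<in> ?K) \<Longrightarrow>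
     norm (f (p + w) - (\<Sum>k<n. hX k w f p / fact k)) \<le> C * norm w ^ n"
    using AH_Taylor[OF open_bidisc assms(1) K, of n] by blast
  have "norm (f (adiag y + w) - (\<Sum>k<n. hX k w f (adiag y) / fact k)) \<le> C * norm w ^ n"
    if y: "norm (y - x0) \<le> r / 2" "norm w \<le> r / 2" for y w
  proof (rule C(2))
    have seg: "adiag y + \<tau> *\<^sub>R w \<in> ?K" if "\<tau> \<in> {0..1}" for \<tau>
    proof (rule adiag_add_in_cbidisc[OF y(1)])
      have "norm (\<tau> *\<^sub>R w) \<le> 1 * norm w" unfolding norm_scaleR by (rule mult_right_mono) (use that in auto)
      then show "norm (\<tau> *\<^sub>R w) \<le> r / 2" using y(2) by simp
    qed
    show "\<forall>\<tau>\<in>{0..1}. adiag y + \<tau> *\<^sub>R w \<in> ?K" using seg by (rule ballI)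
    show "adiag y \<in> ?K" using seg[of 0] by simp
  qed simp
  then show ?thesis using C(1) by (intro exI[of _ C]) simp
qed

lemma phase_Taylor:
  assumes "AH (bidisc x0 R) \<Psi>" "r < R"
  shows "\<exists>C\<ge>0. \<forall>y w. norm (y - x0) \<le> r / 2 \<longrightarrow> norm w \<le> r / 2 \<longrightarrow>
     norm (phase \<Psi> (adiag y) (adiag y + w) - (\<Sum>k<n. phase_hX \<Psi> k w (adiag y) / fact k)) \<le> C * norm w ^ n"
\<comment> \<open>For \<open>n = 0\<close> the Taylor sum is empty and does not contain the constant
  \<open>\<Psi> (adiag y)\<close> that the phase carries, so the four values are bounded
  separately.\<close>
proof (cases "n = 0")
  case True
  obtain C where C0: "C \<ge> 0" "\<forall>y w. norm (y - x0) \<le> r / 2 \<longrightarrow> norm w \<le> r / 2 \<longrightarrow>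
     norm (\<Psi> (adiag y + w) - (\<Sum>k<0. hX k w \<Psi> (adiag y) / fact k)) \<le> C * norm w ^ 0"
    using AH_Taylor_adiag[OF assms, of 0] by (elim exE conjE)
  have C: "C \<ge> 0" "\<And>y w. norm (y - x0) \<le> r / 2 \<Longrightarrow> norm w \<le> r / 2 \<Longrightarrow> norm (\<Psi> (adiag y + w)) \<le> C"
  proof -
    show "C \<ge> 0" by (rule C0(1))
    show "norm (\<Psi> (adiag y + w)) \<le> C" if "norm (y - x0) \<le> r / 2" "norm w \<le> r / 2" for y w
      using C0(2)[rule_format, OF that] by simp
  qed
  have "norm (phase \<Psi> (adiag y) (adiag y + w)) \<le> 4 * C" if y: "norm (y - x0) \<le> r / 2" "norm w \<le> r / 2" for y w
  proof -
    have w: "norm (fst w, 0::complex^'a) \<le> r / 2" "norm (0::complex^'a, snd w) \<le> r / 2" "norm (0 :: 'a cpair) \<le> r / 2"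
      using y(2) norm_fst_le[of "fst w" "snd w"] norm_snd_le[of "snd w" "fst w"] order_trans[OF norm_ge_zero y(2)] by (simp_all add: norm_Pair)
    have "phase \<Psi> (adiag y) (adiag y + w) = \<Psi> (adiag y + w) - \<Psi> (adiag y + (fst w, 0)) - \<Psi> (adiag y + (0, snd w)) + \<Psi> (adiag y + 0)"
      unfolding phase_adiag by (simp add: adiag_def)
    then have "norm (phase \<Psi> (adiag y) (adiag y + w)) = norm (\<Psi> (adiag y + w) - \<Psi> (adiag y + (fst w, 0)) - \<Psi> (adiag y + (0, snd w)) + \<Psi> (adiag y + 0))"
      by (rule arg_cong)
    also have "\<dots> \<le> norm (\<Psi> (adiag y + w)) + norm (\<Psi> (adiag y + (fst w, 0))) + norm (\<Psi> (adiag y + (0, snd w))) + norm (\<Psi> (adiag y + 0))"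
    proof -
      have "norm (a - b - c + d) \<le> norm a + norm b + norm c + norm d" for a b c d :: complex
        using norm_triangle_ineq[of "a - b - c" d] norm_triangle_ineq4[of "a - b" c] norm_triangle_ineq4[of a b] by linarith
      then show ?thesis .
    qed
    also have "\<dots> \<le> 4 * C" using C(2)[OF y(1) y(2)] C(2)[OF y(1) w(1)] C(2)[OF y(1) w(2)] C(2)[OF y(1) w(3)] by linarith
    finally show ?thesis .
  qed
  then show ?thesis using True C(1) by (intro exI[of _ "4 * C"]) simp
next
  case False
  obtain C where C: "C \<ge> 0" "\<And>y w. norm (y - x0) \<le> r / 2 \<Longrightarrow> norm w \<le> r / 2 \<Longrightarrow>
     norm (\<Psi> (adiag y + w) - (\<Sum>k<n. hX k w \<Psi> (adiag y) / fact k)) \<le> C * norm w ^ n"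
    using AH_Taylor_adiag[OF assms, of n] by blast
  have "norm (phase \<Psi> (adiag y) (adiag y + w) - (\<Sum>k<n. phase_hX \<Psi> k w (adiag y) / fact k)) \<le> 3 * C * norm w ^ n"
    if y: "norm (y - x0) \<le> r / 2" "norm w \<le> r / 2" for y w
  proof -
    let ?w1 = "(fst w, 0::complex^'a)" and ?w2 = "(0::complex^'a, snd w)"
    have w: "norm ?w1 \<le> norm w" "norm ?w2 \<le> norm w"
      using norm_fst_le[of "fst w" "snd w"] norm_snd_le[of "snd w" "fst w"] by (simp_all add: norm_Pair)
    let ?E = "\<lambda>w. \<Psi> (adiag y + w) - (\<Sum>k<n. hX k w \<Psi> (adiag y) / fact k)"
    have "(\<Sum>k<n. (if k = 0 then \<Psi> (adiag y) else 0) / fact k) = (\<Sum>k<n. if k = 0 then \<Psi> (adiag y) else 0)"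
      by (rule sum.cong) auto
    also have "\<dots> = \<Psi> (adiag y)" using False by (simp add: sum.delta')
    finally have 0: "(\<Sum>k<n. (if k = 0 then \<Psi> (adiag y) else 0) / fact k) = \<Psi> (adiag y)" .
    have "(\<Sum>k<n. phase_hX \<Psi> k w (adiag y) / fact k) = (\<Sum>k<n. hX k w \<Psi> (adiag y) / fact k) - (\<Sum>k<n. hX k ?w1 \<Psi> (adiag y) / fact k)
       - (\<Sum>k<n. hX k ?w2 \<Psi> (adiag y) / fact k) + \<Psi> (adiag y)"
      unfolding phase_hX_def add_divide_distrib diff_divide_distrib sum.distrib sum_subtractf 0 ..
    moreover have "phase \<Psi> (adiag y) (adiag y + w) = \<Psi> (adiag y + w) - \<Psi> (adiag y + ?w1) - \<Psi> (adiag y + ?w2) + \<Psi> (adiag y)"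
      unfolding phase_adiag by (simp add: adiag_def)
    ultimately have "phase \<Psi> (adiag y) (adiag y + w) - (\<Sum>k<n. phase_hX \<Psi> k w (adiag y) / fact k) = ?E w - ?E ?w1 - ?E ?w2"
      by simp
    then have "norm (phase \<Psi> (adiag y) (adiag y + w) - (\<Sum>k<n. phase_hX \<Psi> k w (adiag y) / fact k)) = norm (?E w - ?E ?w1 - ?E ?w2)"
      by (rule arg_cong)
    also have "\<dots> \<le> norm (?E w) + norm (?E ?w1) + norm (?E ?w2)"
    proof -
      have "norm (a - b - c) \<le> norm a + norm b + norm c" for a b c :: complex
        using norm_triangle_ineq4[of "a - b" c] norm_triangle_ineq4[of a b] by linarith
      then show ?thesis .
    qed
    also have "\<dots> \<le> C * norm w ^ n + C * norm ?w1 ^ n + C * norm ?w2 ^ n"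
      by (rule add_mono[OF add_mono[OF C(2)[OF y] C(2)[OF y(1) order_trans[OF w(1) y(2)]]] C(2)[OF y(1) order_trans[OF w(2) y(2)]]])
    also have "\<dots> \<le> C * norm w ^ n + C * norm w ^ n + C * norm w ^ n"
      by (intro add_mono order_refl mult_left_mono power_mono w C(1) norm_ge_zero)
    also have "\<dots> = 3 * C * norm w ^ n" by simp
    finally show ?thesis .
  qed
  then show ?thesis using C(1) by (intro exI[of _ "3 * C"]) simp
qed

lemma phase_quadratic:
  assumes "AH (bidisc x0 R) \<Psi>" "0 < r" "r < R"
  shows "\<exists>C\<ge>0. \<forall>y w. norm (y - x0) \<le> r / 2 \<longrightarrow> norm w \<le> r / 2 \<longrightarrow>
     norm (phase \<Psi> (adiag y) (adiag y + w) - (\<Sum>j\<in>UNIV. \<Sum>k\<in>UNIV. Lam \<Psi> (adiag y) $ j $ k * (fst w $ j * snd w $ k))) \<le> C * norm w ^ 3"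
proof -
  have p: "adiag y \<in> bidisc x0 R" if "norm (y - x0) \<le> r / 2" for y
    using adiag_add_in_cbidisc[of y x0 r 0] that assms(2,3) unfolding bidisc_def by auto
  have "(\<Sum>k<3. phase_hX \<Psi> k w (adiag y) / fact k) = (\<Sum>j\<in>UNIV. \<Sum>k\<in>UNIV. Lam \<Psi> (adiag y) $ j $ k * (fst w $ j * snd w $ k))"
    if "norm (y - x0) \<le> r / 2" for y w
    using phase_hX_low[OF open_bidisc AH_smooth[OF assms(1)] p[OF that], of w] by (simp add: numeral_3_eq_3)
  note eq = this
  obtain C where C: "C \<ge> 0" "\<forall>y w. norm (y - x0) \<le> r / 2 \<longrightarrow> norm w \<le> r / 2 \<longrightarrow>
     norm (phase \<Psi> (adiag y) (adiag y + w) - (\<Sum>k<3. phase_hX \<Psi> k w (adiag y) / fact k)) \<le> C * norm w ^ 3"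
    using phase_Taylor[OF assms(1,3), of 3] by (elim exE conjE)
  show ?thesis
  proof (intro exI conjI allI impI)
    show "C \<ge> 0" by (rule C(1))
    fix y :: "complex^'a" and w :: "'a cpair" assume a: "norm (y - x0) \<le> r / 2" "norm w \<le> r / 2"
    show "norm (phase \<Psi> (adiag y) (adiag y + w) - (\<Sum>j\<in>UNIV. \<Sum>k\<in>UNIV. Lam \<Psi> (adiag y) $ j $ k * (fst w $ j * snd w $ k))) \<le> C * norm w ^ 3"
      using C(2)[rule_format, OF a] unfolding eq[OF a(1)] .
  qed
qed

section \<open>The adapted contour\<close>

definition bil :: "('n::finite cpair \<Rightarrow> complex) \<Rightarrow> 'n cpair \<Rightarrow> complex^'n \<Rightarrow> complex^'n \<Rightarrow> complex" where
  "bil \<Psi> p z v = (\<Sum>j\<in>UNIV. \<Sum>k\<in>UNIV. Lam \<Psi> p $ j $ k * (z $ j * v $ k))"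

lemma bil_linear: "bil \<Psi> p z (v + w) = bil \<Psi> p z v + bil \<Psi> p z w" "bil \<Psi> p z (c *\<^sub>R v) = of_real c * bil \<Psi> p z v"
  "bil \<Psi> p z (- v) = - bil \<Psi> p z v"
proof -
  show "bil \<Psi> p z (v + w) = bil \<Psi> p z v + bil \<Psi> p z w" "bil \<Psi> p z (- v) = - bil \<Psi> p z v"
    unfolding bil_def by (simp_all add: algebra_simps sum.distrib sum_negf)
  have "Lam \<Psi> p $ j $ k * (z $ j * (c *\<^sub>R v) $ k) = of_real c * (Lam \<Psi> p $ j $ k * (z $ j * v $ k))" for j k
    unfolding vector_scaleR_component by (simp add: scaleR_conv_of_real)
  then show "bil \<Psi> p z (c *\<^sub>R v) = of_real c * bil \<Psi> p z v"
    unfolding bil_def by (simp add: sum_distrib_left)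
qed

text \<open>\<open>Lam\<close> undoes \<open>Lam_inv\<close> on the conjugate of z, and the form
  becomes the Hermitian square. This dictates the shape of the adapted contour.\<close>

lemma bil_Lam_inv:
  assumes "det (Lam \<Psi> p) \<noteq> 0"
  shows "bil \<Psi> p z (Lam_inv \<Psi> p *v vconj z) = of_real ((norm z)\<^sup>2)"
proof -
  have "bil \<Psi> p z v = (\<Sum>j\<in>UNIV. z $ j * (Lam \<Psi> p *v v) $ j)" for v
    unfolding bil_def matrix_vector_mult_def by (simp add: sum_distrib_left mult_ac)
  then have "bil \<Psi> p z (Lam_inv \<Psi> p *v vconj z) = (\<Sum>j\<in>UNIV. z $ j * (Lam \<Psi> p *v (Lam_inv \<Psi> p *v vconj z)) $ j)" .
  also have "Lam \<Psi> p *v (Lam_inv \<Psi> p *v vconj z) = vconj z"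
    unfolding matrix_vector_mul_assoc Lam_Lam_inv[OF assms] by simp
  also have "(\<Sum>j\<in>UNIV. z $ j * vconj z $ j) = of_real ((norm z)\<^sup>2)"
    using sum_mult_cnj[of z] by (simp add: vconj_def)
  finally show ?thesis .
qed

text \<open>At \<open>s = 0\<close> this is the affine contour; at \<open>s = 1\<close> the quadratic part of the phase
  is \<open>- \<bar>t\<bar>\<^sup>2\<close>.\<close>

definition mcon :: "('n::finite cpair \<Rightarrow> complex) \<Rightarrow> real \<times> (real^('n + 'n)) \<times> (complex^'n) \<Rightarrow> 'n cpair" where
  "mcon \<Psi> = (\<lambda>(s, t, y). adiag y + (zvec t, - ((1 - s) *\<^sub>R vconj (zvec t) + s *\<^sub>R (Lam_inv \<Psi> (adiag y) *v vconj (zvec t)))))"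

text \<open>All that the analysis uses: \<Psi> almost holomorphic on a bidisc on which its mixed
  Hessian is invertible, and a Levi form bounded below uniformly over the base points. The function
  \<Phi> itself no longer occurs, and the radius may be decreased.\<close>

locale bergman_phase =
  fixes \<Psi> :: "'n::finite cpair \<Rightarrow> complex" and x0 :: "complex^'n" and R c0 :: real
  assumes R: "R > 0" and c0: "c0 > 0" and \<Psi>: "AH (bidisc x0 R) \<Psi>"
    and det_Lam: "\<And>p. p \<in> bidisc x0 R \<Longrightarrow> det (Lam \<Psi> p) \<noteq> 0"
    and pos: "\<And>y \<xi>. y \<in> ball x0 R \<Longrightarrow> c0 * (norm \<xi>)\<^sup>2 \<le> Re (bil \<Psi> (adiag y) \<xi> (vconj \<xi>))"
begin

lemma adiag_in: "y \<in> ball x0 R \<Longrightarrow> adiag y \<in> bidisc x0 R"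
  unfolding mem_bidisc by (simp add: norm_vconj_diff dist_norm norm_minus_commute)

lemma smooth_on_mcon: "smooth_on (UNIV \<times> UNIV \<times> ball x0 R) (mcon \<Psi>)"
proof -
  let ?S = "UNIV \<times> UNIV \<times> ball x0 R :: (real \<times> (real^('n + 'n)) \<times> (complex^'n)) set"
  have oS: "open ?S" by (intro open_Times open_UNIV open_ball)
  have l1: "bounded_linear (\<lambda>\<zeta>::real \<times> (real^('n + 'n)) \<times> (complex^'n). vconj (zvec (fst (snd \<zeta>))))"
    by (intro bounded_linear_compose[OF bounded_linear_vconj] bounded_linear_compose[OF bounded_linear_zvec]
         bounded_linear_compose[OF bounded_linear_fst] bounded_linear_snd)
  have l2: "bounded_linear (\<lambda>\<zeta>::real \<times> (real^('n + 'n)) \<times> (complex^'n). zvec (fst (snd \<zeta>)))"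
    by (intro bounded_linear_compose[OF bounded_linear_zvec]
         bounded_linear_compose[OF bounded_linear_fst] bounded_linear_snd)
  have l3: "bounded_linear (\<lambda>\<zeta>::real \<times> (real^('n + 'n)) \<times> (complex^'n). adiag (snd (snd \<zeta>)))"
    by (intro bounded_linear_compose[OF bounded_linear_adiag]
         bounded_linear_compose[OF bounded_linear_snd] bounded_linear_snd)
  have m: "smooth_on ?S (\<lambda>\<zeta>. Lam_inv \<Psi> (adiag (snd (snd \<zeta>))) $ k $ l)" for k l
    by (rule smooth_on_compose[OF oS open_bidisc smooth_on_linear[OF l3] AH_smooth[OF AH_Lam_inv[OF open_bidisc \<Psi> det_Lam]]])
       (auto intro!: adiag_in)
  have v: "smooth_on ?S (\<lambda>\<zeta>. Lam_inv \<Psi> (adiag (snd (snd \<zeta>))) *v vconj (zvec (fst (snd \<zeta>))))"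
    unfolding matrix_vector_mult_def
    by (intro smooth_on_vec smooth_on_sum smooth_on_mult oS m smooth_on_linear bounded_linear_compose[OF bounded_linear_vec_nth] l1)
  have "smooth_on ?S (\<lambda>\<zeta>. adiag (snd (snd \<zeta>)) + (zvec (fst (snd \<zeta>)), - ((1 - fst \<zeta>) *\<^sub>R vconj (zvec (fst (snd \<zeta>))) +
     fst \<zeta> *\<^sub>R (Lam_inv \<Psi> (adiag (snd (snd \<zeta>))) *v vconj (zvec (fst (snd \<zeta>)))))))"
    by (rule smooth_on_add[OF oS smooth_on_linear[OF l3] smooth_on_Pair[OF oS smooth_on_linear[OF l2]
         smooth_on_minus[OF oS smooth_on_add[OF oS smooth_on_scaleR[OF oS _ smooth_on_linear[OF l1]] smooth_on_scaleR[OF oS _ v]]]]])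
       (rule smooth_on_sub[OF oS smooth_on_const smooth_on_linear[OF bounded_linear_fst]], rule smooth_on_linear[OF bounded_linear_fst])
  then show ?thesis unfolding mcon_def case_prod_beta .
qed

text \<open>For parameter s the quadratic part of the phase is a convex combination of minus the
  Levi form and minus the squared norm of t, hence negative definite uniformly in s and y. The cubic
  remainder consumes at most half of it for small t, and the distance to the base point lies between
  \<open>norm t\<close> and \<open>B * norm t\<close>.\<close>

lemma mcon_bounds:
  obtains B c \<delta>0 where "B \<ge> 1" "c > 0" "\<delta>0 > 0" "\<delta>0 \<le> R / 8"
    "\<And>s t y. s \<in> {0..1} \<Longrightarrow> y \<in> cball x0 (R / 4) \<Longrightarrow> norm (mcon \<Psi> (s, t, y) - adiag y) \<le> B * norm t"
    "\<And>s t y. norm t \<le> norm (mcon \<Psi> (s, t, y) - adiag y)"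
    "\<And>s t y. s \<in> {0..1} \<Longrightarrow> y \<in> cball x0 (R / 4) \<Longrightarrow> norm t \<le> \<delta>0 \<Longrightarrow> mcon \<Psi> (s, t, y) \<in> bidisc x0 R"
    "\<And>s t y. s \<in> {0..1} \<Longrightarrow> y \<in> cball x0 (R / 4) \<Longrightarrow> norm t \<le> \<delta>0 \<Longrightarrow>
      Re (phase \<Psi> (adiag y) (mcon \<Psi> (s, t, y))) \<le> - c * (norm (mcon \<Psi> (s, t, y) - adiag y))\<^sup>2"
proof -
  have R2: "0 < R / 2" "R / 2 < R" using R by auto
  obtain C where C: "C \<ge> 0" "\<And>y w. norm (y - x0) \<le> R / 2 / 2 \<Longrightarrow> norm w \<le> R / 2 / 2 \<Longrightarrow>
     norm (phase \<Psi> (adiag y) (adiag y + w) - bil \<Psi> (adiag y) (fst w) (snd w)) \<le> C * norm w ^ 3"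
    using phase_quadratic[OF \<Psi> R2] unfolding bil_def by blast
  have sub: "cball x0 (R / 4) \<subseteq> ball x0 R" using R by auto
  have cM: "continuous_on (cball x0 (R / 4)) (\<lambda>y. Lam_inv \<Psi> (adiag y) $ k $ l)" for k l
  proof -
    have 1: "continuous_on (cball x0 (R/4)) adiag" by (rule linear_continuous_on[OF bounded_linear_adiag])
    have 2: "continuous_on (bidisc x0 R) (\<lambda>p. Lam_inv \<Psi> p $ k $ l)"
      by (rule smooth_on_continuous[OF AH_smooth[OF AH_Lam_inv[OF open_bidisc \<Psi> det_Lam]]])
    have "adiag ` cball x0 (R/4) \<subseteq> bidisc x0 R"
    proof (rule image_subsetI)
      fix y assume "y \<in> cball x0 (R/4)"
      then show "adiag y \<in> bidisc x0 R" by (intro adiag_in subsetD[OF sub])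
    qed
    then show ?thesis by (rule continuous_on_compose2[OF 2 1])
  qed
  have "\<exists>BM>0. \<forall>kl. \<forall>y\<in>cball x0 (R / 4). norm (Lam_inv \<Psi> (adiag y) $ fst kl $ snd kl) \<le> BM"
  proof (rule compact_norm_bound_finite[where f="\<lambda>kl y. Lam_inv \<Psi> (adiag y) $ fst kl $ snd kl", OF compact_cball cM])
    fix B assume "B > 0" "\<And>kl y. y \<in> cball x0 (R / 4) \<Longrightarrow> norm (Lam_inv \<Psi> (adiag y) $ fst kl $ snd kl) \<le> B"
    then show ?thesis by (intro exI[of _ B]) simp
  qed
  then obtain BM where BM: "BM > 0" "\<forall>kl. \<forall>y\<in>cball x0 (R / 4). norm (Lam_inv \<Psi> (adiag y) $ fst kl $ snd kl) \<le> BM"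
    by (elim exE conjE)
  \<comment> \<open>One unit for the first component, one for the conjugate part of the second, and
    the bound on \<open>Lam_inv\<close> for the rest.\<close>
  define B where "B = 2 + (real CARD('n))\<^sup>2 * BM"
  have B: "B \<ge> 1" unfolding B_def using BM(1) by simp
  have w: "mcon \<Psi> (s, t, y) - adiag y = (zvec t, - ((1 - s) *\<^sub>R vconj (zvec t) + s *\<^sub>R (Lam_inv \<Psi> (adiag y) *v vconj (zvec t))))" for s t y
    unfolding mcon_def by simp
  have lower: "norm t \<le> norm (mcon \<Psi> (s, t, y) - adiag y)" for s t y
    unfolding w using norm_fst_le[of "zvec t"] by simp
  have upper: "norm (mcon \<Psi> (s, t, y) - adiag y) \<le> B * norm t" if s: "s \<in> {0..1}" and y: "y \<in> cball x0 (R / 4)" for s t y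
  proof -
    have 1: "norm (Lam_inv \<Psi> (adiag y) *v vconj (zvec t)) \<le> (real CARD('n))\<^sup>2 * BM * norm t"
      using norm_matrix_vector_le[of "Lam_inv \<Psi> (adiag y)" BM "vconj (zvec t)"] BM(2)[rule_format, OF y, of "(_, _)"] by simp
    have "norm (mcon \<Psi> (s, t, y) - adiag y) \<le> norm (zvec t) + norm ((1 - s) *\<^sub>R vconj (zvec t) + s *\<^sub>R (Lam_inv \<Psi> (adiag y) *v vconj (zvec t)))"
      unfolding w using norm_Pair_le[of "zvec t"] by (metis norm_minus_cancel)
    also have "\<dots> \<le> norm t + ((1 - s) * norm t + s * norm (Lam_inv \<Psi> (adiag y) *v vconj (zvec t)))"
      using s norm_triangle_ineq[of "(1 - s) *\<^sub>R vconj (zvec t)" "s *\<^sub>R (Lam_inv \<Psi> (adiag y) *v vconj (zvec t))"] by simp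
    also have "\<dots> \<le> norm t + (1 * norm t + 1 * ((real CARD('n))\<^sup>2 * BM * norm t))"
      using s 1 by (intro add_mono mult_mono order_refl) auto
    also have "\<dots> = B * norm t" unfolding B_def by (simp add: algebra_simps)
    finally show ?thesis .
  qed
  define c1 where "c1 = min c0 1"
  have c1: "c1 > 0" "c1 \<le> c0" "c1 \<le> 1" unfolding c1_def using c0 by auto
  have B0: "B > 0" using B by simp
  \<comment> \<open>The first term keeps the contour within R / 8 of its base point, where Taylor's
    formula applies; the second bounds the cubic remainder by half of the quadratic part.\<close>
  define \<delta>0 where "\<delta>0 = min (R / (8 * B)) (c1 / (2 * (C + 1) * B ^ 3))"
  have d0: "\<delta>0 > 0" unfolding \<delta>0_def using R B0 C(1) c1 by (auto intro!: divide_pos_pos mult_pos_pos)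
  have d1: "B * \<delta>0 \<le> R / 8" unfolding \<delta>0_def using B0 R
  proof -
    have "B * min (R / (8 * B)) (c1 / (2 * (C + 1) * B ^ 3)) \<le> B * (R / (8 * B))" using B0 by (intro mult_left_mono) auto
    then show "B * min (R / (8 * B)) (c1 / (2 * (C + 1) * B ^ 3)) \<le> R / 8" using B0 by simp
  qed
  have d2: "C * B ^ 3 * \<delta>0 \<le> c1 / 2"
  proof -
    have "(C + 1) * B ^ 3 * \<delta>0 \<le> (C + 1) * B ^ 3 * (c1 / (2 * (C + 1) * B ^ 3))"
      unfolding \<delta>0_def using B0 C(1) by (intro mult_left_mono) auto
    also have "\<dots> = c1 / 2"
    proof -
      have "a * X * (c1 / (2 * a * X)) = c1 / 2" if "a \<noteq> 0" "X \<noteq> 0" for a X :: real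
        using that by simp
      moreover have "C + 1 \<noteq> 0" "B ^ 3 \<noteq> 0" using B0 C(1) by auto
      ultimately show ?thesis by blast
    qed
    finally have "(C + 1) * B ^ 3 * \<delta>0 \<le> c1 / 2" .
    moreover have "C * B ^ 3 * \<delta>0 \<le> (C + 1) * B ^ 3 * \<delta>0" using B0 C(1) d0 by (intro mult_right_mono) auto
    ultimately show ?thesis by simp
  qed
  have small: "norm (mcon \<Psi> (s, t, y) - adiag y) \<le> R / 8" if "s \<in> {0..1}" "y \<in> cball x0 (R / 4)" "norm t \<le> \<delta>0" for s t y
    using upper[OF that(1,2), of t] d1 mult_left_mono[OF that(3), of B] B0 by linarith
  have inW: "mcon \<Psi> (s, t, y) \<in> bidisc x0 R" if "s \<in> {0..1}" "y \<in> cball x0 (R / 4)" "norm t \<le> \<delta>0" for s t y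
  proof -
    have "adiag y + (mcon \<Psi> (s, t, y) - adiag y) \<in> cball x0 (R/2) \<times> cball (vconj x0) (R/2)"
      by (rule adiag_add_in_cbidisc) (use that small[OF that] R in \<open>auto simp: dist_norm norm_minus_commute\<close>)
    then show ?thesis using R2 unfolding bidisc_def by auto
  qed
  have re: "Re (phase \<Psi> (adiag y) (mcon \<Psi> (s, t, y))) \<le> - (c1 / (2 * B\<^sup>2)) * (norm (mcon \<Psi> (s, t, y) - adiag y))\<^sup>2"
    if s: "s \<in> {0..1}" and y: "y \<in> cball x0 (R / 4)" and t: "norm t \<le> \<delta>0" for s t y
  proof -
    define w where "w = mcon \<Psi> (s, t, y) - adiag y"
    have yb: "y \<in> ball x0 R" using y sub by blast
    have we: "fst w = zvec t" "snd w = - ((1 - s) *\<^sub>R vconj (zvec t) + s *\<^sub>R (Lam_inv \<Psi> (adiag y) *v vconj (zvec t)))"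
      unfolding w_def w by simp_all
    have E: "norm (phase \<Psi> (adiag y) (adiag y + w) - bil \<Psi> (adiag y) (fst w) (snd w)) \<le> C * norm w ^ 3"
      by (rule C(2)) (use y small[OF s y t] R in \<open>auto simp: dist_norm norm_minus_commute w_def\<close>)
    have "bil \<Psi> (adiag y) (fst w) (snd w) = - (of_real (1 - s) * bil \<Psi> (adiag y) (zvec t) (vconj (zvec t)) + of_real s * of_real ((norm t)\<^sup>2))"
      unfolding we bil_linear bil_Lam_inv[OF det_Lam[OF adiag_in[OF yb]]] by simp
    then have "Re (bil \<Psi> (adiag y) (fst w) (snd w)) = - ((1 - s) * Re (bil \<Psi> (adiag y) (zvec t) (vconj (zvec t))) + s * (norm t)\<^sup>2)"
      by simp
    also have "\<dots> \<le> - ((1 - s) * (c1 * (norm t)\<^sup>2) + s * (c1 * (norm t)\<^sup>2))"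
    proof -
      have "c1 * (norm t)\<^sup>2 \<le> c0 * (norm (zvec t))\<^sup>2" using c1 by (simp add: mult_right_mono)
      also have "\<dots> \<le> Re (bil \<Psi> (adiag y) (zvec t) (vconj (zvec t)))" by (rule pos[OF yb])
      finally have 1: "c1 * (norm t)\<^sup>2 \<le> Re (bil \<Psi> (adiag y) (zvec t) (vconj (zvec t)))" .
      have 2: "c1 * (norm t)\<^sup>2 \<le> (norm t)\<^sup>2" using c1 by (simp add: mult_left_le_one_le)
      show ?thesis using mult_left_mono[OF 1, of "1 - s"] mult_left_mono[OF 2, of s] s by simp
    qed
    also have "\<dots> = - c1 * (norm t)\<^sup>2" by (simp add: algebra_simps)
    finally have q: "Re (bil \<Psi> (adiag y) (fst w) (snd w)) \<le> - c1 * (norm t)\<^sup>2" .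
    have "C * norm w ^ 3 \<le> C * (B * norm t) ^ 3"
      unfolding w_def by (intro mult_left_mono power_mono upper s y C(1)) auto
    also have "\<dots> = (C * B ^ 3 * norm t) * (norm t)\<^sup>2" by (simp add: power_mult_distrib power3_eq_cube power2_eq_square)
    also have "\<dots> \<le> (c1 / 2) * (norm t)\<^sup>2"
    proof (rule mult_right_mono)
      have "C * B ^ 3 * norm t \<le> C * B ^ 3 * \<delta>0" using t C(1) B0 by (intro mult_left_mono) auto
      then show "C * B ^ 3 * norm t \<le> c1 / 2" using d2 by linarith
    qed simp
    finally have e: "C * norm w ^ 3 \<le> (c1 / 2) * (norm t)\<^sup>2" .
    have "Re (phase \<Psi> (adiag y) (adiag y + w)) - Re (bil \<Psi> (adiag y) (fst w) (snd w)) \<le> C * norm w ^ 3"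
      using E complex_Re_le_cmod[of "phase \<Psi> (adiag y) (adiag y + w) - bil \<Psi> (adiag y) (fst w) (snd w)"] by simp
    then have "Re (phase \<Psi> (adiag y) (adiag y + w)) \<le> - (c1 / 2) * (norm t)\<^sup>2" using q e by simp
    moreover have "(c1 / (2 * B\<^sup>2)) * (norm w)\<^sup>2 \<le> (c1 / 2) * (norm t)\<^sup>2"
    proof -
      have "(norm w)\<^sup>2 \<le> (B * norm t)\<^sup>2" unfolding w_def by (intro power_mono upper s y) auto
      then have "(c1 / (2 * B\<^sup>2)) * (norm w)\<^sup>2 \<le> (c1 / (2 * B\<^sup>2)) * (B * norm t)\<^sup>2" using c1 by (intro mult_left_mono) auto
      also have "\<dots> = (c1 / 2) * (norm t)\<^sup>2" using B0 by (simp add: power_mult_distrib)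
      finally show ?thesis .
    qed
    ultimately show ?thesis unfolding w_def by simp
  qed
  have "1 * \<delta>0 \<le> B * \<delta>0" by (rule mult_right_mono[OF B]) (use d0 in simp)
  then have d3: "\<delta>0 \<le> R / 8" using d1 R by linarith
  show ?thesis
    by (rule that[OF B _ d0 d3 upper lower inW re]) (use c1 B0 in auto)
qed

text \<open>Stokes between the affine contour at s = 0 and the adapted one at s = 1. The lower bound
  \<open>norm t\<close> for the distance gives the separation from the base point.\<close>

lemma mcon_deformation:
  obtains \<delta>0 where "\<delta>0 > 0"
    "\<And>\<delta> b N. 0 < \<delta> \<Longrightarrow> \<delta> \<le> \<delta>0 \<Longrightarrow> AH (bidisc x0 R) b \<Longrightarrow>
      \<exists>C. \<forall>h\<in>{0<..1}. \<forall>y\<in>cball x0 (R / 4). norm (cut_int \<Psi> (mcon \<Psi>) \<delta> b h 1 y - cut_int \<Psi> (mcon \<Psi>) \<delta> b h 0 y) \<le> C * h ^ N"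
proof (rule mcon_bounds)
  fix B c \<delta>0 :: real
  assume B: "B \<ge> 1" "c > 0" "\<delta>0 > 0"
    and lower: "\<And>s t y. norm t \<le> norm (mcon \<Psi> (s, t, y) - adiag y)"
    and inW: "\<And>s t y. s \<in> {0..1} \<Longrightarrow> y \<in> cball x0 (R / 4) \<Longrightarrow> norm t \<le> \<delta>0 \<Longrightarrow> mcon \<Psi> (s, t, y) \<in> bidisc x0 R"
    and re: "\<And>s t y. s \<in> {0..1} \<Longrightarrow> y \<in> cball x0 (R / 4) \<Longrightarrow> norm t \<le> \<delta>0 \<Longrightarrow>
      Re (phase \<Psi> (adiag y) (mcon \<Psi> (s, t, y))) \<le> - c * (norm (mcon \<Psi> (s, t, y) - adiag y))\<^sup>2"
  let ?S0 = "UNIV \<times> UNIV \<times> ball x0 R :: (real \<times> (real^('n + 'n)) \<times> (complex^'n)) set"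
  let ?S = "?S0 \<inter> mcon \<Psi> -` bidisc x0 R"
  have oS: "open ?S" using continuous_open_preimage[OF smooth_on_continuous[OF smooth_on_mcon] _ open_bidisc]
    by (simp add: open_Times)
  have ct: "cball x0 (R / 4) \<subseteq> ball x0 R" using R by auto
  show thesis
  proof (rule that[OF B(3)])
    fix \<delta> b N assume \<delta>: "0 < \<delta>" "\<delta> \<le> \<delta>0" and b: "AH (bidisc x0 R) b"
    show "\<exists>C. \<forall>h\<in>{0<..1}. \<forall>y\<in>cball x0 (R / 4). norm (cut_int \<Psi> (mcon \<Psi>) \<delta> b h 1 y - cut_int \<Psi> (mcon \<Psi>) \<delta> b h 0 y) \<le> C * h ^ N"
    proof (rule uniform_stokes[OF \<Psi> b oS _ _ _ \<delta>(1) compact_cball ct B(2)])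
      show "smooth_on ?S (mcon \<Psi>)" by (rule smooth_on_subset[OF smooth_on_mcon]) auto
      show "{0..1} \<times> cball 0 \<delta> \<times> cball x0 (R / 4) \<subseteq> ?S"
        using ct inW \<delta>(2) by auto
      show "mcon \<Psi> ` ?S \<subseteq> bidisc x0 R" by auto
      show "Re (phase \<Psi> (adiag y) (mcon \<Psi> (s, t, y))) \<le> - c * (norm (mcon \<Psi> (s, t, y) - adiag y))\<^sup>2"
        if "s \<in> {0..1}" "norm t \<le> \<delta>" "y \<in> cball x0 (R / 4)" for s t y
        by (rule re[OF that(1,3)]) (use that(2) \<delta>(2) in simp)
      show "mcon \<Psi> (s, t, y) \<noteq> adiag y" if "t \<noteq> 0" for s t y using lower[of t s y] that by auto
    qed
  qed
qed

end

section \<open>Reduction to the adapted contour\<close>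

lemma dd_slice1:
  assumes "\<Gamma> differentiable at (s, t, y)"
  shows "dd v (\<lambda>t. \<Gamma> (s, t, y)) t = dd (0, v, 0) \<Gamma> (s, t, y)"
proof (rule dd_eqI)
  have 1: "((\<lambda>t. (s, t, y)) has_derivative (\<lambda>v. (0, v, 0))) (at t)"
    by (auto intro!: derivative_eq_intros)
  show "((\<lambda>t. \<Gamma> (s, t, y)) has_derivative (\<lambda>v. dd (0, v, 0) \<Gamma> (s, t, y))) (at t)"
    using diff_chain_at[OF 1 has_derivative_dd[OF assms]] by (simp only: o_def)
qed

lemma pull_jac_slice:
  assumes "\<Gamma> differentiable at (s, t, y)"
  shows "pull_jac \<Gamma> cdir (s, t, y) = pull_jac (\<lambda>t. \<Gamma> (s, t, y)) (\<lambda>k. axis k 1) t"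
  unfolding pull_jac_def rv_def cdir_def dd_slice1[OF assms] ..

lemma pull_jac_cong_open:
  assumes "open U" "\<And>t. t \<in> U \<Longrightarrow> f t = g t" "t \<in> U"
  shows "pull_jac f e t = pull_jac g e t"
  unfolding pull_jac_def rv_def using dd_cong_open[OF assms] by (simp only:)

lemma contour_jacobian_pull_jac: "contour_jacobian \<gamma> p t = pull_jac (\<lambda>s. \<gamma> (s, p)) (\<lambda>k. axis k 1) t"
proof -
  have "(\<chi> i k. let w = frechet_derivative (\<lambda>s. \<gamma> (s, p)) (at t) (axis k 1)
                 in case i of Inl j \<Rightarrow> fst w $ j | Inr j \<Rightarrow> snd w $ j) =
    transpose (\<chi> k. rv (\<lambda>s. \<gamma> (s, p)) (axis k 1) t)"
    by (simp add: vec_eq_iff transpose_def rv_def crd_def dd_def Let_def)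
  then show ?thesis unfolding contour_jacobian_def pull_jac_def by (simp only: det_transpose)
qed

lemma dd_slice2:
  assumes "\<gamma> differentiable at (t, p)"
  shows "dd v (\<lambda>t. \<gamma> (t, p)) t = dd (v, 0) \<gamma> (t, p)"
proof (rule dd_eqI)
  have 1: "((\<lambda>t. (t, p)) has_derivative (\<lambda>v. (v, 0))) (at t)"
    by (auto intro!: derivative_eq_intros)
  show "((\<lambda>t. \<gamma> (t, p)) has_derivative (\<lambda>v. dd (v, 0) \<gamma> (t, p))) (at t)"
    using diff_chain_at[OF 1 has_derivative_dd[OF assms]] by (simp only: o_def)
qed

lemma set_integral_norm_le:
  fixes f :: "'a::euclidean_space \<Rightarrow> complex"
  assumes "open U" "bounded U" "set_integrable lborel U f" "\<And>t. t \<in> U \<Longrightarrow> norm (f t) \<le> B"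
  shows "norm (LINT t:U|lborel. f t) \<le> B * measure lborel U"
proof -
  have "emeasure lborel U < \<infinity>" by (rule emeasure_bounded_finite[OF assms(2)])
  then have i: "integrable lborel (\<lambda>t. indicator U t * B)" using assms(1) by simp
  have "norm (LINT t:U|lborel. f t) \<le> (LINT t|lborel. norm (indicator U t *\<^sub>R f t))"
    unfolding set_lebesgue_integral_def by (rule integral_norm_bound)
  also have "\<dots> \<le> (LINT t|lborel. indicator U t * B)"
  proof (rule integral_mono)
    show "integrable lborel (\<lambda>t. norm (indicator U t *\<^sub>R f t))"
      using assms(3) unfolding set_integrable_def by (rule integrable_norm)
    show "norm (indicator U t *\<^sub>R f t) \<le> indicator U t * B" for t
      using assms(4)[of t] by (cases "t \<in> U") auto
  qed (rule i)
  also have "\<dots> = B * measure lborel U" using assms(1) by simp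
  finally show ?thesis .
qed

lemma set_integrable_closure:
  fixes f :: "'a::euclidean_space \<Rightarrow> complex"
  assumes "open U" "bounded U" "continuous_on (closure U) f"
  shows "set_integrable lborel U f"
proof -
  have "compact (closure U)" using assms(2) by simp
  then have "set_integrable lborel (closure U) f"
    unfolding set_integrable_def using assms(3) by (rule borel_integrable_compact)
  then show ?thesis by (rule set_integrable_subset) (use assms(1) closure_subset in auto)
qed

section \<open>Cutting off the integral over a good contour\<close>

definition contour_cut_int :: "('n::finite cpair \<Rightarrow> complex) \<Rightarrow> ((real^('n + 'n)) \<times> 'n cpair \<Rightarrow> 'n cpair) \<Rightarrow>
    real \<Rightarrow> ('n cpair \<Rightarrow> complex) \<Rightarrow> real \<Rightarrow> complex^'n \<Rightarrow> complex" where
  "contour_cut_int \<Psi> \<gamma> \<delta> b h y = (LINT t|lborel. cut \<delta> t *\<^sub>R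
     (exp (2 / of_real h * phase \<Psi> (adiag y) (\<gamma> (t, adiag y))) * b (\<gamma> (t, adiag y)) * contour_jacobian \<gamma> (adiag y) t))"

text \<open>Where the cut-off equals 1, the error is the remainder of the symbol, and the
  exponential is bounded by 1. Away from t = 0 the roles change: the symbol is merely bounded and
  the exponential is small, because an embedding of the compact set \<open>closure U\<close> cannot
  return to its base point.\<close>

lemma contour_cutoff:
  fixes \<gamma> :: "(real^('n::finite + 'n)) \<times> 'n cpair \<Rightarrow> 'n cpair"
  assumes gc: "good_contour \<Psi> x0 (bidisc x0 r) U Y C \<gamma>" and cs: "classical_symbol (bidisc x0 r) a as"
    and s\<Psi>: "smooth_on (bidisc x0 r) \<Psi>"
    and \<delta>: "\<delta> > 0" "cball 0 \<delta> \<subseteq> U" and V: "compact V" "adiag ` V \<subseteq> Y" "V \<subseteq> ball x0 r"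
  shows "\<exists>M. \<forall>\<^sub>F h in at_right 0. \<forall>y\<in>V.
    norm ((LINT t:U|lborel. exp (2 / of_real h * phase \<Psi> (adiag y) (\<gamma> (t, adiag y))) * a h (\<gamma> (t, adiag y)) * contour_jacobian \<gamma> (adiag y) t)
      - (\<Sum>j<N. of_real h ^ j * contour_cut_int \<Psi> \<gamma> \<delta> (as j) h y)) \<le> M * h ^ N"
proof -
  let ?W = "bidisc x0 r"
  from gc obtain T where U: "open U" "bounded U" "0 \<in> U" "open Y" "C > 0"
    and T: "open T" "closure U \<subseteq> T" "smooth_on (T \<times> Y) \<gamma>"
    and g: "\<And>p. p \<in> Y \<Longrightarrow> \<gamma> (0, p) = p" "\<And>p. p \<in> Y \<Longrightarrow> inj_on (\<lambda>t. \<gamma> (t, p)) (closure U)"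
      "\<And>p t. p \<in> Y \<Longrightarrow> t \<in> closure U \<Longrightarrow> \<gamma> (t, p) \<in> ?W"
      "\<And>p t. p \<in> Y \<Longrightarrow> t \<in> closure U \<Longrightarrow> Re (phase \<Psi> p (\<gamma> (t, p))) \<le> - (1 / C) * (dist (\<gamma> (t, p)) p)\<^sup>2"
    unfolding good_contour_def by blast
  have UcU: "U \<subseteq> closure U" by (rule closure_subset)
  have oTY: "open (T \<times> Y)" by (intro open_Times T U)
  have cU: "compact (closure U)" using U(2) by simp
  define Z where "Z = closure U \<times> V"
  have cZ: "compact Z" unfolding Z_def by (intro compact_Times cU V)
  have VY: "adiag y \<in> Y" if "y \<in> V" for y using V(2) that by blast
  have cemb: "continuous_on Z (\<lambda>z. (fst z, adiag (snd z)))"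
    by (intro continuous_intros linear_continuous_on_compose[OF _ bounded_linear.linear[OF bounded_linear_adiag]])
  have emb: "(\<lambda>z. (fst z, adiag (snd z))) ` Z \<subseteq> T \<times> Y" unfolding Z_def using T(2) VY by auto
  have cg: "continuous_on Z (\<lambda>z. \<gamma> (fst z, adiag (snd z)))"
    by (rule continuous_on_compose2[OF smooth_on_continuous[OF T(3)] cemb emb])
  define K where "K = (\<lambda>z. \<gamma> (fst z, adiag (snd z))) ` Z"
  have K: "compact K" "K \<subseteq> ?W"
  proof -
    show "compact K" unfolding K_def by (rule compact_continuous_image[OF cg cZ])
    show "K \<subseteq> ?W" unfolding K_def
    proof (rule image_subsetI)
      fix z assume "z \<in> Z"
      then show "\<gamma> (fst z, adiag (snd z)) \<in> ?W" unfolding Z_def by (intro g(3) VY) auto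
    qed
  qed
  have Jeq: "contour_jacobian \<gamma> p t = pull_jac \<gamma> (\<lambda>k. (axis k 1, 0)) (t, p)" if "t \<in> T" "p \<in> Y" for t p
    unfolding contour_jacobian_pull_jac pull_jac_def rv_def
    using dd_slice2[OF smooth_on_diff[OF T(3)], of t p] that by simp
  have cJ: "continuous_on Z (\<lambda>z. pull_jac \<gamma> (\<lambda>k. (axis k 1, 0)) (fst z, adiag (snd z)))"
    by (rule continuous_on_compose2[OF smooth_on_continuous[OF smooth_on_pull_jac[OF oTY T(3)]] cemb emb])
  obtain BJ where BJ0: "BJ > 0" "\<And>z. z \<in> Z \<Longrightarrow> norm (pull_jac \<gamma> (\<lambda>k. (axis k 1, 0)) (fst z, adiag (snd z))) \<le> BJ"
    by (rule compact_norm_bound[OF cZ cJ]) (rule that)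
  have BJ: "norm (contour_jacobian \<gamma> (adiag y) t) \<le> BJ" if "t \<in> closure U" "y \<in> V" for t y
    using BJ0(2)[of "(t, y)"] Jeq[of t "adiag y"] that T(2) VY unfolding Z_def by auto
  \<comment> \<open>The parameters where the cut-off may differ from 1. Injectivity up to the
    closure keeps the contour off its base point here, and compactness makes the distance bounded
    below.\<close>
  define A where "A = (closure U - ball 0 (\<delta> / 2)) \<times> V"
  have AZ: "A \<subseteq> Z" unfolding A_def Z_def by auto
  have cA: "compact A" unfolding A_def by (intro compact_Times compact_diff cU open_ball V)
  have ca: "continuous_on A (\<lambda>z. (norm (\<gamma> (fst z, adiag (snd z)) - adiag (snd z)))\<^sup>2)"
    by (intro continuous_intros continuous_on_subset[OF cg AZ] linear_continuous_on_compose[OF _ bounded_linear.linear[OF bounded_linear_adiag]])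
  have pa: "(norm (\<gamma> (fst z, adiag (snd z)) - adiag (snd z)))\<^sup>2 > 0" if "z \<in> A" for z
  proof -
    obtain t y where z: "z = (t, y)" by (cases z)
    have t: "t \<in> closure U" "t \<noteq> 0" and y: "y \<in> V" using that \<delta>(1) unfolding z A_def by auto
    have "\<gamma> (t, adiag y) \<noteq> \<gamma> (0, adiag y)"
      using inj_onD[OF g(2)[OF VY[OF y]], of t 0] t UcU U(3) by blast
    then show ?thesis using g(1)[OF VY[OF y]] unfolding z by simp
  qed
  obtain \<mu> where \<mu>0: "\<mu> > 0" "\<And>z. z \<in> A \<Longrightarrow> \<mu> \<le> (norm (\<gamma> (fst z, adiag (snd z)) - adiag (snd z)))\<^sup>2"
    by (rule compact_pos_lower_bound[OF cA ca pa]) (assumption, rule that)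
  have \<mu>: "\<mu> \<le> (norm (\<gamma> (t, adiag y) - adiag y))\<^sup>2" if "t \<in> closure U" "norm t \<ge> \<delta> / 2" "y \<in> V" for t y
    using \<mu>0(2)[of "(t, y)"] that unfolding A_def by auto
  define Ce where "Ce = fact N / (2 / C * \<mu>) ^ N"
  have Ce: "Ce \<ge> 0" unfolding Ce_def using U(5) \<mu>0(1) by simp
  have "\<forall>N vs K. compact K \<and> K \<subseteq> ?W \<longrightarrow>
        (\<exists>C. \<forall>\<^sub>F h in at_right 0. \<forall>p\<in>K.
           norm (iter_deriv vs (\<lambda>q. a h q - (\<Sum>j<N. of_real h ^ j * as j q)) p) \<le> C * h ^ N)"
    using cs unfolding classical_symbol_def by blast
  \<comment> \<open>Order 0 of the symbol expansion, with its empty sum, provides the bound on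
    \<open>a h\<close> itself.\<close>
  from this[rule_format, of K "[]" N] this[rule_format, of K "[]" 0] K obtain Ca1 Cn1 where
    Cn1: "\<forall>\<^sub>F h in at_right 0. \<forall>p\<in>K. norm (a h p - (\<Sum>j<N. of_real h ^ j * as j p)) \<le> Cn1 * h ^ N"
    and Ca1: "\<forall>\<^sub>F h in at_right 0. \<forall>p\<in>K. norm (a h p) \<le> Ca1" by auto
  define Ca where "Ca = max Ca1 0"
  define Cn where "Cn = max Cn1 0"
  have sas: "smooth_on ?W (as j)" for j using cs unfolding classical_symbol_def by blast
  have sa: "\<forall>\<^sub>F h in at_right 0. smooth_on ?W (a h)" using cs unfolding classical_symbol_def by blast
  define M where "M = BJ * Cn + Ce * (BJ * (2 * Ca + Cn))"
  have h1: "\<forall>\<^sub>F h in at_right 0. h \<in> {0<..<1::real}" by (rule eventually_at_right_real) simp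
  have "\<forall>\<^sub>F h in at_right 0. \<forall>y\<in>V.
    norm ((LINT t:U|lborel. exp (2 / of_real h * phase \<Psi> (adiag y) (\<gamma> (t, adiag y))) * a h (\<gamma> (t, adiag y)) * contour_jacobian \<gamma> (adiag y) t)
      - (\<Sum>j<N. of_real h ^ j * contour_cut_int \<Psi> \<gamma> \<delta> (as j) h y)) \<le> M * measure lborel U * h ^ N"
    using h1 sa Cn1 Ca1
  proof eventually_elim
    case (elim h)
    have h: "h > 0" "h \<le> 1" using elim(1) by auto
    show ?case
    proof
      fix y assume y: "y \<in> V"
      define p where "p = adiag y"
      have pY: "p \<in> Y" unfolding p_def by (rule VY[OF y])
      have yb: "y \<in> ball x0 r" using V(3) y by blast
      define F where "F t = exp (2 / of_real h * phase \<Psi> p (\<gamma> (t, p)))" for t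
      define J where "J t = contour_jacobian \<gamma> p t" for t
      define S where "S q = (\<Sum>j<N. of_real h ^ j * as j q)" for q
      have ct: "continuous_on (closure U) (\<lambda>t. (t, y))" "(\<lambda>t. (t, y)) ` closure U \<subseteq> Z"
        unfolding Z_def using y by (auto intro!: continuous_intros)
      have cgt: "continuous_on (closure U) (\<lambda>t. \<gamma> (t, p))"
        using continuous_on_compose2[OF cg ct] unfolding p_def by simp
      have gW: "(\<lambda>t. \<gamma> (t, p)) ` closure U \<subseteq> ?W" using g(3)[OF pY] by blast
      have cJt: "continuous_on (closure U) J"
      proof -
        have "continuous_on (closure U) (\<lambda>t. pull_jac \<gamma> (\<lambda>k. (axis k 1, 0)) (t, p))"
          using continuous_on_compose2[OF cJ ct] unfolding p_def by simp
        then show ?thesis by (rule continuous_on_eq) (unfold J_def, rule Jeq[OF _ pY, symmetric], use T(2) in blast)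
      qed
      have cFt: "continuous_on (closure U) F" unfolding F_def
      proof (intro continuous_on_exp continuous_on_mult_left)
        have "smooth_on ?W (phase \<Psi> p)" unfolding p_def by (rule smooth_on_phase[OF s\<Psi> yb])
        then show "continuous_on (closure U) (\<lambda>t. phase \<Psi> p (\<gamma> (t, p)))"
          by (rule continuous_on_compose2[OF smooth_on_continuous cgt gW])
      qed
      have cb: "continuous_on (closure U) (\<lambda>t. b (\<gamma> (t, p)))" if "smooth_on ?W b" for b :: "'n cpair \<Rightarrow> complex"
        by (rule continuous_on_compose2[OF smooth_on_continuous[OF that] cgt gW])
      have i1: "set_integrable lborel U (\<lambda>t. F t * a h (\<gamma> (t, p)) * J t)"
        by (intro set_integrable_closure U continuous_on_mult cFt cJt cb elim(2))
      have i2: "set_integrable lborel U (\<lambda>t. cut \<delta> t *\<^sub>R (F t * as j (\<gamma> (t, p)) * J t))" for j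
        by (intro set_integrable_closure U continuous_on_scaleR cut_continuous continuous_on_mult cFt cJt cb sas)
      have cj: "contour_cut_int \<Psi> \<gamma> \<delta> (as j) h y = (LINT t:U|lborel. cut \<delta> t *\<^sub>R (F t * as j (\<gamma> (t, p)) * J t))" for j
      proof -
        have "cut \<delta> t *\<^sub>R X = indicator U t *\<^sub>R cut \<delta> t *\<^sub>R X" for t and X :: complex
        proof (cases "t \<in> U")
          case False
          then have "norm t \<ge> \<delta>" using \<delta>(2) by (meson linorder_le_cases mem_cball_0 subsetD)
          then show ?thesis using cut_outside(1)[OF \<delta>(1), of t] by simp
        qed simp
        then show ?thesis unfolding contour_cut_int_def set_lebesgue_integral_def F_def J_def p_def
          by (rule Bochner_Integration.integral_cong[OF refl])
      qed
      let ?D = "\<lambda>t. F t * a h (\<gamma> (t, p)) * J t - (\<Sum>j<N. of_real h ^ j * (cut \<delta> t *\<^sub>R (F t * as j (\<gamma> (t, p)) * J t)))"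
      have D: "?D t = F t * a h (\<gamma> (t, p)) * J t - cut \<delta> t *\<^sub>R (F t * S (\<gamma> (t, p)) * J t)" for t
        unfolding S_def by (simp add: sum_distrib_left sum_distrib_right scaleR_sum_right mult_ac)
      have i3: "set_integrable lborel U (\<lambda>t. of_real h ^ j * (cut \<delta> t *\<^sub>R (F t * as j (\<gamma> (t, p)) * J t)))" for j
        using i2[of j] by (rule set_integrable_mult_right) 
      have i4: "set_integrable lborel U (\<lambda>t. \<Sum>j<N. of_real h ^ j * (cut \<delta> t *\<^sub>R (F t * as j (\<gamma> (t, p)) * J t)))"
        using i3 unfolding set_integrable_def scaleR_sum_right by (intro Bochner_Integration.integrable_sum)
      have "(LINT t:U|lborel. ?D t) = (LINT t:U|lborel. F t * a h (\<gamma> (t, p)) * J t) -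
         (LINT t:U|lborel. \<Sum>j<N. of_real h ^ j * (cut \<delta> t *\<^sub>R (F t * as j (\<gamma> (t, p)) * J t)))"
        by (rule set_integral_diff(2)[OF i1 i4])
      also have "(LINT t:U|lborel. \<Sum>j<N. of_real h ^ j * (cut \<delta> t *\<^sub>R (F t * as j (\<gamma> (t, p)) * J t))) =
        (\<Sum>j<N. LINT t:U|lborel. of_real h ^ j * (cut \<delta> t *\<^sub>R (F t * as j (\<gamma> (t, p)) * J t)))"
        using i3 unfolding set_integrable_def set_lebesgue_integral_def scaleR_sum_right
        by (intro Bochner_Integration.integral_sum)
      also have "\<dots> = (\<Sum>j<N. of_real h ^ j * contour_cut_int \<Psi> \<gamma> \<delta> (as j) h y)"
        unfolding cj by (simp only: set_integral_mult_right)
      finally have eq: "(LINT t:U|lborel. F t * a h (\<gamma> (t, p)) * J t) - (\<Sum>j<N. of_real h ^ j * contour_cut_int \<Psi> \<gamma> \<delta> (as j) h y) = (LINT t:U|lborel. ?D t)"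
        by simp
      have bd: "norm (?D t) \<le> M * h ^ N" if t: "t \<in> U" for t
      proof -
        have tc: "t \<in> closure U" using t UcU by blast
        have qK: "\<gamma> (t, p) \<in> K" unfolding K_def p_def Z_def using tc y by force
        have Ph: "norm (F t) \<le> exp (- (2 / C * (norm (\<gamma> (t, p) - p))\<^sup>2 / h))"
        proof -
          have "Re (2 / of_real h * phase \<Psi> p (\<gamma> (t, p))) = 2 / h * Re (phase \<Psi> p (\<gamma> (t, p)))"
            by (simp flip: of_real_divide add: Re_divide_of_real mult.commute)
          also have "\<dots> \<le> 2 / h * (- (1 / C) * (norm (\<gamma> (t, p) - p))\<^sup>2)"
            by (intro mult_left_mono) (use g(4)[OF pY tc] h in \<open>auto simp: dist_norm\<close>)
          finally show ?thesis unfolding F_def norm_exp_eq_Re by (simp add: mult.commute)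
        qed
        have "0 \<le> 2 / C * (norm (\<gamma> (t, p) - p))\<^sup>2 / h" using U(5) h by simp
        then have F1: "norm (F t) \<le> 1" using Ph by (meson exp_le_one_iff neg_le_0_iff_le order_trans)
        have Jb: "norm (J t) \<le> BJ" unfolding J_def p_def by (rule BJ[OF tc y])
        have h01: "h ^ N \<le> 1" "0 \<le> h ^ N" using h by (auto intro: power_le_one)
        have Cn: "Cn \<ge> 0" "Ca \<ge> 0" unfolding Cn_def Ca_def by auto
        have n1: "norm (a h (\<gamma> (t, p)) - S (\<gamma> (t, p))) \<le> Cn * h ^ N"
          using elim(3) qK h01 unfolding S_def Cn_def by (meson max.cobounded1 mult_right_mono order_trans)
        have n2: "norm (a h (\<gamma> (t, p))) \<le> Ca" using elim(4) qK unfolding Ca_def by (meson max.coboundedI1)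
        have M0: "M \<ge> BJ * Cn" "M \<ge> Ce * (BJ * (2 * Ca + Cn))" unfolding M_def using BJ0(1) Cn Ce by auto
        show ?thesis
        proof (cases "norm t \<le> \<delta> / 2")
          case True
          have "?D t = F t * J t * (a h (\<gamma> (t, p)) - S (\<gamma> (t, p)))"
            unfolding D unfolding cut_inside(1)[OF \<delta>(1) True] by (simp add: algebra_simps)
          also have "norm \<dots> \<le> 1 * BJ * (Cn * h ^ N)"
            unfolding norm_mult by (intro mult_mono F1 Jb n1) (use BJ0(1) in auto)
          also have "\<dots> \<le> M * h ^ N" using mult_right_mono[OF M0(1) h01(2)] by (simp add: mult.assoc)
          finally show ?thesis .
        next
          case False
          have "norm (F t) \<le> exp (- (2 / C * \<mu> * 1 / h))"
          proof (rule order_trans[OF Ph])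
            have "\<mu> \<le> (norm (\<gamma> (t, p) - p))\<^sup>2" unfolding p_def by (rule \<mu>[OF tc _ y]) (use False in simp)
            then have "2 / C * \<mu> * 1 / h \<le> 2 / C * (norm (\<gamma> (t, p) - p))\<^sup>2 / h"
              using U(5) h by (intro divide_right_mono) (auto intro!: divide_right_mono)
            then show "exp (- (2 / C * (norm (\<gamma> (t, p) - p))\<^sup>2 / h)) \<le> exp (- (2 / C * \<mu> * 1 / h))" by simp
          qed
          also have "\<dots> = 1 ^ N * exp (- (2 / C * \<mu> * 1 / h))" by simp
          also have "\<dots> \<le> Ce * h ^ N" unfolding Ce_def by (rule power_exp_bound) (use U(5) \<mu>0(1) h in auto)
          finally have F2: "norm (F t) \<le> Ce * h ^ N" .
          have "norm (S (\<gamma> (t, p))) \<le> norm (a h (\<gamma> (t, p))) + norm (a h (\<gamma> (t, p)) - S (\<gamma> (t, p)))"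
            using norm_triangle_ineq4[of "a h (\<gamma> (t, p))" "a h (\<gamma> (t, p)) - S (\<gamma> (t, p))"] by simp
          also have "\<dots> \<le> Ca + Cn" using n1 n2 mult_left_mono[OF h01(1) Cn(1)] by simp
          finally have n3: "norm (S (\<gamma> (t, p))) \<le> Ca + Cn" .
          have "?D t = F t * (J t * (a h (\<gamma> (t, p)) - of_real (cut \<delta> t) * S (\<gamma> (t, p))))"
            unfolding D by (simp add: algebra_simps scaleR_conv_of_real)
          also have "norm \<dots> \<le> (Ce * h ^ N) * (BJ * (2 * Ca + Cn))"
          proof -
            have "norm (of_real (cut \<delta> t) * S (\<gamma> (t, p))) \<le> 1 * norm (S (\<gamma> (t, p)))"
              unfolding norm_mult by (rule mult_right_mono) (use cut_bounds[of \<delta> t] in auto)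
            then have "norm (a h (\<gamma> (t, p)) - of_real (cut \<delta> t) * S (\<gamma> (t, p))) \<le> 2 * Ca + Cn"
              using n2 n3 norm_triangle_ineq4[of "a h (\<gamma> (t, p))" "of_real (cut \<delta> t) * S (\<gamma> (t, p))"] by simp
            then show ?thesis unfolding norm_mult[of "F t"] norm_mult[of "J t"]
              by (intro mult_mono F2 Jb) (use BJ0(1) Ce h01 in auto)
          qed
          also have "\<dots> \<le> M * h ^ N" using mult_right_mono[OF M0(2) h01(2)] by (simp add: mult_ac)
          finally show ?thesis .
        qed
      qed
      have "norm (LINT t:U|lborel. ?D t) \<le> M * h ^ N * measure lborel U"
        by (rule set_integral_norm_le[OF U(1,2) set_integral_diff(1)[OF i1 i4] bd])
      then have "norm ((LINT t:U|lborel. F t * a h (\<gamma> (t, p)) * J t) - (\<Sum>j<N. of_real h ^ j * contour_cut_int \<Psi> \<gamma> \<delta> (as j) h y)) \<le> M * h ^ N * measure lborel U"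
        unfolding eq .
      then show "norm ((LINT t:U|lborel. exp (2 / of_real h * phase \<Psi> (adiag y) (\<gamma> (t, adiag y))) * a h (\<gamma> (t, adiag y)) * contour_jacobian \<gamma> (adiag y) t)
      - (\<Sum>j<N. of_real h ^ j * contour_cut_int \<Psi> \<gamma> \<delta> (as j) h y)) \<le> M * measure lborel U * h ^ N"
        unfolding F_def J_def p_def by (simp only: mult_ac)
    qed
  qed
  then show ?thesis by (rule exI)
qed

lemma mcon_0_affine: "mcon \<Psi> (0, t, y) = affine_contour (t, adiag y)"
  unfolding mcon_def adiag_def by (simp add: zvec_def Let_def)

text \<open>The deformation through good contours with one constant is exactly what
  \<open>uniform_stokes\<close> asks for. Its ends are known only over
  \<open>U' \<times> Y'\<close>; the radii are chosen to stay inside, with agreement on the open set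
  \<open>U'\<close> so that the Jacobians agree too.\<close>

lemma (in bergman_phase) deform_to_affine:
  assumes r: "R \<le> r" and \<Psi>r: "AH (bidisc x0 r) \<Psi>" and def: "deformable_to_affine \<Psi> x0 (bidisc x0 r) U Y \<gamma>"
  obtains \<delta>0 \<rho> where "\<delta>0 > 0" "0 < \<rho>" "\<rho> \<le> R / 4" "cball 0 \<delta>0 \<subseteq> U" "adiag ` cball x0 \<rho> \<subseteq> Y"
    "\<And>\<delta> b N. 0 < \<delta> \<Longrightarrow> \<delta> \<le> \<delta>0 \<Longrightarrow> AH (bidisc x0 r) b \<Longrightarrow>
      \<exists>C. \<forall>h\<in>{0<..1}. \<forall>y\<in>cball x0 \<rho>. norm (contour_cut_int \<Psi> \<gamma> \<delta> b h y - cut_int \<Psi> (mcon \<Psi>) \<delta> b h 0 y) \<le> C * h ^ N"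
proof -
  let ?W = "bidisc x0 r"
  from def obtain U' Y' C G I T where UY: "U' \<subseteq> U" "Y' \<subseteq> Y"
    and I: "open I" "{0..1} \<subseteq> I" and T: "open T" "closure U' \<subseteq> T"
    and sG: "smooth_on (I \<times> T \<times> Y') (\<lambda>(s::real, q). G s q)"
    and gc: "\<And>s. s \<in> {0..1} \<Longrightarrow> good_contour \<Psi> x0 ?W U' Y' C (G s)"
    and ends: "\<And>q. q \<in> U' \<times> Y' \<Longrightarrow> G 0 q = affine_contour q" "\<And>q. q \<in> U' \<times> Y' \<Longrightarrow> G 1 q = \<gamma> q"
    unfolding deformable_to_affine_def by blast
  have gc0: "good_contour \<Psi> x0 ?W U' Y' C (G 0)" by (rule gc) simp
  then have U': "open U'" "0 \<in> U'" "open Y'" "(x0, vconj x0) \<in> Y'" "C > 0" unfolding good_contour_def by blast+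
  have gcs: "G s (0, p) = p" "inj_on (\<lambda>t. G s (t, p)) (closure U')" "t \<in> closure U' \<Longrightarrow> G s (t, p) \<in> ?W"
    "t \<in> closure U' \<Longrightarrow> Re (phase \<Psi> p (G s (t, p))) \<le> - (1 / C) * (dist (G s (t, p)) p)\<^sup>2"
    if "s \<in> {0..1}" "p \<in> Y'" for s p t
    using gc[OF that(1)] that(2) unfolding good_contour_def by blast+
  obtain \<delta>0 where d0: "\<delta>0 > 0" "cball 0 \<delta>0 \<subseteq> U'" using U'(1,2) open_contains_cball by blast
  have ov: "open (adiag -` Y')"
    by (intro open_vimage U'(3) linear_continuous_on[OF bounded_linear_adiag])
  have "x0 \<in> adiag -` Y'" using U'(4) by (simp add: adiag_def)
  then obtain \<rho>1 where \<rho>1: "\<rho>1 > 0" "cball x0 \<rho>1 \<subseteq> adiag -` Y'" using ov open_contains_cball by blast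
  define \<rho> where "\<rho> = min \<rho>1 (R / 4)"
  have \<rho>: "0 < \<rho>" "\<rho> \<le> R / 4" "cball x0 \<rho> \<subseteq> adiag -` Y'" "cball x0 \<rho> \<subseteq> ball x0 r" "cball x0 \<rho> \<subseteq> ball x0 R"
    unfolding \<rho>_def using \<rho>1 R r by auto
  have yY: "adiag y \<in> Y'" if "y \<in> cball x0 \<rho>" for y using \<rho>(3) that by blast
  define \<Gamma> where "\<Gamma> = (\<lambda>\<zeta>::real \<times> (real^('n + 'n)) \<times> (complex^'n). (\<lambda>(s, q). G s q) (fst \<zeta>, fst (snd \<zeta>), adiag (snd (snd \<zeta>))))"
  have \<Gamma>: "\<Gamma> (s, t, y) = G s (t, adiag y)" for s t y unfolding \<Gamma>_def by simp
  define E where "E = (\<lambda>\<zeta>::real \<times> (real^('n + 'n)) \<times> (complex^'n). (fst \<zeta>, fst (snd \<zeta>), adiag (snd (snd \<zeta>))))"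
  have lE: "bounded_linear E" unfolding E_def
    by (intro bounded_linear_Pair bounded_linear_fst bounded_linear_compose[OF bounded_linear_fst]
         bounded_linear_compose[OF bounded_linear_adiag] bounded_linear_compose[OF bounded_linear_snd] bounded_linear_snd)
  define S1 where "S1 = E -` (I \<times> T \<times> Y')"
  have oITY: "open (I \<times> T \<times> Y')" by (intro open_Times I T U')
  have oS1: "open S1" unfolding S1_def by (intro open_vimage oITY linear_continuous_on[OF lE])
  have s1: "smooth_on S1 \<Gamma>" unfolding \<Gamma>_def
    by (rule smooth_on_compose[OF oS1 oITY smooth_on_linear[OF lE, unfolded E_def] sG]) (auto simp: S1_def E_def)
  \<comment> \<open>The deformation is known to take values in the bidisc only over
    \<open>closure U'\<close>; the preimage of the bidisc is an open set around the compact one that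
    is needed.\<close>
  define S where "S = S1 \<inter> \<Gamma> -` ?W"
  have oS: "open S" unfolding S_def by (rule continuous_open_preimage[OF smooth_on_continuous[OF s1] oS1 open_bidisc])
  have sS: "smooth_on S \<Gamma>" by (rule smooth_on_subset[OF s1]) (simp add: S_def)
  have sub: "{0..1} \<times> cball 0 \<delta> \<times> cball x0 \<rho> \<subseteq> S" if "\<delta> \<le> \<delta>0" for \<delta>
  proof
    fix \<zeta> :: "real \<times> (real^('n + 'n)) \<times> (complex^'n)" assume z: "\<zeta> \<in> {0..1} \<times> cball 0 \<delta> \<times> cball x0 \<rho>"
    obtain s t y where e: "\<zeta> = (s, t, y)" by (cases \<zeta>)
    have s: "s \<in> {0..1}" and t: "t \<in> cball 0 \<delta>" and y: "y \<in> cball x0 \<rho>" using z unfolding e by auto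
    have "t \<in> U'" using t that d0(2) by (meson cball_subset_cball_iff mem_cball_0 order_trans subsetD)
    then have tc: "t \<in> closure U'" using closure_subset by blast
    have "\<zeta> \<in> S1" unfolding S1_def E_def e using s I(2) tc T(2) yY[OF y] by auto
    moreover have "\<Gamma> \<zeta> \<in> ?W" unfolding e \<Gamma> by (rule gcs(3)[OF s yY[OF y] tc])
    ultimately show "\<zeta> \<in> S" unfolding S_def by simp
  qed
  show thesis
  proof (rule that[OF d0(1) \<rho>(1,2)])
    show "cball 0 \<delta>0 \<subseteq> U" using d0(2) UY(1) by blast
    show "adiag ` cball x0 \<rho> \<subseteq> Y" using yY UY(2) by blast
    fix \<delta> b N assume \<delta>: "0 < \<delta>" "\<delta> \<le> \<delta>0" and b: "AH ?W b"
    have tU: "t \<in> U'" if "norm t \<le> \<delta>" for t using that \<delta>(2) d0(2) by (meson mem_cball_0 order_trans subsetD)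
    have tcU: "t \<in> closure U'" if "norm t \<le> \<delta>" for t using tU[OF that] closure_subset by blast
    have iC: "1 / C > 0" using U'(5) by simp
    have "\<exists>C. \<forall>h\<in>{0<..1}. \<forall>y\<in>cball x0 \<rho>. norm (cut_int \<Psi> \<Gamma> \<delta> b h 1 y - cut_int \<Psi> \<Gamma> \<delta> b h 0 y) \<le> C * h ^ N"
    proof (rule uniform_stokes[OF \<Psi>r b oS sS sub[OF \<delta>(2)] _ \<delta>(1) compact_cball \<rho>(4) iC])
      show "\<Gamma> ` S \<subseteq> ?W" unfolding S_def by auto
      show "Re (phase \<Psi> (adiag y) (\<Gamma> (s, t, y))) \<le> - (1 / C) * (norm (\<Gamma> (s, t, y) - adiag y))\<^sup>2"
        if "s \<in> {0..1}" "norm t \<le> \<delta>" "y \<in> cball x0 \<rho>" for s t y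
        using gcs(4)[OF that(1) yY[OF that(3)] tcU[OF that(2)]] unfolding \<Gamma> dist_norm .
      show "\<Gamma> (s, t, y) \<noteq> adiag y" if "s \<in> {0..1}" "norm t \<le> \<delta>" "y \<in> cball x0 \<rho>" "t \<noteq> 0" for s t y
      proof
        assume "\<Gamma> (s, t, y) = adiag y"
        then have "G s (t, adiag y) = G s (0, adiag y)" unfolding \<Gamma> gcs(1)[OF that(1) yY[OF that(3)]] .
        moreover have "0 \<in> closure U'" using U'(2) closure_subset by blast
        ultimately show False using inj_onD[OF gcs(2)[OF that(1) yY[OF that(3)]], of t 0] tcU[OF that(2)] that(4) by blast
      qed
    qed
    moreover have "cut_int \<Psi> \<Gamma> \<delta> b h 1 y = contour_cut_int \<Psi> \<gamma> \<delta> b h y" if y: "y \<in> cball x0 \<rho>" for h y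
    proof -
      have eq: "cut \<delta> t *\<^sub>R (exp (2 / of_real h * phase \<Psi> (adiag y) (\<Gamma> (1, t, y))) * b (\<Gamma> (1, t, y)) * pull_jac \<Gamma> cdir (1, t, y)) =
        cut \<delta> t *\<^sub>R (exp (2 / of_real h * phase \<Psi> (adiag y) (\<gamma> (t, adiag y))) * b (\<gamma> (t, adiag y)) * contour_jacobian \<gamma> (adiag y) t)" for t
      proof (cases "norm t \<le> \<delta>")
        case True
        have S1: "(1, t, y) \<in> S" using sub[OF \<delta>(2)] True y by auto
        have "pull_jac \<Gamma> cdir (1, t, y) = pull_jac (\<lambda>t. \<Gamma> (1, t, y)) (\<lambda>k. axis k 1) t"
          by (rule pull_jac_slice[OF smooth_on_diff[OF sS S1]])
        also have "\<dots> = pull_jac (\<lambda>t. \<gamma> (t, adiag y)) (\<lambda>k. axis k 1) t"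
          by (rule pull_jac_cong_open[OF U'(1) _ tU[OF True]]) (use ends(2) yY[OF y] in \<open>simp add: \<Gamma>\<close>)
        finally have "pull_jac \<Gamma> cdir (1, t, y) = contour_jacobian \<gamma> (adiag y) t" unfolding contour_jacobian_pull_jac .
        moreover have "\<Gamma> (1, t, y) = \<gamma> (t, adiag y)" using ends(2) yY[OF y] tU[OF True] by (simp add: \<Gamma>)
        ultimately show ?thesis by simp
      next
        case False
        then show ?thesis using cut_outside(1)[OF \<delta>(1), of t] by simp
      qed
      show ?thesis unfolding cut_int_def contour_cut_int_def eq ..
    qed
    moreover have "cut_int \<Psi> \<Gamma> \<delta> b h 0 y = cut_int \<Psi> (mcon \<Psi>) \<delta> b h 0 y" if y: "y \<in> cball x0 \<rho>" for h y
    proof -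
      have eq: "cut \<delta> t *\<^sub>R (exp (2 / of_real h * phase \<Psi> (adiag y) (\<Gamma> (0, t, y))) * b (\<Gamma> (0, t, y)) * pull_jac \<Gamma> cdir (0, t, y)) =
        cut \<delta> t *\<^sub>R (exp (2 / of_real h * phase \<Psi> (adiag y) (mcon \<Psi> (0, t, y))) * b (mcon \<Psi> (0, t, y)) * pull_jac (mcon \<Psi>) cdir (0, t, y))" for t
      proof (cases "norm t \<le> \<delta>")
        case True
        have S1: "(0, t, y) \<in> S" using sub[OF \<delta>(2)] True y by auto
        have yR: "y \<in> ball x0 R" using y \<rho>(5) by blast
        have "pull_jac \<Gamma> cdir (0, t, y) = pull_jac (\<lambda>t. \<Gamma> (0, t, y)) (\<lambda>k. axis k 1) t"
          by (rule pull_jac_slice[OF smooth_on_diff[OF sS S1]])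
        also have "\<dots> = pull_jac (\<lambda>t. mcon \<Psi> (0, t, y)) (\<lambda>k. axis k 1) t"
          by (rule pull_jac_cong_open[OF U'(1) _ tU[OF True]]) (use ends(1) yY[OF y] in \<open>simp add: \<Gamma> mcon_0_affine\<close>)
        also have "\<dots> = pull_jac (mcon \<Psi>) cdir (0, t, y)"
          by (rule pull_jac_slice[OF smooth_on_diff[OF smooth_on_mcon], symmetric]) (use yR in auto)
        finally have "pull_jac \<Gamma> cdir (0, t, y) = pull_jac (mcon \<Psi>) cdir (0, t, y)" .
        moreover have "\<Gamma> (0, t, y) = mcon \<Psi> (0, t, y)" using ends(1) yY[OF y] tU[OF True] by (simp add: \<Gamma> mcon_0_affine)
        ultimately show ?thesis by simp
      next
        case False
        then show ?thesis using cut_outside(1)[OF \<delta>(1), of t] by simp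
      qed
      show ?thesis unfolding cut_int_def eq ..
    qed
    ultimately show "\<exists>C. \<forall>h\<in>{0<..1}. \<forall>y\<in>cball x0 \<rho>. norm (contour_cut_int \<Psi> \<gamma> \<delta> b h y - cut_int \<Psi> (mcon \<Psi>) \<delta> b h 0 y) \<le> C * h ^ N"
      by simp
  qed
qed

text \<open>Taken at s = 1, along the adapted contour, and with the power of \<open>h\<close> in
  front restored.\<close>

definition model_int :: "('n::finite cpair \<Rightarrow> complex) \<Rightarrow> real \<Rightarrow> ('n cpair \<Rightarrow> complex) \<Rightarrow> real \<Rightarrow> complex^'n \<Rightarrow> complex" where
  "model_int \<Psi> \<delta> b h y = cut_int \<Psi> (mcon \<Psi>) \<delta> b h 1 y / of_real h ^ CARD('n)"

text \<open>The affine contour is the common end of two deformations, one from the given contour and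
  one from the adapted one. The right-hand side no longer involves the given contour.\<close>

lemma (in bergman_phase) contour_reduction:
  assumes r: "R \<le> r" and \<Psi>r: "AH (bidisc x0 r) \<Psi>"
    and cs: "classical_symbol (bidisc x0 r) a as" and as: "\<And>j. AH (bidisc x0 r) (as j)"
    and gc: "oriented_good_contour \<Psi> x0 (bidisc x0 r) U Y \<gamma>"
  obtains \<delta>0 \<rho> where "\<delta>0 > 0" "\<rho> > 0" "\<rho> \<le> R / 4" "adiag ` cball x0 \<rho> \<subseteq> Y"
    "\<And>\<delta> N. 0 < \<delta> \<Longrightarrow> \<delta> \<le> \<delta>0 \<Longrightarrow> \<exists>C. \<forall>\<^sub>F h in at_right 0. \<forall>y\<in>cball x0 \<rho>.
      norm (contour_op \<Psi> U \<gamma> a h (adiag y) - (\<Sum>j<N + CARD('n). of_real h ^ j * model_int \<Psi> \<delta> (as j) h y)) \<le> C * h ^ N"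
proof -
  let ?W = "bidisc x0 r"
  let ?n = "CARD('n)"
  have def: "deformable_to_affine \<Psi> x0 ?W U Y \<gamma>" using gc unfolding oriented_good_contour_def by blast
  obtain Cg where gcC: "good_contour \<Psi> x0 ?W U Y Cg \<gamma>" using gc unfolding oriented_good_contour_def by blast
  show thesis
  proof (rule deform_to_affine[OF r \<Psi>r def])
    fix \<delta>1 \<rho> assume d1: "\<delta>1 > 0" and \<rho>: "0 < \<rho>" "\<rho> \<le> R / 4" and dU: "cball 0 \<delta>1 \<subseteq> U" and VY: "adiag ` cball x0 \<rho> \<subseteq> Y"
      and A: "\<And>\<delta> b N. 0 < \<delta> \<Longrightarrow> \<delta> \<le> \<delta>1 \<Longrightarrow> AH ?W b \<Longrightarrow>
      \<exists>C. \<forall>h\<in>{0<..1}. \<forall>y\<in>cball x0 \<rho>. norm (contour_cut_int \<Psi> \<gamma> \<delta> b h y - cut_int \<Psi> (mcon \<Psi>) \<delta> b h 0 y) \<le> C * h ^ N"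
    show thesis
    proof (rule mcon_deformation)
      fix \<delta>2 assume d2: "\<delta>2 > 0" and B: "\<And>\<delta> b N. 0 < \<delta> \<Longrightarrow> \<delta> \<le> \<delta>2 \<Longrightarrow> AH (bidisc x0 R) b \<Longrightarrow>
      \<exists>C. \<forall>h\<in>{0<..1}. \<forall>y\<in>cball x0 (R / 4). norm (cut_int \<Psi> (mcon \<Psi>) \<delta> b h 1 y - cut_int \<Psi> (mcon \<Psi>) \<delta> b h 0 y) \<le> C * h ^ N"
      show thesis
      proof (rule that[of "min \<delta>1 \<delta>2" \<rho>])
        show "min \<delta>1 \<delta>2 > 0" "\<rho> > 0" "\<rho> \<le> R / 4" "adiag ` cball x0 \<rho> \<subseteq> Y" using d1 d2 \<rho> VY by auto
        fix \<delta> N assume \<delta>: "0 < \<delta>" "\<delta> \<le> min \<delta>1 \<delta>2"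
        \<comment> \<open>The additional n orders compensate for the division by the n-th power of
          \<open>h\<close>.\<close>
        let ?M = "N + ?n"
        have dl: "\<delta> \<le> \<delta>1" "\<delta> \<le> \<delta>2" using \<delta>(2) by auto
        have cU: "cball 0 \<delta> \<subseteq> U" using dU dl(1) by (meson order_trans subset_cball)
        have Vr: "cball x0 \<rho> \<subseteq> ball x0 r" using \<rho> R r by auto
        have bR: "AH (bidisc x0 R) (as j)" for j by (rule AH_subset[OF as]) (use r in \<open>auto simp: mem_bidisc\<close>)
        obtain C1 where C1: "\<forall>\<^sub>F h in at_right 0. \<forall>y\<in>cball x0 \<rho>.
            norm ((LINT t:U|lborel. exp (2 / of_real h * phase \<Psi> (adiag y) (\<gamma> (t, adiag y))) * a h (\<gamma> (t, adiag y)) * contour_jacobian \<gamma> (adiag y) t)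
              - (\<Sum>j<?M. of_real h ^ j * contour_cut_int \<Psi> \<gamma> \<delta> (as j) h y)) \<le> C1 * h ^ ?M"
          using contour_cutoff[OF gcC cs AH_smooth[OF \<Psi>r] \<delta>(1) cU compact_cball VY Vr, of ?M] by (elim exE)
        have "\<forall>j. \<exists>C. \<forall>h\<in>{0<..1}. \<forall>y\<in>cball x0 \<rho>. norm (contour_cut_int \<Psi> \<gamma> \<delta> (as j) h y - cut_int \<Psi> (mcon \<Psi>) \<delta> (as j) h 1 y) \<le> C * h ^ ?M"
        proof
          fix j
          obtain Ca where Ca: "\<forall>h\<in>{0<..1}. \<forall>y\<in>cball x0 \<rho>. norm (contour_cut_int \<Psi> \<gamma> \<delta> (as j) h y - cut_int \<Psi> (mcon \<Psi>) \<delta> (as j) h 0 y) \<le> Ca * h ^ ?M"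
            using A[OF \<delta>(1) dl(1) as, of j ?M] by (elim exE)
          obtain Cb where Cb: "\<forall>h\<in>{0<..1}. \<forall>y\<in>cball x0 (R / 4). norm (cut_int \<Psi> (mcon \<Psi>) \<delta> (as j) h 1 y - cut_int \<Psi> (mcon \<Psi>) \<delta> (as j) h 0 y) \<le> Cb * h ^ ?M"
            using B[OF \<delta>(1) dl(2) bR, of j ?M] by (elim exE)
          show "\<exists>C. \<forall>h\<in>{0<..1}. \<forall>y\<in>cball x0 \<rho>. norm (contour_cut_int \<Psi> \<gamma> \<delta> (as j) h y - cut_int \<Psi> (mcon \<Psi>) \<delta> (as j) h 1 y) \<le> C * h ^ ?M"
          proof (intro exI[of _ "Ca + Cb"] ballI)
            fix h y assume h: "h \<in> {0<..1::real}" and y: "y \<in> cball x0 \<rho>"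
            have y4: "y \<in> cball x0 (R / 4)" using y \<rho>(2) by auto
            show "norm (contour_cut_int \<Psi> \<gamma> \<delta> (as j) h y - cut_int \<Psi> (mcon \<Psi>) \<delta> (as j) h 1 y) \<le> (Ca + Cb) * h ^ ?M"
              using Ca[rule_format, OF h y] Cb[rule_format, OF h y4]
                norm_triangle_ineq4[of "contour_cut_int \<Psi> \<gamma> \<delta> (as j) h y - cut_int \<Psi> (mcon \<Psi>) \<delta> (as j) h 0 y"
                  "cut_int \<Psi> (mcon \<Psi>) \<delta> (as j) h 1 y - cut_int \<Psi> (mcon \<Psi>) \<delta> (as j) h 0 y"]
              by (simp add: distrib_right)
          qed
        qed
        then obtain C2 where C2: "\<And>j h y. h \<in> {0<..1} \<Longrightarrow> y \<in> cball x0 \<rho> \<Longrightarrow>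
            norm (contour_cut_int \<Psi> \<gamma> \<delta> (as j) h y - cut_int \<Psi> (mcon \<Psi>) \<delta> (as j) h 1 y) \<le> C2 j * h ^ ?M" by metis
        have h1: "\<forall>\<^sub>F h in at_right 0. h \<in> {0<..<1::real}" by (rule eventually_at_right_real) simp
        show "\<exists>C. \<forall>\<^sub>F h in at_right 0. \<forall>y\<in>cball x0 \<rho>.
          norm (contour_op \<Psi> U \<gamma> a h (adiag y) - (\<Sum>j<?M. of_real h ^ j * model_int \<Psi> \<delta> (as j) h y)) \<le> C * h ^ N"
        proof (rule exI[of _ "C1 + (\<Sum>j<?M. C2 j)"], use h1 C1 in eventually_elim)
          case (elim h)
          have h: "h > 0" "h \<le> 1" "h \<in> {0<..1}" using elim(1) by auto
          show ?case
          proof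
            fix y assume y: "y \<in> cball x0 \<rho>"
            define X where "X = (LINT t:U|lborel. exp (2 / of_real h * phase \<Psi> (adiag y) (\<gamma> (t, adiag y))) * a h (\<gamma> (t, adiag y)) * contour_jacobian \<gamma> (adiag y) t)"
            have e1: "norm (X - (\<Sum>j<?M. of_real h ^ j * contour_cut_int \<Psi> \<gamma> \<delta> (as j) h y)) \<le> C1 * h ^ ?M"
              using elim(2) y unfolding X_def by blast
            have e2: "norm ((\<Sum>j<?M. of_real h ^ j * contour_cut_int \<Psi> \<gamma> \<delta> (as j) h y) - (\<Sum>j<?M. of_real h ^ j * cut_int \<Psi> (mcon \<Psi>) \<delta> (as j) h 1 y)) \<le> (\<Sum>j<?M. C2 j * h ^ ?M)"
              unfolding sum_subtractf[symmetric] right_diff_distrib[symmetric]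
            proof (rule sum_norm_le)
              fix j
              have "norm (of_real h ^ j * (contour_cut_int \<Psi> \<gamma> \<delta> (as j) h y - cut_int \<Psi> (mcon \<Psi>) \<delta> (as j) h 1 y)) \<le>
                1 * norm (contour_cut_int \<Psi> \<gamma> \<delta> (as j) h y - cut_int \<Psi> (mcon \<Psi>) \<delta> (as j) h 1 y)"
                unfolding norm_mult by (rule mult_right_mono) (use h in \<open>auto simp: norm_power intro: power_le_one\<close>)
              then show "norm (of_real h ^ j * (contour_cut_int \<Psi> \<gamma> \<delta> (as j) h y - cut_int \<Psi> (mcon \<Psi>) \<delta> (as j) h 1 y)) \<le> C2 j * h ^ ?M"
                using C2[OF h(3) y, of j] by simp
            qed
            have e3: "norm (X - (\<Sum>j<?M. of_real h ^ j * cut_int \<Psi> (mcon \<Psi>) \<delta> (as j) h 1 y)) \<le> (C1 + (\<Sum>j<?M. C2 j)) * h ^ ?M"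
              using e1 e2 norm_triangle_ineq[of "X - (\<Sum>j<?M. of_real h ^ j * contour_cut_int \<Psi> \<gamma> \<delta> (as j) h y)"
                "(\<Sum>j<?M. of_real h ^ j * contour_cut_int \<Psi> \<gamma> \<delta> (as j) h y) - (\<Sum>j<?M. of_real h ^ j * cut_int \<Psi> (mcon \<Psi>) \<delta> (as j) h 1 y)"]
              by (simp add: distrib_right sum_distrib_right)
            have "contour_op \<Psi> U \<gamma> a h (adiag y) - (\<Sum>j<?M. of_real h ^ j * model_int \<Psi> \<delta> (as j) h y) =
              (X - (\<Sum>j<?M. of_real h ^ j * cut_int \<Psi> (mcon \<Psi>) \<delta> (as j) h 1 y)) / of_real h ^ ?n"
              unfolding contour_op_def X_def[symmetric] model_int_def
              by (simp add: sum_divide_distrib diff_divide_distrib)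
            then have "norm (contour_op \<Psi> U \<gamma> a h (adiag y) - (\<Sum>j<?M. of_real h ^ j * model_int \<Psi> \<delta> (as j) h y)) =
              norm (X - (\<Sum>j<?M. of_real h ^ j * cut_int \<Psi> (mcon \<Psi>) \<delta> (as j) h 1 y)) / h ^ ?n"
              using h by (simp add: norm_divide norm_power)
            also have "\<dots> \<le> ((C1 + (\<Sum>j<?M. C2 j)) * h ^ ?M) / h ^ ?n"
              by (rule divide_right_mono[OF e3]) (use h in simp)
            also have "\<dots> = (C1 + (\<Sum>j<?M. C2 j)) * h ^ N" using h by (simp add: power_add)
            finally show "norm (contour_op \<Psi> U \<gamma> a h (adiag y) - (\<Sum>j<?M. of_real h ^ j * model_int \<Psi> \<delta> (as j) h y)) \<le> (C1 + (\<Sum>j<?M. C2 j)) * h ^ N" .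
          qed
        qed
      qed
    qed
  qed
qed

section \<open>The Jacobian of the adapted contour\<close>

text \<open>A permutation contributes only if it fixes every \<open>Inl\<close> index; those are the
  extensions by the identity of the permutations of the \<open>Inr\<close> indices, with the same
  sign.\<close>

lemma det_identity_block:
  fixes M :: "complex^'n^'n::finite"
  shows "det ((\<chi> i j. case i of Inl a \<Rightarrow> (case j of Inl b \<Rightarrow> if a = b then 1 else 0 | Inr _ \<Rightarrow> 0)
      | Inr a \<Rightarrow> (case j of Inl _ \<Rightarrow> 0 | Inr b \<Rightarrow> M $ a $ b)) :: complex^('n + 'n)^('n + 'n)) = det M"
proof -
  define B where "B i j = (case i of Inl a \<Rightarrow> (case j of Inl b \<Rightarrow> if a = b then 1 else 0 | Inr _ \<Rightarrow> 0)
      | Inr a \<Rightarrow> (case j of Inl _ \<Rightarrow> 0 | Inr b \<Rightarrow> M $ a $ b))" for i j :: "'n + 'n"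
  define F :: "('n \<Rightarrow> 'n) \<Rightarrow> 'n + 'n \<Rightarrow> 'n + 'n" where "F p = map_permutation UNIV Inr p" for p
  have F: "F p (Inl a) = Inl a" "F p (Inr a) = Inr (p a)" for p :: "'n \<Rightarrow> 'n" and a
    unfolding F_def map_permutation_def restrict_id_def by (auto simp: inv_f_f)
  let ?P = "{p. p permutes (UNIV :: 'n set)}" and ?Q = "{q. q permutes (UNIV :: ('n + 'n) set)}"
  have perm: "F p permutes UNIV" if "p permutes UNIV" for p
  proof -
    have "F p permutes (Inr ` UNIV)" unfolding F_def
      by (rule map_permutation_permutes[OF _ that]) (simp add: bij_betw_def)
    then show ?thesis by (rule permutes_subset) simp
  qed
  have injF: "inj_on F ?P"
  proof (rule inj_onI)
    fix p q assume "F p = F q"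
    then have "F p (Inr a) = F q (Inr a)" for a by simp
    then show "p = q" unfolding F by (auto simp: fun_eq_iff)
  qed
  have sgn: "sign (F p) = sign p" if "p permutes UNIV" for p
    unfolding F_def by (rule sign_map_permutation) (use that in auto)
  have split: "(\<Prod>i\<in>UNIV. g i) = (\<Prod>a\<in>UNIV. g (Inl a)) * (\<Prod>a\<in>UNIV. g (Inr a))" for g :: "'n + 'n \<Rightarrow> complex"
    unfolding UNIV_Plus_UNIV[symmetric] by (subst prod.Plus) auto
  have "det (\<chi> i j. B i j) = (\<Sum>q\<in>?Q. of_int (sign q) * (\<Prod>i\<in>UNIV. B i (q i)))"
    unfolding det_def by simp
  also have "\<dots> = (\<Sum>q\<in>F ` ?P. of_int (sign q) * (\<Prod>i\<in>UNIV. B i (q i)))"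
  proof (rule sum.mono_neutral_right)
    show "finite ?Q" by (rule finite_permutations) simp
    show "F ` ?P \<subseteq> ?Q" using perm by auto
    show "\<forall>q\<in>?Q - F ` ?P. of_int (sign q) * (\<Prod>i\<in>UNIV. B i (q i)) = 0"
    proof
      fix q assume q: "q \<in> ?Q - F ` ?P"
      then have qp: "q permutes UNIV" by simp
      have "(\<Prod>i\<in>UNIV. B i (q i)) = 0"
      proof (rule ccontr)
        assume nz: "(\<Prod>i\<in>UNIV. B i (q i)) \<noteq> 0"
        then have nzi: "B i (q i) \<noteq> 0" for i by simp
        have ql: "q (Inl a) = Inl a" for a
          using nzi[of "Inl a"] unfolding B_def by (auto split: sum.splits if_splits)
        have "\<exists>b. q (Inr a) = Inr b" for a
          using nzi[of "Inr a"] unfolding B_def by (auto split: sum.splits)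
        then obtain p where p: "\<And>a. q (Inr a) = Inr (p a)" by metis
        have "inj p" using permutes_inj[OF qp] p unfolding inj_def by (metis sum.inject(2))
        then have "bij p" using finite_UNIV_inj_surj[of p] by (simp add: bij_def)
        then have "p permutes UNIV" by (intro bij_imp_permutes) auto
        moreover have "q = F p"
        proof
          fix i show "q i = F p i" by (cases i) (simp_all add: ql p F)
        qed
        ultimately show False using q by auto
      qed
      then show "of_int (sign q) * (\<Prod>i\<in>UNIV. B i (q i)) = 0" by simp
    qed
  qed
  also have "\<dots> = (\<Sum>p\<in>?P. of_int (sign (F p)) * (\<Prod>i\<in>UNIV. B i (F p i)))"
    by (subst sum.reindex[OF injF]) simp
  also have "\<dots> = (\<Sum>p\<in>?P. of_int (sign p) * (\<Prod>a\<in>UNIV. M $ a $ p a))"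
    by (rule sum.cong[OF refl]) (simp add: sgn split F B_def)
  finally show ?thesis unfolding B_def det_def[of M] by simp
qed

text \<open>The Jacobian of the affine contour, independent of the base point and of t. The type
  argument records that it depends on the dimension alone.\<close>

definition affine_jac :: "'n::finite itself \<Rightarrow> complex" where
  "affine_jac _ = det (\<chi> k i. crd i (zvec (axis k 1), - vconj (zvec (axis k 1)) :: complex^'n))"

lemma zvec_axis: "zvec (axis (Inl l) 1) = axis l 1" "zvec (axis (Inr l) 1) = axis l \<i>"
  unfolding zvec_def by (auto simp: vec_eq_iff axis_def complex_eq_iff)

lemma vconj_axis: "vconj (axis l c) = axis l (cnj c)"
  unfolding vconj_def by (auto simp: vec_eq_iff axis_def)

lemma affine_jac_nonzero: "affine_jac TYPE('n::finite) \<noteq> 0"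
proof -
  define K :: "complex^('n+'n)^('n+'n)" where "K = (\<chi> k i. crd i (zvec (axis k 1), - vconj (zvec (axis k 1)) :: complex^'n))"
  \<comment> \<open>The inverse of K, found from the blocks with rows \<open>1, -1\<close> and
    \<open>\<i>, \<i>\<close> by inverting a two by two matrix.\<close>
  define L :: "complex^('n+'n)^('n+'n)" where "L = (\<chi> k i. case k of
      Inl a \<Rightarrow> (case i of Inl b \<Rightarrow> if a = b then 1/2 else 0 | Inr b \<Rightarrow> if a = b then - \<i>/2 else 0)
    | Inr a \<Rightarrow> (case i of Inl b \<Rightarrow> if a = b then - 1/2 else 0 | Inr b \<Rightarrow> if a = b then - \<i>/2 else 0))"
  have K: "K $ Inl a $ Inl b = (if a = b then 1 else 0)" "K $ Inl a $ Inr b = (if a = b then - 1 else 0)"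
    "K $ Inr a $ Inl b = (if a = b then \<i> else 0)" "K $ Inr a $ Inr b = (if a = b then \<i> else 0)" for a b
  proof -
    have ax: "axis a x $ b = (if a = b then x else 0)" for a b :: 'n and x :: complex by (simp add: axis_def)
    show "K $ Inl a $ Inl b = (if a = b then 1 else 0)" "K $ Inl a $ Inr b = (if a = b then - 1 else 0)"
      "K $ Inr a $ Inl b = (if a = b then \<i> else 0)" "K $ Inr a $ Inr b = (if a = b then \<i> else 0)"
      unfolding K_def by (simp_all add: crd_def zvec_axis vconj_axis ax)
  qed
  have L: "L $ Inl a $ Inl b = (if a = b then 1/2 else 0)" "L $ Inl a $ Inr b = (if a = b then - \<i>/2 else 0)"
    "L $ Inr a $ Inl b = (if a = b then - 1/2 else 0)" "L $ Inr a $ Inr b = (if a = b then - \<i>/2 else 0)" for a b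
    unfolding L_def by simp_all
  have "(K ** L) $ i $ j = mat 1 $ i $ j" for i j
  proof -
    have e: "(if a = b then x else 0) * (y :: complex) = (if a = b then x * y else 0)" for a b :: 'n and x y by simp
    show ?thesis
      by (cases i; cases j) (simp_all add: matrix_matrix_mult_def sum_UNIV_Plus K L mat_def e)
  qed
  then have "K ** L = mat 1" by (simp add: vec_eq_iff)
  then have "invertible K" using invertible_right_inverse by blast
  then show ?thesis unfolding affine_jac_def K_def[symmetric] invertible_det_nz .
qed

lemma pull_jac_linear:
  assumes "bounded_linear L"
  shows "pull_jac (\<lambda>t. c + L t) e t = det (\<chi> k. \<chi> i. crd i (L (e k)))"
proof -
  have "((\<lambda>t. c + L t) has_derivative L) (at t)" using bounded_linear_imp_has_derivative[OF assms]
    by (auto intro!: derivative_eq_intros)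
  then have "dd v (\<lambda>t. c + L t) t = L v" for v by (rule dd_eqI)
  then show ?thesis unfolding pull_jac_def rv_def by simp
qed

lemma bounded_linear_matrix_vec: "bounded_linear (\<lambda>x. (A :: complex^'n^'n::finite) *v x)"
proof -
  have "linear (\<lambda>x. A *v x)"
    by (rule linearI) (auto simp: matrix_vector_mult_def vec_eq_iff algebra_simps sum.distrib scaleR_sum_right)
  then show ?thesis by (simp add: linear_conv_bounded_linear)
qed

text \<open>At s = 1 the contour is linear in t: the affine contour followed by
  \<open>Lam_inv\<close> on the second group of variables. So the Jacobian is a product of
  determinants and constant in t.\<close>

lemma (in bergman_phase) pull_jac_mcon:
  assumes "y \<in> ball x0 R"
  shows "pull_jac (mcon \<Psi>) cdir (1, t, y) = affine_jac TYPE('n) * det (Lam_inv \<Psi> (adiag y))"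
proof -
  let ?M = "Lam_inv \<Psi> (adiag y)"
  have L: "bounded_linear (\<lambda>t. (zvec t, - (?M *v vconj (zvec t))))"
    by (intro bounded_linear_Pair bounded_linear_zvec bounded_linear_minus
         bounded_linear_compose[OF bounded_linear_matrix_vec] bounded_linear_compose[OF bounded_linear_vconj])
  have "pull_jac (mcon \<Psi>) cdir (1, t, y) = pull_jac (\<lambda>t. mcon \<Psi> (1, t, y)) (\<lambda>k. axis k 1) t"
    by (rule pull_jac_slice[OF smooth_on_diff[OF smooth_on_mcon]]) (use assms in auto)
  also have "(\<lambda>t. mcon \<Psi> (1, t, y)) = (\<lambda>t. adiag y + (zvec t, - (?M *v vconj (zvec t))))"
    unfolding mcon_def by simp
  also have "pull_jac \<dots> (\<lambda>k. axis k 1) t = det (\<chi> k. \<chi> i. crd i (zvec (axis k 1), - (?M *v vconj (zvec (axis k 1)))))"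
    by (rule pull_jac_linear[OF L])
  also have "(\<chi> k. \<chi> i. crd i (zvec (axis k 1), - (?M *v vconj (zvec (axis k 1))))) =
    (\<chi> k i. crd i (zvec (axis k 1), - vconj (zvec (axis k 1)) :: complex^'n)) **
    (\<chi> i j. case i of Inl a \<Rightarrow> (case j of Inl b \<Rightarrow> if a = b then 1 else 0 | Inr _ \<Rightarrow> 0)
      | Inr a \<Rightarrow> (case j of Inl _ \<Rightarrow> 0 | Inr b \<Rightarrow> transpose ?M $ a $ b))" (is "?X = ?Y")
  proof -
    have "?X $ k $ i = ?Y $ k $ i" for k i
    proof -
      have e: "x * (if a = b then 1 else 0) = (if a = b then x else 0)" for a b :: 'n and x :: complex by simp
      show ?thesis
        by (cases i) (simp_all add: matrix_matrix_mult_def sum_UNIV_Plus crd_def matrix_vector_mult_def transpose_def e sum_negf mult.commute)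
    qed
    then show ?thesis by (simp add: vec_eq_iff)
  qed
  also have "det \<dots> = affine_jac TYPE('n) * det ?M"
    unfolding det_mul det_identity_block det_transpose affine_jac_def ..
  finally show ?thesis .
qed

section \<open>Gaussian integrals\<close>

lemma integrable_gauss_real:
  assumes "c > 0"
  shows "integrable lborel (\<lambda>x::real. exp (- c * x\<^sup>2))"
proof -
  \<comment> \<open>The standard deviation for which the Gaussian is a multiple of the normal
    density.\<close>
  define s where "s = 1 / sqrt (2 * c)"
  have s: "s > 0" "s\<^sup>2 = 1 / (2 * c)" unfolding s_def using assms by (auto simp: power_divide)
  have "exp (- c * x\<^sup>2) = sqrt (2 * pi * s\<^sup>2) * normal_density 0 s x" for x
  proof -
    have "x\<^sup>2 / (2 * s\<^sup>2) = c * x\<^sup>2" unfolding s(2) using assms by simp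
    moreover have "sqrt (2 * pi * s\<^sup>2) \<noteq> 0" using s(1) by simp
    ultimately show ?thesis unfolding normal_density_def by (simp del: real_sqrt_eq_0_iff)
  qed
  then show ?thesis using s(1) by simp
qed

text \<open>Lebesgue measure is the image of a product measure over the basis, and the Gaussian is a
  product over the coordinates.\<close>

lemma integrable_gauss:
  assumes "c > 0"
  shows "integrable lborel (\<lambda>s::'a::euclidean_space. exp (- c * (norm s)\<^sup>2))"
proof -
  interpret product_sigma_finite "\<lambda>_::'a. lborel :: real measure"
    unfolding product_sigma_finite_def by (simp add: lborel.sigma_finite_measure_axioms)
  have i: "integrable (\<Pi>\<^sub>M b\<in>(Basis::'a set). lborel) (\<lambda>f. \<Prod>b\<in>(Basis::'a set). exp (- c * (f b)\<^sup>2))"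
    by (rule product_integrable_prod[OF finite_Basis integrable_gauss_real[OF assms]])
  have T: "(\<lambda>f. \<Sum>b\<in>Basis. f b *\<^sub>R b) \<in> (\<Pi>\<^sub>M b\<in>(Basis::'a set). lborel) \<rightarrow>\<^sub>M (borel :: 'a measure)"
  proof (intro borel_measurable_sum borel_measurable_scaleR borel_measurable_const)
    fix b :: 'a assume "b \<in> Basis"
    then have "(\<lambda>f. f b) \<in> (\<Pi>\<^sub>M b\<in>(Basis::'a set). lborel) \<rightarrow>\<^sub>M (lborel :: real measure)"
      by (rule measurable_component_singleton)
    then show "(\<lambda>f. f b) \<in> borel_measurable (\<Pi>\<^sub>M b\<in>(Basis::'a set). (lborel :: real measure))" by simp
  qed
  have e: "exp (- c * (norm (\<Sum>b\<in>(Basis::'a set). f b *\<^sub>R b))\<^sup>2) = (\<Prod>b\<in>(Basis::'a set). exp (- c * (f b)\<^sup>2))" for f :: "'a \<Rightarrow> real"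
  proof -
    define X where "X = (\<Sum>b\<in>(Basis::'a set). f b *\<^sub>R b)"
    have Xb: "X \<bullet> b = f b" if "b \<in> Basis" for b unfolding X_def by (rule inner_sum_left_Basis[OF that])
    have "(norm X)\<^sup>2 = (\<Sum>b\<in>Basis. (X \<bullet> b) * (X \<bullet> b))" unfolding power2_norm_eq_inner by (rule euclidean_inner)
    also have "\<dots> = (\<Sum>b\<in>Basis. (f b)\<^sup>2)" by (rule sum.cong) (simp_all add: Xb power2_eq_square)
    finally have "- c * (norm X)\<^sup>2 = (\<Sum>b\<in>Basis. - c * (f b)\<^sup>2)" by (simp add: sum_distrib_left)
    then show ?thesis unfolding X_def by (simp only: exp_sum[OF finite_Basis])
  qed
  have "integrable (distr (\<Pi>\<^sub>M b\<in>(Basis::'a set). lborel) borel (\<lambda>f. \<Sum>b\<in>Basis. f b *\<^sub>R b)) (\<lambda>s::'a. exp (- c * (norm s)\<^sup>2))"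
    by (subst integrable_distr_eq[OF T]) (use i in \<open>simp_all only: e, measurable\<close>)
  then show ?thesis unfolding lborel_eq[symmetric] .
qed

lemma integrable_gauss_power:
  assumes "c > 0"
  shows "integrable lborel (\<lambda>s::'a::euclidean_space. norm s ^ m * exp (- c * (norm s)\<^sup>2))"
proof -
  have c2: "c / 2 > 0" using assms by simp
  \<comment> \<open>One half of the exponent absorbs the power of the norm: 1 accounts for norms up
    to 1, and the rest comes from \<open>power_exp_bound\<close> with \<open>h = 1\<close>.\<close>
  define A where "A = 1 + fact m / (c / 2) ^ m"
  show ?thesis
  proof (rule Bochner_Integration.integrable_bound)
    show "integrable lborel (\<lambda>s::'a. A * exp (- (c / 2) * (norm s)\<^sup>2))"
      by (rule Bochner_Integration.integrable_mult_right) (rule integrable_gauss[OF c2])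
    show "(\<lambda>s::'a. norm s ^ m * exp (- c * (norm s)\<^sup>2)) \<in> borel_measurable lborel" by measurable
    have "norm s ^ m * exp (- c * (norm s)\<^sup>2) \<le> A * exp (- (c / 2) * (norm s)\<^sup>2)" for s :: 'a
    proof -
      let ?u = "(norm s)\<^sup>2"
      have "norm s ^ m \<le> 1 + ?u ^ m"
      proof (cases "norm s \<le> 1")
        case True
        then have "norm s ^ m \<le> 1" by (simp add: power_le_one)
        moreover have "0 \<le> ?u ^ m" by simp
        ultimately show ?thesis by linarith
      next
        case False
        then have "norm s ^ m \<le> norm s ^ (2 * m)" by (intro power_increasing) auto
        then show ?thesis by (simp add: power_mult)
      qed
      moreover have "?u ^ m * exp (- (c / 2 * ?u / 1)) \<le> fact m / (c / 2) ^ m * 1 ^ m"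
        by (rule power_exp_bound) (use c2 in auto)
      moreover have "1 * exp (- (c / 2 * ?u)) \<le> 1" using c2 by simp
      ultimately have "norm s ^ m * exp (- (c / 2 * ?u)) \<le> A"
      proof -
        have "norm s ^ m * exp (- (c / 2 * ?u)) \<le> (1 + ?u ^ m) * exp (- (c / 2 * ?u))"
          using \<open>norm s ^ m \<le> 1 + ?u ^ m\<close> by (rule mult_right_mono) simp
        also have "\<dots> = 1 * exp (- (c / 2 * ?u)) + ?u ^ m * exp (- (c / 2 * ?u))" by (simp add: distrib_right)
        also have "\<dots> \<le> 1 + fact m / (c / 2) ^ m"
        proof (rule add_mono)
          show "1 * exp (- (c / 2 * ?u)) \<le> 1" by fact
          show "?u ^ m * exp (- (c / 2 * ?u)) \<le> fact m / (c / 2) ^ m"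
            using \<open>?u ^ m * exp (- (c / 2 * ?u / 1)) \<le> fact m / (c / 2) ^ m * 1 ^ m\<close>
            by (simp only: div_by_1 power_one mult_1_right)
        qed
        also have "\<dots> = A" unfolding A_def ..
        finally show ?thesis .
      qed
      then have "(norm s ^ m * exp (- (c / 2 * ?u))) * exp (- (c / 2 * ?u)) \<le> A * exp (- (c / 2 * ?u))"
        by (rule mult_right_mono) simp
      moreover have "exp (- c * ?u) = exp (- (c / 2 * ?u)) * exp (- (c / 2 * ?u))"
        by (simp add: mult_exp_exp)
      ultimately show ?thesis by (simp add: mult.assoc)
    qed
    then show "AE s in lborel. norm (norm s ^ m * exp (- c * (norm s)\<^sup>2)) \<le> norm (A * exp (- (c / 2) * (norm (s::'a))\<^sup>2))"
      using c2 by (auto simp: A_def abs_mult intro!: AE_I2)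
  qed
qed

lemma lborel_integral_scale:
  fixes f :: "'a::euclidean_space \<Rightarrow> complex"
  assumes "\<epsilon> > 0" "f \<in> borel_measurable borel"
  shows "(LINT t|lborel. f t) = of_real (\<epsilon> ^ DIM('a)) * (LINT s|lborel. f (\<epsilon> *\<^sub>R s))"
proof -
  have "(LINT t|lborel. f t) = (LINT t|density (distr lborel borel (\<lambda>x. 0 + \<epsilon> *\<^sub>R x)) (\<lambda>_. ennreal (\<bar>\<epsilon>\<bar> ^ DIM('a))). f t)"
    using lborel_affine[of \<epsilon> "0::'a"] assms(1) by simp
  also have "\<dots> = (LINT t|distr lborel borel (\<lambda>x. \<epsilon> *\<^sub>R x). (\<epsilon> ^ DIM('a)) *\<^sub>R f t)"
    by (subst integral_density) (use assms in auto)
  also have "\<dots> = (LINT s|lborel. (\<epsilon> ^ DIM('a)) *\<^sub>R f (\<epsilon> *\<^sub>R s))"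
    by (rule integral_distr) (use assms in auto)
  finally show ?thesis by (simp add: scaleR_conv_of_real)
qed

lemma lborel_integral_reflect:
  fixes f :: "'a::euclidean_space \<Rightarrow> complex"
  assumes "f \<in> borel_measurable borel"
  shows "(LINT t|lborel. f t) = (LINT s|lborel. f (- s))"
proof -
  have "(LINT t|lborel. f t) = (LINT t|density (distr lborel borel (\<lambda>x. 0 + (-1) *\<^sub>R x)) (\<lambda>_. ennreal (\<bar>-1\<bar> ^ DIM('a))). f t)"
    using lborel_affine[of "-1" "0::'a"] by simp
  also have "\<dots> = (LINT t|distr lborel borel (\<lambda>x. - x). f t)"
    by (subst integral_density) (use assms in auto)
  also have "\<dots> = (LINT s|lborel. f (- s))"
    by (rule integral_distr) (use assms in auto)
  finally show ?thesis .
qed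

text \<open>The factor 2 in the weight is the 2 of \<open>2 / h\<close> in the exponent, once the
  quadratic part is minus the squared norm and t has been scaled by \<open>sqrt h\<close>.\<close>

definition gauss_int :: "('a::euclidean_space \<Rightarrow> complex) \<Rightarrow> complex" where
  "gauss_int q = (LINT s|lborel. exp (- 2 * (norm s)\<^sup>2) *\<^sub>R q s)"

section \<open>Homogeneous functions with almost holomorphic coefficients\<close>

text \<open>Sums of products of an almost holomorphic function of the base point and a homogeneous
  function of t, which need only be continuous. The separation of variables makes integration over t
  harmless for almost holomorphy, and homogeneity for all real factors includes parity.\<close>

inductive hpoly :: "'n::finite cpair set \<Rightarrow> nat \<Rightarrow> ('n cpair \<Rightarrow> real^('n + 'n) \<Rightarrow> complex) \<Rightarrow> bool" for W k where
  hpoly_term: "AH W c \<Longrightarrow> continuous_on UNIV q \<Longrightarrow> (\<And>\<tau> t. q (\<tau> *\<^sub>R t) = of_real \<tau> ^ k * q t) \<Longrightarrow> hpoly W k (\<lambda>p t. c p * q t)"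
| hpoly_add: "hpoly W k P \<Longrightarrow> hpoly W k Q \<Longrightarrow> hpoly W k (\<lambda>p t. P p t + Q p t)"

lemma hpoly_0 [simp]: "hpoly W k (\<lambda>_ _. 0)"
  using hpoly_term[of W "\<lambda>_. 0" "\<lambda>_. 0" k] by simp

lemma hpoly_sum: "(\<And>i. i \<in> I \<Longrightarrow> hpoly W k (P i)) \<Longrightarrow> hpoly W k (\<lambda>p t. \<Sum>i\<in>I. P i p t)"
  by (induction I rule: infinite_finite_induct) (auto intro!: hpoly_add)

lemma hpoly_mult_AH:
  assumes "open W" "AH W a"
  shows "hpoly W k P \<Longrightarrow> hpoly W k (\<lambda>p t. a p * P p t)"
proof (induction rule: hpoly.induct)
  case (hpoly_term c q)
  then have "hpoly W k (\<lambda>p t. (a p * c p) * q t)" by (intro hpoly.hpoly_term AH_mult assms)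
  then show ?case by (simp add: mult.assoc)
next
  case (hpoly_add P Q)
  then show ?case unfolding distrib_left by (intro hpoly.hpoly_add)
qed

lemma hpoly_cmult: "open W \<Longrightarrow> hpoly W k P \<Longrightarrow> hpoly W k (\<lambda>p t. c * P p t)"
  by (rule hpoly_mult_AH) auto

lemma hpoly_mult:
  assumes "open W"
  shows "hpoly W j P \<Longrightarrow> hpoly W k Q \<Longrightarrow> hpoly W (j + k) (\<lambda>p t. P p t * Q p t)"
proof (induction arbitrary: Q rule: hpoly.induct)
  case (hpoly_term c q)
  from hpoly_term(4) show ?case
  proof (induction rule: hpoly.induct)
    case (hpoly_term c' q')
    have "hpoly W (j + k) (\<lambda>p t. (c p * c' p) * (q t * q' t))"
      by (rule hpoly.hpoly_term) (use hpoly_term \<open>AH W c\<close> \<open>continuous_on UNIV q\<close> \<open>\<And>\<tau> t. q (\<tau> *\<^sub>R t) = of_real \<tau> ^ j * q t\<close>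
        in \<open>auto intro!: AH_mult assms continuous_on_mult simp: power_add\<close>)
    then show ?case by (simp add: mult_ac)
  next
    case (hpoly_add P Q)
    then show ?case unfolding distrib_left by (intro hpoly.hpoly_add)
  qed
next
  case (hpoly_add P P')
  then show ?case unfolding distrib_right by (intro hpoly.hpoly_add) auto
qed

lemma homogeneous_bound:
  fixes q :: "'a::euclidean_space \<Rightarrow> complex"
  assumes "continuous_on UNIV q" "\<And>\<tau> t. q (\<tau> *\<^sub>R t) = of_real \<tau> ^ k * q t"
  obtains C where "C \<ge> 0" "\<And>t. norm (q t) \<le> C * norm t ^ k"
proof -
  have c: "continuous_on (cball 0 1) q" using assms(1) continuous_on_subset by blast
  obtain C where C: "C > 0" "\<And>t. t \<in> cball 0 1 \<Longrightarrow> norm (q t) \<le> C"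
    by (rule compact_norm_bound[OF compact_cball c]) (rule that)
  have "norm (q t) \<le> C * norm t ^ k" for t
  proof (cases "t = 0")
    case True
    show ?thesis
    proof (cases "k = 0")
      case True
      then show ?thesis using C(2)[of t] \<open>t = 0\<close> by simp
    next
      case False
      then show ?thesis using assms(2)[of 0 t] \<open>t = 0\<close> by (simp add: power_0_left)
    qed
  next
    case False
    have "q t = of_real (norm t) ^ k * q (t /\<^sub>R norm t)"
      using assms(2)[of "norm t" "t /\<^sub>R norm t"] False by simp
    then have "norm (q t) = norm t ^ k * norm (q (t /\<^sub>R norm t))" by (simp add: norm_mult norm_power)
    also have "\<dots> \<le> norm t ^ k * C" by (intro mult_left_mono C(2)) (use False in auto)
    finally show ?thesis by (simp add: mult.commute)
  qed
  then show ?thesis using C(1) that[of C] by simp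
qed

lemma hpoly_homogeneous: "hpoly W k P \<Longrightarrow> P p (\<tau> *\<^sub>R t) = of_real \<tau> ^ k * P p t"
  by (induction rule: hpoly.induct) (auto simp: algebra_simps)

lemma hpoly_continuous: "hpoly W k P \<Longrightarrow> continuous_on UNIV (P p)"
  by (induction rule: hpoly.induct) (auto intro!: continuous_intros)

lemma hpoly_bound:
  assumes "compact K" "K \<subseteq> W"
  shows "hpoly W k P \<Longrightarrow> \<exists>C\<ge>0. \<forall>p\<in>K. \<forall>t. norm (P p t) \<le> C * norm t ^ k"
proof (induction rule: hpoly.induct)
  case (hpoly_term c q)
  obtain C where C: "C \<ge> 0" "\<And>t. norm (q t) \<le> C * norm t ^ k"
    by (rule homogeneous_bound[OF hpoly_term(2,3)]) (rule that)
  obtain B where B: "B > 0" "\<And>p. p \<in> K \<Longrightarrow> norm (c p) \<le> B"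
    by (rule compact_norm_bound[OF assms(1) continuous_on_subset[OF smooth_on_continuous[OF AH_smooth[OF hpoly_term(1)]] assms(2)]]) (rule that)
  have "norm (c p * q t) \<le> (B * C) * norm t ^ k" if "p \<in> K" for p t
  proof -
    have "norm (c p) * norm (q t) \<le> B * (C * norm t ^ k)"
      by (intro mult_mono B(2) C(2) that) (use B(1) in auto)
    then show ?thesis by (simp add: norm_mult)
  qed
  then show ?case using B(1) C(1) by (intro exI[of _ "B * C"]) auto
next
  case (hpoly_add P Q)
  then obtain C D where C: "C \<ge> 0" "\<forall>p\<in>K. \<forall>t. norm (P p t) \<le> C * norm t ^ k"
    and D: "D \<ge> 0" "\<forall>p\<in>K. \<forall>t. norm (Q p t) \<le> D * norm t ^ k" by (elim exE conjE)
  have "norm (P p t + Q p t) \<le> (C + D) * norm t ^ k" if "p \<in> K" for p t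
    unfolding distrib_right
    by (rule order_trans[OF norm_triangle_ineq add_mono]) (use C(2) D(2) that in auto)
  then show ?case using C(1) D(1) by (intro exI[of _ "C + D"]) auto
qed

lemma hpoly_integrable:
  "hpoly W k P \<Longrightarrow> integrable lborel (\<lambda>s. exp (- 2 * (norm s)\<^sup>2) *\<^sub>R P p s)"
proof (induction rule: hpoly.induct)
  case (hpoly_term c q)
  obtain C where C: "C \<ge> 0" "\<And>t. norm (q t) \<le> C * norm t ^ k"
    by (rule homogeneous_bound[OF hpoly_term(2,3)]) (rule that)
  have "integrable lborel (\<lambda>s. exp (- 2 * (norm s)\<^sup>2) *\<^sub>R q s)"
  proof (rule Bochner_Integration.integrable_bound)
    show "integrable lborel (\<lambda>s::real^('a+'a). C * (norm s ^ k * exp (- 2 * (norm s)\<^sup>2)))"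
      using integrable_gauss_power[of 2 k, where 'a="real^('a+'a)"] by simp
    have [measurable]: "q \<in> borel_measurable borel" by (rule borel_measurable_continuous_onI[OF hpoly_term(2)])
    show "(\<lambda>s. exp (- 2 * (norm s)\<^sup>2) *\<^sub>R q s) \<in> borel_measurable lborel" by measurable
    have "exp (- 2 * (norm s)\<^sup>2) * norm (q s) \<le> exp (- 2 * (norm s)\<^sup>2) * (C * norm s ^ k)" for s
      by (intro mult_left_mono C(2)) simp
    then show "AE s in lborel. norm (exp (- 2 * (norm s)\<^sup>2) *\<^sub>R q s) \<le> norm (C * (norm s ^ k * exp (- 2 * (norm s)\<^sup>2)))"
      using C(1) by (auto intro!: AE_I2 simp: mult_ac)
  qed
  then have "integrable lborel (\<lambda>s. c p * (exp (- 2 * (norm s)\<^sup>2) *\<^sub>R q s))" by (rule Bochner_Integration.integrable_mult_right)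
  then show ?case by simp
next
  case (hpoly_add P Q)
  then show ?case unfolding scaleR_add_right by (intro Bochner_Integration.integrable_add)
qed

text \<open>The integral acts on the t-factors alone and yields constants, so the result is a linear
  combination of the coefficients and nothing is differentiated under the integral.\<close>

lemma AH_gauss_int:
  assumes "open W"
  shows "hpoly W k P \<Longrightarrow> AH W (\<lambda>p. gauss_int (P p))"
proof (induction rule: hpoly.induct)
  case (hpoly_term c q)
  have "gauss_int (\<lambda>t. c p * q t) = c p * gauss_int q" for p
    unfolding gauss_int_def by (simp flip: integral_mult_right_zero)
  moreover have "AH W (\<lambda>p. c p * gauss_int q)" by (intro AH_mult assms hpoly_term AH_const)
  ultimately show ?case by simp
next
  case (hpoly_add P Q)
  have "gauss_int (\<lambda>t. P p t + Q p t) = gauss_int (P p) + gauss_int (Q p)" for p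
    unfolding gauss_int_def scaleR_add_right
    by (rule Bochner_Integration.integral_add[OF hpoly_integrable[OF hpoly_add.hyps(1)] hpoly_integrable[OF hpoly_add.hyps(2)]])
  then show ?case using AH_add[OF assms hpoly_add.IH] by (simp only:)
qed

text \<open>Reflection in the origin. This removes the half-integral powers of \<open>h\<close> from
  the expansion.\<close>

lemma gauss_int_odd:
  assumes "hpoly W k P" "odd k"
  shows "gauss_int (P p) = 0"
proof -
  have [measurable]: "P p \<in> borel_measurable borel"
    by (rule borel_measurable_continuous_onI[OF hpoly_continuous[OF assms(1)]])
  have "P p (- s) = - P p s" for s using hpoly_homogeneous[OF assms(1), of p "-1" s] assms(2) by simp
  then have "gauss_int (P p) = - gauss_int (P p)"
    unfolding gauss_int_def by (subst lborel_integral_reflect) simp_all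
  then show ?thesis by simp
qed

text \<open>Every step of \<open>hX\<close> contributes one coordinate of the direction, of degree 1
  in t, and one \<open>dz\<close>, which preserves almost holomorphy.\<close>

lemma hX_hpoly:
  assumes "open W" "\<And>i. hpoly W (Suc 0) (\<lambda>p t. crd i (w p t))"
  shows "AH W f \<Longrightarrow> hpoly W k (\<lambda>p t. hX k (w p t) f p)"
proof (induction k arbitrary: f)
  case 0
  then show ?case using hpoly_term[of W f "\<lambda>_. 1" 0] by simp
next
  case (Suc k)
  have "hpoly W (Suc 0 + k) (\<lambda>p t. \<Sum>i\<in>UNIV. crd i (w p t) * hX k (w p t) (dz i f) p)"
    by (intro hpoly_sum hpoly_mult assms Suc.IH AH_dz Suc.prems)
  then show ?case by simp
qed

section \<open>Asymptotic expansion along the adapted contour\<close>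

text \<open>A Taylor expansion at t = 0, uniform over the base points in V. Its terms are required
  to be defined on all of W, although only their values on the anti-diagonal enter the
  estimate.\<close>

definition jet :: "'n::finite cpair set \<Rightarrow> (complex^'n) set \<Rightarrow> real \<Rightarrow> (complex^'n \<Rightarrow> real^('n + 'n) \<Rightarrow> complex) \<Rightarrow>
    (nat \<Rightarrow> 'n cpair \<Rightarrow> real^('n + 'n) \<Rightarrow> complex) \<Rightarrow> bool" where
  "jet W V \<delta> u P \<longleftrightarrow> (\<forall>k. hpoly W k (P k)) \<and>
     (\<forall>K. \<exists>C\<ge>0. \<forall>y\<in>V. \<forall>t. norm t \<le> \<delta> \<longrightarrow> norm (u y t - (\<Sum>k<K. P k (adiag y) t)) \<le> C * norm t ^ K)"

lemma jet_hpoly: "jet W V \<delta> u P \<Longrightarrow> hpoly W k (P k)"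
  unfolding jet_def by blast

lemma jetE:
  assumes "jet W V \<delta> u P"
  obtains C where "C \<ge> 0" "\<And>y t. y \<in> V \<Longrightarrow> norm t \<le> \<delta> \<Longrightarrow> norm (u y t - (\<Sum>k<K. P k (adiag y) t)) \<le> C * norm t ^ K"
proof -
  have "\<exists>C\<ge>0. \<forall>y\<in>V. \<forall>t. norm t \<le> \<delta> \<longrightarrow> norm (u y t - (\<Sum>k<K. P k (adiag y) t)) \<le> C * norm t ^ K"
    using assms unfolding jet_def by simp
  then obtain C where C: "C \<ge> 0" "\<forall>y\<in>V. \<forall>t. norm t \<le> \<delta> \<longrightarrow> norm (u y t - (\<Sum>k<K. P k (adiag y) t)) \<le> C * norm t ^ K"
    by (elim exE conjE)
  show thesis
  proof (rule that[OF C(1)])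
    fix y t assume "y \<in> V" "norm (t :: real^('a+'a)) \<le> \<delta>"
    then show "norm (u y t - (\<Sum>k<K. P k (adiag y) t)) \<le> C * norm t ^ K" using C(2) by simp
  qed
qed

lemma jet_smaller: "jet W V \<delta> u P \<Longrightarrow> \<delta>' \<le> \<delta> \<Longrightarrow> jet W V \<delta>' u P"
  unfolding jet_def by (meson order_trans)

lemma hpoly_bound_adiag:
  assumes "hpoly W k P" "compact V" "adiag ` V \<subseteq> W"
  obtains C where "C \<ge> 0" "\<And>y t. y \<in> V \<Longrightarrow> norm (P (adiag y) t) \<le> C * norm t ^ k"
proof -
  have c: "compact (adiag ` V)"
    by (rule compact_continuous_image[OF linear_continuous_on[OF bounded_linear_adiag] assms(2)])
  obtain C where C: "C \<ge> 0" "\<forall>p\<in>adiag ` V. \<forall>t. norm (P p t) \<le> C * norm t ^ k"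
    using hpoly_bound[OF c assms(3,1)] by (elim exE conjE)
  show thesis by (rule that[of C]) (use C in auto)
qed

text \<open>Cauchy product. The pairs of degrees left over from the product of the partial sums have
  total degree at least K, and \<open>\<delta> \<le> 1\<close> lets the power K of the norm dominate
  them all.\<close>

lemma jet_mult:
  assumes W: "open W" and V: "compact V" "adiag ` V \<subseteq> W" and \<delta>: "\<delta> \<le> 1"
    and u: "jet W V \<delta> u P" and v: "jet W V \<delta> v Q"
  shows "jet W V \<delta> (\<lambda>y t. u y t * v y t) (\<lambda>k p t. \<Sum>i\<le>k. P i p t * Q (k - i) p t)"
  unfolding jet_def
proof (intro conjI allI)
  fix k
  show "hpoly W k (\<lambda>p t. \<Sum>i\<le>k. P i p t * Q (k - i) p t)"
  proof (rule hpoly_sum)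
    fix i assume "i \<in> {..k}"
    then have "i + (k - i) = k" by simp
    then show "hpoly W k (\<lambda>p t. P i p t * Q (k - i) p t)"
      using hpoly_mult[OF W jet_hpoly[OF u, of i] jet_hpoly[OF v, of "k - i"]] by (simp only:)
  qed
next
  fix K
  obtain CP where CP: "CP \<ge> 0" "\<And>y t. y \<in> V \<Longrightarrow> norm t \<le> \<delta> \<Longrightarrow> norm (u y t - (\<Sum>k<K. P k (adiag y) t)) \<le> CP * norm t ^ K"
    by (rule jetE[OF u, of K]) (rule that)
  obtain CQ where CQ: "CQ \<ge> 0" "\<And>y t. y \<in> V \<Longrightarrow> norm t \<le> \<delta> \<Longrightarrow> norm (v y t - (\<Sum>k<K. Q k (adiag y) t)) \<le> CQ * norm t ^ K"
    by (rule jetE[OF v, of K]) (rule that)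
  obtain Bu where Bu: "Bu \<ge> 0" "\<And>y t. y \<in> V \<Longrightarrow> norm t \<le> \<delta> \<Longrightarrow> norm (u y t - (\<Sum>k<0. P k (adiag y) t)) \<le> Bu * norm t ^ 0"
    by (rule jetE[OF u, of 0]) (rule that)
  have "\<forall>i. \<exists>D\<ge>0. \<forall>y\<in>V. \<forall>t. norm (P i (adiag y) t) \<le> D * norm t ^ i"
    by (metis hpoly_bound_adiag[OF jet_hpoly[OF u] V])
  then obtain D where D: "\<And>i. D i \<ge> 0" "\<And>i y t. y \<in> V \<Longrightarrow> norm (P i (adiag y) t) \<le> D i * norm t ^ i" by metis
  have "\<forall>i. \<exists>D\<ge>0. \<forall>y\<in>V. \<forall>t. norm (Q i (adiag y) t) \<le> D * norm t ^ i"
    by (metis hpoly_bound_adiag[OF jet_hpoly[OF v] V])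
  then obtain E where E: "\<And>i. E i \<ge> 0" "\<And>i y t. y \<in> V \<Longrightarrow> norm (Q i (adiag y) t) \<le> E i * norm t ^ i" by metis
  define BQ where "BQ = (\<Sum>k<K. E k)"
  define DE where "DE = (\<Sum>i<K. \<Sum>j<K. D i * E j)"
  have BQ0: "BQ \<ge> 0" unfolding BQ_def by (intro sum_nonneg E)
  have DE0: "DE \<ge> 0" unfolding DE_def by (intro sum_nonneg mult_nonneg_nonneg E D)
  define C where "C = Bu * CQ + CP * BQ + DE"
  have C0: "C \<ge> 0" unfolding C_def using Bu CQ CP BQ0 DE0 by simp
  have "norm (u y t * v y t - (\<Sum>k<K. \<Sum>i\<le>k. P i (adiag y) t * Q (k - i) (adiag y) t)) \<le> C * norm t ^ K"
    if y: "y \<in> V" and t: "norm t \<le> \<delta>" for y t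
  proof -
    define p where "p = adiag y"
    define SP where "SP = (\<Sum>k<K. P k p t)"
    define SQ where "SQ = (\<Sum>k<K. Q k p t)"
    define T where "T = (\<Sum>k<K. \<Sum>i\<le>k. P i p t * Q (k - i) p t)"
    have t1: "norm t \<le> 1" using t \<delta> by simp
    have b1: "norm (u y t) \<le> Bu" using Bu(2)[OF y t] by simp
    have b2: "norm SQ \<le> BQ" unfolding SQ_def BQ_def
    proof (rule sum_norm_le)
      fix k
      have "norm (Q k p t) \<le> E k * norm t ^ k" unfolding p_def by (rule E(2)[OF y])
      also have "\<dots> \<le> E k * 1" by (intro mult_left_mono power_le_one t1 E) auto
      finally show "norm (Q k p t) \<le> E k" by simp
    qed
    have T: "T = (\<Sum>(i, j)\<in>{(i, j). i + j < K}. P i p t * Q j p t)"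
      unfolding T_def by (rule sum.triangle_reindex[symmetric])
    have S: "SP * SQ = (\<Sum>(i, j)\<in>{..<K} \<times> {..<K}. P i p t * Q j p t)"
      unfolding SP_def SQ_def sum_product by (rule sum.cartesian_product)
    have sub: "{(i, j). i + j < K} \<subseteq> {..<K} \<times> {..<K}" by auto
    have "SP * SQ - T = (\<Sum>(i, j)\<in>{..<K} \<times> {..<K} - {(i, j). i + j < K}. P i p t * Q j p t)"
      unfolding S T by (rule sum_diff[OF _ sub, symmetric]) simp
    also have "norm \<dots> \<le> (\<Sum>(i, j)\<in>{..<K} \<times> {..<K} - {(i, j). i + j < K}. D i * E j * norm t ^ K)"
    proof (rule sum_norm_le)
      fix ij assume ij: "ij \<in> {..<K} \<times> {..<K} - {(i, j). i + j < K}"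
      obtain i j where e: "ij = (i, j)" by (cases ij)
      have k: "K \<le> i + j" using ij unfolding e by auto
      have "norm (P i p t * Q j p t) \<le> (D i * norm t ^ i) * (E j * norm t ^ j)"
        unfolding norm_mult p_def by (intro mult_mono D(2) E(2) y) (auto intro: mult_nonneg_nonneg D)
      also have "\<dots> = D i * E j * norm t ^ (i + j)" by (simp add: power_add)
      also have "\<dots> \<le> D i * E j * norm t ^ K"
        by (intro mult_left_mono power_decreasing k t1) (auto intro: mult_nonneg_nonneg D E)
      finally show "norm (case ij of (i, j) \<Rightarrow> P i p t * Q j p t) \<le> (case ij of (i, j) \<Rightarrow> D i * E j * norm t ^ K)"
        unfolding e by simp
    qed
    also have "\<dots> \<le> (\<Sum>(i, j)\<in>{..<K} \<times> {..<K}. D i * E j * norm t ^ K)"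
      by (rule sum_mono2) (auto intro!: mult_nonneg_nonneg D E)
    also have "\<dots> = DE * norm t ^ K"
      unfolding DE_def sum_distrib_right by (rule sum.cartesian_product[symmetric])
    finally have b3: "norm (SP * SQ - T) \<le> DE * norm t ^ K" .
    \<comment> \<open>Replace first v and then u by its partial sum, and finally the product of the
      partial sums by its part of degree below K.\<close>
    have "u y t * v y t - T = u y t * (v y t - SQ) + (u y t - SP) * SQ + (SP * SQ - T)" by (simp add: algebra_simps)
    then have "norm (u y t * v y t - T) = norm (u y t * (v y t - SQ) + (u y t - SP) * SQ + (SP * SQ - T))" by (rule arg_cong)
    also have "\<dots> \<le> norm (u y t * (v y t - SQ)) + norm ((u y t - SP) * SQ) + norm (SP * SQ - T)"
      using norm_triangle_ineq[of "u y t * (v y t - SQ) + (u y t - SP) * SQ" "SP * SQ - T"]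
        norm_triangle_ineq[of "u y t * (v y t - SQ)" "(u y t - SP) * SQ"] by linarith
    also have "\<dots> \<le> Bu * (CQ * norm t ^ K) + (CP * norm t ^ K) * BQ + DE * norm t ^ K"
    proof (intro add_mono b3)
      show "norm (u y t * (v y t - SQ)) \<le> Bu * (CQ * norm t ^ K)"
        unfolding norm_mult SQ_def p_def by (intro mult_mono b1 CQ(2) y t) (use Bu in auto)
      show "norm ((u y t - SP) * SQ) \<le> (CP * norm t ^ K) * BQ"
        unfolding norm_mult by (intro mult_mono b2) (use CP y t in \<open>auto simp: SP_def p_def\<close>)
    qed
    also have "\<dots> = C * norm t ^ K" unfolding C_def by (simp add: algebra_simps)
    finally show ?thesis unfolding T_def p_def .
  qed
  then show "\<exists>C\<ge>0. \<forall>y\<in>V. \<forall>t. norm t \<le> \<delta> \<longrightarrow>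
     norm (u y t * v y t - (\<Sum>k<K. \<Sum>i\<le>k. P i (adiag y) t * Q (k - i) (adiag y) t)) \<le> C * norm t ^ K"
    using C0 by (intro exI[of _ C]) simp
qed

text \<open>If R and Q are the jets of r and u, this is the part of degree k in the jet of
  \<open>r ^ l * u\<close>.\<close>

primrec jpow :: "(nat \<Rightarrow> 'n::finite cpair \<Rightarrow> real^('n + 'n) \<Rightarrow> complex) \<Rightarrow> (nat \<Rightarrow> 'n cpair \<Rightarrow> real^('n + 'n) \<Rightarrow> complex) \<Rightarrow>
    nat \<Rightarrow> nat \<Rightarrow> 'n cpair \<Rightarrow> real^('n + 'n) \<Rightarrow> complex" where
  "jpow R Q 0 = Q"
| "jpow R Q (Suc l) = (\<lambda>k p t. \<Sum>i\<le>k. R i p t * jpow R Q l (k - i) p t)"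

text \<open>A factor without terms below degree 3 raises the lowest degree by 3 each time. This is
  why only finitely many l contribute to a given power of \<open>h\<close>.\<close>

lemma jpow_low:
  assumes "\<And>k p t. k < 3 \<Longrightarrow> R k p t = 0"
  shows "k < 3 * l \<Longrightarrow> jpow R Q l k p t = 0"
proof (induction l arbitrary: k)
  case 0
  then show ?case by simp
next
  case (Suc l)
  have "R i p t * jpow R Q l (k - i) p t = 0" if "i \<le> k" for i
  proof (cases "i < 3")
    case True
    then show ?thesis using assms by simp
  next
    case False
    then have "k - i < 3 * l" using Suc.prems that by simp
    then show ?thesis using Suc.IH by simp
  qed
  then show ?case by (simp only: jpow.simps) (intro sum.neutral, simp)
qed

lemma jpow_cong: "(\<And>k t. Q k p t = Q' k p t) \<Longrightarrow> jpow R Q l k p t = jpow R Q' l k p t"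
  by (induction l arbitrary: k) simp_all

lemma jet_jpow:
  assumes W: "open W" and V: "compact V" "adiag ` V \<subseteq> W" and \<delta>: "\<delta> \<le> 1"
    and r: "jet W V \<delta> r R" and u: "jet W V \<delta> u Q"
  shows "jet W V \<delta> (\<lambda>y t. r y t ^ l * u y t) (jpow R Q l)"
proof (induction l)
  case 0
  then show ?case using u by simp
next
  case (Suc l)
  show ?case using jet_mult[OF W V \<delta> r Suc] by (simp add: mult.assoc)
qed

section \<open>Gaussian asymptotics with a uniform remainder\<close>

lemma power_le_one_plus: "0 \<le> x \<Longrightarrow> a \<le> b \<Longrightarrow> x ^ a \<le> 1 + (x::real) ^ b"
proof (cases "x \<le> 1")
  case True
  assume "0 \<le> x" "a \<le> b"
  then have "x ^ a \<le> 1" "0 \<le> x ^ b" using True by (auto simp: power_le_one)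
  then show ?thesis by linarith
next
  case False
  assume "0 \<le> x" "a \<le> b"
  then have "x ^ a \<le> x ^ b" using False by (intro power_increasing) auto
  then show ?thesis by simp
qed

lemma one_minus_cut_le:
  assumes "\<delta> > 0"
  shows "1 - cut \<delta> t \<le> (2 * norm t / \<delta>) ^ m"
proof (cases "norm t \<le> \<delta> / 2")
  case True
  then show ?thesis using cut_inside(1)[OF assms True] assms by simp
next
  case False
  then have "1 \<le> 2 * norm t / \<delta>" using assms by (simp add: field_simps)
  then have "1 \<le> (2 * norm t / \<delta>) ^ m" by (rule one_le_power)
  then show ?thesis using cut_bounds(1)[of \<delta> t] by linarith
qed

text \<open>Only even degrees \<open>k = 2 * i\<close> survive; they carry the power
  \<open>i - l\<close> of \<open>h\<close>, which becomes the new index j. The condition that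
  \<open>2 * (j + l)\<close> be at least \<open>3 * l\<close> is the same as
  \<open>l \<le> 2 * j\<close>.\<close>

lemma gauss_series_reindex:
  fixes m :: "nat \<Rightarrow> nat \<Rightarrow> complex" and h :: real
  assumes \<epsilon>: "\<epsilon>\<^sup>2 = h" "h > 0" and z: "\<And>l k. k < 3 * l \<Longrightarrow> m l k = 0" "\<And>l k. odd k \<Longrightarrow> m l k = 0"
  shows "(\<Sum>l\<le>2 * N. (2 / of_real h) ^ l / fact l * (\<Sum>k<2 * N + 2 * l. of_real \<epsilon> ^ k * m l k)) =
    (\<Sum>j<N. of_real h ^ j * (\<Sum>l\<le>2 * j. 2 ^ l / fact l * m l (2 * (j + l))))"
proof -
  have 1: "(2 / of_real h) ^ l / fact l * (\<Sum>k<2 * N + 2 * l. of_real \<epsilon> ^ k * m l k) =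
    (\<Sum>j<N. of_real h ^ j * (2 ^ l / fact l * m l (2 * (j + l))))" for l
  proof -
    have "(\<Sum>k<2 * N + 2 * l. of_real \<epsilon> ^ k * m l k) = (\<Sum>k\<in>(\<lambda>i. 2 * i) ` {..<N + l}. of_real \<epsilon> ^ k * m l k)"
    proof (rule sum.mono_neutral_right)
      show "\<forall>k\<in>{..<2 * N + 2 * l} - (\<lambda>i. 2 * i) ` {..<N + l}. of_real \<epsilon> ^ k * m l k = 0"
      proof
        fix k assume k: "k \<in> {..<2 * N + 2 * l} - (\<lambda>i. 2 * i) ` {..<N + l}"
        have "odd k"
        proof
          assume "even k"
          then obtain i where "k = 2 * i" by (elim evenE)
          then show False using k by auto
        qed
        then show "of_real \<epsilon> ^ k * m l k = 0" using z(2) by simp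
      qed
    qed auto
    also have "\<dots> = (\<Sum>i<N + l. of_real \<epsilon> ^ (2 * i) * m l (2 * i))"
      by (subst sum.reindex) (auto simp: inj_on_def)
    also have "\<dots> = (\<Sum>i<N + l. of_real h ^ i * m l (2 * i))"
      unfolding power_mult \<epsilon>(1)[symmetric] by simp
    also have "\<dots> = (\<Sum>i\<in>{l..<N + l}. of_real h ^ i * m l (2 * i))"
    proof (rule sum.mono_neutral_right)
      show "\<forall>i\<in>{..<N + l} - {l..<N + l}. of_real h ^ i * m l (2 * i) = 0"
      proof
        fix i assume "i \<in> {..<N + l} - {l..<N + l}"
        then have "2 * i < 3 * l" by auto
        then show "of_real h ^ i * m l (2 * i) = 0" using z(1) by simp
      qed
    qed auto
    also have "\<dots> = (\<Sum>j<N. of_real h ^ (j + l) * m l (2 * (j + l)))"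
    proof -
      have "{l..<N + l} = (\<lambda>j. j + l) ` {..<N}"
      proof (intro equalityI subsetI)
        fix x assume "x \<in> {l..<N + l}"
        then show "x \<in> (\<lambda>j. j + l) ` {..<N}" by (intro image_eqI[of _ _ "x - l"]) auto
      qed auto
      then show ?thesis by (simp add: sum.reindex inj_on_def)
    qed
    finally have "(\<Sum>k<2 * N + 2 * l. of_real \<epsilon> ^ k * m l k) = (\<Sum>j<N. of_real h ^ (j + l) * m l (2 * (j + l)))" .
    moreover have "(2 / of_real h) ^ l / fact l * (of_real h ^ (j + l) * x) = of_real h ^ j * (2 ^ l / fact l * x)" for j and x :: complex
      using \<epsilon>(2) by (simp add: power_add power_divide mult_ac)
    ultimately show ?thesis by (simp only: sum_distrib_left)
  qed
  have "(\<Sum>l\<le>2 * N. (2 / of_real h) ^ l / fact l * (\<Sum>k<2 * N + 2 * l. of_real \<epsilon> ^ k * m l k)) =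
    (\<Sum>j<N. of_real h ^ j * (\<Sum>l\<le>2 * N. 2 ^ l / fact l * m l (2 * (j + l))))"
    by (simp only: 1) (simp only: sum.swap[of _ "{..<N}"] sum_distrib_left[symmetric])
  also have "\<dots> = (\<Sum>j<N. of_real h ^ j * (\<Sum>l\<le>2 * j. 2 ^ l / fact l * m l (2 * (j + l))))"
  proof (rule sum.cong[OF refl])
    fix j assume j: "j \<in> {..<N}"
    have "(\<Sum>l\<le>2 * N. 2 ^ l / fact l * m l (2 * (j + l))) = (\<Sum>l\<le>2 * j. 2 ^ l / fact l * m l (2 * (j + l)))"
    proof (rule sum.mono_neutral_right)
      show "\<forall>l\<in>{..2 * N} - {..2 * j}. 2 ^ l / fact l * m l (2 * (j + l)) = 0"
      proof
        fix l assume "l \<in> {..2 * N} - {..2 * j}"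
        then have "2 * (j + l) < 3 * l" by simp
        then show "2 ^ l / fact l * m l (2 * (j + l)) = 0" using z(1) by simp
      qed
    qed (use j in auto)
    then show "of_real h ^ j * (\<Sum>l\<le>2 * N. 2 ^ l / fact l * m l (2 * (j + l))) =
      of_real h ^ j * (\<Sum>l\<le>2 * j. 2 ^ l / fact l * m l (2 * (j + l)))" by simp
  qed
  finally show ?thesis .
qed

text \<open>With \<open>t = sqrt h * s\<close> the exponential is
  \<open>exp (- 2 * (norm s)\<^sup>2)\<close> times \<open>exp w\<close>, where w is of order
  \<open>sqrt h\<close> times the cube of \<open>norm s\<close>. The series of \<open>exp w\<close>
  is stopped at \<open>2 * N\<close>, so that its tail is of order \<open>h ^ N\<close>; the term of
  order l contains the l-th power of \<open>2 / h\<close>, and its jet is therefore kept up to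
  degree \<open>2 * N + 2 * l\<close>.\<close>

lemma gauss_expansion:
  fixes \<phi> u :: "complex^'n::finite \<Rightarrow> real^('n + 'n) \<Rightarrow> complex"
  assumes W: "open W" and V: "compact V" "adiag ` V \<subseteq> W" and \<delta>: "0 < \<delta>" "\<delta> \<le> 1"
    and P: "\<And>l. jet W V \<delta> (\<lambda>y t. (\<phi> y t + of_real ((norm t)\<^sup>2)) ^ l * u y t) (P l)" "\<And>l k p t. k < 3 * l \<Longrightarrow> P l k p t = 0"
    and CR: "CR \<ge> 0" "2 * CR * \<delta> \<le> 1" "\<And>y t. y \<in> V \<Longrightarrow> norm t \<le> \<delta> \<Longrightarrow> norm (\<phi> y t + of_real ((norm t)\<^sup>2)) \<le> CR * norm t ^ 3"
    and cont: "\<And>y. y \<in> V \<Longrightarrow> continuous_on (cball 0 \<delta>) (\<phi> y)" "\<And>y. y \<in> V \<Longrightarrow> continuous_on (cball 0 \<delta>) (u y)"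
  shows "\<exists>C. \<forall>h\<in>{0<..1}. \<forall>y\<in>V. norm ((LINT t|lborel. cut \<delta> t *\<^sub>R (exp (2 / of_real h * \<phi> y t) * u y t)) / of_real h ^ CARD('n)
     - (\<Sum>j<N. of_real h ^ j * (\<Sum>l\<le>2 * j. 2 ^ l / fact l * gauss_int (P l (2 * (j + l)) (adiag y))))) \<le> C * h ^ N"
proof -
  have "\<forall>l. \<exists>C\<ge>0. \<forall>y\<in>V. \<forall>t. norm t \<le> \<delta> \<longrightarrow> norm ((\<phi> y t + of_real ((norm t)\<^sup>2)) ^ l * u y t - (\<Sum>k<2 * N + 2 * l. P l k (adiag y) t)) \<le> C * norm t ^ (2 * N + 2 * l)"
    using P(1) unfolding jet_def by blast
  then obtain CJ where CJ: "\<And>l. CJ l \<ge> 0" "\<And>l y t. y \<in> V \<Longrightarrow> norm t \<le> \<delta> \<Longrightarrow>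
      norm ((\<phi> y t + of_real ((norm t)\<^sup>2)) ^ l * u y t - (\<Sum>k<2 * N + 2 * l. P l k (adiag y) t)) \<le> CJ l * norm t ^ (2 * N + 2 * l)"
    by metis
  obtain Bu where Bu0: "Bu \<ge> 0" "\<And>y t. y \<in> V \<Longrightarrow> norm t \<le> \<delta> \<Longrightarrow>
      norm ((\<phi> y t + of_real ((norm t)\<^sup>2)) ^ 0 * u y t - (\<Sum>k<0. P 0 k (adiag y) t)) \<le> Bu * norm t ^ 0"
    by (rule jetE[OF P(1)[of 0], of 0]) (rule that)
  have Bu: "norm (u y t) \<le> Bu" if "y \<in> V" "norm t \<le> \<delta>" for y t using Bu0(2)[OF that] by simp
  have "\<forall>l k. \<exists>D\<ge>0. \<forall>y\<in>V. \<forall>t. norm (P l k (adiag y) t) \<le> D * norm t ^ k"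
    by (metis hpoly_bound_adiag[OF jet_hpoly[OF P(1)] V])
  then obtain D where D: "\<And>l k. D l k \<ge> 0" "\<And>l k y t. y \<in> V \<Longrightarrow> norm (P l k (adiag y) t) \<le> D l k * norm t ^ k" by metis
  \<comment> \<open>One integrable majorant for all errors. The powers of \<open>norm s\<close> that
    occur are \<open>6 * N + 3\<close> from the tail of the exponential,
    \<open>2 * N + 2 * l\<close> from the jets and \<open>2 * N + 2 * l + k\<close> from the
    cut-off, with \<open>l \<le> 2 * N\<close> and \<open>k < 2 * N + 2 * l\<close>.\<close>
  define Z where "Z s = (1 + norm s ^ (12 * N + 3)) * exp (- (norm s)\<^sup>2)" for s :: "real^('n + 'n)"
  have Z0: "Z s \<ge> 0" for s unfolding Z_def by (simp add: add_nonneg_nonneg)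
  have iZ: "integrable lborel Z"
  proof -
    have "integrable lborel (\<lambda>s::real^('n + 'n). exp (- 1 * (norm s)\<^sup>2) + norm s ^ (12 * N + 3) * exp (- 1 * (norm s)\<^sup>2))"
      by (intro Bochner_Integration.integrable_add integrable_gauss integrable_gauss_power) simp_all
    then show ?thesis unfolding Z_def by (simp add: distrib_right)
  qed
  have Zge: "norm s ^ a * exp (- 2 * (norm s)\<^sup>2) \<le> Z s" "norm s ^ a * exp (- (norm s)\<^sup>2) \<le> Z s" if "a \<le> 12 * N + 3" for s :: "real^('n + 'n)" and a
  proof -
    show 2: "norm s ^ a * exp (- (norm s)\<^sup>2) \<le> Z s" unfolding Z_def
      by (intro mult_right_mono power_le_one_plus that) auto
    have "exp (- 2 * (norm s)\<^sup>2) \<le> exp (- (norm s)\<^sup>2)" by simp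
    then have "norm s ^ a * exp (- 2 * (norm s)\<^sup>2) \<le> norm s ^ a * exp (- (norm s)\<^sup>2)" by (rule mult_left_mono) simp
    then show "norm s ^ a * exp (- 2 * (norm s)\<^sup>2) \<le> Z s" using 2 by linarith
  qed
  define A1 where "A1 = Bu * (2 * CR) ^ (2 * N + 1)"
  define A2 where "A2 l = 2 ^ l * CJ l" for l
  define A3 where "A3 l k = 2 ^ l * (2 / \<delta>) ^ (2 * N + 2 * l) * D l k" for l k
  define A where "A = A1 + (\<Sum>l\<le>2 * N. A2 l + (\<Sum>k<2 * N + 2 * l. A3 l k))"
  have main: "norm ((LINT t|lborel. cut \<delta> t *\<^sub>R (exp (2 / of_real h * \<phi> y t) * u y t)) / of_real h ^ CARD('n)
     - (\<Sum>j<N. of_real h ^ j * (\<Sum>l\<le>2 * j. 2 ^ l / fact l * gauss_int (P l (2 * (j + l)) (adiag y))))) \<le> A * (LINT s|lborel. Z s) * h ^ N"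
    if h: "h \<in> {0<..1}" and y: "y \<in> V" for h y
  proof -
    define p where "p = adiag y"
    define \<epsilon> where "\<epsilon> = sqrt h"
    have h0: "h > 0" "h \<le> 1" using h by auto
    have \<epsilon>: "\<epsilon> > 0" "\<epsilon> \<le> 1" "\<epsilon>\<^sup>2 = h" unfolding \<epsilon>_def using h0 by auto
    have ehN: "\<epsilon> ^ (2 * m) = h ^ m" for m unfolding power_mult \<epsilon>(3) ..
    define f where "f t = cut \<delta> t *\<^sub>R (exp (2 / of_real h * \<phi> y t) * u y t)" for t
    obtain a where box: "cball (0 :: real^('n + 'n)) \<delta> \<subseteq> cbox (- a) a"
      using bounded_subset_cbox_symmetric[OF bounded_cball] by blast
    have cf: "continuous_on UNIV f"
    proof -
      have "continuous_on ({0::real} \<times> cball 0 \<delta>) (\<lambda>z. exp (2 / of_real h * \<phi> y (snd z)) * u y (snd z))"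
        by (intro continuous_intros continuous_on_compose2[OF cont(1)[OF y]] continuous_on_compose2[OF cont(2)[OF y]]) auto
      from continuous_on_cutoff[OF _ this cut_continuous cut_outside(1)[OF \<delta>(1)]]
      have "continuous_on ({0::real} \<times> UNIV) (\<lambda>(s, t). cut \<delta> t *\<^sub>R (exp (2 / of_real h * \<phi> y t) * u y t))" by simp
      then have "continuous_on UNIV (\<lambda>t. (\<lambda>(s, t). cut \<delta> t *\<^sub>R (exp (2 / of_real h * \<phi> y t) * u y t)) (0::real, t))"
        by (rule continuous_on_compose2) (auto intro!: continuous_intros)
      then show ?thesis unfolding f_def by simp
    qed
    have mf [measurable]: "f \<in> borel_measurable borel" by (rule borel_measurable_continuous_onI[OF cf])
    have sc: "(LINT t|lborel. f t) / of_real h ^ CARD('n) = (LINT s|lborel. f (\<epsilon> *\<^sub>R s))"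
    proof -
      have "DIM(real^('n + 'n)) = 2 * CARD('n)" by simp
      then have "(LINT t|lborel. f t) = of_real (h ^ CARD('n)) * (LINT s|lborel. f (\<epsilon> *\<^sub>R s))"
        using lborel_integral_scale[OF \<epsilon>(1) mf] ehN[of "CARD('n)"] by (simp only:)
      then show ?thesis using h0 by simp
    qed
    define g where "g s = (\<Sum>l\<le>2 * N. (2 / of_real h) ^ l / fact l * (\<Sum>k<2 * N + 2 * l. of_real \<epsilon> ^ k * (exp (- 2 * (norm s)\<^sup>2) *\<^sub>R P l k p s)))" for s
    have iP: "integrable lborel (\<lambda>s. exp (- 2 * (norm s)\<^sup>2) *\<^sub>R P l k p s)" for l k
      by (rule hpoly_integrable[OF jet_hpoly[OF P(1)]])
    have ig: "integrable lborel g" unfolding g_def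
      by (intro Bochner_Integration.integrable_sum Bochner_Integration.integrable_mult_right iP)
    have Ig: "(LINT s|lborel. g s) = (\<Sum>l\<le>2 * N. (2 / of_real h) ^ l / fact l * (\<Sum>k<2 * N + 2 * l. of_real \<epsilon> ^ k * gauss_int (P l k p)))"
      unfolding g_def gauss_int_def
      by (subst Bochner_Integration.integral_sum, intro Bochner_Integration.integrable_mult_right Bochner_Integration.integrable_sum iP)
         (intro sum.cong refl, subst integral_mult_right_zero, subst Bochner_Integration.integral_sum,
          intro Bochner_Integration.integrable_mult_right iP, subst integral_mult_right_zero, rule refl)
    have gz: "gauss_int (P l k p) = 0" if "k < 3 * l" for l k
    proof -
      have "P l k p = (\<lambda>_. 0)" using P(2)[OF that] by (intro ext) simp
      then show ?thesis unfolding gauss_int_def by simp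
    qed
    have Ig2: "(LINT s|lborel. g s) = (\<Sum>j<N. of_real h ^ j * (\<Sum>l\<le>2 * j. 2 ^ l / fact l * gauss_int (P l (2 * (j + l)) p)))"
      unfolding Ig by (rule gauss_series_reindex[OF \<epsilon>(3) h0(1) gz gauss_int_odd[OF jet_hpoly[OF P(1)]]])
    have pw: "norm (f (\<epsilon> *\<^sub>R s) - g s) \<le> A * h ^ N * Z s" for s
    proof -
      define t where "t = \<epsilon> *\<^sub>R s"
      define c where "c = cut \<delta> t"
      have c: "0 \<le> c" "c \<le> 1" unfolding c_def by (rule cut_bounds)+
      have nt: "norm t = \<epsilon> * norm s" unfolding t_def using \<epsilon>(1) by simp
      define G where "G = exp (- 2 * (norm s)\<^sup>2)"
      have G0: "G > 0" unfolding G_def by simp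
      define r where "r = \<phi> y t + of_real ((norm t)\<^sup>2)"
      define w where "w = 2 / of_real h * r"
      have Pt: "P l k p t = of_real \<epsilon> ^ k * P l k p s" for l k
        unfolding t_def by (rule hpoly_homogeneous[OF jet_hpoly[OF P(1)]])
      have nth: "(norm t)\<^sup>2 = h * (norm s)\<^sup>2" unfolding nt power_mult_distrib \<epsilon>(3) ..
      have ew: "2 / of_real h * \<phi> y t = w + of_real (- 2 * (norm s)\<^sup>2)"
        unfolding w_def r_def nth using h0 by (simp add: field_simps)
      have F: "exp (2 / of_real h * \<phi> y t) = of_real G * exp w"
        unfolding G_def ew by (simp only: exp_add exp_of_real mult.commute)
      define S where "S l = (\<Sum>k<2 * N + 2 * l. P l k p t)" for l
      have geq: "g s = of_real G * (\<Sum>l\<le>2 * N. (2 / of_real h) ^ l / fact l * S l)"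
        unfolding g_def S_def G_def[symmetric] Pt by (simp add: sum_distrib_left scaleR_conv_of_real mult_ac)
      define E1 where "E1 = exp w - (\<Sum>l\<le>2 * N. w ^ l / fact l)"
      have wl: "w ^ l / fact l = (2 / of_real h) ^ l / fact l * r ^ l" for l unfolding w_def power_mult_distrib by simp
      \<comment> \<open>Three errors: the tail of the exponential series, the remainders of the jets
        where the cut-off acts, and the jet terms lost by it.\<close>
      have dec: "f t - g s = of_real G * (of_real c * (u y t * E1) +
         (\<Sum>l\<le>2 * N. (2 / of_real h) ^ l / fact l * (of_real c * (r ^ l * u y t - S l) - of_real (1 - c) * S l)))"
      proof -
        have "f t = of_real G * (of_real c * (u y t * exp w))"
          unfolding f_def c_def[symmetric] F by (simp add: scaleR_conv_of_real mult_ac)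
        moreover have "u y t * exp w = u y t * E1 + (\<Sum>l\<le>2 * N. (2 / of_real h) ^ l / fact l * (r ^ l * u y t))"
          unfolding E1_def wl by (simp add: algebra_simps sum_distrib_left)
        moreover have "(\<Sum>l\<le>2 * N. (2 / of_real h) ^ l / fact l * (of_real c * (r ^ l * u y t - S l) - of_real (1 - c) * S l)) =
          of_real c * (\<Sum>l\<le>2 * N. (2 / of_real h) ^ l / fact l * (r ^ l * u y t)) - (\<Sum>l\<le>2 * N. (2 / of_real h) ^ l / fact l * S l)"
          unfolding sum_distrib_left sum_subtractf[symmetric] by (intro sum.cong refl) (simp add: algebra_simps)
        moreover have "G * (c * ue) - G * Q = G * (c * X + D)" if "ue = X + Y" "D = c * Y - Q" for G c ue X Y D Q :: complex
          unfolding that by (simp add: algebra_simps)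
        ultimately show ?thesis unfolding geq by (simp only:)
      qed
      have T1: "G * norm (of_real c * (u y t * E1)) \<le> A1 * (h ^ N * Z s)"
      proof (cases "norm t \<le> \<delta>")
        case False
        then have "c = 0" unfolding c_def using cut_outside(1)[OF \<delta>(1), of t] False by simp
        then show ?thesis unfolding A1_def using Bu0(1) CR(1) Z0 h0 by simp
      next
        case True
        have rb: "norm r \<le> CR * norm t ^ 3" unfolding r_def by (rule CR(3)[OF y True])
        have nw: "norm w = 2 / h * norm r" unfolding w_def using h0 by (simp add: norm_mult norm_divide)
        have w1: "norm w \<le> 2 * CR * \<epsilon> * norm s ^ 3"
        proof -
          have "norm w \<le> 2 / h * (CR * norm t ^ 3)" unfolding nw by (intro mult_left_mono rb) (use h0 in simp)
          also have "\<dots> = 2 * CR * \<epsilon> * norm s ^ 3"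
            unfolding nt using \<epsilon>(1) unfolding \<epsilon>(3)[symmetric] by (simp add: power_mult_distrib power2_eq_square power3_eq_cube)
          finally show ?thesis .
        qed
        \<comment> \<open>A second bound on w, by the choice of \<delta>: the exponential of
          \<open>norm w\<close> then uses up only one half of the Gaussian weight.\<close>
        have w2: "norm w \<le> (norm s)\<^sup>2"
        proof -
          have "norm w \<le> 2 / h * (CR * norm t ^ 3)" unfolding nw by (intro mult_left_mono rb) (use h0 in simp)
          also have "\<dots> = (2 * CR * norm t) * ((norm t)\<^sup>2 / h)" by (simp add: power2_eq_square power3_eq_cube)
          also have "\<dots> \<le> 1 * ((norm t)\<^sup>2 / h)"
          proof (rule mult_right_mono)
            have "2 * CR * norm t \<le> 2 * CR * \<delta>" using True CR(1) by (intro mult_left_mono) auto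
            then show "2 * CR * norm t \<le> 1" using CR(2) by simp
          qed (use h0 in simp)
          also have "\<dots> = (norm s)\<^sup>2" unfolding nth using h0 by simp
          finally show ?thesis .
        qed
        have "norm E1 \<le> exp (norm w) * norm w ^ Suc (2 * N) / fact (2 * N)" unfolding E1_def by (rule Taylor_exp_field)
        also have "\<dots> \<le> exp ((norm s)\<^sup>2) * (2 * CR * \<epsilon> * norm s ^ 3) ^ Suc (2 * N) / 1"
          by (intro frac_le mult_mono power_mono w1) (use w2 CR(1) \<epsilon>(1) in \<open>auto simp: fact_ge_1\<close>)
        also have "\<dots> = exp ((norm s)\<^sup>2) * ((2 * CR) ^ (2 * N + 1) * \<epsilon> ^ (2 * N + 1) * norm s ^ (6 * N + 3))"
          by (simp add: power_mult_distrib power_mult[symmetric] power_add algebra_simps)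
        also have "\<dots> \<le> exp ((norm s)\<^sup>2) * ((2 * CR) ^ (2 * N + 1) * \<epsilon> ^ (2 * N) * norm s ^ (6 * N + 3))"
          by (intro mult_left_mono mult_right_mono power_decreasing) (use \<epsilon> CR(1) in auto)
        finally have E1b: "norm E1 \<le> exp ((norm s)\<^sup>2) * ((2 * CR) ^ (2 * N + 1) * h ^ N * norm s ^ (6 * N + 3))"
          unfolding ehN .
        have "norm (of_real c * (u y t * E1)) \<le> 1 * (Bu * (exp ((norm s)\<^sup>2) * ((2 * CR) ^ (2 * N + 1) * h ^ N * norm s ^ (6 * N + 3))))"
          unfolding norm_mult by (intro mult_mono E1b Bu[OF y True]) (use c Bu0(1) in auto)
        then have "G * norm (of_real c * (u y t * E1)) \<le> G * (Bu * (exp ((norm s)\<^sup>2) * ((2 * CR) ^ (2 * N + 1) * h ^ N * norm s ^ (6 * N + 3))))"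
          using G0 by (intro mult_left_mono) auto
        also have "\<dots> = A1 * (h ^ N * (norm s ^ (6 * N + 3) * (G * exp ((norm s)\<^sup>2))))" unfolding A1_def by (simp only: mult_ac)
        also have "G * exp ((norm s)\<^sup>2) = exp (- (norm s)\<^sup>2)" unfolding G_def by (simp add: mult_exp_exp)
        also have "A1 * (h ^ N * (norm s ^ (6 * N + 3) * exp (- (norm s)\<^sup>2))) \<le> A1 * (h ^ N * Z s)"
          by (intro mult_left_mono Zge) (use Bu0(1) CR(1) h0 in \<open>auto simp: A1_def\<close>)
        finally show ?thesis .
      qed
      have hl: "(2 / h) ^ l / fact l \<le> 2 ^ l / h ^ l" for l
      proof -
        have "(2 / h) ^ l / fact l \<le> (2 / h) ^ l / 1" by (intro divide_left_mono) (use h0 in \<open>auto simp: fact_ge_1\<close>)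
        then show ?thesis by (simp add: power_divide)
      qed
      have T2: "G * ((2 / h) ^ l / fact l * norm (of_real c * (r ^ l * u y t - S l))) \<le> A2 l * (h ^ N * Z s)" if l: "l \<le> 2 * N" for l
      proof (cases "norm t \<le> \<delta>")
        case False
        then have "c = 0" unfolding c_def using cut_outside(1)[OF \<delta>(1), of t] False by simp
        then show ?thesis unfolding A2_def using CJ(1) Z0 h0 by simp
      next
        case True
        have "norm (r ^ l * u y t - S l) \<le> CJ l * norm t ^ (2 * N + 2 * l)"
          unfolding r_def S_def p_def by (rule CJ(2)[OF y True])
        then have "norm (of_real c * (r ^ l * u y t - S l)) \<le> 1 * (CJ l * norm t ^ (2 * N + 2 * l))"
          unfolding norm_mult by (intro mult_mono) (use c in auto)
        then have "(2 / h) ^ l / fact l * norm (of_real c * (r ^ l * u y t - S l)) \<le> 2 ^ l / h ^ l * (CJ l * norm t ^ (2 * N + 2 * l))"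
          by (intro mult_mono hl) (use h0 in auto)
        also have "\<dots> = A2 l * (h ^ N * norm s ^ (2 * N + 2 * l))"
        proof -
          have "norm t ^ (2 * N + 2 * l) = h ^ N * h ^ l * norm s ^ (2 * N + 2 * l)"
            unfolding nt power_mult_distrib by (simp add: power_add ehN)
          then show ?thesis unfolding A2_def using h0 by simp
        qed
        finally have "G * ((2 / h) ^ l / fact l * norm (of_real c * (r ^ l * u y t - S l))) \<le> G * (A2 l * (h ^ N * norm s ^ (2 * N + 2 * l)))"
          using G0 by (intro mult_left_mono) auto
        also have "\<dots> = A2 l * (h ^ N * (norm s ^ (2 * N + 2 * l) * G))" by (simp only: mult_ac)
        also have "\<dots> \<le> A2 l * (h ^ N * Z s)"
          unfolding G_def by (intro mult_left_mono Zge) (use l CJ(1) h0 in \<open>auto simp: A2_def\<close>)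
        finally show ?thesis .
      qed
      have T3: "G * ((2 / h) ^ l / fact l * norm (of_real (1 - c) * P l k p t)) \<le> A3 l k * (h ^ N * Z s)"
        if l: "l \<le> 2 * N" and k: "k < 2 * N + 2 * l" for l k
      proof -
        have "norm (of_real (1 - c) * P l k p t) \<le> (2 * norm t / \<delta>) ^ (2 * N + 2 * l) * (D l k * norm t ^ k)"
        proof -
          have "norm (of_real (1 - c) :: complex) = 1 - c" unfolding norm_of_real using c by simp
          also have "\<dots> \<le> (2 * norm t / \<delta>) ^ (2 * N + 2 * l)" unfolding c_def by (rule one_minus_cut_le[OF \<delta>(1)])
          finally have "norm (of_real (1 - c) :: complex) \<le> (2 * norm t / \<delta>) ^ (2 * N + 2 * l)" .
          moreover have "norm (P l k p t) \<le> D l k * norm t ^ k" unfolding p_def by (rule D(2)[OF y])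
          ultimately show ?thesis unfolding norm_mult by (intro mult_mono) (use \<delta>(1) in auto)
        qed
        then have "(2 / h) ^ l / fact l * norm (of_real (1 - c) * P l k p t) \<le> 2 ^ l / h ^ l * ((2 * norm t / \<delta>) ^ (2 * N + 2 * l) * (D l k * norm t ^ k))"
          by (intro mult_mono hl) (use h0 in auto)
        also have "\<dots> = A3 l k * (h ^ N * (norm s ^ (2 * N + 2 * l) * (\<epsilon> ^ k * norm s ^ k)))"
        proof -
          have "(2 * norm t / \<delta>) ^ (2 * N + 2 * l) = (2 / \<delta>) ^ (2 * N + 2 * l) * norm t ^ (2 * N + 2 * l)"
            by (simp add: power_mult_distrib[symmetric])
          moreover have "norm t ^ (2 * N + 2 * l) = h ^ N * h ^ l * norm s ^ (2 * N + 2 * l)"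
            unfolding nt power_mult_distrib by (simp add: power_add ehN)
          moreover have "norm t ^ k = \<epsilon> ^ k * norm s ^ k" unfolding nt power_mult_distrib ..
          moreover have "h ^ l \<noteq> 0" using h0 by simp
          moreover have "2 ^ l / X * (B * (Y * X * Q) * (D l k * U)) = (2 ^ l * B * D l k) * (Y * (Q * U))" if "X \<noteq> 0" for X B Y Q U :: real
            using that by (simp add: field_simps)
          ultimately show ?thesis unfolding A3_def by (simp only:)
        qed
        also have "\<dots> \<le> A3 l k * (h ^ N * (norm s ^ (2 * N + 2 * l) * (1 * norm s ^ k)))"
          by (intro mult_left_mono mult_right_mono power_le_one) (use \<epsilon> D(1) \<delta>(1) h0 in \<open>auto simp: A3_def\<close>)
        finally have "G * ((2 / h) ^ l / fact l * norm (of_real (1 - c) * P l k p t)) \<le> G * (A3 l k * (h ^ N * (norm s ^ (2 * N + 2 * l) * (1 * norm s ^ k))))"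
          using G0 by (intro mult_left_mono) auto
        also have "\<dots> = A3 l k * (h ^ N * (norm s ^ (2 * N + 2 * l + k) * G))" by (simp add: power_add mult_ac)
        also have "\<dots> \<le> A3 l k * (h ^ N * Z s)"
          unfolding G_def by (intro mult_left_mono Zge) (use l k D(1) \<delta>(1) h0 in \<open>auto simp: A3_def\<close>)
        finally show ?thesis .
      qed
      have T23: "G * norm ((2 / of_real h) ^ l / fact l * (of_real c * (r ^ l * u y t - S l) - of_real (1 - c) * S l)) \<le>
        (A2 l + (\<Sum>k<2 * N + 2 * l. A3 l k)) * (h ^ N * Z s)" if l: "l \<le> 2 * N" for l
      proof -
        have q: "norm ((2 / of_real h) ^ l / fact l :: complex) = (2 / h) ^ l / fact l"
          using h0 by (simp add: norm_divide norm_power)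
        have "norm (of_real (1 - c) * S l) \<le> (\<Sum>k<2 * N + 2 * l. norm (of_real (1 - c) * P l k p t))"
          unfolding S_def sum_distrib_left by (rule norm_sum)
        then have "norm (of_real c * (r ^ l * u y t - S l) - of_real (1 - c) * S l) \<le>
          norm (of_real c * (r ^ l * u y t - S l)) + (\<Sum>k<2 * N + 2 * l. norm (of_real (1 - c) * P l k p t))"
          using norm_triangle_ineq4[of "of_real c * (r ^ l * u y t - S l)" "of_real (1 - c) * S l"] by linarith
        then have "G * ((2 / h) ^ l / fact l * norm (of_real c * (r ^ l * u y t - S l) - of_real (1 - c) * S l)) \<le>
          G * ((2 / h) ^ l / fact l * (norm (of_real c * (r ^ l * u y t - S l)) + (\<Sum>k<2 * N + 2 * l. norm (of_real (1 - c) * P l k p t))))"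
          using G0 h0 by (intro mult_left_mono) auto
        also have "\<dots> = G * ((2 / h) ^ l / fact l * norm (of_real c * (r ^ l * u y t - S l))) +
          (\<Sum>k<2 * N + 2 * l. G * ((2 / h) ^ l / fact l * norm (of_real (1 - c) * P l k p t)))"
          unfolding distrib_left sum_distrib_left ..
        also have "\<dots> \<le> A2 l * (h ^ N * Z s) + (\<Sum>k<2 * N + 2 * l. A3 l k * (h ^ N * Z s))"
          by (intro add_mono T2[OF l] sum_mono T3[OF l]) simp
        finally show ?thesis unfolding norm_mult[of "(2 / of_real h) ^ l / fact l"] q by (simp add: distrib_right sum_distrib_right)
      qed
      have "norm (f t - g s) \<le> G * norm (of_real c * (u y t * E1)) +
        (\<Sum>l\<le>2 * N. G * norm ((2 / of_real h) ^ l / fact l * (of_real c * (r ^ l * u y t - S l) - of_real (1 - c) * S l)))"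
      proof -
        have "norm (f t - g s) = G * norm (of_real c * (u y t * E1) +
         (\<Sum>l\<le>2 * N. (2 / of_real h) ^ l / fact l * (of_real c * (r ^ l * u y t - S l) - of_real (1 - c) * S l)))"
          unfolding dec norm_mult[of "of_real G"] using G0 by simp
        also have "\<dots> \<le> G * (norm (of_real c * (u y t * E1)) + (\<Sum>l\<le>2 * N. norm ((2 / of_real h) ^ l / fact l * (of_real c * (r ^ l * u y t - S l) - of_real (1 - c) * S l))))"
          by (intro mult_left_mono order_trans[OF norm_triangle_ineq add_mono] order_refl norm_sum) (use G0 in simp)
        finally show ?thesis unfolding distrib_left sum_distrib_left .
      qed
      also have "\<dots> \<le> A1 * (h ^ N * Z s) + (\<Sum>l\<le>2 * N. (A2 l + (\<Sum>k<2 * N + 2 * l. A3 l k)) * (h ^ N * Z s))"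
        by (intro add_mono T1 sum_mono T23) simp
      also have "\<dots> = A * h ^ N * Z s" unfolding A_def distrib_right sum_distrib_right by (simp add: mult.assoc)
      finally show ?thesis unfolding t_def .
    qed
    have ibd: "integrable lborel (\<lambda>s. A * h ^ N * Z s)" using iZ by simp
    have ifs: "integrable lborel (\<lambda>s. f (\<epsilon> *\<^sub>R s) - g s)"
    proof (rule Bochner_Integration.integrable_bound[OF ibd])
      have [measurable]: "g \<in> borel_measurable lborel" using ig by (rule borel_measurable_integrable)
      show "(\<lambda>s. f (\<epsilon> *\<^sub>R s) - g s) \<in> borel_measurable lborel" by measurable
      show "AE s in lborel. norm (f (\<epsilon> *\<^sub>R s) - g s) \<le> norm (A * h ^ N * Z s)"
        using pw order_trans[OF pw abs_ge_self] by (intro AE_I2) simp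
    qed
    have iff: "integrable lborel (\<lambda>s. f (\<epsilon> *\<^sub>R s))"
      using Bochner_Integration.integrable_add[OF ifs ig] by simp
    have "norm ((LINT s|lborel. f (\<epsilon> *\<^sub>R s)) - (LINT s|lborel. g s)) = norm (LINT s|lborel. f (\<epsilon> *\<^sub>R s) - g s)"
      using Bochner_Integration.integral_diff[OF iff ig] by simp
    also have "\<dots> \<le> (LINT s|lborel. norm (f (\<epsilon> *\<^sub>R s) - g s))" by (rule integral_norm_bound)
    also have "\<dots> \<le> (LINT s|lborel. A * h ^ N * Z s)"
      by (rule integral_mono[OF integrable_norm[OF ifs] ibd pw])
    also have "\<dots> = A * (LINT s|lborel. Z s) * h ^ N" by simp
    finally have "norm ((LINT s|lborel. f (\<epsilon> *\<^sub>R s)) - (LINT s|lborel. g s)) \<le> A * (LINT s|lborel. Z s) * h ^ N" .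
    then show ?thesis unfolding sc[symmetric] Ig2 unfolding p_def f_def .
  qed
  then show ?thesis by (intro exI[of _ "A * (LINT s|lborel. Z s)"]) simp
qed

section \<open>The coefficients of the expansion\<close>

definition mcon_dir :: "('n::finite cpair \<Rightarrow> complex) \<Rightarrow> 'n cpair \<Rightarrow> real^('n + 'n) \<Rightarrow> 'n cpair" where
  "mcon_dir \<Psi> p t = (zvec t, - (Lam_inv \<Psi> p *v vconj (zvec t)))"

lemma mcon_1: "mcon \<Psi> (1, t, y) = adiag y + mcon_dir \<Psi> (adiag y) t"
  unfolding mcon_def mcon_dir_def by simp

text \<open>The jet of the phase plus the squared norm of t. The degrees below 3, which on the
  anti-diagonal sum to minus this square, are set to zero everywhere, so that
  \<open>jpow_low\<close> applies at all points.\<close>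

definition phase_jet :: "('n::finite cpair \<Rightarrow> complex) \<Rightarrow> nat \<Rightarrow> 'n cpair \<Rightarrow> real^('n + 'n) \<Rightarrow> complex" where
  "phase_jet \<Psi> k p t = (if k < 3 then 0 else phase_hX \<Psi> k (mcon_dir \<Psi> p t) p / fact k)"

definition symbol_jet :: "('n::finite cpair \<Rightarrow> complex) \<Rightarrow> ('n cpair \<Rightarrow> complex) \<Rightarrow> nat \<Rightarrow> 'n cpair \<Rightarrow> real^('n + 'n) \<Rightarrow> complex" where
  "symbol_jet \<Psi> b k p t = hX k (mcon_dir \<Psi> p t) b p / fact k"

text \<open>Expand \<open>exp (2 * r / h)\<close> in powers of \<open>r = phase + \<bar>t\<bar>\<^sup>2\<close> and substitute \<open>t = sqrt h * s\<close>: the degree \<open>k\<close>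
  part of \<open>r ^ l * b\<close> carries the factor \<open>h powr (k / 2 - l)\<close>, and only even \<open>k\<close> contribute.\<close>

definition expansion_coeff :: "('n::finite cpair \<Rightarrow> complex) \<Rightarrow> ('n cpair \<Rightarrow> complex) \<Rightarrow> nat \<Rightarrow> 'n cpair \<Rightarrow> complex" where
  "expansion_coeff \<Psi> b j p = affine_jac TYPE('n) * det (Lam_inv \<Psi> p) *
     (\<Sum>l\<le>2 * j. 2 ^ l / fact l * gauss_int (jpow (phase_jet \<Psi>) (symbol_jet \<Psi> b) l (2 * (j + l)) p))"

text \<open>The total mass of the Gaussian weight; together with \<open>affine_jac\<close> it is the
  constant factor of the leading coefficient in \<open>expansion_coeff_0\<close>.\<close>

definition gauss_const :: "'n::finite itself \<Rightarrow> complex" where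
  "gauss_const _ = gauss_int (\<lambda>_ :: real^('n + 'n). 1)"

lemma expansion_coeff_0: "expansion_coeff \<Psi> b 0 p = gauss_const TYPE('n) * affine_jac TYPE('n) * det (Lam_inv \<Psi> p) * b p" for p :: "'n::finite cpair"
proof -
  have "gauss_int (symbol_jet \<Psi> b 0 p) = gauss_const TYPE('n) * b p"
    unfolding gauss_int_def gauss_const_def symbol_jet_def
    by (simp add: scaleR_conv_of_real)
  then show ?thesis unfolding expansion_coeff_def by simp
qed

lemma gauss_const_nonzero: "gauss_const TYPE('n::finite) \<noteq> 0"
proof -
  have i: "integrable lborel (\<lambda>s::real^('n + 'n). exp (- 2 * (norm s)\<^sup>2))" by (rule integrable_gauss) simp
  have e: "gauss_const TYPE('n) = of_real (LINT s|lborel. exp (- 2 * (norm (s::real^('n + 'n)))\<^sup>2))"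
    unfolding gauss_const_def gauss_int_def by (simp add: scaleR_conv_of_real)
  have "(LINT s|lborel. exp (- 2 * (norm (s::real^('n + 'n)))\<^sup>2)) \<noteq> 0"
  proof
    assume "(LINT s|lborel. exp (- 2 * (norm (s::real^('n + 'n)))\<^sup>2)) = 0"
    then have "AE s in lborel. exp (- 2 * (norm (s::real^('n + 'n)))\<^sup>2) = 0"
      using integral_nonneg_eq_0_iff_AE[OF i] by simp
    then have "AE s::real^('n + 'n) in lborel. False" by simp
    then show False by (simp add: eventually_False ae_filter_eq_bot_iff)
  qed
  then show ?thesis unfolding e by simp
qed

text \<open>The symbol enters through its holomorphic jet at the point alone, and by
  \<open>hX_antidiag_cong\<close> this depends only on the restriction to the anti-diagonal
  nearby.\<close>

lemma expansion_coeff_cong: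
  assumes "open W" "open V" "\<And>x. x \<in> V \<Longrightarrow> adiag x \<in> W" "AH W b" "AH W b'"
    "\<And>x. x \<in> V \<Longrightarrow> b (adiag x) = b' (adiag x)" "y \<in> V"
  shows "expansion_coeff \<Psi> b j (adiag y) = expansion_coeff \<Psi> b' j (adiag y)"
proof -
  have "symbol_jet \<Psi> b k (adiag y) t = symbol_jet \<Psi> b' k (adiag y) t" for k t
    using hX_antidiag_cong[OF assms(1,2) assms(3)[unfolded adiag_def] assms(4,5) assms(6)[unfolded adiag_def] assms(7)]
    unfolding symbol_jet_def adiag_def by simp
  then have "jpow (phase_jet \<Psi>) (symbol_jet \<Psi> b) l k (adiag y) = jpow (phase_jet \<Psi>) (symbol_jet \<Psi> b') l k (adiag y)" for l k
    by (intro ext jpow_cong)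
  then show ?thesis unfolding expansion_coeff_def by simp
qed

context bergman_phase
begin

lemma AH_Lam_inv_entry: "AH (bidisc x0 R) (\<lambda>p. Lam_inv \<Psi> p $ k $ l)"
  by (rule AH_Lam_inv[OF open_bidisc \<Psi> det_Lam])

lemma AH_det_Lam_inv: "AH (bidisc x0 R) (\<lambda>p. det (Lam_inv \<Psi> p))"
  using AH_det[OF open_bidisc, of x0 R "\<lambda>p k l. Lam_inv \<Psi> p $ k $ l"] AH_Lam_inv_entry by simp

lemma hpoly_mcon_dir_fst: "hpoly (bidisc x0 R) (Suc 0) (\<lambda>p t. zvec t $ j)"
proof -
  have "hpoly (bidisc x0 R) (Suc 0) (\<lambda>p t. 1 * zvec t $ j)"
  proof (rule hpoly_term[OF AH_const])
    show "continuous_on UNIV (\<lambda>t :: real^('n + 'n). zvec t $ j)"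
      by (rule continuous_on_component[OF linear_continuous_on[OF bounded_linear_zvec]])
    show "zvec (\<tau> *\<^sub>R t) $ j = of_real \<tau> ^ Suc 0 * zvec t $ j" for \<tau> and t :: "real^('n + 'n)"
      unfolding zvec_scaleR vector_scaleR_component by (simp add: scaleR_conv_of_real)
  qed
  then show ?thesis by simp
qed

lemma hpoly_mcon_dir_snd: "hpoly (bidisc x0 R) (Suc 0) (\<lambda>p t. - (Lam_inv \<Psi> p *v vconj (zvec t)) $ j)"
proof -
  have "hpoly (bidisc x0 R) (Suc 0) (\<lambda>p t. \<Sum>k\<in>UNIV. (- 1 * Lam_inv \<Psi> p $ j $ k) * cnj (zvec t $ k))"
  proof (intro hpoly_sum hpoly_term)
    show "AH (bidisc x0 R) (\<lambda>p. - 1 * Lam_inv \<Psi> p $ j $ k)" for k by (rule AH_cmult[OF open_bidisc AH_Lam_inv_entry])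
    show "continuous_on UNIV (\<lambda>t :: real^('n + 'n). cnj (zvec t $ k))" for k
      by (intro continuous_on_cnj continuous_on_component[OF linear_continuous_on[OF bounded_linear_zvec]])
    show "cnj (zvec (\<tau> *\<^sub>R t) $ k) = of_real \<tau> ^ Suc 0 * cnj (zvec t $ k)" for \<tau> k and t :: "real^('n + 'n)"
      unfolding zvec_scaleR vector_scaleR_component by (simp add: scaleR_conv_of_real)
  qed
  then show ?thesis by (simp add: matrix_vector_mult_def vconj_def sum_negf)
qed

lemma hpoly_symbol_jet: "AH (bidisc x0 R) b \<Longrightarrow> hpoly (bidisc x0 R) k (symbol_jet \<Psi> b k)"
proof -
  assume b: "AH (bidisc x0 R) b"
  have "hpoly (bidisc x0 R) (Suc 0) (\<lambda>p t. crd i (mcon_dir \<Psi> p t))" for i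
    by (cases i) (simp_all add: crd_def mcon_dir_def hpoly_mcon_dir_fst hpoly_mcon_dir_snd[simplified])
  then have "hpoly (bidisc x0 R) k (\<lambda>p t. 1 / fact k * hX k (mcon_dir \<Psi> p t) b p)"
    by (intro hpoly_cmult hX_hpoly open_bidisc b)
  then show ?thesis unfolding symbol_jet_def by simp
qed

lemma hpoly_phase_jet: "hpoly (bidisc x0 R) k (phase_jet \<Psi> k)"
proof (cases "k < 3")
  case True
  then show ?thesis unfolding phase_jet_def by simp
next
  case False
  have h: "hpoly (bidisc x0 R) k (\<lambda>p t. hX k (w p t) \<Psi> p)" if "\<And>i. hpoly (bidisc x0 R) (Suc 0) (\<lambda>p t. crd i (w p t))" for w
    by (rule hX_hpoly[OF open_bidisc that \<Psi>])
  have c: "hpoly (bidisc x0 R) (Suc 0) (\<lambda>p t. crd i (mcon_dir \<Psi> p t))"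
    "hpoly (bidisc x0 R) (Suc 0) (\<lambda>p t. crd i (fst (mcon_dir \<Psi> p t), 0))"
    "hpoly (bidisc x0 R) (Suc 0) (\<lambda>p t. crd i (0, snd (mcon_dir \<Psi> p t)))" for i
    by (cases i; simp add: crd_def mcon_dir_def hpoly_mcon_dir_fst hpoly_mcon_dir_snd[simplified])+
  have "hpoly (bidisc x0 R) k (\<lambda>p t. 1 / fact k * (hX k (mcon_dir \<Psi> p t) \<Psi> p +
     (- 1) * hX k (fst (mcon_dir \<Psi> p t), 0) \<Psi> p + (- 1) * hX k (0, snd (mcon_dir \<Psi> p t)) \<Psi> p))"
    by (intro hpoly_cmult hpoly_add open_bidisc h c)
  moreover have "phase_jet \<Psi> k = (\<lambda>p t. 1 / fact k * (hX k (mcon_dir \<Psi> p t) \<Psi> p +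
     (- 1) * hX k (fst (mcon_dir \<Psi> p t), 0) \<Psi> p + (- 1) * hX k (0, snd (mcon_dir \<Psi> p t)) \<Psi> p))"
    using False by (intro ext) (simp add: phase_jet_def phase_hX_def)
  ultimately show ?thesis by simp
qed

lemma hpoly_jpow: "(\<And>k. hpoly (bidisc x0 R) k (Q k)) \<Longrightarrow> hpoly (bidisc x0 R) k (jpow (phase_jet \<Psi>) Q l k)"
proof (induction l arbitrary: k)
  case 0
  then show ?case by simp
next
  case (Suc l)
  show ?case unfolding jpow.simps
  proof (rule hpoly_sum)
    fix i assume "i \<in> {..k}"
    then have "i + (k - i) = k" by simp
    then show "hpoly (bidisc x0 R) k (\<lambda>p t. phase_jet \<Psi> i p t * jpow (phase_jet \<Psi>) Q l (k - i) p t)"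
      using hpoly_mult[OF open_bidisc hpoly_phase_jet[of i] Suc.IH[OF Suc.prems, of "k - i"]] by (simp only:)
  qed
qed

text \<open>The operators preserve almost holomorphy on the whole bidisc, so they can be applied
  again to their own results in the recursion for the symbol.\<close>

lemma AH_expansion_coeff: "AH (bidisc x0 R) b \<Longrightarrow> AH (bidisc x0 R) (expansion_coeff \<Psi> b j)"
  unfolding expansion_coeff_def
  by (intro AH_mult AH_sum open_bidisc AH_const AH_det_Lam_inv AH_gauss_int[OF open_bidisc hpoly_jpow[OF hpoly_symbol_jet]])

lemma phase_expansion_bound:
  obtains C where "C \<ge> 0" "\<And>y w. norm (y - x0) \<le> R / 4 \<Longrightarrow> norm w \<le> R / 4 \<Longrightarrow>
     norm (phase \<Psi> (adiag y) (adiag y + w) - (\<Sum>k<n. phase_hX \<Psi> k w (adiag y) / fact k)) \<le> C * norm w ^ n"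
proof -
  have "R / 2 < R" using R by simp
  from phase_Taylor[OF \<Psi> this, of n] obtain C where C: "C \<ge> 0" "\<forall>y w. norm (y - x0) \<le> R / 2 / 2 \<longrightarrow> norm w \<le> R / 2 / 2 \<longrightarrow>
     norm (phase \<Psi> (adiag y) (adiag y + w) - (\<Sum>k<n. phase_hX \<Psi> k w (adiag y) / fact k)) \<le> C * norm w ^ n"
    by (elim exE conjE)
  show thesis by (rule that[OF C(1)], rule C(2)[rule_format]) simp_all
qed

lemma symbol_expansion_bound:
  assumes "AH (bidisc x0 R) b"
  obtains C where "C \<ge> 0" "\<And>y w. norm (y - x0) \<le> R / 4 \<Longrightarrow> norm w \<le> R / 4 \<Longrightarrow>
     norm (b (adiag y + w) - (\<Sum>k<n. hX k w b (adiag y) / fact k)) \<le> C * norm w ^ n"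
proof -
  have "R / 2 < R" using R by simp
  from AH_Taylor_adiag[OF assms this, of n] obtain C where C: "C \<ge> 0" "\<forall>y w. norm (y - x0) \<le> R / 2 / 2 \<longrightarrow> norm w \<le> R / 2 / 2 \<longrightarrow>
     norm (b (adiag y + w) - (\<Sum>k<n. hX k w b (adiag y) / fact k)) \<le> C * norm w ^ n"
    by (elim exE conjE)
  show thesis by (rule that[OF C(1)], rule C(2)[rule_format]) simp_all
qed

text \<open>Degrees 0 and 1 vanish, and in degree 2 the adapted direction turns the bilinear form
  into minus the squared norm.\<close>

lemma phase_hX_mcon_dir:
  assumes "y \<in> ball x0 R"
  shows "(\<Sum>k<3. phase_hX \<Psi> k (mcon_dir \<Psi> (adiag y) t) (adiag y) / fact k) = - of_real ((norm t)\<^sup>2)"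
proof -
  let ?p = "adiag y"
  have p: "?p \<in> bidisc x0 R" by (rule adiag_in[OF assms])
  note low = phase_hX_low[OF open_bidisc AH_smooth[OF \<Psi>] p, of "mcon_dir \<Psi> ?p t"]
  have "(\<Sum>j\<in>UNIV. \<Sum>k\<in>UNIV. Lam \<Psi> ?p $ j $ k * (fst (mcon_dir \<Psi> ?p t) $ j * snd (mcon_dir \<Psi> ?p t) $ k)) = bil \<Psi> ?p (zvec t) (- (Lam_inv \<Psi> ?p *v vconj (zvec t)))"
    unfolding bil_def mcon_dir_def by simp
  also have "\<dots> = - of_real ((norm t)\<^sup>2)" unfolding bil_linear bil_Lam_inv[OF det_Lam[OF p]] by simp
  finally have e: "phase_hX \<Psi> (Suc (Suc 0)) (mcon_dir \<Psi> ?p t) ?p = 2 * (- of_real ((norm t)\<^sup>2))" unfolding low by (rule arg_cong)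
  show ?thesis by (simp add: numeral_3_eq_3 low(1,2) e)
qed

lemma expansion_radius:
  obtains \<delta>0 B CR where "0 < \<delta>0" "\<delta>0 \<le> 1" "B \<ge> 0" "B * \<delta>0 \<le> R / 4" "CR \<ge> 0" "2 * CR * \<delta>0 \<le> 1"
    "\<And>y t. y \<in> cball x0 (R / 4) \<Longrightarrow> norm (mcon_dir \<Psi> (adiag y) t) \<le> B * norm t"
    "\<And>y t. y \<in> cball x0 (R / 4) \<Longrightarrow> norm t \<le> \<delta>0 \<Longrightarrow> mcon \<Psi> (1, t, y) \<in> bidisc x0 R"
    "\<And>y t. y \<in> cball x0 (R / 4) \<Longrightarrow> norm t \<le> \<delta>0 \<Longrightarrow>
       norm (phase \<Psi> (adiag y) (mcon \<Psi> (1, t, y)) + of_real ((norm t)\<^sup>2)) \<le> CR * norm t ^ 3"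
proof -
  obtain B \<delta>1 where B: "B \<ge> 1" "\<delta>1 > 0"
    "\<And>s t y. s \<in> {0..1} \<Longrightarrow> y \<in> cball x0 (R / 4) \<Longrightarrow> norm (mcon \<Psi> (s, t, y) - adiag y) \<le> B * norm t"
    "\<And>s t y. s \<in> {0..1} \<Longrightarrow> y \<in> cball x0 (R / 4) \<Longrightarrow> norm t \<le> \<delta>1 \<Longrightarrow> mcon \<Psi> (s, t, y) \<in> bidisc x0 R"
    by (rule mcon_bounds) (rule that)
  have wB: "norm (mcon_dir \<Psi> (adiag y) t) \<le> B * norm t" if "y \<in> cball x0 (R / 4)" for y t
    using B(3)[of 1 y t] that unfolding mcon_1 by simp
  obtain C where C: "C \<ge> 0" "\<And>y w. norm (y - x0) \<le> R / 4 \<Longrightarrow> norm w \<le> R / 4 \<Longrightarrow>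
     norm (phase \<Psi> (adiag y) (adiag y + w) - (\<Sum>k<3. phase_hX \<Psi> k w (adiag y) / fact k)) \<le> C * norm w ^ 3"
    by (rule phase_expansion_bound[of 3]) (rule that)
  define CR where "CR = C * B ^ 3"
  have CR: "CR \<ge> 0" unfolding CR_def using C B by simp
  \<comment> \<open>One condition per term: products of jets, values in the bidisc, increments
    within the range of Taylor's formula, and \<open>2 * CR * \<delta> \<le> 1\<close> for the
    second bound on the exponent.\<close>
  define \<delta> where "\<delta> = min (min 1 \<delta>1) (min (R / (4 * B)) (1 / (2 * CR + 1)))"
  have d: "\<delta> > 0" "\<delta> \<le> 1" "\<delta> \<le> \<delta>1" "\<delta> \<le> R / (4 * B)" "\<delta> \<le> 1 / (2 * CR + 1)"
    unfolding \<delta>_def using B R CR by auto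
  have Bd: "B * \<delta> \<le> R / 4" using d(4) B(1) by (simp add: field_simps)
  show thesis
  proof (rule that[OF d(1,2) _ Bd CR])
    show "B \<ge> 0" using B by simp
    have "2 * CR * \<delta> \<le> (2 * CR + 1) * \<delta>" using d(1) by (intro mult_right_mono) auto
    also have "\<dots> \<le> (2 * CR + 1) * (1 / (2 * CR + 1))" using d(5) CR by (intro mult_left_mono) auto
    also have "\<dots> = 1" using CR by simp
    finally show "2 * CR * \<delta> \<le> 1" .
    fix y :: "complex^'n" and t :: "real^('n + 'n)" assume y: "y \<in> cball x0 (R / 4)"
    show "norm (mcon_dir \<Psi> (adiag y) t) \<le> B * norm t" by (rule wB[OF y])
    assume t: "norm t \<le> \<delta>"
    show "mcon \<Psi> (1, t, y) \<in> bidisc x0 R" using B(4)[of 1 y t] y t d(3) by simp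
    have yb: "y \<in> ball x0 R" using y R by simp
    have w: "norm (mcon_dir \<Psi> (adiag y) t) \<le> R / 4"
      using order_trans[OF wB[OF y] order_trans[OF mult_left_mono[OF t] Bd]] B(1) by simp
    have "norm (phase \<Psi> (adiag y) (mcon \<Psi> (1, t, y)) + of_real ((norm t)\<^sup>2)) \<le> C * norm (mcon_dir \<Psi> (adiag y) t) ^ 3"
      using C(2)[OF _ w, of y] y unfolding phase_hX_mcon_dir[OF yb] mcon_1 by (simp add: dist_norm norm_minus_commute)
    also have "\<dots> \<le> C * (B * norm t) ^ 3" by (intro mult_left_mono power_mono wB y C) simp
    finally show "norm (phase \<Psi> (adiag y) (mcon \<Psi> (1, t, y)) + of_real ((norm t)\<^sup>2)) \<le> CR * norm t ^ 3"
      unfolding CR_def by (simp add: power_mult_distrib)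
  qed
qed

text \<open>The Jacobian is constant along the adapted contour and leaves the integral; what remains
  is a Gaussian expansion for the jets of phase and symbol. The radius does not depend on the
  symbol.\<close>

lemma expansion:
  obtains \<delta>0 where "\<delta>0 > 0"
    "\<And>b \<delta> N. AH (bidisc x0 R) b \<Longrightarrow> 0 < \<delta> \<Longrightarrow> \<delta> \<le> \<delta>0 \<Longrightarrow> \<exists>C. \<forall>h\<in>{0<..1}. \<forall>y\<in>cball x0 (R / 4).
       norm (model_int \<Psi> \<delta> b h y - (\<Sum>j<N. of_real h ^ j * expansion_coeff \<Psi> b j (adiag y))) \<le> C * h ^ N"
proof -
  let ?W = "bidisc x0 R" and ?V = "cball x0 (R / 4)"
  obtain \<delta>0 B CR where d0: "0 < \<delta>0" "\<delta>0 \<le> 1" and B: "B \<ge> 0" "B * \<delta>0 \<le> R / 4" and CR: "CR \<ge> 0" "2 * CR * \<delta>0 \<le> 1"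
    and wB: "\<And>y t. y \<in> ?V \<Longrightarrow> norm (mcon_dir \<Psi> (adiag y) t) \<le> B * norm t"
    and mW: "\<And>y t. y \<in> ?V \<Longrightarrow> norm t \<le> \<delta>0 \<Longrightarrow> mcon \<Psi> (1, t, y) \<in> ?W"
    and ph: "\<And>y t. y \<in> ?V \<Longrightarrow> norm t \<le> \<delta>0 \<Longrightarrow>
       norm (phase \<Psi> (adiag y) (mcon \<Psi> (1, t, y)) + of_real ((norm t)\<^sup>2)) \<le> CR * norm t ^ 3"
    by (rule expansion_radius) (rule that)
  have VW: "?V \<subseteq> ball x0 R" using R by auto
  have aV: "adiag ` ?V \<subseteq> ?W" using adiag_in VW by blast
  have w4: "norm (mcon_dir \<Psi> (adiag y) t) \<le> R / 4" if "y \<in> ?V" "norm t \<le> \<delta>0" for y t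
    using order_trans[OF wB[OF that(1)] order_trans[OF mult_left_mono[OF that(2) B(1)] B(2)]] .
  have y4: "norm (y - x0) \<le> R / 4" if "y \<in> ?V" for y using that by (simp add: dist_norm norm_minus_commute)
  have wK: "norm (mcon_dir \<Psi> (adiag y) t) ^ K \<le> B ^ K * norm t ^ K" if "y \<in> ?V" for y t K
    using power_mono[OF wB[OF that, of t] norm_ge_zero, of K] by (simp add: power_mult_distrib)
  have rj: "jet ?W ?V \<delta>0 (\<lambda>y t. phase \<Psi> (adiag y) (mcon \<Psi> (1, t, y)) + of_real ((norm t)\<^sup>2)) (phase_jet \<Psi>)"
    unfolding jet_def
  proof (intro conjI allI hpoly_phase_jet)
    fix K
    show "\<exists>C\<ge>0. \<forall>y\<in>?V. \<forall>t. norm t \<le> \<delta>0 \<longrightarrow> norm (phase \<Psi> (adiag y) (mcon \<Psi> (1, t, y)) + of_real ((norm t)\<^sup>2)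
      - (\<Sum>k<K. phase_jet \<Psi> k (adiag y) t)) \<le> C * norm t ^ K"
    \<comment> \<open>Up to order 3 all jet terms are zero and the cubic bound is enough. Beyond
      that, the degrees below 3 of the Taylor sum have to be split off.\<close>
    proof (cases "K \<le> 3")
      case True
      show ?thesis
      proof (intro exI[of _ CR] conjI ballI allI impI CR(1))
        fix y t assume y: "y \<in> ?V" and t: "norm (t :: real^('n + 'n)) \<le> \<delta>0"
        have "(\<Sum>k<K. phase_jet \<Psi> k (adiag y) t) = 0" using True by (intro sum.neutral) (simp add: phase_jet_def)
        moreover have "CR * norm t ^ 3 \<le> CR * norm t ^ K"
          by (intro mult_left_mono power_decreasing True CR) (use t d0 in auto)
        ultimately show "norm (phase \<Psi> (adiag y) (mcon \<Psi> (1, t, y)) + of_real ((norm t)\<^sup>2)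
          - (\<Sum>k<K. phase_jet \<Psi> k (adiag y) t)) \<le> CR * norm t ^ K" using ph[OF y t] by simp
      qed
    next
      case False
      obtain C where C: "C \<ge> 0" "\<And>y w. norm (y - x0) \<le> R / 4 \<Longrightarrow> norm w \<le> R / 4 \<Longrightarrow>
         norm (phase \<Psi> (adiag y) (adiag y + w) - (\<Sum>k<K. phase_hX \<Psi> k w (adiag y) / fact k)) \<le> C * norm w ^ K"
        by (rule phase_expansion_bound[of K]) (rule that)
      show ?thesis
      proof (intro exI[of _ "C * B ^ K"] conjI ballI allI impI)
        show "0 \<le> C * B ^ K" using C B by simp
        fix y t assume y: "y \<in> ?V" and t: "norm (t :: real^('n + 'n)) \<le> \<delta>0"
        let ?f = "\<lambda>k. phase_hX \<Psi> k (mcon_dir \<Psi> (adiag y) t) (adiag y) / fact k"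
        have K: "{..<K} = {..<3} \<union> {3..<K}" using False by auto
        have "sum ?f {..<K} = sum ?f {..<3} + sum ?f {3..<K}" unfolding K by (rule sum.union_disjoint) auto
        also have "sum ?f {..<3} = - of_real ((norm t)\<^sup>2)" using phase_hX_mcon_dir[of y t] y VW by blast
        also have "sum ?f {3..<K} = (\<Sum>k<K. phase_jet \<Psi> k (adiag y) t)"
          by (rule sum.mono_neutral_cong_left) (auto simp: phase_jet_def)
        finally have e: "sum ?f {..<K} = - of_real ((norm t)\<^sup>2) + (\<Sum>k<K. phase_jet \<Psi> k (adiag y) t)" .
        have "norm (phase \<Psi> (adiag y) (mcon \<Psi> (1, t, y)) + of_real ((norm t)\<^sup>2) - (\<Sum>k<K. phase_jet \<Psi> k (adiag y) t))
          \<le> C * norm (mcon_dir \<Psi> (adiag y) t) ^ K"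
          using C(2)[OF y4[OF y] w4[OF y t]] unfolding mcon_1 e by (simp add: algebra_simps)
        also have "\<dots> \<le> C * (B ^ K * norm t ^ K)" by (intro mult_left_mono wK y C)
        finally show "norm (phase \<Psi> (adiag y) (mcon \<Psi> (1, t, y)) + of_real ((norm t)\<^sup>2) - (\<Sum>k<K. phase_jet \<Psi> k (adiag y) t))
          \<le> C * B ^ K * norm t ^ K" by (simp only: mult.assoc)
      qed
    qed
  qed
  have bj: "jet ?W ?V \<delta>0 (\<lambda>y t. b (mcon \<Psi> (1, t, y))) (symbol_jet \<Psi> b)" if b: "AH ?W b" for b
    unfolding jet_def
  proof (intro conjI allI hpoly_symbol_jet b)
    fix K
    obtain C where C: "C \<ge> 0" "\<And>y w. norm (y - x0) \<le> R / 4 \<Longrightarrow> norm w \<le> R / 4 \<Longrightarrow>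
       norm (b (adiag y + w) - (\<Sum>k<K. hX k w b (adiag y) / fact k)) \<le> C * norm w ^ K"
      by (rule symbol_expansion_bound[OF b, of K]) (rule that)
    show "\<exists>C\<ge>0. \<forall>y\<in>?V. \<forall>t. norm t \<le> \<delta>0 \<longrightarrow> norm (b (mcon \<Psi> (1, t, y)) - (\<Sum>k<K. symbol_jet \<Psi> b k (adiag y) t)) \<le> C * norm t ^ K"
    proof (intro exI[of _ "C * B ^ K"] conjI ballI allI impI)
      show "0 \<le> C * B ^ K" using C B by simp
      fix y t assume y: "y \<in> ?V" and t: "norm (t :: real^('n + 'n)) \<le> \<delta>0"
      have "norm (b (mcon \<Psi> (1, t, y)) - (\<Sum>k<K. symbol_jet \<Psi> b k (adiag y) t)) \<le> C * norm (mcon_dir \<Psi> (adiag y) t) ^ K"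
        using C(2)[OF y4[OF y] w4[OF y t]] unfolding mcon_1 symbol_jet_def .
      also have "\<dots> \<le> C * (B ^ K * norm t ^ K)" by (intro mult_left_mono wK y C)
      finally show "norm (b (mcon \<Psi> (1, t, y)) - (\<Sum>k<K. symbol_jet \<Psi> b k (adiag y) t)) \<le> C * B ^ K * norm t ^ K" by (simp only: mult.assoc)
    qed
  qed
  have cm: "continuous_on (cball 0 \<delta>) (\<lambda>t. mcon \<Psi> (1, t, y))" if "y \<in> ?V" for y \<delta>
    by (rule continuous_on_compose2[OF smooth_on_continuous[OF smooth_on_mcon], of _ "\<lambda>t. (1, t, y)"])
       (use that VW in \<open>auto intro!: continuous_intros\<close>)
  show thesis
  proof (rule that[OF d0(1)])
    fix b \<delta> N assume b: "AH ?W b" and \<delta>: "0 < \<delta>" "\<delta> \<le> \<delta>0"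
    have sub: "(\<lambda>t. mcon \<Psi> (1, t, y)) ` cball 0 \<delta> \<subseteq> ?W" if "y \<in> ?V" for y
      using mW[OF that] \<delta> by auto
    have "\<exists>C. \<forall>h\<in>{0<..1}. \<forall>y\<in>?V. norm ((LINT t|lborel. cut \<delta> t *\<^sub>R (exp (2 / of_real h * phase \<Psi> (adiag y) (mcon \<Psi> (1, t, y))) * b (mcon \<Psi> (1, t, y)))) / of_real h ^ CARD('n)
     - (\<Sum>j<N. of_real h ^ j * (\<Sum>l\<le>2 * j. 2 ^ l / fact l * gauss_int (jpow (phase_jet \<Psi>) (symbol_jet \<Psi> b) l (2 * (j + l)) (adiag y))))) \<le> C * h ^ N"
    proof (rule gauss_expansion[OF open_bidisc compact_cball aV \<delta>(1)])
      show "\<delta> \<le> 1" using \<delta> d0 by simp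
      show "jet ?W ?V \<delta> (\<lambda>y t. (phase \<Psi> (adiag y) (mcon \<Psi> (1, t, y)) + of_real ((norm t)\<^sup>2)) ^ l * b (mcon \<Psi> (1, t, y)))
        (jpow (phase_jet \<Psi>) (symbol_jet \<Psi> b) l)" for l
        by (rule jet_smaller[OF jet_jpow[OF open_bidisc compact_cball aV d0(2) rj bj[OF b]] \<delta>(2)])
      show "jpow (phase_jet \<Psi>) (symbol_jet \<Psi> b) l k p t = 0" if "k < 3 * l" for l k p t
        by (rule jpow_low[OF _ that]) (simp add: phase_jet_def)
      show "CR \<ge> 0" by (rule CR)
      show "2 * CR * \<delta> \<le> 1" using mult_left_mono[OF \<delta>(2), of "2 * CR"] CR by simp
      show "norm (phase \<Psi> (adiag y) (mcon \<Psi> (1, t, y)) + of_real ((norm t)\<^sup>2)) \<le> CR * norm t ^ 3" if "y \<in> ?V" "norm t \<le> \<delta>" for y t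
        using ph that \<delta> by simp
      fix y assume y: "y \<in> ?V"
      then have yb: "y \<in> ball x0 R" using VW by blast
      show "continuous_on (cball 0 \<delta>) (\<lambda>t. phase \<Psi> (adiag y) (mcon \<Psi> (1, t, y)))"
        by (rule continuous_on_compose2[OF smooth_on_continuous[OF smooth_on_phase[OF AH_smooth[OF \<Psi>] yb]] cm[OF y] sub[OF y]])
      show "continuous_on (cball 0 \<delta>) (\<lambda>t. b (mcon \<Psi> (1, t, y)))"
        by (rule continuous_on_compose2[OF smooth_on_continuous[OF AH_smooth[OF b]] cm[OF y] sub[OF y]])
    qed
    then obtain C where C: "\<forall>h\<in>{0<..1}. \<forall>y\<in>?V. norm ((LINT t|lborel. cut \<delta> t *\<^sub>R (exp (2 / of_real h * phase \<Psi> (adiag y) (mcon \<Psi> (1, t, y))) * b (mcon \<Psi> (1, t, y)))) / of_real h ^ CARD('n)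
     - (\<Sum>j<N. of_real h ^ j * (\<Sum>l\<le>2 * j. 2 ^ l / fact l * gauss_int (jpow (phase_jet \<Psi>) (symbol_jet \<Psi> b) l (2 * (j + l)) (adiag y))))) \<le> C * h ^ N"
      by (elim exE)
    have "continuous_on ?V (\<lambda>y. affine_jac TYPE('n) * det (Lam_inv \<Psi> (adiag y)))"
      by (intro continuous_on_mult continuous_on_const
          continuous_on_compose2[OF smooth_on_continuous[OF AH_smooth[OF AH_det_Lam_inv]] linear_continuous_on[OF bounded_linear_adiag] aV])
    note D' = compact_norm_bound[OF compact_cball this]
    obtain D where D: "D > 0" "\<And>y. y \<in> ?V \<Longrightarrow> norm (affine_jac TYPE('n) * det (Lam_inv \<Psi> (adiag y))) \<le> D"
      by (rule D') (rule that)
    show "\<exists>C. \<forall>h\<in>{0<..1}. \<forall>y\<in>?V. norm (model_int \<Psi> \<delta> b h y - (\<Sum>j<N. of_real h ^ j * expansion_coeff \<Psi> b j (adiag y))) \<le> C * h ^ N"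
    proof (intro exI[of _ "D * C"] ballI)
      fix h y assume h: "h \<in> {0<..1::real}" and y: "y \<in> ?V"
      define K where "K = affine_jac TYPE('n) * det (Lam_inv \<Psi> (adiag y))"
      define I where "I = (LINT t|lborel. cut \<delta> t *\<^sub>R (exp (2 / of_real h * phase \<Psi> (adiag y) (mcon \<Psi> (1, t, y))) * b (mcon \<Psi> (1, t, y))))"
      define G where "G j = (\<Sum>l\<le>2 * j. 2 ^ l / fact l * gauss_int (jpow (phase_jet \<Psi>) (symbol_jet \<Psi> b) l (2 * (j + l)) (adiag y)))" for j
      have yb: "y \<in> ball x0 R" using y VW by blast
      have "cut_int \<Psi> (mcon \<Psi>) \<delta> b h 1 y = (LINT t|lborel. K * (cut \<delta> t *\<^sub>R (exp (2 / of_real h * phase \<Psi> (adiag y) (mcon \<Psi> (1, t, y))) * b (mcon \<Psi> (1, t, y)))))"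
        unfolding cut_int_def pull_jac_mcon[OF yb] K_def by (simp add: scaleR_conv_of_real mult_ac)
      also have "\<dots> = K * I" unfolding I_def by (rule integral_mult_right_zero)
      finally have m: "model_int \<Psi> \<delta> b h y = K * (I / of_real h ^ CARD('n))" unfolding model_int_def by simp
      have g: "(\<Sum>j<N. of_real h ^ j * expansion_coeff \<Psi> b j (adiag y)) = K * (\<Sum>j<N. of_real h ^ j * G j)"
        unfolding expansion_coeff_def K_def[symmetric] G_def[symmetric] sum_distrib_left by (intro sum.cong refl) (simp only: mult_ac)
      have n0: "norm (I / of_real h ^ CARD('n) - (\<Sum>j<N. of_real h ^ j * G j)) \<le> C * h ^ N"
        unfolding I_def G_def by (rule C[rule_format, OF h y])
      have "norm (model_int \<Psi> \<delta> b h y - (\<Sum>j<N. of_real h ^ j * expansion_coeff \<Psi> b j (adiag y))) = norm K * norm (I / of_real h ^ CARD('n) - (\<Sum>j<N. of_real h ^ j * G j))"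
        unfolding m g right_diff_distrib[symmetric] norm_mult ..
      also have "\<dots> \<le> D * (C * h ^ N)" by (intro mult_mono n0) (use D y in \<open>auto simp: K_def\<close>)
      finally show "norm (model_int \<Psi> \<delta> b h y - (\<Sum>j<N. of_real h ^ j * expansion_coeff \<Psi> b j (adiag y))) \<le> D * C * h ^ N" by (simp only: mult.assoc)
    qed
  qed
qed

end

section \<open>Summation of symbols\<close>

text \<open>Borel's argument: keep the \<open>j\<close>-th term only when \<open>h\<close> is small compared with its \<open>j\<close>-th derivatives.\<close>

lemma borel_symbol:
  fixes as :: "nat \<Rightarrow> 'n::finite cpair \<Rightarrow> complex"
  assumes W: "open W" "\<And>j. smooth_on W (as j)" and K0: "compact K0" "K0 \<subseteq> W" and W0: "open W0" "W0 \<subseteq> K0"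
  obtains a where "classical_symbol W0 a as"
proof -
  have b: "\<forall>j k. \<exists>C\<ge>0. \<forall>p\<in>K0. \<forall>vs. length vs \<le> k \<longrightarrow> norm (iter_deriv vs (as j) p) \<le> C * prod_list (map norm vs)"
    by (intro allI iter_deriv_bound[OF W(1) K0] W(2))
  obtain M where M: "\<And>j k. M j k \<ge> 0" "\<And>j k p vs. p \<in> K0 \<Longrightarrow> length vs \<le> k \<Longrightarrow>
      norm (iter_deriv vs (as j) p) \<le> M j k * prod_list (map norm vs)"
    using b by metis
  \<comment> \<open>The factor \<open>2 ^ j\<close> makes the tail a geometric series; since
    \<open>M j j + 1\<close> is at least 1, it also forces \<open>J h\<close> to be finite, so each
    \<open>a h\<close> is a finite sum.\<close>
  define J where "J h = {j. h * (M j j + 1) * 2 ^ j \<le> 1}" for h :: real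
  define a where "a h p = (\<Sum>j\<in>J h. of_real h ^ j * as j p)" for h p
  have finJ: "finite (J h)" if h: "h > 0" for h
  proof -
    obtain n where n: "1 / h < 2 ^ n" using real_arch_pow[of 2 "1 / h"] by auto
    have "J h \<subseteq> {..<n}"
    proof
      fix j assume "j \<in> J h"
      then have 1: "h * (M j j + 1) * 2 ^ j \<le> 1" unfolding J_def by simp
      have "h * 1 * 2 ^ j \<le> h * (M j j + 1) * 2 ^ j" using h M(1) by (intro mult_right_mono mult_left_mono) auto
      then have "h * 2 ^ j \<le> 1" using 1 by simp
      then have "2 ^ j \<le> 1 / h" using h by (simp add: field_simps)
      then have "(2::real) ^ j < 2 ^ n" using n by linarith
      then show "j \<in> {..<n}" by simp
    qed
    then show ?thesis by (rule finite_subset) simp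
  qed
  have W0W: "W0 \<subseteq> W" using W0 K0 by blast
  have s0: "smooth_on W0 (as j)" for j by (rule smooth_on_subset[OF W(2) W0W])
  have "classical_symbol W0 a as"
    unfolding classical_symbol_def
  proof (intro conjI allI impI)
    show "smooth_on W0 (as j)" for j by (rule s0)
    have "smooth_on W0 (a h)" for h
      unfolding a_def by (intro smooth_on_sum smooth_on_mult smooth_on_const s0 W0(1))
    then show "\<forall>\<^sub>F h in at_right 0. smooth_on W0 (a h)" by simp
  next
    fix N :: nat and vs :: "'n cpair list" and K :: "'n cpair set" assume K: "compact K \<and> K \<subseteq> W0"
    define k where "k = length vs"
    define \<pi> where "\<pi> = prod_list (map norm vs)"
    \<comment> \<open>From L on, \<open>M j j\<close> covers derivatives of order k, and
      \<open>j \<ge> Suc N\<close> leaves one spare factor \<open>h\<close> to be spent on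
      \<open>M j j\<close>. The finitely many terms below L are all present for small
      \<open>h\<close> and are bounded individually.\<close>
    define L where "L = max N k + 1"
    define S where "S = (\<Sum>j<L. M j k)"
    have \<pi>: "\<pi> \<ge> 0" unfolding \<pi>_def by (rule prod_list_norm_nonneg)
    have S0: "S \<ge> 0" unfolding S_def by (intro sum_nonneg M)
    have ev: "\<forall>\<^sub>F h in at_right 0. 0 < h \<and> h \<le> 1 \<and> {..<L} \<subseteq> J h"
    proof -
      have "\<forall>\<^sub>F h in at_right 0. h * (M j j + 1) * 2 ^ j \<le> 1" for j
      proof -
        have "((\<lambda>h. h * (M j j + 1) * 2 ^ j) \<longlongrightarrow> 0 * (M j j + 1) * 2 ^ j) (at_right 0)" by (intro tendsto_intros)
        then have "\<forall>\<^sub>F h in at_right 0. h * (M j j + 1) * 2 ^ j < 1" by (rule order_tendstoD(2)) simp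
        then show ?thesis by (rule eventually_mono) simp
      qed
      then have "\<forall>\<^sub>F h in at_right 0. \<forall>j\<in>{..<L}. h * (M j j + 1) * 2 ^ j \<le> 1" by (intro eventually_ball_finite) auto
      moreover have "\<forall>\<^sub>F h in at_right 0. (0::real) < h" by (rule eventually_at_right_less)
      moreover have "\<forall>\<^sub>F h in at_right 0. h < (1::real)" by (rule order_tendstoD(2)[OF tendsto_ident_at]) simp
      ultimately show ?thesis by eventually_elim (auto simp: J_def)
    qed
    show "\<exists>C. \<forall>\<^sub>F h in at_right 0. \<forall>p\<in>K. norm (iter_deriv vs (\<lambda>q. a h q - (\<Sum>j<N. of_real h ^ j * as j q)) p) \<le> C * h ^ N"
    proof (intro exI[of _ "\<pi> * (S + 2)"], rule eventually_mono[OF ev], intro ballI)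
      fix h p assume h: "0 < h \<and> h \<le> 1 \<and> {..<L} \<subseteq> J h" and p: "p \<in> K"
      have pW: "p \<in> W0" and pK: "p \<in> K0" using p K W0 by auto
      let ?I = "J h - {..<N}"
      have fJ: "finite (J h)" using finJ h by simp
      have sub: "{..<N} \<subseteq> J h" using h unfolding L_def by auto
      have "iter_deriv vs (\<lambda>q. a h q - (\<Sum>j<N. of_real h ^ j * as j q)) p = iter_deriv vs (\<lambda>q. \<Sum>j\<in>?I. of_real h ^ j * as j q) p"
        unfolding a_def sum_diff[OF fJ sub] ..
      also have "\<dots> = (\<Sum>j\<in>?I. iter_deriv vs (\<lambda>q. of_real h ^ j * as j q) p)"
        by (rule iter_deriv_sum[OF W0(1) pW]) (intro smooth_on_mult smooth_on_const s0 W0(1))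
      also have "\<dots> = (\<Sum>j\<in>?I. of_real h ^ j * iter_deriv vs (as j) p)"
        by (intro sum.cong refl iter_deriv_linear[OF W0(1) pW s0] bounded_linear_mult_right)
      finally have e: "norm (iter_deriv vs (\<lambda>q. a h q - (\<Sum>j<N. of_real h ^ j * as j q)) p) = norm (\<Sum>j\<in>?I. of_real h ^ j * iter_deriv vs (as j) p)"
        by (rule arg_cong)
      have "norm (of_real h ^ j * iter_deriv vs (as j) p) \<le> \<pi> * h ^ N * ((if j < L then M j k else 0) + (1 / 2) ^ j)" if j: "j \<in> ?I" for j
      proof -
        have jN: "N \<le> j" using j by simp
        have n: "norm (of_real h ^ j * iter_deriv vs (as j) p) = h ^ j * norm (iter_deriv vs (as j) p)"
          using h by (simp add: norm_mult norm_power)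
        show ?thesis
        proof (cases "j < L")
          case True
          have "h ^ j * norm (iter_deriv vs (as j) p) \<le> h ^ N * (M j k * \<pi>)"
            unfolding \<pi>_def k_def by (intro mult_mono power_decreasing jN M(2) pK order_refl) (use h in auto)
          also have "\<dots> = \<pi> * h ^ N * (M j k + 0)" by simp
          also have "\<dots> \<le> \<pi> * h ^ N * (M j k + (1 / 2) ^ j)" using \<pi> h by (intro mult_left_mono add_left_mono) auto
          finally show ?thesis unfolding n using True by simp
        next
          case False
          then have jL: "k \<le> j" "Suc N \<le> j" unfolding L_def by auto
          have "h * (M j j + 1) * 2 ^ j \<le> 1" using j unfolding J_def by simp
          moreover have "h * M j j * 2 ^ j \<le> h * (M j j + 1) * 2 ^ j" using h by (intro mult_right_mono mult_left_mono) auto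
          ultimately have "h * M j j * 2 ^ j \<le> 1" by linarith
          then have hM: "h * M j j \<le> (1 / 2) ^ j" by (simp add: power_one_over field_simps)
          have "h ^ j * norm (iter_deriv vs (as j) p) \<le> h ^ Suc N * (M j j * \<pi>)"
            unfolding \<pi>_def by (intro mult_mono power_decreasing jL M(2) pK) (use h jL in \<open>auto simp: k_def\<close>)
          also have "\<dots> = \<pi> * h ^ N * (h * M j j)" by simp
          also have "\<dots> \<le> \<pi> * h ^ N * (1 / 2) ^ j" using \<pi> h by (intro mult_left_mono hM) auto
          finally show ?thesis unfolding n using False by simp
        qed
      qed
      then have "norm (\<Sum>j\<in>?I. of_real h ^ j * iter_deriv vs (as j) p) \<le> (\<Sum>j\<in>?I. \<pi> * h ^ N * ((if j < L then M j k else 0) + (1 / 2) ^ j))"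
        by (rule sum_norm_le)
      also have "\<dots> = \<pi> * h ^ N * ((\<Sum>j\<in>?I. if j < L then M j k else 0) + (\<Sum>j\<in>?I. (1 / 2) ^ j))"
        by (simp only: sum_distrib_left[symmetric] sum.distrib)
      also have "\<dots> \<le> \<pi> * h ^ N * (S + 2)"
      proof (intro mult_left_mono add_mono)
        have "(\<Sum>j\<in>?I. if j < L then M j k else 0) = (\<Sum>j\<in>?I \<inter> {..<L}. M j k)"
          using fJ by (simp add: sum.inter_restrict)
        also have "\<dots> \<le> S" unfolding S_def by (rule sum_mono2) (auto simp: M)
        finally show "(\<Sum>j\<in>?I. if j < L then M j k else 0) \<le> S" .
        have "(\<Sum>j\<in>?I. (1 / 2 :: real) ^ j) \<le> suminf (\<lambda>j. (1 / 2) ^ j)"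
          using fJ by (intro sum_le_suminf summable_geometric) auto
        also have "\<dots> = 2" by (subst suminf_geometric) auto
        finally show "(\<Sum>j\<in>?I. (1 / 2 :: real) ^ j) \<le> 2" .
      qed (use \<pi> h in auto)
      finally show "norm (iter_deriv vs (\<lambda>q. a h q - (\<Sum>j<N. of_real h ^ j * as j q)) p) \<le> \<pi> * (S + 2) * h ^ N"
        unfolding e by (simp only: mult_ac)
    qed
  qed
  then show thesis by (rule that)
qed

section \<open>The expansion of the contour integral\<close>

text \<open>If all earlier coefficients vanish, the sum up to m is a single term; divide by
  \<open>h ^ m\<close> and let h tend to 0.\<close>

lemma asymptotic_coefficients_zero:
  fixes e :: "nat \<Rightarrow> complex"
  assumes "\<And>N. \<exists>C. \<forall>\<^sub>F h in at_right 0. norm (\<Sum>m<N. of_real h ^ m * e m) \<le> C * h ^ N"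
  shows "e m = 0"
proof (induction m rule: less_induct)
  case (less m)
  obtain C where C: "\<forall>\<^sub>F h in at_right 0. norm (\<Sum>i<Suc m. of_real h ^ i * e i) \<le> C * h ^ Suc m"
    using assms by (elim exE allE meta_allE)
  have "\<forall>\<^sub>F h in at_right (0::real). norm (e m) \<le> C * h"
    using C eventually_at_right_less
  proof eventually_elim
    case (elim h)
    have "(\<Sum>i<Suc m. of_real h ^ i * e i) = of_real h ^ m * e m" using less by simp
    then have "h ^ m * norm (e m) \<le> h ^ m * (C * h)" using elim by (simp add: norm_mult norm_power mult_ac)
    then show ?case using elim by (simp add: mult_le_cancel_left_pos)
  qed
  moreover have "((\<lambda>h. C * h) \<longlongrightarrow> C * 0) (at_right 0)" by (intro tendsto_intros)
  ultimately have "norm (e m) \<le> C * 0" by (intro tendsto_lowerbound) auto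
  then show ?case by simp
qed

context bergman_phase
begin

text \<open>Inserting the expansion of every model integral gives a double sum, which is regrouped
  by total power of \<open>h\<close>; the pairs outside the triangle of total degree below N only
  contribute to the error.\<close>

lemma contour_expansion:
  assumes r: "R \<le> r" and \<Psi>r: "AH (bidisc x0 r) \<Psi>"
    and cs: "classical_symbol (bidisc x0 r) a as" and as: "\<And>j. AH (bidisc x0 r) (as j)"
    and gc: "oriented_good_contour \<Psi> x0 (bidisc x0 r) U Y \<gamma>"
  obtains \<rho> where "\<rho> > 0" "\<rho> \<le> R / 4" "adiag ` cball x0 \<rho> \<subseteq> Y"
    "\<And>N. \<exists>C. \<forall>\<^sub>F h in at_right 0. \<forall>y\<in>cball x0 \<rho>.
      norm (contour_op \<Psi> U \<gamma> a h (adiag y) - (\<Sum>m<N. of_real h ^ m * (\<Sum>i\<le>m. expansion_coeff \<Psi> (as i) (m - i) (adiag y)))) \<le> C * h ^ N"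
proof -
  obtain \<delta>1 \<rho> where \<rho>: "\<delta>1 > 0" "\<rho> > 0" "\<rho> \<le> R / 4" "adiag ` cball x0 \<rho> \<subseteq> Y"
    "\<And>\<delta> N. 0 < \<delta> \<Longrightarrow> \<delta> \<le> \<delta>1 \<Longrightarrow> \<exists>C. \<forall>\<^sub>F h in at_right 0. \<forall>y\<in>cball x0 \<rho>.
      norm (contour_op \<Psi> U \<gamma> a h (adiag y) - (\<Sum>j<N + CARD('n). of_real h ^ j * model_int \<Psi> \<delta> (as j) h y)) \<le> C * h ^ N"
    by (rule contour_reduction[OF assms]) (rule that)
  obtain \<delta>2 where \<delta>2: "\<delta>2 > 0" "\<And>b \<delta> N. AH (bidisc x0 R) b \<Longrightarrow> 0 < \<delta> \<Longrightarrow> \<delta> \<le> \<delta>2 \<Longrightarrow> \<exists>C. \<forall>h\<in>{0<..1}. \<forall>y\<in>cball x0 (R / 4).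
       norm (model_int \<Psi> \<delta> b h y - (\<Sum>j<N. of_real h ^ j * expansion_coeff \<Psi> b j (adiag y))) \<le> C * h ^ N"
    by (rule expansion) (rule that)
  define \<delta> where "\<delta> = min \<delta>1 \<delta>2"
  have \<delta>: "0 < \<delta>" "\<delta> \<le> \<delta>1" "\<delta> \<le> \<delta>2" unfolding \<delta>_def using \<rho>(1) \<delta>2(1) by auto
  have "bidisc x0 R \<subseteq> bidisc x0 r" using r unfolding bidisc_def by auto
  then have asR: "AH (bidisc x0 R) (as j)" for j by (rule AH_subset[OF as])
  have aV: "adiag ` cball x0 (R / 4) \<subseteq> bidisc x0 R" using adiag_in R by fastforce
  have Vs: "cball x0 \<rho> \<subseteq> cball x0 (R / 4)" using \<rho>(3) by auto
  have "\<forall>i k. \<exists>G\<ge>0. \<forall>y\<in>cball x0 (R / 4). norm (expansion_coeff \<Psi> (as i) k (adiag y)) \<le> G"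
  proof (intro allI)
    fix i k
    have c: "continuous_on (cball x0 (R / 4)) (\<lambda>y. expansion_coeff \<Psi> (as i) k (adiag y))"
      by (rule continuous_on_compose2[OF smooth_on_continuous[OF AH_smooth[OF AH_expansion_coeff[OF asR]]] linear_continuous_on[OF bounded_linear_adiag] aV])
    obtain G where "G > 0" "\<And>y. y \<in> cball x0 (R / 4) \<Longrightarrow> norm (expansion_coeff \<Psi> (as i) k (adiag y)) \<le> G"
      by (rule compact_norm_bound[OF compact_cball c]) (rule that)
    then show "\<exists>G\<ge>0. \<forall>y\<in>cball x0 (R / 4). norm (expansion_coeff \<Psi> (as i) k (adiag y)) \<le> G" by (intro exI[of _ G]) auto
  qed
  then obtain G where G: "\<And>i k. G i k \<ge> 0" "\<And>i k y. y \<in> cball x0 (R / 4) \<Longrightarrow> norm (expansion_coeff \<Psi> (as i) k (adiag y)) \<le> G i k"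
    by metis
  show thesis
  proof (rule that[OF \<rho>(2-4)])
    fix N
    \<comment> \<open>The number of terms kept by \<open>contour_reduction\<close> at order N; the
      surplus terms end up in the error.\<close>
    define L where "L = N + CARD('n)"
    have NL: "N \<le> L" unfolding L_def by simp
    obtain C1 where C1: "\<forall>\<^sub>F h in at_right 0. \<forall>y\<in>cball x0 \<rho>.
      norm (contour_op \<Psi> U \<gamma> a h (adiag y) - (\<Sum>j<L. of_real h ^ j * model_int \<Psi> \<delta> (as j) h y)) \<le> C1 * h ^ N"
      using \<rho>(5)[OF \<delta>(1,2), of N] unfolding L_def by (elim exE)
    have "\<forall>j. \<exists>C. \<forall>h\<in>{0<..1}. \<forall>y\<in>cball x0 (R / 4).
       norm (model_int \<Psi> \<delta> (as j) h y - (\<Sum>k<L. of_real h ^ k * expansion_coeff \<Psi> (as j) k (adiag y))) \<le> C * h ^ L"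
      by (intro allI \<delta>2(2) asR \<delta>)
    then obtain C2 where C2: "\<And>j h y. h \<in> {0<..1} \<Longrightarrow> y \<in> cball x0 (R / 4) \<Longrightarrow>
       norm (model_int \<Psi> \<delta> (as j) h y - (\<Sum>k<L. of_real h ^ k * expansion_coeff \<Psi> (as j) k (adiag y))) \<le> C2 j * h ^ L"
      by metis
    define D where "D = (\<Sum>i<L. \<Sum>k<L. G i k)"
    show "\<exists>C. \<forall>\<^sub>F h in at_right 0. \<forall>y\<in>cball x0 \<rho>.
      norm (contour_op \<Psi> U \<gamma> a h (adiag y) - (\<Sum>m<N. of_real h ^ m * (\<Sum>i\<le>m. expansion_coeff \<Psi> (as i) (m - i) (adiag y)))) \<le> C * h ^ N"
    proof (intro exI[of _ "C1 + (\<Sum>j<L. \<bar>C2 j\<bar>) + D"])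
      have "\<forall>\<^sub>F h in at_right 0. h < (1::real)" by (rule order_tendstoD(2)[OF tendsto_ident_at]) simp
      with C1 eventually_at_right_less[of "0::real"]
      show "\<forall>\<^sub>F h in at_right 0. \<forall>y\<in>cball x0 \<rho>.
        norm (contour_op \<Psi> U \<gamma> a h (adiag y) - (\<Sum>m<N. of_real h ^ m * (\<Sum>i\<le>m. expansion_coeff \<Psi> (as i) (m - i) (adiag y)))) \<le> (C1 + (\<Sum>j<L. \<bar>C2 j\<bar>) + D) * h ^ N"
      proof eventually_elim
        case (elim h)
        then have h: "h \<in> {0<..1}" by simp
        show ?case
        proof
          fix y assume y: "y \<in> cball x0 \<rho>"
          then have yV: "y \<in> cball x0 (R / 4)" using Vs by blast
          define g where "g i k = expansion_coeff \<Psi> (as i) k (adiag y)" for i k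
          define m where "m j = model_int \<Psi> \<delta> (as j) h y" for j
          define X where "X = contour_op \<Psi> U \<gamma> a h (adiag y)"
          define T where "T = (\<Sum>j<N. of_real h ^ j * (\<Sum>i\<le>j. g i (j - i)))"
          define S where "S = (\<Sum>j<L. \<Sum>k<L. of_real h ^ (j + k) * g j k)"
          have b1: "norm (X - (\<Sum>j<L. of_real h ^ j * m j)) \<le> C1 * h ^ N" unfolding X_def m_def using elim y by blast
          have b2: "norm ((\<Sum>j<L. of_real h ^ j * m j) - S) \<le> (\<Sum>j<L. \<bar>C2 j\<bar>) * h ^ N"
          proof -
            have "(\<Sum>j<L. of_real h ^ j * m j) - S = (\<Sum>j<L. of_real h ^ j * (m j - (\<Sum>k<L. of_real h ^ k * g j k)))"
              unfolding S_def by (simp only: sum_subtractf[symmetric] right_diff_distrib sum_distrib_left power_add mult.assoc)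
            then have "norm ((\<Sum>j<L. of_real h ^ j * m j) - S) = norm (\<Sum>j<L. of_real h ^ j * (m j - (\<Sum>k<L. of_real h ^ k * g j k)))"
              by (rule arg_cong)
            also have "\<dots> \<le> (\<Sum>j<L. \<bar>C2 j\<bar> * h ^ N)"
            proof (rule sum_norm_le)
              fix j
              have "norm (of_real h ^ j * (m j - (\<Sum>k<L. of_real h ^ k * g j k))) = h ^ j * norm (m j - (\<Sum>k<L. of_real h ^ k * g j k))"
                using h by (simp add: norm_mult norm_power)
              also have "\<dots> \<le> 1 * (C2 j * h ^ L)"
                unfolding m_def g_def by (intro mult_mono C2 h yV power_le_one) (use h in auto)
              also have "\<dots> \<le> \<bar>C2 j\<bar> * h ^ N"
                using h NL by (simp, intro mult_mono power_decreasing) auto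
              finally show "norm (of_real h ^ j * (m j - (\<Sum>k<L. of_real h ^ k * g j k))) \<le> \<bar>C2 j\<bar> * h ^ N" .
            qed
            finally show ?thesis by (simp only: sum_distrib_right)
          qed
          have b3: "norm (S - T) \<le> D * h ^ N"
          proof -
            have S: "S = (\<Sum>(j, k)\<in>{..<L} \<times> {..<L}. of_real h ^ (j + k) * g j k)" unfolding S_def by (rule sum.cartesian_product)
            have "T = (\<Sum>j<N. \<Sum>i\<le>j. of_real h ^ (i + (j - i)) * g i (j - i))"
              unfolding T_def sum_distrib_left by (intro sum.cong refl) auto
            then have T: "T = (\<Sum>(j, k)\<in>{(j, k). j + k < N}. of_real h ^ (j + k) * g j k)"
              unfolding sum.triangle_reindex .
            have sub: "{(j, k). j + k < N} \<subseteq> {..<L} \<times> {..<L}" using NL by auto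
            have "S - T = (\<Sum>(j, k)\<in>{..<L} \<times> {..<L} - {(j, k). j + k < N}. of_real h ^ (j + k) * g j k)"
              unfolding S T by (rule sum_diff[OF _ sub, symmetric]) simp
            then have "norm (S - T) = norm (\<Sum>(j, k)\<in>{..<L} \<times> {..<L} - {(j, k). j + k < N}. of_real h ^ (j + k) * g j k)" by (rule arg_cong)
            also have "\<dots> \<le> (\<Sum>(j, k)\<in>{..<L} \<times> {..<L} - {(j, k). j + k < N}. G j k * h ^ N)"
            proof (rule sum_norm_le)
              fix q assume q: "q \<in> {..<L} \<times> {..<L} - {(j, k). j + k < N}"
              obtain j k where e: "q = (j, k)" by (cases q)
              have jk: "N \<le> j + k" using q unfolding e by auto
              have "norm (of_real h ^ (j + k) * g j k) = norm (g j k) * h ^ (j + k)" using h by (simp add: norm_mult norm_power)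
              also have "\<dots> \<le> G j k * h ^ N" unfolding g_def by (intro mult_mono G yV power_decreasing jk) (use h in auto)
              finally show "norm (case q of (j, k) \<Rightarrow> of_real h ^ (j + k) * g j k) \<le> (case q of (j, k) \<Rightarrow> G j k * h ^ N)" unfolding e by simp
            qed
            also have "\<dots> \<le> (\<Sum>(j, k)\<in>{..<L} \<times> {..<L}. G j k * h ^ N)"
              using h G(1) by (intro sum_mono2) (auto intro!: mult_nonneg_nonneg)
            also have "\<dots> = D * h ^ N" unfolding D_def sum_distrib_right by (rule sum.cartesian_product[symmetric])
            finally show ?thesis .
          qed
          have "norm (X - T) \<le> norm (X - (\<Sum>j<L. of_real h ^ j * m j)) + norm ((\<Sum>j<L. of_real h ^ j * m j) - S) + norm (S - T)"
            using norm_triangle_ineq[of "X - (\<Sum>j<L. of_real h ^ j * m j)" "(\<Sum>j<L. of_real h ^ j * m j) - S"] norm_triangle_ineq[of "X - S" "S - T"] by simp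
          then have "norm (X - T) \<le> (C1 + (\<Sum>j<L. \<bar>C2 j\<bar>) + D) * h ^ N" using b1 b2 b3 by (simp add: distrib_right)
          then show "norm (contour_op \<Psi> U \<gamma> a h (adiag y) - (\<Sum>m<N. of_real h ^ m * (\<Sum>i\<le>m. expansion_coeff \<Psi> (as i) (m - i) (adiag y)))) \<le> (C1 + (\<Sum>j<L. \<bar>C2 j\<bar>) + D) * h ^ N"
            unfolding X_def T_def g_def .
        qed
      qed
    qed
  qed
qed

text \<open>At a fixed base point the contour integral has two asymptotic expansions, the constant 1
  and the one just obtained, so their coefficients agree.\<close>

lemma normalized_coefficients:
  assumes "R \<le> r" "AH (bidisc x0 r) \<Psi>" "classical_symbol (bidisc x0 r) a as" "\<And>j. AH (bidisc x0 r) (as j)"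
    "oriented_good_contour \<Psi> x0 (bidisc x0 r) U Y \<gamma>" and n: "normalized_on_contour \<Psi> x0 U Y \<gamma> a"
  shows "\<forall>\<^sub>F y in nhds x0. \<forall>m. (\<Sum>i\<le>m. expansion_coeff \<Psi> (as i) (m - i) (adiag y)) = (if m = 0 then 1 else 0)"
proof -
  obtain \<rho> where \<rho>: "\<rho> > 0" "\<rho> \<le> R / 4" "\<And>N. \<exists>C. \<forall>\<^sub>F h in at_right 0. \<forall>y\<in>cball x0 \<rho>.
      norm (contour_op \<Psi> U \<gamma> a h (adiag y) - (\<Sum>m<N. of_real h ^ m * (\<Sum>i\<le>m. expansion_coeff \<Psi> (as i) (m - i) (adiag y)))) \<le> C * h ^ N"
    by (rule contour_expansion[OF assms(1-5)]) (rule that)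
  obtain V where V: "open V" "x0 \<in> V" "\<forall>N::nat. \<exists>C. \<forall>\<^sub>F h in at_right 0. \<forall>y\<in>V.
           norm (contour_op \<Psi> U \<gamma> a h (y, vconj y) - 1) \<le> C * h ^ N"
    using n unfolding normalized_on_contour_def by (elim exE conjE)
  have "(\<Sum>i\<le>m. expansion_coeff \<Psi> (as i) (m - i) (adiag y)) = (if m = 0 then 1 else 0)" if y: "y \<in> V \<inter> ball x0 \<rho>" for y m
  proof -
    define e where "e m = (\<Sum>i\<le>m. expansion_coeff \<Psi> (as i) (m - i) (adiag y)) - (if m = 0 then 1 else 0)" for m
    have "\<exists>C. \<forall>\<^sub>F h in at_right 0. norm (\<Sum>m<N. of_real h ^ m * e m) \<le> C * h ^ N" for N
    \<comment> \<open>The partial sum of the constant expansion equals 1 only if it contains the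
      term of index 0; for \<open>N = 0\<close> both sides are trivial.\<close>
    proof (cases "N = 0")
      case True
      then show ?thesis by (intro exI[of _ 0]) simp
    next
      case False
      obtain C where C: "\<forall>\<^sub>F h in at_right 0. \<forall>y\<in>cball x0 \<rho>.
        norm (contour_op \<Psi> U \<gamma> a h (adiag y) - (\<Sum>m<N. of_real h ^ m * (\<Sum>i\<le>m. expansion_coeff \<Psi> (as i) (m - i) (adiag y)))) \<le> C * h ^ N"
        using \<rho>(3)[of N] by (elim exE)
      obtain C' where C': "\<forall>\<^sub>F h in at_right 0. \<forall>y\<in>V. norm (contour_op \<Psi> U \<gamma> a h (y, vconj y) - 1) \<le> C' * h ^ N"
        using V(3)[rule_format, of N] by (elim exE)
      have s1: "(\<Sum>m<N. of_real h ^ m * (if m = 0 then 1 else 0)) = (1::complex)" for h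
      proof -
        have "(\<Sum>m<N. of_real h ^ m * (if m = 0 then 1 else 0)) = (\<Sum>m<N. if m = 0 then 1 else (0::complex))"
          by (intro sum.cong refl) simp
        then show ?thesis using False by simp
      qed
      show ?thesis
      proof (intro exI[of _ "C + C'"])
        show "\<forall>\<^sub>F h in at_right 0. norm (\<Sum>m<N. of_real h ^ m * e m) \<le> (C + C') * h ^ N"
          using C C'
        proof eventually_elim
          case (elim h)
          define X where "X = contour_op \<Psi> U \<gamma> a h (adiag y)"
          define T where "T = (\<Sum>m<N. of_real h ^ m * (\<Sum>i\<le>m. expansion_coeff \<Psi> (as i) (m - i) (adiag y)))"
          have 1: "norm (X - T) \<le> C * h ^ N" unfolding X_def T_def using elim(1) y by simp
          have 2: "norm (X - 1) \<le> C' * h ^ N" unfolding X_def adiag_def using elim(2) y by simp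
          have "(\<Sum>m<N. of_real h ^ m * e m) = T - 1"
            unfolding e_def right_diff_distrib sum_subtractf s1 T_def ..
          also have "norm (T - 1) \<le> norm (X - 1) + norm (X - T)" using norm_triangle_ineq4[of "X - 1" "X - T"] by simp
          finally show ?case using 1 2 by (simp add: distrib_right)
        qed
      qed
    qed
    then have "e m = 0" by (rule asymptotic_coefficients_zero)
    then show ?thesis unfolding e_def by simp
  qed
  then show ?thesis unfolding eventually_nhds using V(1,2) \<rho>(1) by (intro exI[of _ "V \<inter> ball x0 \<rho>"]) auto
qed

text \<open>In the equation of index m the symbol of index m occurs only through the leading
  operator, multiplication by a nonzero number. The terms before it agree by induction, and they do
  so on the open set V, as their derivatives require.\<close>

lemma coefficients_determine_symbol:
  assumes as: "\<And>j. AH (bidisc x0 R) (as j)" and bs: "\<And>j. AH (bidisc x0 R) (bs j)"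
    and V: "open V" "V \<subseteq> ball x0 R"
    and eq: "\<And>y m. y \<in> V \<Longrightarrow> (\<Sum>i\<le>m. expansion_coeff \<Psi> (as i) (m - i) (adiag y)) = (\<Sum>i\<le>m. expansion_coeff \<Psi> (bs i) (m - i) (adiag y))"
  shows "y \<in> V \<Longrightarrow> as m (adiag y) = bs m (adiag y)"
proof (induction m arbitrary: y rule: less_induct)
  case (less m)
  have aW: "adiag x \<in> bidisc x0 R" if "x \<in> V" for x using adiag_in V that by blast
  have "expansion_coeff \<Psi> (as i) (m - i) (adiag y) = expansion_coeff \<Psi> (bs i) (m - i) (adiag y)" if "i < m" for i
    by (rule expansion_coeff_cong[OF open_bidisc V(1) aW as bs less.IH[OF that] less.prems])
  then have "(\<Sum>i<m. expansion_coeff \<Psi> (as i) (m - i) (adiag y)) = (\<Sum>i<m. expansion_coeff \<Psi> (bs i) (m - i) (adiag y))" by (intro sum.cong refl) simp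
  then have g: "expansion_coeff \<Psi> (as m) 0 (adiag y) = expansion_coeff \<Psi> (bs m) 0 (adiag y)"
    using eq[OF less.prems, of m] by (simp add: lessThan_Suc_atMost[symmetric])
  have "det (Lam \<Psi> (adiag y)) * det (Lam_inv \<Psi> (adiag y)) = 1"
    using Lam_Lam_inv[OF det_Lam[OF aW[OF less.prems]]] by (metis det_mul det_I)
  then have "det (Lam_inv \<Psi> (adiag y)) \<noteq> 0" by auto
  then show ?case using g gauss_const_nonzero[where 'n='n] affine_jac_nonzero[where 'n='n] unfolding expansion_coeff_0 by simp
qed

end

section \<open>The normalizing symbol\<close>

text \<open>The equation of index j solved for the j-th symbol. Dividing by the leading operator
  means multiplying by \<open>det (Lam \<Psi> p)\<close>, the inverse of
  \<open>det (Lam_inv \<Psi> p)\<close> wherever it is nonzero. The equations are imposed at every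
  point of the bidisc, which is more than the normalization asks for.\<close>

function normalizing_symbol :: "('n::finite cpair \<Rightarrow> complex) \<Rightarrow> nat \<Rightarrow> 'n cpair \<Rightarrow> complex" where
  "normalizing_symbol \<Psi> j = (\<lambda>p. 1 / (gauss_const TYPE('n) * affine_jac TYPE('n)) * det (Lam \<Psi> p) *
     ((if j = 0 then 1 else 0) - (\<Sum>i<j. expansion_coeff \<Psi> (normalizing_symbol \<Psi> i) (j - i) p)))"
  by auto
termination by (relation "Wellfounded.measure snd") auto

declare normalizing_symbol.simps [simp del]

context bergman_phase
begin

lemma AH_normalizing_symbol: "AH (bidisc x0 R) (normalizing_symbol \<Psi> j)"
proof (induction j rule: less_induct)
  case (less j)
  have "AH (bidisc x0 R) (\<lambda>p. 1 / (gauss_const TYPE('n) * affine_jac TYPE('n)) * det (Lam \<Psi> p) *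
     ((if j = 0 then 1 else 0) - (\<Sum>i<j. expansion_coeff \<Psi> (normalizing_symbol \<Psi> i) (j - i) p)))"
    by (intro AH_mult AH_diff_fun AH_sum AH_const AH_expansion_coeff AH_det_Lam open_bidisc \<Psi>) (simp add: less)
  then show ?case by (subst normalizing_symbol.simps)
qed

lemma normalizing_symbol_coefficients:
  assumes "p \<in> bidisc x0 R"
  shows "(\<Sum>i\<le>m. expansion_coeff \<Psi> (normalizing_symbol \<Psi> i) (m - i) p) = (if m = 0 then 1 else 0)"
proof -
  have "det (Lam \<Psi> p) * det (Lam_inv \<Psi> p) = 1"
    using Lam_Lam_inv[OF det_Lam[OF assms]] by (metis det_mul det_I)
  moreover have "expansion_coeff \<Psi> (normalizing_symbol \<Psi> m) 0 p = (det (Lam \<Psi> p) * det (Lam_inv \<Psi> p)) *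
     ((if m = 0 then 1 else 0) - (\<Sum>i<m. expansion_coeff \<Psi> (normalizing_symbol \<Psi> i) (m - i) p))"
    unfolding expansion_coeff_0 using gauss_const_nonzero[where 'n='n] affine_jac_nonzero[where 'n='n] by (subst normalizing_symbol.simps) simp
  ultimately show ?thesis by (simp add: lessThan_Suc_atMost[symmetric])
qed

lemma normalizing_symbol_normalized:
  assumes cs: "classical_symbol (bidisc x0 R) a (normalizing_symbol \<Psi>)"
    and gc: "oriented_good_contour \<Psi> x0 (bidisc x0 R) U Y \<gamma>"
  shows "normalized_on_contour \<Psi> x0 U Y \<gamma> a"
proof -
  obtain \<rho> where \<rho>: "\<rho> > 0" "\<rho> \<le> R / 4" "adiag ` cball x0 \<rho> \<subseteq> Y" "\<And>N. \<exists>C. \<forall>\<^sub>F h in at_right 0. \<forall>y\<in>cball x0 \<rho>.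
      norm (contour_op \<Psi> U \<gamma> a h (adiag y) - (\<Sum>m<N. of_real h ^ m * (\<Sum>i\<le>m. expansion_coeff \<Psi> (normalizing_symbol \<Psi> i) (m - i) (adiag y)))) \<le> C * h ^ N"
    by (rule contour_expansion[OF order_refl \<Psi> cs AH_normalizing_symbol gc]) (rule that)
  have aW: "adiag y \<in> bidisc x0 R" if "y \<in> cball x0 \<rho>" for y using adiag_in that \<rho>(2) R by simp
  \<comment> \<open>The upper limit \<open>Suc N\<close> makes sure that the term of index 0 is
    present.\<close>
  have s: "(\<Sum>m<Suc N. of_real h ^ m * (\<Sum>i\<le>m. expansion_coeff \<Psi> (normalizing_symbol \<Psi> i) (m - i) (adiag y))) = 1" if "y \<in> cball x0 \<rho>" for y N h
  proof -
    have "(\<Sum>m<Suc N. of_real h ^ m * (\<Sum>i\<le>m. expansion_coeff \<Psi> (normalizing_symbol \<Psi> i) (m - i) (adiag y))) = (\<Sum>m<Suc N. if m = 0 then 1 else (0::complex))"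
      unfolding normalizing_symbol_coefficients[OF aW[OF that]] by (intro sum.cong refl) simp
    then show ?thesis by simp
  qed
  show ?thesis unfolding normalized_on_contour_def
  proof (intro exI[of _ "ball x0 \<rho>"] conjI ballI allI)
    show "(y, vconj y) \<in> Y" if "y \<in> ball x0 \<rho>" for y
      using \<rho>(3) that unfolding adiag_def by (auto simp: image_subset_iff)
    fix N
    obtain C where C: "\<forall>\<^sub>F h in at_right 0. \<forall>y\<in>cball x0 \<rho>.
      norm (contour_op \<Psi> U \<gamma> a h (adiag y) - (\<Sum>m<Suc N. of_real h ^ m * (\<Sum>i\<le>m. expansion_coeff \<Psi> (normalizing_symbol \<Psi> i) (m - i) (adiag y)))) \<le> C * h ^ Suc N"
      using \<rho>(4)[of "Suc N"] by (elim exE)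
    have l1: "\<forall>\<^sub>F h in at_right 0. h < (1::real)" by (rule order_tendstoD(2)[OF tendsto_ident_at]) simp
    show "\<exists>C. \<forall>\<^sub>F h in at_right 0. \<forall>y\<in>ball x0 \<rho>. norm (contour_op \<Psi> U \<gamma> a h (y, vconj y) - 1) \<le> C * h ^ N"
    proof (intro exI[of _ "\<bar>C\<bar>"])
      show "\<forall>\<^sub>F h in at_right 0. \<forall>y\<in>ball x0 \<rho>. norm (contour_op \<Psi> U \<gamma> a h (y, vconj y) - 1) \<le> \<bar>C\<bar> * h ^ N"
        using C eventually_at_right_less[of "0::real"] l1
      proof eventually_elim
        case (elim h)
        show ?case
        proof
          fix y assume "y \<in> ball x0 \<rho>"
          then have y: "y \<in> cball x0 \<rho>" by simp
          have "norm (contour_op \<Psi> U \<gamma> a h (adiag y) - 1) \<le> C * h ^ Suc N"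
            using elim(1)[rule_format, OF y] unfolding s[OF y] .
          also have "\<dots> \<le> \<bar>C\<bar> * h ^ N" using elim(2,3) by (intro mult_mono power_decreasing) auto
          finally show "norm (contour_op \<Psi> U \<gamma> a h (y, vconj y) - 1) \<le> \<bar>C\<bar> * h ^ N" unfolding adiag_def .
        qed
      qed
    qed
  qed (use \<rho>(1) in auto)
qed

end

section \<open>Passage from \<Phi> to the locale; existence and uniqueness\<close>

lemma bergman_phase_mono:
  assumes "bergman_phase \<Psi> x0 R c0" "0 < R'" "R' \<le> R"
  shows "bergman_phase \<Psi> x0 R' c0"
proof -
  interpret bergman_phase \<Psi> x0 R c0 by fact
  have "bidisc x0 R' \<subseteq> bidisc x0 R" using assms(3) unfolding bidisc_def by auto
  then show ?thesis
    by unfold_locales (use assms c0 AH_subset[OF \<Psi>] det_Lam pos in auto)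
qed

text \<open>For a kernel vector w the form vanishes at \<xi> = \<open>vconj w\<close>, against the
  lower bound.\<close>

lemma det_nonzero_bil:
  assumes "c > 0" "\<And>\<xi>. c * (norm \<xi>)\<^sup>2 \<le> Re (bil \<Psi> p \<xi> (vconj \<xi>))"
  shows "det (Lam \<Psi> p) \<noteq> 0"
proof
  assume "det (Lam \<Psi> p) = 0"
  then have "\<not> (\<exists>B. B ** Lam \<Psi> p = mat 1)" using invertible_det_nz[of "Lam \<Psi> p"] invertible_left_inverse by blast
  then obtain w where w: "Lam \<Psi> p *v w = 0" "w \<noteq> 0" unfolding matrix_left_invertible_ker by blast
  have "bil \<Psi> p (vconj w) w = (\<Sum>j\<in>UNIV. vconj w $ j * (Lam \<Psi> p *v w) $ j)"
    unfolding bil_def matrix_vector_mult_def by (simp add: sum_distrib_left mult_ac)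
  then have "bil \<Psi> p (vconj w) (vconj (vconj w)) = 0" unfolding w by simp
  then have "c * (norm (vconj w))\<^sup>2 \<le> 0" using assms(2)[of "vconj w"] by simp
  then have "(norm w)\<^sup>2 \<le> 0" using assms(1) by (simp add: mult_le_0_iff)
  then show False using w(2) by simp
qed

text \<open>The two Wirtinger derivatives of the relation between \<Psi> and \<Phi> on the
  anti-diagonal identify \<open>Lam\<close> with the Levi matrix, by \<open>AH_antidiag\<close>.
  Positivity gives invertibility at the centre; by continuity, \<open>Lam\<close> is invertible and
  the Levi form is bounded below by half of \<open>c x0\<close> on a small bidisc.\<close>

lemma polarization_bergman_phase:
  fixes \<Phi> :: "complex^'n::finite \<Rightarrow> real"
  assumes \<Omega>: "open \<Omega>" "strictly_psh_on \<Omega> \<Phi>" "x0 \<in> \<Omega>" and pol: "almost_hol_polarization D \<Psi> \<Phi> x0"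
  obtains R c0 where "bidisc x0 R \<subseteq> D" "bergman_phase \<Psi> x0 R c0" "\<And>x. x \<in> ball x0 R \<Longrightarrow> Lam \<Psi> (adiag x) = levi_matrix \<Phi> x"
proof -
  have D: "open D" "adiag x0 \<in> D" "smooth_on D \<Psi>" "almost_hol_on D \<Psi>"
    and "\<forall>\<^sub>F x in nhds x0. \<Psi> (x, vconj x) = complex_of_real (\<Phi> x)"
    using pol unfolding almost_hol_polarization_def adiag_def by simp_all
  then obtain V where V: "open V" "x0 \<in> V" "\<And>x. x \<in> V \<Longrightarrow> \<Psi> (x, vconj x) = complex_of_real (\<Phi> x)"
    unfolding eventually_nhds by blast
  have AHD: "AH D \<Psi>" using almost_hol_on_AH[OF D(1,3)] D(4) by simp
  obtain c where c: "continuous_on \<Omega> c" "\<And>x. x \<in> \<Omega> \<Longrightarrow> c x > 0"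
    "\<And>x \<xi>. x \<in> \<Omega> \<Longrightarrow> Re (\<Sum>j\<in>UNIV. \<Sum>k\<in>UNIV. levi_matrix \<Phi> x $ j $ k * \<xi> $ j * cnj (\<xi> $ k)) \<ge> c x * (norm \<xi>)\<^sup>2"
    using \<Omega>(2) unfolding strictly_psh_on_def by (elim exE conjE) blast
  define U where "U = V \<inter> adiag -` D"
  have U: "open U" unfolding U_def
    by (intro open_Int V(1) open_vimage D(1) linear_continuous_on bounded_linear_adiag)
  have L: "Lam \<Psi> (adiag x) = levi_matrix \<Phi> x" if x: "x \<in> U" for x
  proof -
    have b: "d_bar k (\<lambda>z. complex_of_real (\<Phi> z)) z = dz (Inr k) \<Psi> (z, vconj z)" if z: "z \<in> U" for k z
    proof -
      have "d_bar k (\<lambda>z. complex_of_real (\<Phi> z)) z = d_bar k (\<lambda>z. \<Psi> (z, vconj z)) z"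
        by (rule d_hol_cong(2)[OF U z]) (simp add: V(3) U_def)
      then show ?thesis using AH_antidiag(2)[OF D(1) AHD, of z k] z unfolding U_def adiag_def by simp
    qed
    have "levi_matrix \<Phi> x $ j $ k = Lam \<Psi> (adiag x) $ j $ k" for j k
    proof -
      have "d_hol j (d_bar k (\<lambda>z. complex_of_real (\<Phi> z))) x = d_hol j (\<lambda>z. dz (Inr k) \<Psi> (z, vconj z)) x"
        by (rule d_hol_cong(1)[OF U x b])
      then show ?thesis
        using AH_antidiag(1)[OF D(1) AH_dz[OF D(1) AHD, of "Inr k"], of x j] x
        unfolding levi_matrix_def Lam_def U_def adiag_def by simp
    qed
    then show ?thesis by (simp add: vec_eq_iff)
  qed
  have bl: "c x * (norm \<xi>)\<^sup>2 \<le> Re (bil \<Psi> (adiag x) \<xi> (vconj \<xi>))" if "x \<in> U" "x \<in> \<Omega>" for x \<xi>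
    using c(3)[OF that(2), of \<xi>] unfolding bil_def L[OF that(1)] by (simp add: vconj_def mult.assoc)
  have x0U: "x0 \<in> U" unfolding U_def using V(2) D(2) by simp
  have d0: "det (Lam \<Psi> (adiag x0)) \<noteq> 0" by (rule det_nonzero_bil[OF c(2)[OF \<Omega>(3)] bl[OF x0U \<Omega>(3)]])
  have "continuous_on D (\<lambda>p. det (Lam \<Psi> p))" by (rule smooth_on_continuous[OF AH_smooth[OF AH_det_Lam[OF D(1) AHD]]])
  then have "open (D \<inter> (\<lambda>p. det (Lam \<Psi> p)) -` (- {0}))" by (rule continuous_open_preimage[OF _ D(1)]) auto
  moreover have "adiag x0 \<in> D \<inter> (\<lambda>p. det (Lam \<Psi> p)) -` (- {0})" using D(2) d0 by simp
  ultimately obtain e where e: "e > 0" "ball (adiag x0) e \<subseteq> D \<inter> (\<lambda>p. det (Lam \<Psi> p)) -` (- {0})"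
    using open_contains_ball by meson
  have "open (\<Omega> \<inter> c -` {c x0 / 2<..})" by (rule continuous_open_preimage[OF c(1) \<Omega>(1)]) auto
  then have "open (U \<inter> (\<Omega> \<inter> c -` {c x0 / 2<..}))" using U by blast
  moreover have "x0 \<in> U \<inter> (\<Omega> \<inter> c -` {c x0 / 2<..})" using x0U \<Omega>(3) c(2)[OF \<Omega>(3)] by simp
  ultimately obtain e' where e': "e' > 0" "ball x0 e' \<subseteq> U \<inter> (\<Omega> \<inter> c -` {c x0 / 2<..})"
    using open_contains_ball by meson
  \<comment> \<open>Half of e, because the norm of a pair is estimated by the sum of the norms of
    its two components.\<close>
  define R where "R = min (e / 2) e'"
  have R: "R > 0" "R \<le> e / 2" "R \<le> e'" unfolding R_def using e e' by auto
  have sub: "bidisc x0 R \<subseteq> ball (adiag x0) e"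
  proof
    fix p assume "p \<in> bidisc x0 R"
    then have p: "norm (fst p - x0) < R" "norm (snd p - vconj x0) < R" unfolding mem_bidisc by auto
    have "norm (p - adiag x0) \<le> norm (fst p - x0) + norm (snd p - vconj x0)"
      using norm_Pair_le[of "fst p - x0" "snd p - vconj x0"] by (simp add: adiag_def minus_prod_def)
    then show "p \<in> ball (adiag x0) e" using p R(2) by (simp add: dist_norm norm_minus_commute)
  qed
  have yU: "y \<in> U" "y \<in> \<Omega>" "c x0 / 2 < c y" if "y \<in> ball x0 R" for y
  proof -
    have "y \<in> ball x0 e'" using that R(3) by simp
    then have "y \<in> U \<inter> (\<Omega> \<inter> c -` {c x0 / 2<..})" using e'(2) by blast
    then show "y \<in> U" "y \<in> \<Omega>" "c x0 / 2 < c y" by simp_all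
  qed
  have "bergman_phase \<Psi> x0 R (c x0 / 2)"
  proof
    show "R > 0" by (rule R)
    show "c x0 / 2 > 0" using c(2)[OF \<Omega>(3)] by simp
    show "AH (bidisc x0 R) \<Psi>" by (rule AH_subset[OF AHD]) (use sub e in blast)
    show "det (Lam \<Psi> p) \<noteq> 0" if "p \<in> bidisc x0 R" for p using that sub e by blast
    fix y \<xi> :: "complex^'n" assume y: "y \<in> ball x0 R"
    have "c x0 / 2 * (norm \<xi>)\<^sup>2 \<le> c y * (norm \<xi>)\<^sup>2" using yU(3)[OF y] by (intro mult_right_mono) auto
    then show "c x0 / 2 * (norm \<xi>)\<^sup>2 \<le> Re (bil \<Psi> (adiag y) \<xi> (vconj \<xi>))" using bl[OF yU(1,2)[OF y], of \<xi>] by linarith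
  qed
  then show thesis using sub e L yU(1) by (intro that) auto
qed

lemma existence:
  fixes \<Phi> :: "complex^'n::finite \<Rightarrow> real"
  assumes "open \<Omega>" "strictly_psh_on \<Omega> \<Phi>" "x0 \<in> \<Omega>" "almost_hol_polarization D \<Psi> \<Phi> x0"
  shows "\<exists>r>0. bidisc x0 r \<subseteq> D \<and> (\<exists>a as. admissible_symbol x0 (bidisc x0 r) a as \<and>
      (\<forall>U Y \<gamma>. oriented_good_contour \<Psi> x0 (bidisc x0 r) U Y \<gamma> \<longrightarrow> normalized_on_contour \<Psi> x0 U Y \<gamma> a) \<and>
      (\<forall>\<^sub>F x in nhds x0. as 0 (x, vconj x) = 1 / (gauss_const TYPE('n) * affine_jac TYPE('n)) * det (levi_matrix \<Phi> x)))"
proof -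
  obtain R c0 where R: "bidisc x0 R \<subseteq> D" "bergman_phase \<Psi> x0 R c0" "\<And>x. x \<in> ball x0 R \<Longrightarrow> Lam \<Psi> (adiag x) = levi_matrix \<Phi> x"
    by (rule polarization_bergman_phase[OF assms]) (rule that)
  interpret B: bergman_phase \<Psi> x0 R c0 by (rule R)
  \<comment> \<open>Borel summation needs a compact set between the domain of the sum and that of
    its terms; here it is the closed product of radius r.\<close>
  define r where "r = R / 2"
  have r: "0 < r" "r < R" unfolding r_def using B.R by auto
  interpret B': bergman_phase \<Psi> x0 r c0 by (rule bergman_phase_mono[OF R(2) r(1)]) (use r in simp)
  have sub: "bidisc x0 r \<subseteq> bidisc x0 R" using r unfolding bidisc_def by auto
  obtain a where a: "classical_symbol (bidisc x0 r) a (normalizing_symbol \<Psi>)"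
  proof (rule borel_symbol[of "bidisc x0 R" "normalizing_symbol \<Psi>" "cball x0 r \<times> cball (vconj x0) r" "bidisc x0 r"])
    show "smooth_on (bidisc x0 R) (normalizing_symbol \<Psi> j)" for j by (rule AH_smooth[OF B.AH_normalizing_symbol])
    show "compact (cball x0 r \<times> cball (vconj x0) r)" by (intro compact_Times compact_cball)
    show "cball x0 r \<times> cball (vconj x0) r \<subseteq> bidisc x0 R" using r unfolding bidisc_def by auto
    show "bidisc x0 r \<subseteq> cball x0 r \<times> cball (vconj x0) r" unfolding bidisc_def by auto
  qed (use that in auto)
  \<comment> \<open>The origin of the constant in the theorem: in the equation of index 0 the
    leading operator is \<open>gauss_const\<close> times \<open>affine_jac\<close> divided by the
    determinant of the Levi matrix.\<close>
  have n0: "normalizing_symbol \<Psi> 0 p = 1 / (gauss_const TYPE('n) * affine_jac TYPE('n)) * det (Lam \<Psi> p)" for p :: "'n cpair"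
    by (subst normalizing_symbol.simps) simp
  have "admissible_symbol x0 (bidisc x0 r) a (normalizing_symbol \<Psi>)"
    unfolding admissible_symbol_def
  proof (intro conjI allI a)
    have "normalizing_symbol \<Psi> 0 p \<noteq> 0" if "p \<in> bidisc x0 r" for p
      unfolding n0 using B'.det_Lam[OF that] gauss_const_nonzero[where 'n='n] affine_jac_nonzero[where 'n='n] by simp
    moreover have "(x0, vconj x0) \<in> bidisc x0 r" using r unfolding bidisc_def by simp
    ultimately show "\<forall>\<^sub>F p in nhds (x0, vconj x0). normalizing_symbol \<Psi> 0 p \<noteq> 0"
      unfolding eventually_nhds by (intro exI[of _ "bidisc x0 r"]) simp
    show "almost_hol_on (bidisc x0 r) (normalizing_symbol \<Psi> j)" for j
      using almost_hol_on_AH[OF open_bidisc AH_smooth[OF B'.AH_normalizing_symbol]] B'.AH_normalizing_symbol by simp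
  qed
  moreover have "\<forall>\<^sub>F x in nhds x0. normalizing_symbol \<Psi> 0 (x, vconj x) = 1 / (gauss_const TYPE('n) * affine_jac TYPE('n)) * det (levi_matrix \<Phi> x)"
    unfolding eventually_nhds using R(3) B.R by (intro exI[of _ "ball x0 R"]) (simp add: n0 adiag_def)
  ultimately show ?thesis
    using r(1) R(1) sub B'.normalizing_symbol_normalized[OF a]
    by (intro exI[of _ r] exI[of _ a] exI[of _ "normalizing_symbol \<Psi>"] conjI allI impI) auto
qed

text \<open>Both symbols solve the same triangular system near \<open>x0\<close>, whatever bidiscs
  and contours they come with; the expansion coefficients depend on \<Psi> alone.\<close>

lemma uniqueness:
  fixes \<Phi> :: "complex^'n::finite \<Rightarrow> real"
  assumes pol: "open \<Omega>" "strictly_psh_on \<Omega> \<Phi>" "x0 \<in> \<Omega>" "almost_hol_polarization D \<Psi> \<Phi> x0"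
    and a: "r > 0" "bidisc x0 r \<subseteq> D" "admissible_symbol x0 (bidisc x0 r) a as"
      "oriented_good_contour \<Psi> x0 (bidisc x0 r) U Y \<gamma>" "normalized_on_contour \<Psi> x0 U Y \<gamma> a"
    and b: "r' > 0" "bidisc x0 r' \<subseteq> D" "admissible_symbol x0 (bidisc x0 r') b bs"
      "oriented_good_contour \<Psi> x0 (bidisc x0 r') U' Y' \<gamma>'" "normalized_on_contour \<Psi> x0 U' Y' \<gamma>' b"
  shows "\<forall>\<^sub>F x in nhds x0. \<forall>j. as j (x, vconj x) = bs j (x, vconj x)"
proof -
  obtain R0 c0 where R0: "bergman_phase \<Psi> x0 R0 c0"
    by (rule polarization_bergman_phase[OF pol]) (rule that)
  have "R0 > 0" using R0 by (rule bergman_phase.R)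
  \<comment> \<open>The symbols and contours keep their own bidiscs, while the adapted contour and
    the coefficients live on the smallest of the three.\<close>
  define R where "R = min R0 (min r r')"
  have Rr: "R > 0" "R \<le> R0" "R \<le> r" "R \<le> r'" unfolding R_def using \<open>R0 > 0\<close> a(1) b(1) by auto
  interpret bergman_phase \<Psi> x0 R c0 by (rule bergman_phase_mono[OF R0 Rr(1,2)])
  have D: "open D" "smooth_on D \<Psi>" "almost_hol_on D \<Psi>" using pol(4) unfolding almost_hol_polarization_def by simp_all
  have AHD: "AH D \<Psi>" using almost_hol_on_AH[OF D(1,2)] D(3) by simp
  have A: "AH (bidisc x0 s) (fs j)" "classical_symbol (bidisc x0 s) f fs" if "admissible_symbol x0 (bidisc x0 s) f fs" for s f fs j
  proof -
    show c: "classical_symbol (bidisc x0 s) f fs" using that unfolding admissible_symbol_def by simp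
    then have "smooth_on (bidisc x0 s) (fs j)" unfolding classical_symbol_def by simp
    then show "AH (bidisc x0 s) (fs j)" using that almost_hol_on_AH[OF open_bidisc] unfolding admissible_symbol_def by blast
  qed
  have sub: "bidisc x0 R \<subseteq> bidisc x0 s" if "R \<le> s" for s using that unfolding bidisc_def by auto
  have "\<forall>\<^sub>F y in nhds x0. y \<in> ball x0 R" using Rr(1) by (intro eventually_nhds_in_open) auto
  with normalized_coefficients[OF Rr(3) AH_subset[OF AHD a(2)] A(2)[OF a(3)] A(1)[OF a(3)] a(4,5)]
    normalized_coefficients[OF Rr(4) AH_subset[OF AHD b(2)] A(2)[OF b(3)] A(1)[OF b(3)] b(4,5)]
  have "\<forall>\<^sub>F y in nhds x0. y \<in> ball x0 R \<and> (\<forall>m. (\<Sum>i\<le>m. expansion_coeff \<Psi> (as i) (m - i) (adiag y)) = (\<Sum>i\<le>m. expansion_coeff \<Psi> (bs i) (m - i) (adiag y)))"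
    by eventually_elim simp
  then obtain V where V: "open V" "x0 \<in> V" "\<And>y. y \<in> V \<Longrightarrow> y \<in> ball x0 R"
    "\<And>y m. y \<in> V \<Longrightarrow> (\<Sum>i\<le>m. expansion_coeff \<Psi> (as i) (m - i) (adiag y)) = (\<Sum>i\<le>m. expansion_coeff \<Psi> (bs i) (m - i) (adiag y))"
    unfolding eventually_nhds by blast
  have "as j (adiag y) = bs j (adiag y)" if "y \<in> V" for y j
    by (rule coefficients_determine_symbol[OF AH_subset[OF A(1)[OF a(3)] sub[OF Rr(3)]] AH_subset[OF A(1)[OF b(3)] sub[OF Rr(4)]] V(1) _ V(4) that])
       (use V(3) in auto)
  then show ?thesis unfolding eventually_nhds adiag_def using V(1,2) by blast
qed

theorem theorem2p4:
  shows "\<exists>A::complex. A \<noteq> 0 \<and>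
    (\<forall>(\<Omega>::(complex^'n::finite) set) (\<Phi>::complex^'n \<Rightarrow> real) (x0::complex^'n)
       (D::'n cpair set) (\<Psi>::'n cpair \<Rightarrow> complex).
      open \<Omega> \<and> smooth_on \<Omega> \<Phi> \<and> strictly_psh_on \<Omega> \<Phi> \<and> x0 \<in> \<Omega> \<and>
      almost_hol_polarization D \<Psi> \<Phi> x0 \<longrightarrow>
        (\<exists>r>0. bidisc x0 r \<subseteq> D \<and>
           (\<exists>a as. admissible_symbol x0 (bidisc x0 r) a as \<and>
              (\<forall>U Y \<gamma>. oriented_good_contour \<Psi> x0 (bidisc x0 r) U Y \<gamma> \<longrightarrow>
                 normalized_on_contour \<Psi> x0 U Y \<gamma> a) \<and>
              (\<forall>\<^sub>F x in nhds x0. as 0 (x, vconj x) = A * det (levi_matrix \<Phi> x)))) \<and>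
        (\<forall>r>0. \<forall>r'>0. \<forall>a as b bs U Y \<gamma> U' Y' \<gamma>'.
           bidisc x0 r \<subseteq> D \<and> admissible_symbol x0 (bidisc x0 r) a as \<and>
           oriented_good_contour \<Psi> x0 (bidisc x0 r) U Y \<gamma> \<and>
           normalized_on_contour \<Psi> x0 U Y \<gamma> a \<and>
           bidisc x0 r' \<subseteq> D \<and> admissible_symbol x0 (bidisc x0 r') b bs \<and>
           oriented_good_contour \<Psi> x0 (bidisc x0 r') U' Y' \<gamma>' \<and>
           normalized_on_contour \<Psi> x0 U' Y' \<gamma>' b \<longrightarrow>
             (\<forall>\<^sub>F x in nhds x0. \<forall>j. as j (x, vconj x) = bs j (x, vconj x))))"
proof (intro exI[of _ "1 / (gauss_const TYPE('n) * affine_jac TYPE('n))"] conjI allI impI, goal_cases)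
  case 1
  show ?case using gauss_const_nonzero[where 'n='n] affine_jac_nonzero[where 'n='n] by simp
next
  case (2 \<Omega> \<Phi> x0 D \<Psi>)
  then show ?case by (elim conjE) (rule existence)
next
  case (3 \<Omega> \<Phi> x0 D \<Psi> r r' a as b bs U Y \<gamma> U' Y' \<gamma>')
  from 3(1,4) show ?case by (elim conjE) (rule uniqueness[OF _ _ _ _ 3(2) _ _ _ _ 3(3)])
qed

end
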